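(* Let $(\mathcal V,\sigma)$ be a braided tensor category, let $\mathcal C$ be a $\mathcal V$-central tensor category via a right exact functor $G:\mathcal V\to\mathcal Z(\mathcal C)$, and let $\mathcal M$ be a left $\mathcal C$-module category. Let $\rho:\mathcal C\to\mathrm{End}_{\mathcal V}(\mathcal M)$, $\rho(X)=X\triangleright-$, be the action functor. Then a right adjoint of $\rho$ is given by the functor $$\bar\rho:\mathrm{End}_{\mathcal V}(\mathcal M)\to\mathcal C,\qquad \bar\rho(F,d)=\oint_{M\in\mathcal M}\big(\underline{\mathrm{Hom}}(M,F(M)),\beta\big),$$ where $\oint$ is the relative end over the $\mathcal V$-module category $\mathcal M$ taken with respect to the prebalancing $\beta$ defined in the context (in particular these relative ends exist).
   Context: Conventions: $\Bbbk$ is an algebraically closed field; all categories are finite abelian $\Bbbk$-linear; monoidal categories are strict; tensor categories are finite, rigid, with simple unit $\mathbf 1$ (in the sense of Etingof–Ostrik). Duals: $\mathrm{ev}_X:X^*\otimes X\to\mathbf 1$, $\mathrm{coev}_X:\mathbf 1\to X\otimes X^*$. Associativity isomorphisms of module categories are suppressed. Center: objects of $\mathcal Z(\mathcal C)$ are pairs $(A,\sigma_{A,-})$ with natural isomorphisms $\sigma_{A,X}:A\otimes X\to X\otimes A$, $\sigma_{A,X\otimes Y}=(\mathrm{id}_X\otimes\sigma_{A,Y})(\sigma_{A,X}\otimes\mathrm{id}_Y)$; the braiding of $\mathcal Z(\mathcal C)$ is $\sigma_{A,B}$. $\mathcal C$ is $\mathcal V$-central if there is a faithful braided monoidal functor $G:\mathcal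 V\to\mathcal Z(\mathcal C)$; write $\sigma_{G(V),X}:G(V)\otimes X\to X\otimes G(V)$ for the half-braiding of $G(V)$, and identify $G(V^* )=G(V)^*$. A left $\mathcal C$-module category is a category $\mathcal M$ with an associative and unital action $\triangleright:\mathcal C\times\mathcal M\to\mathcal M$, bilinear and exact in each variable. It is a $\mathcal V$-module category via $V\blacktriangleright M:=G(V)\triangleright M$. $\mathrm{End}_{\mathcal V}(\mathcal M)$ is the category of $\mathcal V$-module functors $(F,d)$, with $F:\mathcal M\to\mathcal M$ right exact $\Bbbk$-linear and $d_{V,M}:F(V\blacktriangleright M)\to V\blacktriangleright F(M)$ natural isomorphisms satisfying the usual coherence axioms; morphisms are natural module transformations. The functor $\rho(X)=X\triangleright-$ has $\mathcal V$-module structure $d^X_{V,M}=\sigma_{G(V),X}^{-1}\triangleright\mathrm{id}_M$. Internal Hom: $\underline{\mathrm{Hom}}(M,N)\in\mathcal C$ represents $\mathrm{Hom}_{\mathcal M}(-\triangleright M,N)$, with natural isomorphisms $\phi^X_{M,N}:\mathrm{Hom}_{\mathcal C}(X,\underline{\mathrm{Hom}}(M,N))\to\mathrm{Hom}_{\mathcal M}(X\triangleright M,N)$. Prebalancing and relative end: for a functor $S:\mathcal M^{\mathrm{op}}\times\mathcal M\to\mathcal A$, a $\mathcal V$-prebalancing is a natural isomorphism $\beta^V_{M,N}:S(M,V\blacktriangleright N)\to S(V^*\blacktriangleright M,N)$. The relative end $\oint_{M\in\mathcal M}(S,\beta)$ is an object $E$ with dinatural transformations $\pi_M:E\to S(M,M)$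 such that $S(\mathrm{ev}_V\blacktriangleright\mathrm{id}_M,\mathrm{id}_M)\,\pi_M=\beta^V_{V\blacktriangleright M,M}\,\pi_{V\blacktriangleright M}$ for all $V\in\mathcal V$, $M\in\mathcal M$, universal among such pairs: any other $(\widetilde E,\xi)$ factors as $\xi_M=\pi_M h$ for a unique $h:\widetilde E\to E$. The prebalancing used: let $(F,d)\in\mathrm{End}_{\mathcal V}(\mathcal M)$. For $f\in\mathrm{Hom}_{\mathcal M}(X\triangleright M,F(V\blacktriangleright N))$ put $$\gamma^X_{V,M,N}(f)=(\mathrm{ev}_{G(V)}\triangleright\mathrm{id}_{F(N)})(\mathrm{id}_{G(V^* )}\triangleright d_{V,N}f)(\sigma_{G(V^* ),X}^{-1}\triangleright\mathrm{id}_M)\in\mathrm{Hom}_{\mathcal M}(X\triangleright(V^*\blacktriangleright M),F(N)).$$ With $E=\underline{\mathrm{Hom}}(M,F(V\blacktriangleright N))$, $\beta^V_{M,N}:\underline{\mathrm{Hom}}(M,F(V\blacktriangleright N))\to\underline{\mathrm{Hom}}(V^*\blacktriangleright M,F(N))$ is the unique morphism with $\phi^{E}_{V^*\blacktriangleright M,F(N)}(\beta^V_{M,N})=\gamma^{E}_{V,M,N}(\phi^{E}_{M,F(V\blacktriangleright N)}(\mathrm{id}_E))$. On morphisms, with $\lambda^F_M:\bar\rho(F,d)\to\underline{\mathrm{Hom}}(M,F(M))$ the dinatural transformations of the relative end, $\bar\rho(\alpha)$ is the unique morphism with $\underline{\mathrm{Hom}}(\mathrm{id}_M,\alpha_M)\lambda^F_M=\lambda^{\widetilde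 F}_M\bar\rho(\alpha)$ for a module transformation $\alpha:(F,d)\to(\widetilde F,\widetilde d)$. *)

theory Defs
  imports "HOL-Library.FuncSet" "HOL-Computational_Algebra.Polynomial"
begin

section \<open>Categories\<close>

record ('o, 'm) cat =
  Obj :: "'o set"
  Arr :: "'m set"
  Dom :: "'m \<Rightarrow> 'o"
  Cod :: "'m \<Rightarrow> 'o"
  Id :: "'o \<Rightarrow> 'm"
  Comp :: "'m \<Rightarrow> 'm \<Rightarrow> 'm"  (infixr "\<cdot>\<index>" 60)

definition hom :: "('o, 'm, 'x) cat_scheme \<Rightarrow> 'o \<Rightarrow> 'o \<Rightarrow> 'm set" where
  "hom C X Y = {f \<in> Arr C. Dom C f = X \<and> Cod C f = Y}"

locale category =
  fixes C :: "('o, 'm, 'x) cat_scheme" (structure)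
  assumes dom_obj: "f \<in> Arr C \<Longrightarrow> Dom C f \<in> Obj C"
    and cod_obj: "f \<in> Arr C \<Longrightarrow> Cod C f \<in> Obj C"
    and id_hom: "X \<in> Obj C \<Longrightarrow> Id C X \<in> hom C X X"
    and comp_hom: "g \<in> hom C Y Z \<Longrightarrow> f \<in> hom C X Y \<Longrightarrow> g \<cdot> f \<in> hom C X Z"
    and id_left: "f \<in> hom C X Y \<Longrightarrow> Id C Y \<cdot> f = f"
    and id_right: "f \<in> hom C X Y \<Longrightarrow> f \<cdot> Id C X = f"
    and comp_assoc: "h \<in> hom C Z W \<Longrightarrow> g \<in> hom C Y Z \<Longrightarrow> f \<in> hom C X Y \<Longrightarrow>
                     (h \<cdot> g) \<cdot> f = h \<cdot> (g \<cdot> f)"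

definition inverse_arrows :: "('o, 'm, 'x) cat_scheme \<Rightarrow> 'm \<Rightarrow> 'm \<Rightarrow> bool" where
  "inverse_arrows C f g \<longleftrightarrow> f \<in> Arr C \<and> g \<in> hom C (Cod C f) (Dom C f) \<and>
     g \<cdot>\<^bsub>C\<^esub> f = Id C (Dom C f) \<and> f \<cdot>\<^bsub>C\<^esub> g = Id C (Cod C f)"

definition is_iso :: "('o, 'm, 'x) cat_scheme \<Rightarrow> 'm \<Rightarrow> bool" where
  "is_iso C f \<longleftrightarrow> (\<exists>g. inverse_arrows C f g)"

definition inv_arr :: "('o, 'm, 'x) cat_scheme \<Rightarrow> 'm \<Rightarrow> 'm" where
  "inv_arr C f = (THE g. inverse_arrows C f g)"

definition isomorphic :: "('o, 'm, 'x) cat_scheme \<Rightarrow> 'o \<Rightarrow> 'o \<Rightarrow> bool" where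
  "isomorphic C X Y \<longleftrightarrow> (\<exists>f \<in> hom C X Y. is_iso C f)"

definition is_mono :: "('o, 'm, 'x) cat_scheme \<Rightarrow> 'm \<Rightarrow> bool" where
  "is_mono C f \<longleftrightarrow> f \<in> Arr C \<and>
     (\<forall>X. \<forall>g \<in> hom C X (Dom C f). \<forall>h \<in> hom C X (Dom C f). f \<cdot>\<^bsub>C\<^esub> g = f \<cdot>\<^bsub>C\<^esub> h \<longrightarrow> g = h)"

definition is_epi :: "('o, 'm, 'x) cat_scheme \<Rightarrow> 'm \<Rightarrow> bool" where
  "is_epi C f \<longleftrightarrow> f \<in> Arr C \<and>
     (\<forall>X. \<forall>g \<in> hom C (Cod C f) X. \<forall>h \<in> hom C (Cod C f) X. g \<cdot>\<^bsub>C\<^esub> f = h \<cdot>\<^bsub>C\<^esub> f \<longrightarrow> g = h)"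

definition is_zero_obj :: "('o, 'm, 'x) cat_scheme \<Rightarrow> 'o \<Rightarrow> bool" where
  "is_zero_obj C Z \<longleftrightarrow> Z \<in> Obj C \<and>
     (\<forall>X \<in> Obj C. (\<exists>!f. f \<in> hom C X Z) \<and> (\<exists>!f. f \<in> hom C Z X))"

definition is_simple :: "('o, 'm, 'x) cat_scheme \<Rightarrow> 'o \<Rightarrow> bool" where
  "is_simple C S \<longleftrightarrow> S \<in> Obj C \<and> \<not> is_zero_obj C S \<and>
     (\<forall>i. is_mono C i \<and> Cod C i = S \<longrightarrow> is_zero_obj C (Dom C i) \<or> is_iso C i)"

definition is_projective :: "('o, 'm, 'x) cat_scheme \<Rightarrow> 'o \<Rightarrow> bool" where
  "is_projective C P \<longleftrightarrow> P \<in> Obj C \<and>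
     (\<forall>e. is_epi C e \<longrightarrow> (\<forall>f \<in> hom C P (Cod C e). \<exists>g \<in> hom C P (Dom C e). e \<cdot>\<^bsub>C\<^esub> g = f))"

definition projective_cover :: "('o, 'm, 'x) cat_scheme \<Rightarrow> 'o \<Rightarrow> 'o \<Rightarrow> 'm \<Rightarrow> bool" where
  "projective_cover C X P p \<longleftrightarrow> is_projective C P \<and> p \<in> hom C P X \<and> is_epi C p \<and>
     (\<forall>Q g. is_projective C Q \<and> g \<in> hom C Q X \<and> is_epi C g \<longrightarrow>
        (\<exists>h \<in> hom C Q P. is_epi C h \<and> p \<cdot>\<^bsub>C\<^esub> h = g))"


section \<open>Finite abelian linear categories\<close>

record ('o, 'm, 'k) lincat = "('o, 'm) cat" +
  Zero :: "'o \<Rightarrow> 'o \<Rightarrow> 'm"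
  Add :: "'m \<Rightarrow> 'm \<Rightarrow> 'm"  (infixl "\<oplus>\<index>" 55)
  Smul :: "'k \<Rightarrow> 'm \<Rightarrow> 'm"  (infixr "\<odot>\<index>" 58)

locale linear_category = category C
  for C :: "('o, 'm, 'k::field, 'x) lincat_scheme" (structure) +
  assumes zero_hom: "X \<in> Obj C \<Longrightarrow> Y \<in> Obj C \<Longrightarrow> Zero C X Y \<in> hom C X Y"
    and add_hom: "f \<in> hom C X Y \<Longrightarrow> g \<in> hom C X Y \<Longrightarrow> f \<oplus> g \<in> hom C X Y"
    and smul_hom: "f \<in> hom C X Y \<Longrightarrow> a \<odot> f \<in> hom C X Y"
    and add_assoc: "f \<in> hom C X Y \<Longrightarrow> g \<in> hom C X Y \<Longrightarrow> h \<in> hom C X Y \<Longrightarrow>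
                    (f \<oplus> g) \<oplus> h = f \<oplus> (g \<oplus> h)"
    and add_commute: "f \<in> hom C X Y \<Longrightarrow> g \<in> hom C X Y \<Longrightarrow> f \<oplus> g = g \<oplus> f"
    and add_zero: "f \<in> hom C X Y \<Longrightarrow> f \<oplus> Zero C X Y = f"
    and add_inverse: "f \<in> hom C X Y \<Longrightarrow> \<exists>g \<in> hom C X Y. f \<oplus> g = Zero C X Y"
    and smul_add_right: "f \<in> hom C X Y \<Longrightarrow> g \<in> hom C X Y \<Longrightarrow> a \<odot> (f \<oplus> g) = a \<odot> f \<oplus> a \<odot> g"
    and smul_add_left: "f \<in> hom C X Y \<Longrightarrow> (a + b) \<odot> f = a \<odot> f \<oplus> b \<odot> f"
    and smul_smul: "f \<in> hom C X Y \<Longrightarrow> a \<odot> (b \<odot> f) = (a * b) \<odot> f"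
    and smul_one: "f \<in> hom C X Y \<Longrightarrow> 1 \<odot> f = f"
    and comp_add_left: "g \<in> hom C Y Z \<Longrightarrow> g' \<in> hom C Y Z \<Longrightarrow> f \<in> hom C X Y \<Longrightarrow>
                        (g \<oplus> g') \<cdot> f = (g \<cdot> f) \<oplus> (g' \<cdot> f)"
    and comp_add_right: "g \<in> hom C Y Z \<Longrightarrow> f \<in> hom C X Y \<Longrightarrow> f' \<in> hom C X Y \<Longrightarrow>
                         g \<cdot> (f \<oplus> f') = (g \<cdot> f) \<oplus> (g \<cdot> f')"
    and comp_smul_left: "g \<in> hom C Y Z \<Longrightarrow> f \<in> hom C X Y \<Longrightarrow> (a \<odot> g) \<cdot> f = a \<odot> (g \<cdot> f)"
    and comp_smul_right: "g \<in> hom C Y Z \<Longrightarrow> f \<in> hom C X Y \<Longrightarrow> g \<cdot> (a \<odot> f) = a \<odot> (g \<cdot> f)"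

definition is_kernel :: "('o, 'm, 'k, 'x) lincat_scheme \<Rightarrow> 'm \<Rightarrow> 'm \<Rightarrow> bool" where
  "is_kernel C f k \<longleftrightarrow> f \<in> Arr C \<and> k \<in> Arr C \<and> Cod C k = Dom C f \<and>
     f \<cdot>\<^bsub>C\<^esub> k = Zero C (Dom C k) (Cod C f) \<and>
     (\<forall>X. \<forall>h \<in> hom C X (Dom C f). f \<cdot>\<^bsub>C\<^esub> h = Zero C X (Cod C f) \<longrightarrow>
        (\<exists>!u. u \<in> hom C X (Dom C k) \<and> k \<cdot>\<^bsub>C\<^esub> u = h))"

definition is_cokernel :: "('o, 'm, 'k, 'x) lincat_scheme \<Rightarrow> 'm \<Rightarrow> 'm \<Rightarrow> bool" where
  "is_cokernel C f p \<longleftrightarrow> f \<in> Arr C \<and> p \<in> Arr C \<and> Dom C p = Cod C f \<and>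
     p \<cdot>\<^bsub>C\<^esub> f = Zero C (Dom C f) (Cod C p) \<and>
     (\<forall>X. \<forall>h \<in> hom C (Cod C f) X. h \<cdot>\<^bsub>C\<^esub> f = Zero C (Dom C f) X \<longrightarrow>
        (\<exists>!u. u \<in> hom C (Cod C p) X \<and> u \<cdot>\<^bsub>C\<^esub> p = h))"

definition is_biproduct ::
    "('o, 'm, 'k, 'x) lincat_scheme \<Rightarrow> 'o \<Rightarrow> 'o \<Rightarrow> 'o \<Rightarrow> 'm \<Rightarrow> 'm \<Rightarrow> 'm \<Rightarrow> 'm \<Rightarrow> bool" where
  "is_biproduct C X Y B i j p q \<longleftrightarrow>
     B \<in> Obj C \<and> i \<in> hom C X B \<and> j \<in> hom C Y B \<and> p \<in> hom C B X \<and> q \<in> hom C B Y \<and>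
     p \<cdot>\<^bsub>C\<^esub> i = Id C X \<and> q \<cdot>\<^bsub>C\<^esub> j = Id C Y \<and>
     q \<cdot>\<^bsub>C\<^esub> i = Zero C X Y \<and> p \<cdot>\<^bsub>C\<^esub> j = Zero C Y X \<and>
     (i \<cdot>\<^bsub>C\<^esub> p) \<oplus>\<^bsub>C\<^esub> (j \<cdot>\<^bsub>C\<^esub> q) = Id C B"

locale abelian_category = linear_category C
  for C :: "('o, 'm, 'k::field, 'x) lincat_scheme" (structure) +
  assumes ex_zero_obj: "\<exists>Z. is_zero_obj C Z"
    and ex_biproduct: "X \<in> Obj C \<Longrightarrow> Y \<in> Obj C \<Longrightarrow> \<exists>B i j p q. is_biproduct C X Y B i j p q"
    and ex_kernel: "f \<in> Arr C \<Longrightarrow> \<exists>k. is_kernel C f k"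
    and ex_cokernel: "f \<in> Arr C \<Longrightarrow> \<exists>p. is_cokernel C f p"
    and mono_kernel: "is_mono C i \<Longrightarrow> \<exists>f. is_kernel C f i"
    and epi_cokernel: "is_epi C p \<Longrightarrow> \<exists>f. is_cokernel C f p"

inductive_set lin_span :: "('o, 'm, 'k, 'x) lincat_scheme \<Rightarrow> 'o \<Rightarrow> 'o \<Rightarrow> 'm set \<Rightarrow> 'm set"
  for C :: "('o, 'm, 'k, 'x) lincat_scheme" and X Y :: 'o and B :: "'m set" where
  zero: "Zero C X Y \<in> lin_span C X Y B"
| base: "f \<in> B \<Longrightarrow> f \<in> lin_span C X Y B"
| add: "f \<in> lin_span C X Y B \<Longrightarrow> g \<in> lin_span C X Y B \<Longrightarrow> f \<oplus>\<^bsub>C\<^esub> g \<in> lin_span C X Y B"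
| smul: "f \<in> lin_span C X Y B \<Longrightarrow> a \<odot>\<^bsub>C\<^esub> f \<in> lin_span C X Y B"

text \<open>An object has finite length iff it has a finite filtration, starting at a zero object,
  whose successive quotients are simple.\<close>

inductive finite_length :: "('o, 'm, 'k, 'x) lincat_scheme \<Rightarrow> 'o \<Rightarrow> bool"
  for C :: "('o, 'm, 'k, 'x) lincat_scheme" where
  zero: "is_zero_obj C Z \<Longrightarrow> finite_length C Z"
| step: "finite_length C (Dom C i) \<Longrightarrow> is_mono C i \<Longrightarrow> is_cokernel C i p \<Longrightarrow>
         is_simple C (Cod C p) \<Longrightarrow> finite_length C (Cod C i)"

locale finite_category = abelian_category C
  for C :: "('o, 'm, 'k::alg_closed_field, 'x) lincat_scheme" (structure) +
  assumes finite_dim_hom: "X \<in> Obj C \<Longrightarrow> Y \<in> Obj C \<Longrightarrow>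
            \<exists>B. finite B \<and> B \<subseteq> hom C X Y \<and> hom C X Y = lin_span C X Y B"
    and finite_length_obj: "X \<in> Obj C \<Longrightarrow> finite_length C X"
    and enough_projectives: "is_simple C S \<Longrightarrow> \<exists>P p. projective_cover C S P p"
    and finitely_many_simples:
          "\<exists>T. finite T \<and> (\<forall>S. is_simple C S \<longrightarrow> (\<exists>S' \<in> T. is_simple C S' \<and> isomorphic C S S'))"


section \<open>Functors\<close>

record ('o, 'm, 'p, 'n) functr =
  omap :: "'o \<Rightarrow> 'p"
  amap :: "'m \<Rightarrow> 'n"

definition is_functor ::
    "('o, 'm, 'x) cat_scheme \<Rightarrow> ('p, 'n, 'y) cat_scheme \<Rightarrow> ('o, 'm, 'p, 'n, 'z) functr_scheme \<Rightarrow> bool" where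
  "is_functor C D F \<longleftrightarrow>
     (\<forall>X \<in> Obj C. omap F X \<in> Obj D) \<and>
     (\<forall>X Y. \<forall>f \<in> hom C X Y. amap F f \<in> hom D (omap F X) (omap F Y)) \<and>
     (\<forall>X \<in> Obj C. amap F (Id C X) = Id D (omap F X)) \<and>
     (\<forall>X Y Z. \<forall>g \<in> hom C Y Z. \<forall>f \<in> hom C X Y. amap F (g \<cdot>\<^bsub>C\<^esub> f) = amap F g \<cdot>\<^bsub>D\<^esub> amap F f)"

definition faithful ::
    "('o, 'm, 'x) cat_scheme \<Rightarrow> ('o, 'm, 'p, 'n, 'z) functr_scheme \<Rightarrow> bool" where
  "faithful C F \<longleftrightarrow> (\<forall>X \<in> Obj C. \<forall>Y \<in> Obj C. inj_on (amap F) (hom C X Y))"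

definition linear_functor ::
    "('o, 'm, 'k, 'x) lincat_scheme \<Rightarrow> ('p, 'n, 'k, 'y) lincat_scheme \<Rightarrow>
     ('o, 'm, 'p, 'n, 'z) functr_scheme \<Rightarrow> bool" where
  "linear_functor C D F \<longleftrightarrow> is_functor C D F \<and>
     (\<forall>X Y. \<forall>f \<in> hom C X Y. \<forall>g \<in> hom C X Y. amap F (f \<oplus>\<^bsub>C\<^esub> g) = amap F f \<oplus>\<^bsub>D\<^esub> amap F g) \<and>
     (\<forall>a. \<forall>f \<in> Arr C. amap F (a \<odot>\<^bsub>C\<^esub> f) = a \<odot>\<^bsub>D\<^esub> amap F f)"

definition right_exact ::
    "('o, 'm, 'k, 'x) lincat_scheme \<Rightarrow> ('p, 'n, 'k, 'y) lincat_scheme \<Rightarrow>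
     ('o, 'm, 'p, 'n, 'z) functr_scheme \<Rightarrow> bool" where
  "right_exact C D F \<longleftrightarrow> linear_functor C D F \<and>
     (\<forall>f p. is_cokernel C f p \<longrightarrow> is_cokernel D (amap F f) (amap F p))"

definition left_exact ::
    "('o, 'm, 'k, 'x) lincat_scheme \<Rightarrow> ('p, 'n, 'k, 'y) lincat_scheme \<Rightarrow>
     ('o, 'm, 'p, 'n, 'z) functr_scheme \<Rightarrow> bool" where
  "left_exact C D F \<longleftrightarrow> linear_functor C D F \<and>
     (\<forall>f k. is_kernel C f k \<longrightarrow> is_kernel D (amap F f) (amap F k))"

definition exact ::
    "('o, 'm, 'k, 'x) lincat_scheme \<Rightarrow> ('p, 'n, 'k, 'y) lincat_scheme \<Rightarrow>
     ('o, 'm, 'p, 'n, 'z) functr_scheme \<Rightarrow> bool" where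
  "exact C D F \<longleftrightarrow> left_exact C D F \<and> right_exact C D F"

text \<open>\<open>R\<close> is right adjoint to \<open>L : C \<rightarrow> D\<close>.\<close>

definition right_adjoint ::
    "('o, 'm, 'x) cat_scheme \<Rightarrow> ('p, 'n, 'y) cat_scheme \<Rightarrow> ('o, 'm, 'p, 'n, 'z) functr_scheme \<Rightarrow>
     ('p, 'n, 'o, 'm, 'w) functr_scheme \<Rightarrow> bool" where
  "right_adjoint C D L R \<longleftrightarrow>
     category C \<and> category D \<and> is_functor C D L \<and> is_functor D C R \<and>
     (\<exists>\<Psi>.
        (\<forall>X \<in> Obj C. \<forall>P \<in> Obj D. bij_betw (\<Psi> X P) (hom D (omap L X) P) (hom C X (omap R P))) \<and>
        (\<forall>X \<in> Obj C. \<forall>Y \<in> Obj C. \<forall>P \<in> Obj D. \<forall>Q \<in> Obj D.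
           \<forall>f \<in> hom C Y X. \<forall>u \<in> hom D (omap L X) P. \<forall>g \<in> hom D P Q.
             \<Psi> Y Q (g \<cdot>\<^bsub>D\<^esub> u \<cdot>\<^bsub>D\<^esub> amap L f) = amap R g \<cdot>\<^bsub>C\<^esub> \<Psi> X P u \<cdot>\<^bsub>C\<^esub> f))"


section \<open>Tensor categories, braidings and the center\<close>

record ('o, 'm, 'k) moncat = "('o, 'm, 'k) lincat" +
  Unit :: 'o  ("\<one>\<index>")
  TenO :: "'o \<Rightarrow> 'o \<Rightarrow> 'o"  (infixr "\<otimes>\<index>" 70)
  TenA :: "'m \<Rightarrow> 'm \<Rightarrow> 'm"  (infixr "\<boxtimes>\<index>" 70)

text \<open>Strict monoidal category with bilinear tensor product; \<open>\<otimes>\<close> is the tensor product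
  of objects and \<open>\<boxtimes>\<close> that of morphisms.\<close>

locale strict_monoidal_category = linear_category C
  for C :: "('o, 'm, 'k::field, 'x) moncat_scheme" (structure) +
  assumes unit_obj: "\<one> \<in> Obj C"
    and ten_obj: "X \<in> Obj C \<Longrightarrow> Y \<in> Obj C \<Longrightarrow> X \<otimes> Y \<in> Obj C"
    and ten_hom: "f \<in> hom C X Y \<Longrightarrow> g \<in> hom C X' Y' \<Longrightarrow> f \<boxtimes> g \<in> hom C (X \<otimes> X') (Y \<otimes> Y')"
    and ten_id: "X \<in> Obj C \<Longrightarrow> Y \<in> Obj C \<Longrightarrow> Id C X \<boxtimes> Id C Y = Id C (X \<otimes> Y)"
    and ten_comp: "g \<in> hom C Y Z \<Longrightarrow> f \<in> hom C X Y \<Longrightarrow> g' \<in> hom C Y' Z' \<Longrightarrow> f' \<in> hom C X' Y' \<Longrightarrow>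
                   (g \<cdot> f) \<boxtimes> (g' \<cdot> f') = (g \<boxtimes> g') \<cdot> (f \<boxtimes> f')"
    and ten_add_left: "f \<in> hom C X Y \<Longrightarrow> f' \<in> hom C X Y \<Longrightarrow> g \<in> Arr C \<Longrightarrow>
                       (f \<oplus> f') \<boxtimes> g = (f \<boxtimes> g) \<oplus> (f' \<boxtimes> g)"
    and ten_add_right: "f \<in> Arr C \<Longrightarrow> g \<in> hom C X Y \<Longrightarrow> g' \<in> hom C X Y \<Longrightarrow>
                        f \<boxtimes> (g \<oplus> g') = (f \<boxtimes> g) \<oplus> (f \<boxtimes> g')"
    and ten_smul_left: "f \<in> Arr C \<Longrightarrow> g \<in> Arr C \<Longrightarrow> (a \<odot> f) \<boxtimes> g = a \<odot> (f \<boxtimes> g)"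
    and ten_smul_right: "f \<in> Arr C \<Longrightarrow> g \<in> Arr C \<Longrightarrow> f \<boxtimes> (a \<odot> g) = a \<odot> (f \<boxtimes> g)"
    and ten_assoc_obj: "X \<in> Obj C \<Longrightarrow> Y \<in> Obj C \<Longrightarrow> Z \<in> Obj C \<Longrightarrow>
                        (X \<otimes> Y) \<otimes> Z = X \<otimes> (Y \<otimes> Z)"
    and ten_assoc_arr: "f \<in> Arr C \<Longrightarrow> g \<in> Arr C \<Longrightarrow> h \<in> Arr C \<Longrightarrow>
                        (f \<boxtimes> g) \<boxtimes> h = f \<boxtimes> (g \<boxtimes> h)"
    and unit_left_obj: "X \<in> Obj C \<Longrightarrow> \<one> \<otimes> X = X"
    and unit_right_obj: "X \<in> Obj C \<Longrightarrow> X \<otimes> \<one> = X"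
    and unit_left_arr: "f \<in> Arr C \<Longrightarrow> Id C \<one> \<boxtimes> f = f"
    and unit_right_arr: "f \<in> Arr C \<Longrightarrow> f \<boxtimes> Id C \<one> = f"

text \<open>\<open>X'\<close> is a left dual of \<open>X\<close>, with \<open>ev : X' \<otimes> X \<rightarrow> \<one>\<close> and \<open>coev : \<one> \<rightarrow> X \<otimes> X'\<close>.\<close>

definition is_left_dual ::
    "('o, 'm, 'k, 'x) moncat_scheme \<Rightarrow> 'o \<Rightarrow> 'o \<Rightarrow> 'm \<Rightarrow> 'm \<Rightarrow> bool" where
  "is_left_dual C X X' ev coev \<longleftrightarrow>
     X \<in> Obj C \<and> X' \<in> Obj C \<and>
     ev \<in> hom C (X' \<otimes>\<^bsub>C\<^esub> X) \<one>\<^bsub>C\<^esub> \<and> coev \<in> hom C \<one>\<^bsub>C\<^esub> (X \<otimes>\<^bsub>C\<^esub> X') \<and>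
     (Id C X \<boxtimes>\<^bsub>C\<^esub> ev) \<cdot>\<^bsub>C\<^esub> (coev \<boxtimes>\<^bsub>C\<^esub> Id C X) = Id C X \<and>
     (ev \<boxtimes>\<^bsub>C\<^esub> Id C X') \<cdot>\<^bsub>C\<^esub> (Id C X' \<boxtimes>\<^bsub>C\<^esub> coev) = Id C X'"

locale tensor_category = finite_category C + strict_monoidal_category C
  for C :: "('o, 'm, 'k::alg_closed_field, 'x) moncat_scheme" (structure) +
  assumes ex_left_dual: "X \<in> Obj C \<Longrightarrow> \<exists>X' ev coev. is_left_dual C X X' ev coev"
    and ex_right_dual: "X \<in> Obj C \<Longrightarrow> \<exists>X' ev coev. is_left_dual C X' X ev coev"
    and simple_unit: "is_simple C \<one>"

record ('o, 'm) duality =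
  DualO :: "'o \<Rightarrow> 'o"
  Ev :: "'o \<Rightarrow> 'm"
  Coev :: "'o \<Rightarrow> 'm"

definition left_duality ::
    "('o, 'm, 'k, 'x) moncat_scheme \<Rightarrow> ('o, 'm) duality \<Rightarrow> bool" where
  "left_duality C D \<longleftrightarrow> (\<forall>X \<in> Obj C. is_left_dual C X (DualO D X) (Ev D X) (Coev D X))"

text \<open>The dual \<open>f\<^sup>* : Y\<^sup>* \<rightarrow> X\<^sup>*\<close> of a morphism \<open>f : X \<rightarrow> Y\<close>.\<close>

definition DualA ::
    "('o, 'm, 'k, 'x) moncat_scheme \<Rightarrow> ('o, 'm) duality \<Rightarrow> 'm \<Rightarrow> 'm" where
  "DualA C D f =
     (let X = Dom C f; Y = Cod C f; X' = DualO D X; Y' = DualO D Y in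
       (Ev D Y \<boxtimes>\<^bsub>C\<^esub> Id C X') \<cdot>\<^bsub>C\<^esub> (Id C Y' \<boxtimes>\<^bsub>C\<^esub> f \<boxtimes>\<^bsub>C\<^esub> Id C X') \<cdot>\<^bsub>C\<^esub> (Id C Y' \<boxtimes>\<^bsub>C\<^esub> Coev D X))"

definition is_braiding ::
    "('o, 'm, 'k, 'x) moncat_scheme \<Rightarrow> ('o \<Rightarrow> 'o \<Rightarrow> 'm) \<Rightarrow> bool" where
  "is_braiding C c \<longleftrightarrow>
     (\<forall>X \<in> Obj C. \<forall>Y \<in> Obj C. c X Y \<in> hom C (X \<otimes>\<^bsub>C\<^esub> Y) (Y \<otimes>\<^bsub>C\<^esub> X) \<and> is_iso C (c X Y)) \<and>
     (\<forall>X X' Y Y'. \<forall>f \<in> hom C X X'. \<forall>g \<in> hom C Y Y'.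
        c X' Y' \<cdot>\<^bsub>C\<^esub> (f \<boxtimes>\<^bsub>C\<^esub> g) = (g \<boxtimes>\<^bsub>C\<^esub> f) \<cdot>\<^bsub>C\<^esub> c X Y) \<and>
     (\<forall>X \<in> Obj C. \<forall>Y \<in> Obj C. \<forall>Z \<in> Obj C.
        c X (Y \<otimes>\<^bsub>C\<^esub> Z) = (Id C Y \<boxtimes>\<^bsub>C\<^esub> c X Z) \<cdot>\<^bsub>C\<^esub> (c X Y \<boxtimes>\<^bsub>C\<^esub> Id C Z)) \<and>
     (\<forall>X \<in> Obj C. \<forall>Y \<in> Obj C. \<forall>Z \<in> Obj C.
        c (X \<otimes>\<^bsub>C\<^esub> Y) Z = (c X Z \<boxtimes>\<^bsub>C\<^esub> Id C Y) \<cdot>\<^bsub>C\<^esub> (Id C X \<boxtimes>\<^bsub>C\<^esub> c Y Z))"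

locale braided_tensor_category = tensor_category C
  for C :: "('o, 'm, 'k::alg_closed_field, 'x) moncat_scheme" (structure)
    and c :: "'o \<Rightarrow> 'o \<Rightarrow> 'm" +
  assumes braiding: "is_braiding C c"

text \<open>Half-braidings are extensional functions, so that the center is again strict.\<close>

definition half_braiding ::
    "('o, 'm, 'k, 'x) moncat_scheme \<Rightarrow> 'o \<Rightarrow> ('o \<Rightarrow> 'm) \<Rightarrow> bool" where
  "half_braiding C A s \<longleftrightarrow> A \<in> Obj C \<and> s \<in> extensional (Obj C) \<and>
     (\<forall>X \<in> Obj C. s X \<in> hom C (A \<otimes>\<^bsub>C\<^esub> X) (X \<otimes>\<^bsub>C\<^esub> A) \<and> is_iso C (s X)) \<and>
     (\<forall>X Y. \<forall>f \<in> hom C X Y. s Y \<cdot>\<^bsub>C\<^esub> (Id C A \<boxtimes>\<^bsub>C\<^esub> f) = (f \<boxtimes>\<^bsub>C\<^esub> Id C A) \<cdot>\<^bsub>C\<^esub> s X) \<and>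
     (\<forall>X \<in> Obj C. \<forall>Y \<in> Obj C.
        s (X \<otimes>\<^bsub>C\<^esub> Y) = (Id C X \<boxtimes>\<^bsub>C\<^esub> s Y) \<cdot>\<^bsub>C\<^esub> (s X \<boxtimes>\<^bsub>C\<^esub> Id C Y))"

type_synonym ('o, 'm) center_obj = "'o \<times> ('o \<Rightarrow> 'm)"
type_synonym ('o, 'm) center_arr = "('o, 'm) center_obj \<times> 'm \<times> ('o, 'm) center_obj"

text \<open>A morphism of the center is a triple (source, underlying morphism, target).\<close>

definition und :: "'a \<times> 'm \<times> 'a \<Rightarrow> 'm" where
  "und f = fst (snd f)"

definition center_ten ::
    "('o, 'm, 'k, 'x) moncat_scheme \<Rightarrow> ('o, 'm) center_obj \<Rightarrow> ('o, 'm) center_obj \<Rightarrow> ('o, 'm) center_obj" where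
  "center_ten C P Q =
     (fst P \<otimes>\<^bsub>C\<^esub> fst Q,
      \<lambda>X \<in> Obj C. (snd P X \<boxtimes>\<^bsub>C\<^esub> Id C (fst Q)) \<cdot>\<^bsub>C\<^esub> (Id C (fst P) \<boxtimes>\<^bsub>C\<^esub> snd Q X))"

definition center ::
    "('o, 'm, 'k, 'x) moncat_scheme \<Rightarrow> (('o, 'm) center_obj, ('o, 'm) center_arr, 'k) moncat" where
  "center C =
    \<lparr> Obj = {(A, s). half_braiding C A s},
      Arr = {((A, s), f, (B, t)). half_braiding C A s \<and> half_braiding C B t \<and> f \<in> hom C A B \<and>
               (\<forall>X \<in> Obj C. (Id C X \<boxtimes>\<^bsub>C\<^esub> f) \<cdot>\<^bsub>C\<^esub> s X = t X \<cdot>\<^bsub>C\<^esub> (f \<boxtimes>\<^bsub>C\<^esub> Id C X))},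
      Dom = \<lambda>f. fst f,
      Cod = \<lambda>f. snd (snd f),
      Id = \<lambda>P. (P, Id C (fst P), P),
      Comp = \<lambda>g f. (fst f, und g \<cdot>\<^bsub>C\<^esub> und f, snd (snd g)),
      Zero = \<lambda>P Q. (P, Zero C (fst P) (fst Q), Q),
      Add = \<lambda>f g. (fst f, und f \<oplus>\<^bsub>C\<^esub> und g, snd (snd f)),
      Smul = \<lambda>a f. (fst f, a \<odot>\<^bsub>C\<^esub> und f, snd (snd f)),
      Unit = (\<one>\<^bsub>C\<^esub>, \<lambda>X \<in> Obj C. Id C X),
      TenO = center_ten C,
      TenA = \<lambda>f g. (center_ten C (fst f) (fst g), und f \<boxtimes>\<^bsub>C\<^esub> und g,
                     center_ten C (snd (snd f)) (snd (snd g))) \<rparr>"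

definition center_braiding ::
    "('o, 'm, 'k, 'x) moncat_scheme \<Rightarrow>
     ('o, 'm) center_obj \<Rightarrow> ('o, 'm) center_obj \<Rightarrow> ('o, 'm) center_arr" where
  "center_braiding C P Q = (center_ten C P Q, snd P (fst Q), center_ten C Q P)"

text \<open>A monoidal functor \<open>F\<close> comes with natural isomorphisms
  \<open>Mu F X Y : F X \<otimes> F Y \<rightarrow> F (X \<otimes> Y)\<close> and an isomorphism \<open>Eta F : \<one> \<rightarrow> F \<one>\<close>.\<close>

record ('o, 'm, 'p, 'n) monfunctr = "('o, 'm, 'p, 'n) functr" +
  Mu :: "'o \<Rightarrow> 'o \<Rightarrow> 'n"
  Eta :: 'n

definition monoidal_functor ::
    "('o, 'm, 'k, 'x) moncat_scheme \<Rightarrow> ('p, 'n, 'k, 'y) moncat_scheme \<Rightarrow>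
     ('o, 'm, 'p, 'n, 'z) monfunctr_scheme \<Rightarrow> bool" where
  "monoidal_functor C D F \<longleftrightarrow> linear_functor C D F \<and>
     Eta F \<in> hom D \<one>\<^bsub>D\<^esub> (omap F \<one>\<^bsub>C\<^esub>) \<and> is_iso D (Eta F) \<and>
     (\<forall>X \<in> Obj C. \<forall>Y \<in> Obj C.
        Mu F X Y \<in> hom D (omap F X \<otimes>\<^bsub>D\<^esub> omap F Y) (omap F (X \<otimes>\<^bsub>C\<^esub> Y)) \<and> is_iso D (Mu F X Y)) \<and>
     (\<forall>X X' Y Y'. \<forall>f \<in> hom C X X'. \<forall>g \<in> hom C Y Y'.
        Mu F X' Y' \<cdot>\<^bsub>D\<^esub> (amap F f \<boxtimes>\<^bsub>D\<^esub> amap F g) = amap F (f \<boxtimes>\<^bsub>C\<^esub> g) \<cdot>\<^bsub>D\<^esub> Mu F X Y) \<and>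
     (\<forall>X \<in> Obj C. \<forall>Y \<in> Obj C. \<forall>Z \<in> Obj C.
        Mu F (X \<otimes>\<^bsub>C\<^esub> Y) Z \<cdot>\<^bsub>D\<^esub> (Mu F X Y \<boxtimes>\<^bsub>D\<^esub> Id D (omap F Z)) =
        Mu F X (Y \<otimes>\<^bsub>C\<^esub> Z) \<cdot>\<^bsub>D\<^esub> (Id D (omap F X) \<boxtimes>\<^bsub>D\<^esub> Mu F Y Z)) \<and>
     (\<forall>X \<in> Obj C.
        Mu F \<one>\<^bsub>C\<^esub> X \<cdot>\<^bsub>D\<^esub> (Eta F \<boxtimes>\<^bsub>D\<^esub> Id D (omap F X)) = Id D (omap F X) \<and>
        Mu F X \<one>\<^bsub>C\<^esub> \<cdot>\<^bsub>D\<^esub> (Id D (omap F X) \<boxtimes>\<^bsub>D\<^esub> Eta F) = Id D (omap F X))"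

definition braided_functor ::
    "('o, 'm, 'k, 'x) moncat_scheme \<Rightarrow> ('o \<Rightarrow> 'o \<Rightarrow> 'm) \<Rightarrow>
     ('p, 'n, 'k, 'y) moncat_scheme \<Rightarrow> ('p \<Rightarrow> 'p \<Rightarrow> 'n) \<Rightarrow>
     ('o, 'm, 'p, 'n, 'z) monfunctr_scheme \<Rightarrow> bool" where
  "braided_functor C c D d F \<longleftrightarrow> monoidal_functor C D F \<and>
     (\<forall>X \<in> Obj C. \<forall>Y \<in> Obj C.
        amap F (c X Y) \<cdot>\<^bsub>D\<^esub> Mu F X Y = Mu F Y X \<cdot>\<^bsub>D\<^esub> d (omap F X) (omap F Y))"

definition central_via ::
    "('o, 'm, 'k, 'x) moncat_scheme \<Rightarrow> ('o \<Rightarrow> 'o \<Rightarrow> 'm) \<Rightarrow> ('p, 'n, 'k, 'y) moncat_scheme \<Rightarrow>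
     ('o, 'm, ('p, 'n) center_obj, ('p, 'n) center_arr) monfunctr \<Rightarrow> bool" where
  "central_via V c C G \<longleftrightarrow>
     braided_functor V c (center C) (center_braiding C) G \<and> faithful V G"

text \<open>Object of \<open>C\<close> underlying \<open>G v\<close>, and its half-braiding.\<close>

abbreviation GO :: "('o, 'm, ('p, 'n) center_obj, ('p, 'n) center_arr) monfunctr \<Rightarrow> 'o \<Rightarrow> 'p" where
  "GO G v \<equiv> fst (omap G v)"

abbreviation hb :: "('o, 'm, ('p, 'n) center_obj, ('p, 'n) center_arr) monfunctr \<Rightarrow> 'o \<Rightarrow> 'p \<Rightarrow> 'n" where
  "hb G v \<equiv> snd (omap G v)"

text \<open>Evaluation of \<open>G v\<close> under the identification \<open>G (v\<^sup>*) = (G v)\<^sup>*\<close>: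
  \<open>G (v\<^sup>*) \<otimes> G v \<rightarrow> G (v\<^sup>* \<otimes> v) \<rightarrow> G \<one> \<rightarrow> \<one>\<close>.\<close>

definition GEv ::
    "('p, 'n, 'k, 'y) moncat_scheme \<Rightarrow> ('o, 'm) duality \<Rightarrow>
     ('o, 'm, ('p, 'n) center_obj, ('p, 'n) center_arr) monfunctr \<Rightarrow> 'o \<Rightarrow> 'n" where
  "GEv C D G v = inv_arr C (und (Eta G)) \<cdot>\<^bsub>C\<^esub> und (amap G (Ev D v)) \<cdot>\<^bsub>C\<^esub> und (Mu G (DualO D v) v)"


section \<open>Module categories\<close>

text \<open>\<open>\<rhd>\<close> is the action on objects and \<open>\<triangleright>\<close> the action on morphisms;
  \<open>Asc A X Y M : (X \<otimes> Y) \<rhd> M \<rightarrow> X \<rhd> (Y \<rhd> M)\<close> and \<open>Lun A M : \<one> \<rhd> M \<rightarrow> M\<close>.\<close>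

record ('o, 'm, 'p, 'n) action =
  ActO :: "'o \<Rightarrow> 'p \<Rightarrow> 'p"  (infixr "\<rhd>\<index>" 70)
  ActA :: "'m \<Rightarrow> 'n \<Rightarrow> 'n"  (infixr "\<triangleright>\<index>" 70)
  Asc :: "'o \<Rightarrow> 'o \<Rightarrow> 'p \<Rightarrow> 'n"
  Lun :: "'p \<Rightarrow> 'n"

locale module_category = finite_category M
  for C :: "('o, 'm, 'k::alg_closed_field, 'x) moncat_scheme"
    and M :: "('p, 'n, 'k, 'y) lincat_scheme"
    and A :: "('o, 'm, 'p, 'n) action" (structure) +
  assumes act_obj: "X \<in> Obj C \<Longrightarrow> N \<in> Obj M \<Longrightarrow> X \<rhd> N \<in> Obj M"
    and act_hom: "f \<in> hom C X Y \<Longrightarrow> g \<in> hom M N L \<Longrightarrow> f \<triangleright> g \<in> hom M (X \<rhd> N) (Y \<rhd> L)"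
    and act_id: "X \<in> Obj C \<Longrightarrow> N \<in> Obj M \<Longrightarrow> Id C X \<triangleright> Id M N = Id M (X \<rhd> N)"
    and act_comp: "f' \<in> hom C Y Z \<Longrightarrow> f \<in> hom C X Y \<Longrightarrow> g' \<in> hom M L K \<Longrightarrow> g \<in> hom M N L \<Longrightarrow>
                   (f' \<cdot>\<^bsub>C\<^esub> f) \<triangleright> (g' \<cdot>\<^bsub>M\<^esub> g) = (f' \<triangleright> g') \<cdot>\<^bsub>M\<^esub> (f \<triangleright> g)"
    and act_exact_left: "N \<in> Obj M \<Longrightarrow>
           exact C M \<lparr> omap = \<lambda>X. X \<rhd> N, amap = \<lambda>f. f \<triangleright> Id M N \<rparr>"
    and act_exact_right: "X \<in> Obj C \<Longrightarrow>
           exact M M \<lparr> omap = \<lambda>N. X \<rhd> N, amap = \<lambda>g. Id C X \<triangleright> g \<rparr>"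
    and asc_iso: "X \<in> Obj C \<Longrightarrow> Y \<in> Obj C \<Longrightarrow> N \<in> Obj M \<Longrightarrow>
           Asc A X Y N \<in> hom M ((X \<otimes>\<^bsub>C\<^esub> Y) \<rhd> N) (X \<rhd> Y \<rhd> N) \<and> is_iso M (Asc A X Y N)"
    and asc_natural: "f \<in> hom C X X' \<Longrightarrow> f' \<in> hom C Y Y' \<Longrightarrow> g \<in> hom M N N' \<Longrightarrow>
           Asc A X' Y' N' \<cdot>\<^bsub>M\<^esub> ((f \<boxtimes>\<^bsub>C\<^esub> f') \<triangleright> g) = (f \<triangleright> f' \<triangleright> g) \<cdot>\<^bsub>M\<^esub> Asc A X Y N"
    and lun_iso: "N \<in> Obj M \<Longrightarrow> Lun A N \<in> hom M (\<one>\<^bsub>C\<^esub> \<rhd> N) N \<and> is_iso M (Lun A N)"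
    and lun_natural: "g \<in> hom M N N' \<Longrightarrow>
           Lun A N' \<cdot>\<^bsub>M\<^esub> (Id C \<one>\<^bsub>C\<^esub> \<triangleright> g) = g \<cdot>\<^bsub>M\<^esub> Lun A N"
    and pentagon: "X \<in> Obj C \<Longrightarrow> Y \<in> Obj C \<Longrightarrow> Z \<in> Obj C \<Longrightarrow> N \<in> Obj M \<Longrightarrow>
           Asc A X Y (Z \<rhd> N) \<cdot>\<^bsub>M\<^esub> Asc A (X \<otimes>\<^bsub>C\<^esub> Y) Z N =
           (Id C X \<triangleright> Asc A Y Z N) \<cdot>\<^bsub>M\<^esub> Asc A X (Y \<otimes>\<^bsub>C\<^esub> Z) N"
    and triangle: "X \<in> Obj C \<Longrightarrow> N \<in> Obj M \<Longrightarrow>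
           (Id C X \<triangleright> Lun A N) \<cdot>\<^bsub>M\<^esub> Asc A X \<one>\<^bsub>C\<^esub> N = Id M (X \<rhd> N)"

text \<open>The action of \<open>V\<close> on \<open>M\<close> given by restriction of the action \<open>A\<close> of \<open>C\<close> along \<open>G\<close>.\<close>

definition central_action ::
    "('p, 'n, 'k, 'y) moncat_scheme \<Rightarrow> ('q, 'r, 'k, 'w) lincat_scheme \<Rightarrow> ('p, 'n, 'q, 'r) action \<Rightarrow>
     ('o, 'm, ('p, 'n) center_obj, ('p, 'n) center_arr) monfunctr \<Rightarrow> ('o, 'm, 'q, 'r) action" where
  "central_action C M A G =
    \<lparr> ActO = \<lambda>v N. GO G v \<rhd>\<^bsub>A\<^esub> N,
      ActA = \<lambda>f g. und (amap G f) \<triangleright>\<^bsub>A\<^esub> g,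
      Asc = \<lambda>v w N. Asc A (GO G v) (GO G w) N \<cdot>\<^bsub>M\<^esub> (inv_arr C (und (Mu G v w)) \<triangleright>\<^bsub>A\<^esub> Id M N),
      Lun = \<lambda>N. Lun A N \<cdot>\<^bsub>M\<^esub> (inv_arr C (und (Eta G)) \<triangleright>\<^bsub>A\<^esub> Id M N) \<rparr>"

type_synonym ('o, 'p, 'n) modend = "('p, 'n, 'p, 'n) functr \<times> ('o \<Rightarrow> 'p \<Rightarrow> 'n)"

text \<open>Right exact module endofunctors \<open>(F, d)\<close> of a \<open>V\<close>-module category \<open>M\<close> with action \<open>B\<close>.\<close>

definition module_endofunctor ::
    "('o, 'm, 'k, 'x) moncat_scheme \<Rightarrow> ('p, 'n, 'k, 'y) lincat_scheme \<Rightarrow> ('o, 'm, 'p, 'n) action \<Rightarrow>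
     ('o, 'p, 'n) modend \<Rightarrow> bool" where
  "module_endofunctor V M B P \<longleftrightarrow> (let F = fst P; d = snd P in
     right_exact M M F \<and>
     (\<forall>v \<in> Obj V. \<forall>N \<in> Obj M.
        d v N \<in> hom M (omap F (v \<rhd>\<^bsub>B\<^esub> N)) (v \<rhd>\<^bsub>B\<^esub> omap F N) \<and> is_iso M (d v N)) \<and>
     (\<forall>v w N L. \<forall>f \<in> hom V v w. \<forall>g \<in> hom M N L.
        d w L \<cdot>\<^bsub>M\<^esub> amap F (f \<triangleright>\<^bsub>B\<^esub> g) = (f \<triangleright>\<^bsub>B\<^esub> amap F g) \<cdot>\<^bsub>M\<^esub> d v N) \<and>
     (\<forall>v \<in> Obj V. \<forall>w \<in> Obj V. \<forall>N \<in> Obj M.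
        Asc B v w (omap F N) \<cdot>\<^bsub>M\<^esub> d (v \<otimes>\<^bsub>V\<^esub> w) N =
        (Id V v \<triangleright>\<^bsub>B\<^esub> d w N) \<cdot>\<^bsub>M\<^esub> d v (w \<rhd>\<^bsub>B\<^esub> N) \<cdot>\<^bsub>M\<^esub> amap F (Asc B v w N)) \<and>
     (\<forall>N \<in> Obj M. Lun B (omap F N) \<cdot>\<^bsub>M\<^esub> d \<one>\<^bsub>V\<^esub> N = amap F (Lun B N)))"

definition module_transformation ::
    "('o, 'm, 'k, 'x) moncat_scheme \<Rightarrow> ('p, 'n, 'k, 'y) lincat_scheme \<Rightarrow> ('o, 'm, 'p, 'n) action \<Rightarrow>
     ('o, 'p, 'n) modend \<Rightarrow> ('p \<Rightarrow> 'n) \<Rightarrow> ('o, 'p, 'n) modend \<Rightarrow> bool" where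
  "module_transformation V M B P \<alpha> Q \<longleftrightarrow> \<alpha> \<in> extensional (Obj M) \<and>
     (\<forall>N \<in> Obj M. \<alpha> N \<in> hom M (omap (fst P) N) (omap (fst Q) N)) \<and>
     (\<forall>N L. \<forall>g \<in> hom M N L. \<alpha> L \<cdot>\<^bsub>M\<^esub> amap (fst P) g = amap (fst Q) g \<cdot>\<^bsub>M\<^esub> \<alpha> N) \<and>
     (\<forall>v \<in> Obj V. \<forall>N \<in> Obj M.
        snd Q v N \<cdot>\<^bsub>M\<^esub> \<alpha> (v \<rhd>\<^bsub>B\<^esub> N) = (Id V v \<triangleright>\<^bsub>B\<^esub> \<alpha> N) \<cdot>\<^bsub>M\<^esub> snd P v N)"

definition EndV ::
    "('o, 'm, 'k, 'x) moncat_scheme \<Rightarrow> ('p, 'n, 'k, 'y) lincat_scheme \<Rightarrow> ('o, 'm, 'p, 'n) action \<Rightarrow>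
     (('o, 'p, 'n) modend, ('o, 'p, 'n) modend \<times> ('p \<Rightarrow> 'n) \<times> ('o, 'p, 'n) modend) cat" where
  "EndV V M B =
    \<lparr> Obj = {P. module_endofunctor V M B P},
      Arr = {(P, \<alpha>, Q). module_endofunctor V M B P \<and> module_endofunctor V M B Q \<and>
                        module_transformation V M B P \<alpha> Q},
      Dom = \<lambda>f. fst f,
      Cod = \<lambda>f. snd (snd f),
      Id = \<lambda>P. (P, \<lambda>N \<in> Obj M. Id M (omap (fst P) N), P),
      Comp = \<lambda>g f. (fst f, \<lambda>N \<in> Obj M. und g N \<cdot>\<^bsub>M\<^esub> und f N, snd (snd g)) \<rparr>"

text \<open>The action functor \<open>\<rho> : C \<rightarrow> End\<^sub>V(M)\<close>; the module structure
  \<open>X \<rhd> (G v \<rhd> N) \<rightarrow> G v \<rhd> (X \<rhd> N)\<close> of \<open>X \<rhd> -\<close> is given by the inverse half-braiding.\<close>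

definition act_obj_functor ::
    "('p, 'n, 'k, 'y) moncat_scheme \<Rightarrow> ('q, 'r, 'k, 'w) lincat_scheme \<Rightarrow> ('p, 'n, 'q, 'r) action \<Rightarrow>
     ('o, 'm, ('p, 'n) center_obj, ('p, 'n) center_arr) monfunctr \<Rightarrow> 'p \<Rightarrow> ('o, 'q, 'r) modend" where
  "act_obj_functor C M A G X =
     (\<lparr> omap = \<lambda>N. X \<rhd>\<^bsub>A\<^esub> N, amap = \<lambda>g. Id C X \<triangleright>\<^bsub>A\<^esub> g \<rparr>,
      \<lambda>v N. Asc A (GO G v) X N \<cdot>\<^bsub>M\<^esub> (inv_arr C (hb G v X) \<triangleright>\<^bsub>A\<^esub> Id M N) \<cdot>\<^bsub>M\<^esub>
            inv_arr M (Asc A X (GO G v) N))"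

definition act_functor ::
    "('p, 'n, 'k, 'y) moncat_scheme \<Rightarrow> ('q, 'r, 'k, 'w) lincat_scheme \<Rightarrow> ('p, 'n, 'q, 'r) action \<Rightarrow>
     ('o, 'm, ('p, 'n) center_obj, ('p, 'n) center_arr) monfunctr \<Rightarrow>
     ('p, 'n, ('o, 'q, 'r) modend, ('o, 'q, 'r) modend \<times> ('q \<Rightarrow> 'r) \<times> ('o, 'q, 'r) modend) functr" where
  "act_functor C M A G =
    \<lparr> omap = act_obj_functor C M A G,
      amap = \<lambda>f. (act_obj_functor C M A G (Dom C f), \<lambda>N \<in> Obj M. f \<triangleright>\<^bsub>A\<^esub> Id M N,
                   act_obj_functor C M A G (Cod C f)) \<rparr>"


section \<open>Internal Hom\<close>

text \<open>\<open>IHom H N L\<close> represents \<open>Hom(- \<rhd> N, L)\<close>, via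
  \<open>Phi H N L X : Hom(X, IHom H N L) \<rightarrow> Hom(X \<rhd> N, L)\<close>.\<close>

record ('p, 'n, 'q, 'r) inthom =
  IHom :: "'q \<Rightarrow> 'q \<Rightarrow> 'p"
  Phi :: "'q \<Rightarrow> 'q \<Rightarrow> 'p \<Rightarrow> 'n \<Rightarrow> 'r"

definition internal_hom ::
    "('p, 'n, 'k, 'y) moncat_scheme \<Rightarrow> ('q, 'r, 'k, 'w) lincat_scheme \<Rightarrow> ('p, 'n, 'q, 'r) action \<Rightarrow>
     ('p, 'n, 'q, 'r) inthom \<Rightarrow> bool" where
  "internal_hom C M A H \<longleftrightarrow>
     (\<forall>N \<in> Obj M. \<forall>L \<in> Obj M. IHom H N L \<in> Obj C \<and>
        (\<forall>X \<in> Obj C. bij_betw (Phi H N L X) (hom C X (IHom H N L)) (hom M (X \<rhd>\<^bsub>A\<^esub> N) L)) \<and>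
        (\<forall>X Y. \<forall>f \<in> hom C Y X. \<forall>u \<in> hom C X (IHom H N L).
           Phi H N L Y (u \<cdot>\<^bsub>C\<^esub> f) = Phi H N L X u \<cdot>\<^bsub>M\<^esub> (f \<triangleright>\<^bsub>A\<^esub> Id M N)))"

text \<open>The universal morphism \<open>IHom H N L \<rhd> N \<rightarrow> L\<close>.\<close>

definition ih_eval ::
    "('p, 'n, 'k, 'y) moncat_scheme \<Rightarrow> ('p, 'n, 'q, 'r) inthom \<Rightarrow> 'q \<Rightarrow> 'q \<Rightarrow> 'r" where
  "ih_eval C H N L = Phi H N L (IHom H N L) (Id C (IHom H N L))"

text \<open>Functoriality of the internal Hom, by the Yoneda lemma: for \<open>f : N' \<rightarrow> N\<close> and
  \<open>g : L \<rightarrow> L'\<close>, the morphism \<open>IHom H N L \<rightarrow> IHom H N' L'\<close> corresponding to the map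
  \<open>h \<mapsto> g \<cdot> h \<cdot> (X \<rhd> f)\<close> from \<open>Hom(X \<rhd> N, L)\<close> to \<open>Hom(X \<rhd> N', L')\<close>.\<close>

definition IHomA ::
    "('p, 'n, 'k, 'y) moncat_scheme \<Rightarrow> ('q, 'r, 'k, 'w) lincat_scheme \<Rightarrow> ('p, 'n, 'q, 'r) action \<Rightarrow>
     ('p, 'n, 'q, 'r) inthom \<Rightarrow> 'r \<Rightarrow> 'r \<Rightarrow> 'n" where
  "IHomA C M A H f g =
     (let N' = Dom M f; N = Cod M f; L = Dom M g; L' = Cod M g; E = IHom H N L in
       THE u. u \<in> hom C E (IHom H N' L') \<and>
              Phi H N' L' E u = g \<cdot>\<^bsub>M\<^esub> ih_eval C H N L \<cdot>\<^bsub>M\<^esub> (Id C E \<triangleright>\<^bsub>A\<^esub> f))"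


section \<open>Relative ends\<close>

text \<open>Functors \<open>S : M\<^sup>o\<^sup>p \<times> M \<rightarrow> C\<close>: for \<open>f : N' \<rightarrow> N\<close> and \<open>g : L \<rightarrow> L'\<close>,
  \<open>SA S f g : S(N, L) \<rightarrow> S(N', L')\<close>.\<close>

record ('q, 'r, 'p, 'n) bifunctr =
  SO :: "'q \<Rightarrow> 'q \<Rightarrow> 'p"
  SA :: "'r \<Rightarrow> 'r \<Rightarrow> 'n"

definition is_bifunctor ::
    "('q, 'r, 'x) cat_scheme \<Rightarrow> ('p, 'n, 'y) cat_scheme \<Rightarrow> ('q, 'r, 'p, 'n) bifunctr \<Rightarrow> bool" where
  "is_bifunctor M C S \<longleftrightarrow>
     (\<forall>N \<in> Obj M. \<forall>L \<in> Obj M. SO S N L \<in> Obj C \<and> SA S (Id M N) (Id M L) = Id C (SO S N L)) \<and>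
     (\<forall>N N' L L'. \<forall>f \<in> hom M N' N. \<forall>g \<in> hom M L L'.
        SA S f g \<in> hom C (SO S N L) (SO S N' L')) \<and>
     (\<forall>N N' N'' L L' L''. \<forall>f \<in> hom M N' N. \<forall>f' \<in> hom M N'' N'. \<forall>g \<in> hom M L L'. \<forall>g' \<in> hom M L' L''.
        SA S (f \<cdot>\<^bsub>M\<^esub> f') (g' \<cdot>\<^bsub>M\<^esub> g) = SA S f' g' \<cdot>\<^bsub>C\<^esub> SA S f g)"

definition prebalancing ::
    "('o, 'm, 'k, 'x) moncat_scheme \<Rightarrow> ('o, 'm) duality \<Rightarrow> ('q, 'r, 'w) cat_scheme \<Rightarrow>
     ('o, 'm, 'q, 'r) action \<Rightarrow> ('p, 'n, 'y) cat_scheme \<Rightarrow> ('q, 'r, 'p, 'n) bifunctr \<Rightarrow>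
     ('o \<Rightarrow> 'q \<Rightarrow> 'q \<Rightarrow> 'n) \<Rightarrow> bool" where
  "prebalancing V D M B C S \<beta> \<longleftrightarrow>
     (\<forall>v \<in> Obj V. \<forall>N \<in> Obj M. \<forall>L \<in> Obj M.
        \<beta> v N L \<in> hom C (SO S N (v \<rhd>\<^bsub>B\<^esub> L)) (SO S (DualO D v \<rhd>\<^bsub>B\<^esub> N) L) \<and> is_iso C (\<beta> v N L)) \<and>
     (\<forall>v w N N' L L'. \<forall>k \<in> hom V v w. \<forall>f \<in> hom M N' N. \<forall>g \<in> hom M L L'.
        \<beta> w N' L' \<cdot>\<^bsub>C\<^esub> SA S f (k \<triangleright>\<^bsub>B\<^esub> g) = SA S (DualA V D k \<triangleright>\<^bsub>B\<^esub> f) g \<cdot>\<^bsub>C\<^esub> \<beta> v N L)"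

text \<open>The morphism \<open>v\<^sup>* \<rhd> (v \<rhd> N) \<rightarrow> N\<close> induced by the evaluation of \<open>v\<close>.\<close>

definition act_ev ::
    "('o, 'm) duality \<Rightarrow> ('q, 'r, 'w) cat_scheme \<Rightarrow> ('o, 'm, 'q, 'r) action \<Rightarrow> 'o \<Rightarrow> 'q \<Rightarrow> 'r" where
  "act_ev D M B v N =
     Lun B N \<cdot>\<^bsub>M\<^esub> (Ev D v \<triangleright>\<^bsub>B\<^esub> Id M N) \<cdot>\<^bsub>M\<^esub> inv_arr M (Asc B (DualO D v) v N)"

definition relative_wedge ::
    "('o, 'm, 'k, 'x) moncat_scheme \<Rightarrow> ('o, 'm) duality \<Rightarrow> ('q, 'r, 'w) cat_scheme \<Rightarrow>
     ('o, 'm, 'q, 'r) action \<Rightarrow> ('p, 'n, 'y) cat_scheme \<Rightarrow> ('q, 'r, 'p, 'n) bifunctr \<Rightarrow>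
     ('o \<Rightarrow> 'q \<Rightarrow> 'q \<Rightarrow> 'n) \<Rightarrow> 'p \<Rightarrow> ('q \<Rightarrow> 'n) \<Rightarrow> bool" where
  "relative_wedge V D M B C S \<beta> E \<pi> \<longleftrightarrow> E \<in> Obj C \<and>
     (\<forall>N \<in> Obj M. \<pi> N \<in> hom C E (SO S N N)) \<and>
     (\<forall>N L. \<forall>f \<in> hom M N L. SA S (Id M N) f \<cdot>\<^bsub>C\<^esub> \<pi> N = SA S f (Id M L) \<cdot>\<^bsub>C\<^esub> \<pi> L) \<and>
     (\<forall>v \<in> Obj V. \<forall>N \<in> Obj M.
        SA S (act_ev D M B v N) (Id M N) \<cdot>\<^bsub>C\<^esub> \<pi> N = \<beta> v (v \<rhd>\<^bsub>B\<^esub> N) N \<cdot>\<^bsub>C\<^esub> \<pi> (v \<rhd>\<^bsub>B\<^esub> N))"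

definition relative_end ::
    "('o, 'm, 'k, 'x) moncat_scheme \<Rightarrow> ('o, 'm) duality \<Rightarrow> ('q, 'r, 'w) cat_scheme \<Rightarrow>
     ('o, 'm, 'q, 'r) action \<Rightarrow> ('p, 'n, 'y) cat_scheme \<Rightarrow> ('q, 'r, 'p, 'n) bifunctr \<Rightarrow>
     ('o \<Rightarrow> 'q \<Rightarrow> 'q \<Rightarrow> 'n) \<Rightarrow> 'p \<Rightarrow> ('q \<Rightarrow> 'n) \<Rightarrow> bool" where
  "relative_end V D M B C S \<beta> E \<pi> \<longleftrightarrow>
     is_bifunctor M C S \<and> prebalancing V D M B C S \<beta> \<and> relative_wedge V D M B C S \<beta> E \<pi> \<and>
     (\<forall>E' \<xi>. relative_wedge V D M B C S \<beta> E' \<xi> \<longrightarrow>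
        (\<exists>!h. h \<in> hom C E' E \<and> (\<forall>N \<in> Obj M. \<xi> N = \<pi> N \<cdot>\<^bsub>C\<^esub> h)))"


section \<open>The functor given by relative ends of internal Homs\<close>

text \<open>The functor \<open>(N, L) \<mapsto> IHom H N (F L)\<close>.\<close>

definition ihom_bifunctr ::
    "('p, 'n, 'k, 'y) moncat_scheme \<Rightarrow> ('q, 'r, 'k, 'w) lincat_scheme \<Rightarrow> ('p, 'n, 'q, 'r) action \<Rightarrow>
     ('p, 'n, 'q, 'r) inthom \<Rightarrow> ('q, 'r, 'q, 'r) functr \<Rightarrow> ('q, 'r, 'p, 'n) bifunctr" where
  "ihom_bifunctr C M A H F =
    \<lparr> SO = \<lambda>N L. IHom H N (omap F L), SA = \<lambda>f g. IHomA C M A H f (amap F g) \<rparr>"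

text \<open>For \<open>f : X \<rhd> N \<rightarrow> F (G v \<rhd> L)\<close>, the composite
  \<open>X \<rhd> (G v\<^sup>* \<rhd> N) \<rightarrow> (X \<otimes> G v\<^sup>*) \<rhd> N \<rightarrow> (G v\<^sup>* \<otimes> X) \<rhd> N \<rightarrow> G v\<^sup>* \<rhd> (X \<rhd> N)
  \<rightarrow> G v\<^sup>* \<rhd> (G v \<rhd> F L) \<rightarrow> (G v\<^sup>* \<otimes> G v) \<rhd> F L \<rightarrow> \<one> \<rhd> F L \<rightarrow> F L\<close>.\<close>

definition gamma ::
    "('o, 'm) duality \<Rightarrow> ('p, 'n, 'k, 'y) moncat_scheme \<Rightarrow> ('q, 'r, 'k, 'w) lincat_scheme \<Rightarrow>
     ('p, 'n, 'q, 'r) action \<Rightarrow> ('o, 'm, ('p, 'n) center_obj, ('p, 'n) center_arr) monfunctr \<Rightarrow>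
     ('o, 'q, 'r) modend \<Rightarrow> 'p \<Rightarrow> 'o \<Rightarrow> 'q \<Rightarrow> 'q \<Rightarrow> 'r \<Rightarrow> 'r" where
  "gamma D C M A G P X v N L f =
     (let FL = omap (fst P) L; d = snd P; v' = DualO D v in
       Lun A FL \<cdot>\<^bsub>M\<^esub>
       (GEv C D G v \<triangleright>\<^bsub>A\<^esub> Id M FL) \<cdot>\<^bsub>M\<^esub>
       inv_arr M (Asc A (GO G v') (GO G v) FL) \<cdot>\<^bsub>M\<^esub>
       (Id C (GO G v') \<triangleright>\<^bsub>A\<^esub> (d v L \<cdot>\<^bsub>M\<^esub> f)) \<cdot>\<^bsub>M\<^esub>
       Asc A (GO G v') X N \<cdot>\<^bsub>M\<^esub>
       (inv_arr C (hb G v' X) \<triangleright>\<^bsub>A\<^esub> Id M N) \<cdot>\<^bsub>M\<^esub>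
       inv_arr M (Asc A X (GO G v') N))"

definition beta ::
    "('o, 'm) duality \<Rightarrow> ('p, 'n, 'k, 'y) moncat_scheme \<Rightarrow> ('q, 'r, 'k, 'w) lincat_scheme \<Rightarrow>
     ('p, 'n, 'q, 'r) action \<Rightarrow> ('o, 'm, ('p, 'n) center_obj, ('p, 'n) center_arr) monfunctr \<Rightarrow>
     ('p, 'n, 'q, 'r) inthom \<Rightarrow> ('o, 'q, 'r) modend \<Rightarrow> 'o \<Rightarrow> 'q \<Rightarrow> 'q \<Rightarrow> 'n" where
  "beta D C M A G H P v N L =
     (let F = fst P; vN = GO G (DualO D v) \<rhd>\<^bsub>A\<^esub> N; FvL = omap F (GO G v \<rhd>\<^bsub>A\<^esub> L); E = IHom H N FvL in
       THE b. b \<in> hom C E (IHom H vN (omap F L)) \<and>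
              Phi H vN (omap F L) E b = gamma D C M A G P E v N L (ih_eval C H N FvL))"

definition ihom_relative_end ::
    "('o, 'm, 'k, 'x) moncat_scheme \<Rightarrow> ('o, 'm) duality \<Rightarrow> ('p, 'n, 'k, 'y) moncat_scheme \<Rightarrow>
     ('q, 'r, 'k, 'w) lincat_scheme \<Rightarrow> ('p, 'n, 'q, 'r) action \<Rightarrow>
     ('o, 'm, ('p, 'n) center_obj, ('p, 'n) center_arr) monfunctr \<Rightarrow> ('p, 'n, 'q, 'r) inthom \<Rightarrow>
     ('o, 'q, 'r) modend \<Rightarrow> 'p \<Rightarrow> ('q \<Rightarrow> 'n) \<Rightarrow> bool" where
  "ihom_relative_end V D C M A G H P E \<pi> \<longleftrightarrow>
     relative_end V D M (central_action C M A G) C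
       (ihom_bifunctr C M A H (fst P)) (beta D C M A G H P) E \<pi>"

text \<open>The functor \<open>P \<mapsto> R P\<close>, for a choice of relative ends \<open>R P\<close> with dinatural
  transformations \<open>\<lambda> P\<close>.\<close>

definition rho_bar ::
    "('p, 'n, 'k, 'y) moncat_scheme \<Rightarrow> ('q, 'r, 'k, 'w) lincat_scheme \<Rightarrow> ('p, 'n, 'q, 'r) action \<Rightarrow>
     ('p, 'n, 'q, 'r) inthom \<Rightarrow> (('o, 'q, 'r) modend \<Rightarrow> 'p) \<Rightarrow> (('o, 'q, 'r) modend \<Rightarrow> 'q \<Rightarrow> 'n) \<Rightarrow>
     (('o, 'q, 'r) modend, ('o, 'q, 'r) modend \<times> ('q \<Rightarrow> 'r) \<times> ('o, 'q, 'r) modend, 'p, 'n) functr" where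
  "rho_bar C M A H R lam =
    \<lparr> omap = R,
      amap = \<lambda>(P, \<alpha>, Q). THE u. u \<in> hom C (R P) (R Q) \<and>
               (\<forall>N \<in> Obj M. IHomA C M A H (Id M N) (\<alpha> N) \<cdot>\<^bsub>C\<^esub> lam P N = lam Q N \<cdot>\<^bsub>C\<^esub> u) \<rparr>"

end

theory Submission
  imports Defs
begin

text \<open>Under \<open>Hom(X, IHom(N, F N)) \<cong> Hom(X \<rhd> N, F N)\<close> a relative wedge with vertex \<open>X\<close> becomes a
  module transformation \<open>\<rho> X \<rightarrow> (F, d)\<close>: dinaturality becomes naturality, and transposing along
  the duality between \<open>G v\<^sup>*\<close> and \<open>G v\<close> turns the condition on \<open>\<beta>\<close> into compatibility with \<open>d\<close>.
  So a relative end represents \<open>X \<mapsto> Hom(\<rho> X, (F, d))\<close>, which is the adjunction. It exists because transformations out of \<open>X \<rhd> -\<close>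
  are determined by their component at a generator \<open>Q\<close> of \<open>M\<close>; they form a subfunctor of
  \<open>Hom(-, IHom(Q, F Q))\<close> stable under sums and under descent along epimorphisms, and since objects have
  finite length, such a subfunctor is represented by a largest subobject. Internal Homs are found in
  the same way: take enough copies of a generator \<open>P\<close> of \<open>C\<close> to reach all of \<open>Hom(P \<rhd> N, L)\<close>, and
  divide by the largest subobject on which the evaluation vanishes.\<close>

text \<open>Both the internal Homs and the relative ends are defined by conditions over all objects,
  so neither is a finite limit that could be written down. Finiteness enters in two places: finitely
  many simples, each with a projective cover, give one object from which all others arise by
  biproducts and quotients; finite length lets the largest subobject be built along a filtration
  with simple quotients, where a single member of the class with nonzero image in the simple
  quotient is already epi onto it and settles the step. Descent along an epimorphism holds for
  transformations because the composite with the kernel vanishes at the generator, hence everywhere,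
  and the action is exact. The other obstacle is that the action is associative only up to
  isomorphism, while \<open>gamma\<close> and the module axioms mix associators, unitors and
  half-braidings. Each such composite is rewritten as \<open>br\<close> of one morphism of the
  strict category \<open>C\<close>. What then remains is that \<open>mu\<close>, \<open>eta\<close>
  and the images under \<open>G\<close> of morphisms of \<open>V\<close> commute with
  half-braidings, being morphisms of the center.\<close>

lemma in_hom: "f \<in> hom C X Y \<longleftrightarrow> f \<in> Arr C \<and> Dom C f = X \<and> Cod C f = Y"
  by (auto simp: hom_def)

section \<open>Categories\<close>

context category
begin

lemma Dom_Cod_Obj [simp]: "f \<in> Arr C \<Longrightarrow> Dom C f \<in> Obj C" "f \<in> Arr C \<Longrightarrow> Cod C f \<in> Obj C"
  by (auto intro: dom_obj cod_obj)

lemma Id_arr [simp]: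
  assumes "X \<in> Obj C"
  shows "Id C X \<in> Arr C" "Dom C (Id C X) = X" "Cod C (Id C X) = X"
  using id_hom[OF assms] by (auto simp: in_hom)

lemma Comp_arr [simp]:
  assumes "g \<in> Arr C" "f \<in> Arr C" "Dom C g = Cod C f"
  shows "g \<cdot> f \<in> Arr C" "Dom C (g \<cdot> f) = Dom C f" "Cod C (g \<cdot> f) = Cod C g"
  using comp_hom[of g "Cod C f" "Cod C g" f "Dom C f"] assms by (auto simp: in_hom)

lemma Comp_Id [simp]:
  "f \<in> Arr C \<Longrightarrow> Cod C f = Y \<Longrightarrow> Id C Y \<cdot> f = f"
  "f \<in> Arr C \<Longrightarrow> Dom C f = X \<Longrightarrow> f \<cdot> Id C X = f"
  using id_left[of f X Y] id_left[of f "Dom C f" Y] id_right[of f X "Cod C f"]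
  by (auto simp: in_hom)

lemma Comp_assoc [simp]:
  assumes "h \<in> Arr C" "g \<in> Arr C" "f \<in> Arr C" "Dom C h = Cod C g" "Dom C g = Cod C f"
  shows "(h \<cdot> g) \<cdot> f = h \<cdot> (g \<cdot> f)"
  using assms by (rule_tac comp_assoc) (auto simp: in_hom)

text \<open>Composites are normalised to right-nested form, so an equation for
  \<open>g \<cdot> f\<close> no longer matches once \<open>f\<close> is followed by a further factor
  \<open>x\<close>. This form, and \<open>Comp_extend2\<close> for commuting squares, rewrite at the
  head of such a composite.\<close>

lemma Comp_extend:
  assumes "g \<cdot> f = e" "g \<in> Arr C" "f \<in> Arr C" "Dom C g = Cod C f" "x \<in> Arr C" "Dom C f = Cod C x"
  shows "g \<cdot> (f \<cdot> x) = e \<cdot> x"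
  using assms by (metis Comp_assoc)

lemma Comp_extend2:
  assumes "g \<cdot> f = g' \<cdot> f'" "g \<in> Arr C" "f \<in> Arr C" "Dom C g = Cod C f"
    "g' \<in> Arr C" "f' \<in> Arr C" "Dom C g' = Cod C f'" "x \<in> Arr C" "Dom C f = Cod C x"
  shows "g \<cdot> (f \<cdot> x) = g' \<cdot> (f' \<cdot> x)"
proof -
  have "Dom C f' = Dom C f"
    using assms by (metis Comp_arr(2))
  then show ?thesis
    using assms by (metis Comp_assoc)
qed

lemma inverse_arrows_unique:
  assumes "inverse_arrows C f g" "inverse_arrows C f h"
  shows "g = h"
proof -
  have "g = g \<cdot> (f \<cdot> h)"
    using assms by (simp add: inverse_arrows_def in_hom)
  also have "\<dots> = (g \<cdot> f) \<cdot> h"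
    using assms by (subst Comp_assoc) (auto simp: inverse_arrows_def in_hom)
  also have "\<dots> = h"
    using assms by (simp add: inverse_arrows_def in_hom)
  finally show ?thesis .
qed

lemma inv_arr_eqI: "inverse_arrows C f g \<Longrightarrow> inv_arr C f = g"
  unfolding inv_arr_def by (rule the_equality) (auto intro: inverse_arrows_unique)

lemma inverse_arrows_inv_arr: "is_iso C f \<Longrightarrow> inverse_arrows C f (inv_arr C f)"
  using inv_arr_eqI by (auto simp: is_iso_def)

lemma iso_arr: "is_iso C f \<Longrightarrow> f \<in> Arr C"
  by (auto simp: is_iso_def inverse_arrows_def)

lemma inv_arr [simp]:
  assumes "is_iso C f"
  shows "inv_arr C f \<in> Arr C" "Dom C (inv_arr C f) = Cod C f" "Cod C (inv_arr C f) = Dom C f"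
    "f \<cdot> inv_arr C f = Id C (Cod C f)" "inv_arr C f \<cdot> f = Id C (Dom C f)"
  using inverse_arrows_inv_arr[OF assms] by (auto simp: inverse_arrows_def in_hom)

lemma inv_arr_cancel [simp]:
  assumes "is_iso C f" "x \<in> Arr C"
  shows "Cod C x = Cod C f \<Longrightarrow> f \<cdot> (inv_arr C f \<cdot> x) = x"
    "Cod C x = Dom C f \<Longrightarrow> inv_arr C f \<cdot> (f \<cdot> x) = x"
  using assms iso_arr[OF assms(1)] by (simp_all add: Comp_extend[of f] Comp_extend[of "inv_arr C f"])

lemma isoI:
  assumes "f \<in> Arr C" "g \<in> Arr C" "Dom C g = Cod C f" "Cod C g = Dom C f"
    "g \<cdot> f = Id C (Dom C f)" "f \<cdot> g = Id C (Cod C f)"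
  shows "is_iso C f" "inv_arr C f = g"
proof -
  have "inverse_arrows C f g"
    using assms by (auto simp: inverse_arrows_def in_hom)
  then show "is_iso C f" "inv_arr C f = g"
    using inv_arr_eqI by (auto simp: is_iso_def)
qed

lemma iso_inv_arr [simp]: "is_iso C f \<Longrightarrow> is_iso C (inv_arr C f)"
  by (rule isoI[of _ f]) (auto dest: iso_arr)

lemma inv_arr_inv_arr [simp]: "is_iso C f \<Longrightarrow> inv_arr C (inv_arr C f) = f"
  by (rule isoI[of _ f]) (auto dest: iso_arr)

lemma iso_Id [simp]: "X \<in> Obj C \<Longrightarrow> is_iso C (Id C X)" "X \<in> Obj C \<Longrightarrow> inv_arr C (Id C X) = Id C X"
  by (auto intro: isoI[of _ "Id C X"])

lemma iso_Comp:
  assumes "is_iso C g" "is_iso C f" "Dom C g = Cod C f"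
  shows "is_iso C (g \<cdot> f)" "inv_arr C (g \<cdot> f) = inv_arr C f \<cdot> inv_arr C g"
  using isoI[of "g \<cdot> f" "inv_arr C f \<cdot> inv_arr C g"] assms iso_arr[OF assms(1)] iso_arr[OF assms(2)]
  by auto

lemma iso_cancel_right:
  assumes "is_iso C f" "g \<cdot> f = h \<cdot> f" "g \<in> Arr C" "h \<in> Arr C" "Dom C g = Cod C f" "Dom C h = Cod C f"
  shows "g = h"
proof -
  have "(g \<cdot> f) \<cdot> inv_arr C f = (h \<cdot> f) \<cdot> inv_arr C f"
    using assms(2) by simp
  then show ?thesis
    using assms(1,3-) iso_arr[OF assms(1)] by simp
qed

text \<open>Inverts the two parallel isomorphisms of a commuting square. This turns naturality of
  half-braidings, of \<open>mu\<close> and of \<open>can\<close> into naturality of their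
  inverses.\<close>

lemma conj_inv:
  assumes "is_iso C s" "is_iso C t" "t \<cdot> f = g \<cdot> s" "f \<in> Arr C" "g \<in> Arr C"
    "Dom C t = Cod C f" "Dom C g = Cod C s"
  shows "inv_arr C t \<cdot> g = f \<cdot> inv_arr C s"
proof -
  note a = iso_arr[OF assms(1)] iso_arr[OF assms(2)]
  have d: "Dom C f = Dom C s" "Cod C g = Cod C t"
    using assms a by (metis Comp_arr(2), metis Comp_arr(3))
  have "inv_arr C t \<cdot> g = inv_arr C t \<cdot> ((g \<cdot> s) \<cdot> inv_arr C s)"
    using assms a d by simp
  also have "\<dots> = inv_arr C t \<cdot> ((t \<cdot> f) \<cdot> inv_arr C s)"
    using assms by simp
  also have "\<dots> = f \<cdot> inv_arr C s"
    using assms(1,2,4-) a d by simp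
  finally show ?thesis .
qed

lemma mono_arr: "is_mono C f \<Longrightarrow> f \<in> Arr C"
  by (simp add: is_mono_def)

lemma epi_arr: "is_epi C f \<Longrightarrow> f \<in> Arr C"
  by (simp add: is_epi_def)

lemma mono_cancel:
  assumes "is_mono C f" "f \<cdot> g = f \<cdot> h" "g \<in> Arr C" "h \<in> Arr C" "Cod C g = Dom C f" "Cod C h = Dom C f"
  shows "g = h"
proof -
  have "Dom C g = Dom C h"
    using assms by (metis Comp_arr(2) mono_arr)
  then have "g \<in> hom C (Dom C h) (Dom C f)" "h \<in> hom C (Dom C h) (Dom C f)"
    using assms by (auto simp: in_hom)
  then show ?thesis
    using assms(1,2) unfolding is_mono_def by blast
qed

lemma epi_cancel:
  assumes "is_epi C f" "g \<cdot> f = h \<cdot> f" "g \<in> Arr C" "h \<in> Arr C" "Dom C g = Cod C f" "Dom C h = Cod C f"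
  shows "g = h"
proof -
  have "Cod C g = Cod C h"
    using assms by (metis Comp_arr(3) epi_arr)
  then have "g \<in> hom C (Cod C f) (Cod C h)" "h \<in> hom C (Cod C f) (Cod C h)"
    using assms by (auto simp: in_hom)
  then show ?thesis
    using assms(1,2) unfolding is_epi_def by blast
qed

lemma epi_Comp:
  assumes "is_epi C g" "is_epi C f" "Dom C g = Cod C f"
  shows "is_epi C (g \<cdot> f)"
  unfolding is_epi_def
proof (intro conjI allI ballI impI)
  note a = epi_arr[OF assms(1)] epi_arr[OF assms(2)]
  show "g \<cdot> f \<in> Arr C" using a assms by simp
  fix X h k
  assume "h \<in> hom C (Cod C (g \<cdot> f)) X" "k \<in> hom C (Cod C (g \<cdot> f)) X" and eq: "h \<cdot> (g \<cdot> f) = k \<cdot> (g \<cdot> f)"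
  then have h: "h \<in> Arr C" "k \<in> Arr C" "Dom C h = Cod C g" "Dom C k = Cod C g"
    using a assms by (auto simp: in_hom)
  have "(h \<cdot> g) \<cdot> f = (k \<cdot> g) \<cdot> f"
    using h a assms(3) eq by simp
  then have "h \<cdot> g = k \<cdot> g"
    using h a assms by (rule_tac epi_cancel[OF assms(2)]) auto
  then show "h = k"
    using h by (rule_tac epi_cancel[OF assms(1)]) auto
qed

lemma iso_epi:
  assumes "is_iso C f"
  shows "is_epi C f"
  unfolding is_epi_def
proof (intro conjI allI ballI impI)
  fix X g h
  assume "g \<in> hom C (Cod C f) X" "h \<in> hom C (Cod C f) X" "g \<cdot> f = h \<cdot> f"
  then show "g = h"
    by (rule_tac iso_cancel_right[OF assms]) (auto simp: in_hom)
qed (rule iso_arr[OF assms])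

end

section \<open>Linear and abelian categories\<close>

context linear_category
begin

lemma Zero_arr [simp]:
  assumes "X \<in> Obj C" "Y \<in> Obj C"
  shows "Zero C X Y \<in> Arr C" "Dom C (Zero C X Y) = X" "Cod C (Zero C X Y) = Y"
  using zero_hom[OF assms] by (auto simp: in_hom)

lemma Smul_arr [simp]:
  assumes "f \<in> Arr C"
  shows "a \<odot> f \<in> Arr C" "Dom C (a \<odot> f) = Dom C f" "Cod C (a \<odot> f) = Cod C f"
  using smul_hom[of f "Dom C f" "Cod C f" a] assms by (auto simp: in_hom)

lemma Add_arr [simp]:
  assumes "f \<in> Arr C" "g \<in> Arr C" "Dom C f = Dom C g" "Cod C f = Cod C g"
  shows "f \<oplus> g \<in> Arr C" "Dom C (f \<oplus> g) = Dom C g" "Cod C (f \<oplus> g) = Cod C g"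
  using add_hom[of f "Dom C g" "Cod C g" g] assms by (auto simp: in_hom)

lemma Add_Zero [simp]:
  assumes "f \<in> Arr C" "Dom C f = X" "Cod C f = Y"
  shows "f \<oplus> Zero C X Y = f" "Zero C X Y \<oplus> f = f"
proof -
  have f: "f \<in> hom C X Y" "X \<in> Obj C" "Y \<in> Obj C"
    using assms by (auto simp: in_hom)
  show "f \<oplus> Zero C X Y = f"
    using f by (simp add: add_zero)
  then show "Zero C X Y \<oplus> f = f"
    using f by (simp add: add_commute[OF zero_hom])
qed

lemma add_right_cancel:
  assumes "f \<in> hom C X Y" "g \<in> hom C X Y" "h \<in> hom C X Y" "f \<oplus> h = g \<oplus> h"
  shows "f = g"
proof -
  obtain k where k: "k \<in> hom C X Y" "h \<oplus> k = Zero C X Y"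
    using add_inverse assms by blast
  have "(f \<oplus> h) \<oplus> k = (g \<oplus> h) \<oplus> k"
    using assms by simp
  then show ?thesis
    using assms(1-3) k by (simp add: add_assoc add_zero)
qed

lemma Smul_0:
  assumes "f \<in> hom C X Y"
  shows "0 \<odot> f = Zero C X Y"
proof -
  have X: "X \<in> Obj C" "Y \<in> Obj C"
    using assms by (auto simp: in_hom)
  have "0 \<odot> f \<oplus> 0 \<odot> f = Zero C X Y \<oplus> 0 \<odot> f"
    using smul_add_left[OF assms, of 0 0] assms by (simp add: in_hom)
  then show ?thesis
    using X by (rule_tac add_right_cancel[of _ X Y _ "0 \<odot> f"]) (auto intro: smul_hom assms zero_hom)
qed

lemma Comp_Zero [simp]:
  assumes "f \<in> Arr C" "X \<in> Obj C" "Y \<in> Obj C"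
  shows "Cod C f = X \<Longrightarrow> Zero C X Y \<cdot> f = Zero C (Dom C f) Y"
    "Dom C f = Y \<Longrightarrow> f \<cdot> Zero C X Y = Zero C X (Cod C f)"
proof -
  \<comment> \<open>That zero morphisms absorb composition is not an axiom; written as a multiple by
    the scalar 0, it follows from bilinearity.\<close>
  have z: "Zero C X Y = 0 \<odot> Zero C X Y"
    using assms Smul_0 by (simp add: in_hom)
  show "Zero C X Y \<cdot> f = Zero C (Dom C f) Y" if "Cod C f = X"
    using assms that
    by (subst z, subst comp_smul_left[of _ X Y _ "Dom C f"]) (auto simp: in_hom intro!: Smul_0)
  show "f \<cdot> Zero C X Y = Zero C X (Cod C f)" if "Dom C f = Y"
    using assms that
    by (subst z, subst comp_smul_right[of _ Y "Cod C f" _ X]) (auto simp: in_hom intro!: Smul_0)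
qed

lemma Smul_Zero [simp]:
  assumes "X \<in> Obj C" "Y \<in> Obj C"
  shows "a \<odot> Zero C X Y = Zero C X Y"
proof -
  have "a \<odot> Zero C X Y = a \<odot> 0 \<odot> Zero C X Y"
    using assms Smul_0[of "Zero C X Y" X Y] by (simp add: in_hom)
  also have "\<dots> = Zero C X Y"
    using assms smul_smul[of "Zero C X Y" X Y a 0] Smul_0[of "Zero C X Y" X Y] by (simp add: in_hom)
  finally show ?thesis .
qed

lemma Comp_Add:
  assumes "f \<in> Arr C" "g \<in> Arr C" "Dom C f = Dom C g" "Cod C f = Cod C g" "x \<in> Arr C"
  shows "Dom C g = Cod C x \<Longrightarrow> (f \<oplus> g) \<cdot> x = f \<cdot> x \<oplus> g \<cdot> x"
    "Dom C x = Cod C g \<Longrightarrow> x \<cdot> (f \<oplus> g) = x \<cdot> f \<oplus> x \<cdot> g"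
  using assms comp_add_left[of f "Dom C g" "Cod C g" g x "Dom C x"]
    comp_add_right[of x "Cod C g" "Cod C x" f "Dom C g" g]
  by (auto simp: in_hom)

lemma Comp_Smul:
  assumes "f \<in> Arr C" "x \<in> Arr C"
  shows "Dom C f = Cod C x \<Longrightarrow> (a \<odot> f) \<cdot> x = a \<odot> (f \<cdot> x)"
    "Dom C x = Cod C f \<Longrightarrow> x \<cdot> (a \<odot> f) = a \<odot> (x \<cdot> f)"
  using assms comp_smul_left[of f "Dom C f" "Cod C f" x "Dom C x" a]
    comp_smul_right[of x "Cod C f" "Cod C x" f "Dom C f" a]
  by (auto simp: in_hom)

text \<open>The structure carries no negation; \<open>(- 1) \<odot> f\<close> takes its place, and
  every difference below is written with it.\<close>

lemma Add_neg [simp]: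
  assumes "f \<in> Arr C"
  shows "f \<oplus> (- 1) \<odot> f = Zero C (Dom C f) (Cod C f)" "(- 1) \<odot> f \<oplus> f = Zero C (Dom C f) (Cod C f)"
proof -
  have f: "f \<in> hom C (Dom C f) (Cod C f)" using assms by (simp add: in_hom)
  have "f \<oplus> (- 1) \<odot> f = 1 \<odot> f \<oplus> (- 1) \<odot> f"
    using f by (simp add: smul_one)
  also have "\<dots> = 0 \<odot> f"
    using smul_add_left[OF f, of 1 "-1"] by simp
  finally show *: "f \<oplus> (- 1) \<odot> f = Zero C (Dom C f) (Cod C f)"
    using Smul_0[OF f] by simp
  then show "(- 1) \<odot> f \<oplus> f = Zero C (Dom C f) (Cod C f)"
    using add_commute[OF f] f smul_hom by metis
qed

lemma eq_if_diff_Zero: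
  assumes "f \<in> Arr C" "g \<in> Arr C" "Dom C f = Dom C g" "Cod C f = Cod C g"
    and "f \<oplus> (- 1) \<odot> g = Zero C (Dom C g) (Cod C g)"
  shows "f = g"
proof (rule add_right_cancel)
  show "f \<oplus> (- 1) \<odot> g = g \<oplus> (- 1) \<odot> g"
    using assms by simp
qed (use assms in \<open>auto simp: in_hom\<close>)

text \<open>By bilinearity, \<open>f \<cdot> g = f \<cdot> h\<close> says that \<open>f\<close>
  kills a difference, so only zero composites need testing.\<close>

lemma monoI:
  assumes "f \<in> Arr C"
    and "\<And>g. g \<in> Arr C \<Longrightarrow> Cod C g = Dom C f \<Longrightarrow> f \<cdot> g = Zero C (Dom C g) (Cod C f) \<Longrightarrow>
      g = Zero C (Dom C g) (Dom C f)"
  shows "is_mono C f"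
  unfolding is_mono_def
proof (intro conjI allI ballI impI)
  fix X g h
  assume gh: "g \<in> hom C X (Dom C f)" "h \<in> hom C X (Dom C f)" and eq: "f \<cdot> g = f \<cdot> h"
  have "f \<cdot> (g \<oplus> (- 1) \<odot> h) = Zero C X (Cod C f)"
    using gh assms(1) eq by (auto simp: in_hom Comp_Add Comp_Smul)
  then have "g \<oplus> (- 1) \<odot> h = Zero C X (Dom C f)"
    using assms(2)[of "g \<oplus> (- 1) \<odot> h"] gh by (auto simp: in_hom)
  then show "g = h"
    using gh by (rule_tac eq_if_diff_Zero) (auto simp: in_hom)
qed (rule assms)

lemma epiI:
  assumes "f \<in> Arr C"
    and "\<And>g. g \<in> Arr C \<Longrightarrow> Dom C g = Cod C f \<Longrightarrow> g \<cdot> f = Zero C (Dom C f) (Cod C g) \<Longrightarrow>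
      g = Zero C (Cod C f) (Cod C g)"
  shows "is_epi C f"
  unfolding is_epi_def
proof (intro conjI allI ballI impI)
  fix X g h
  assume gh: "g \<in> hom C (Cod C f) X" "h \<in> hom C (Cod C f) X" and eq: "g \<cdot> f = h \<cdot> f"
  have "(g \<oplus> (- 1) \<odot> h) \<cdot> f = Zero C (Dom C f) X"
    using gh assms(1) eq by (auto simp: in_hom Comp_Add Comp_Smul)
  then have "g \<oplus> (- 1) \<odot> h = Zero C (Cod C f) X"
    using assms(2)[of "g \<oplus> (- 1) \<odot> h"] gh by (auto simp: in_hom)
  then show "g = h"
    using gh by (rule_tac eq_if_diff_Zero) (auto simp: in_hom)
qed (rule assms)

lemma mono_Zero:
  assumes "is_mono C f" "g \<in> Arr C" "Cod C g = Dom C f" "f \<cdot> g = Zero C (Dom C g) (Cod C f)"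
  shows "g = Zero C (Dom C g) (Dom C f)"
  using assms mono_arr[OF assms(1)] by (rule_tac mono_cancel[OF assms(1)]) auto

lemma epi_Zero:
  assumes "is_epi C f" "g \<in> Arr C" "Dom C g = Cod C f" "g \<cdot> f = Zero C (Dom C f) (Cod C g)"
  shows "g = Zero C (Cod C f) (Cod C g)"
  using assms epi_arr[OF assms(1)] by (rule_tac epi_cancel[OF assms(1)]) auto

lemma kernelD:
  assumes "is_kernel C f k"
  shows "f \<in> Arr C" "k \<in> Arr C" "Cod C k = Dom C f" "f \<cdot> k = Zero C (Dom C k) (Cod C f)"
  using assms by (auto simp: is_kernel_def)

lemma kernel_lift:
  assumes "is_kernel C f k" "h \<in> Arr C" "Cod C h = Dom C f" "f \<cdot> h = Zero C (Dom C h) (Cod C f)"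
  obtains u where "u \<in> Arr C" "Dom C u = Dom C h" "Cod C u = Dom C k" "k \<cdot> u = h"
proof -
  have "h \<in> hom C (Dom C h) (Dom C f)"
    using assms by (simp add: in_hom)
  then have "\<exists>u. u \<in> hom C (Dom C h) (Dom C k) \<and> k \<cdot> u = h"
    using assms(1,4) unfolding is_kernel_def by blast
  then show thesis
    using that by (auto simp: in_hom)
qed

lemma cokernelD:
  assumes "is_cokernel C f p"
  shows "f \<in> Arr C" "p \<in> Arr C" "Dom C p = Cod C f" "p \<cdot> f = Zero C (Dom C f) (Cod C p)"
  using assms by (auto simp: is_cokernel_def)

lemma cokernel_desc:
  assumes "is_cokernel C f p" "h \<in> Arr C" "Dom C h = Cod C f" "h \<cdot> f = Zero C (Dom C f) (Cod C h)"
  obtains u where "u \<in> Arr C" "Dom C u = Cod C p" "Cod C u = Cod C h" "u \<cdot> p = h"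
proof -
  have "h \<in> hom C (Cod C f) (Cod C h)"
    using assms by (simp add: in_hom)
  then have "\<exists>u. u \<in> hom C (Cod C p) (Cod C h) \<and> u \<cdot> p = h"
    using assms(1,4) unfolding is_cokernel_def by blast
  then show thesis
    using that by (auto simp: in_hom)
qed

lemma kernel_mono:
  assumes "is_kernel C f k"
  shows "is_mono C k"
proof -
  note k = kernelD[OF assms]
  have u: "\<exists>!u. u \<in> hom C X (Dom C k) \<and> k \<cdot> u = h" if "h \<in> hom C X (Dom C f)" "f \<cdot> h = Zero C X (Cod C f)" for X h
    using assms that by (auto simp: is_kernel_def)
  show ?thesis
    unfolding is_mono_def
  proof (intro conjI allI ballI impI)
    fix X g h
    assume gh: "g \<in> hom C X (Dom C k)" "h \<in> hom C X (Dom C k)" and eq: "k \<cdot> g = k \<cdot> h"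
    have "f \<cdot> (k \<cdot> g) = Zero C X (Cod C f)"
      using k gh by (subst Comp_extend[OF k(4)]) (auto simp: in_hom)
    then have "\<exists>!u. u \<in> hom C X (Dom C k) \<and> k \<cdot> u = k \<cdot> g"
      using gh k by (rule_tac u) (auto simp: in_hom)
    then show "g = h"
      using gh eq by metis
  qed (rule k)
qed

lemma cokernel_epi:
  assumes "is_cokernel C f p"
  shows "is_epi C p"
proof -
  note p = cokernelD[OF assms]
  have u: "\<exists>!u. u \<in> hom C (Cod C p) X \<and> u \<cdot> p = h" if "h \<in> hom C (Cod C f) X" "h \<cdot> f = Zero C (Dom C f) X" for X h
    using assms that by (auto simp: is_cokernel_def)
  show ?thesis
    unfolding is_epi_def
  proof (intro conjI allI ballI impI)
    fix X g h
    assume gh: "g \<in> hom C (Cod C p) X" "h \<in> hom C (Cod C p) X" and eq: "g \<cdot> p = h \<cdot> p"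
    have "(g \<cdot> p) \<cdot> f = Zero C (Dom C f) X"
      using p gh by (subst Comp_assoc) (auto simp: in_hom)
    then have "\<exists>!u. u \<in> hom C (Cod C p) X \<and> u \<cdot> p = g \<cdot> p"
      using gh p by (rule_tac u) (auto simp: in_hom)
    then show "g = h"
      using gh eq by metis
  qed (rule p)
qed

lemma biproductD:
  assumes "is_biproduct C X Y B i j p q"
  shows "X \<in> Obj C" "Y \<in> Obj C" "B \<in> Obj C" "i \<in> Arr C" "j \<in> Arr C" "p \<in> Arr C" "q \<in> Arr C"
    "Dom C i = X" "Cod C i = B" "Dom C j = Y" "Cod C j = B"
    "Dom C p = B" "Cod C p = X" "Dom C q = B" "Cod C q = Y"
    "p \<cdot> i = Id C X" "q \<cdot> j = Id C Y" "q \<cdot> i = Zero C X Y" "p \<cdot> j = Zero C Y X"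
    "(i \<cdot> p) \<oplus> (j \<cdot> q) = Id C B"
  using assms Dom_Cod_Obj[of i] Dom_Cod_Obj[of j] by (auto simp: is_biproduct_def in_hom)

lemma biproduct_cancel:
  assumes B: "is_biproduct C X Y B i j p q" and x: "x \<in> Arr C"
  shows "Cod C x = X \<Longrightarrow> p \<cdot> (i \<cdot> x) = x" "Cod C x = Y \<Longrightarrow> q \<cdot> (j \<cdot> x) = x"
    "Cod C x = X \<Longrightarrow> q \<cdot> (i \<cdot> x) = Zero C (Dom C x) Y" "Cod C x = Y \<Longrightarrow> p \<cdot> (j \<cdot> x) = Zero C (Dom C x) X"
  using biproductD[OF B] x by (simp_all add: Comp_extend)

lemma biproduct_epi:
  assumes B: "is_biproduct C X Y B i j p q"
  shows "is_epi C p" "is_epi C q"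
proof -
  note b = biproductD[OF B]
  show "is_epi C p"
  proof (rule epiI)
    fix g assume g: "g \<in> Arr C" "Dom C g = Cod C p" "g \<cdot> p = Zero C (Dom C p) (Cod C g)"
    have "g \<cdot> (p \<cdot> i) = Zero C (Dom C p) (Cod C g) \<cdot> i"
      using g b by (rule_tac Comp_extend) simp_all
    then show "g = Zero C (Cod C p) (Cod C g)"
      using g b by simp
  qed (use b in simp)
  show "is_epi C q"
  proof (rule epiI)
    fix g assume g: "g \<in> Arr C" "Dom C g = Cod C q" "g \<cdot> q = Zero C (Dom C q) (Cod C g)"
    have "g \<cdot> (q \<cdot> j) = Zero C (Dom C q) (Cod C g) \<cdot> j"
      using g b by (rule_tac Comp_extend) simp_all
    then show "g = Zero C (Cod C q) (Cod C g)"
      using g b by simp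
  qed (use b in simp)
qed

lemma zero_obj_unique:
  assumes "is_zero_obj C Z" "f \<in> Arr C" "Dom C f = Z \<or> Cod C f = Z"
  shows "f = Zero C (Dom C f) (Cod C f)"
proof -
  have "f \<in> hom C (Dom C f) (Cod C f)" "Zero C (Dom C f) (Cod C f) \<in> hom C (Dom C f) (Cod C f)"
    "Dom C f \<in> Obj C" "Cod C f \<in> Obj C" using assms by (auto simp: in_hom)
  then show ?thesis
    using assms(1,3) unfolding is_zero_obj_def by metis
qed

end

section \<open>Images, pullbacks of epimorphisms and largest subobjects in abelian
  categories\<close>

context abelian_category
begin

text \<open>By \<open>mono_kernel\<close>, \<open>i\<close> is the kernel of some \<open>m\<close>,
  and \<open>m\<close> factors through the cokernel \<open>p\<close>. So whatever \<open>p\<close>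
  kills is killed by \<open>m\<close> and lifts through \<open>i\<close>.\<close>

lemma mono_is_kernel_of_cokernel:
  assumes i: "is_mono C i" and p: "is_cokernel C i p"
  shows "is_kernel C p i"
proof -
  obtain m where m: "is_kernel C m i"
    using mono_kernel[OF i] by blast
  note mD = kernelD[OF m] and pD = cokernelD[OF p]
  obtain m' where m': "m' \<in> Arr C" "Dom C m' = Cod C p" "Cod C m' = Cod C m" "m' \<cdot> p = m"
    using cokernel_desc[OF p, of m] mD by auto
  have "\<exists>!u. u \<in> hom C X (Dom C i) \<and> i \<cdot> u = h"
    if h: "h \<in> hom C X (Dom C p)" and ph: "p \<cdot> h = Zero C X (Cod C p)" for X h
  proof -
    have "m' \<cdot> (p \<cdot> h) = m \<cdot> h"
      using h m' pD by (intro Comp_extend) (auto simp: in_hom)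
    then have "m \<cdot> h = Zero C X (Cod C m)"
      using h ph m'(1-3) pD by (auto simp: in_hom)
    moreover have "h \<in> hom C X (Dom C m)"
      using h mD pD by (auto simp: in_hom)
    ultimately show ?thesis
      using m by (simp add: is_kernel_def)
  qed
  then show ?thesis
    unfolding is_kernel_def using pD mD by auto
qed

text \<open>Dual argument: \<open>p\<close> is the cokernel of some \<open>m\<close>, and
  \<open>m\<close> factors through the kernel \<open>k\<close>, so a morphism that kills
  \<open>k\<close> kills \<open>m\<close>.\<close>

lemma epi_is_cokernel_of_kernel:
  assumes p: "is_epi C p" and k: "is_kernel C p k"
  shows "is_cokernel C k p"
proof -
  obtain m where m: "is_cokernel C m p"
    using epi_cokernel[OF p] by blast
  note mD = cokernelD[OF m] and kD = kernelD[OF k]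
  obtain m' where m': "m' \<in> Arr C" "Dom C m' = Dom C m" "Cod C m' = Dom C k" "k \<cdot> m' = m"
    using kernel_lift[OF k, of m] mD by auto
  have "\<exists>!u. u \<in> hom C (Cod C p) X \<and> u \<cdot> p = h"
    if h: "h \<in> hom C (Cod C k) X" and hk: "h \<cdot> k = Zero C (Dom C k) X" for X h
  proof -
    have "h \<cdot> (k \<cdot> m') = Zero C (Dom C k) X \<cdot> m'"
      using h m' kD by (rule_tac Comp_extend[OF hk]) (auto simp: in_hom)
    then have "h \<cdot> m = Zero C (Dom C m) X"
      using h m'(1-3) kD by (auto simp: in_hom) (simp add: m'(4))
    moreover have "h \<in> hom C (Cod C m) X"
      using h mD kD by (auto simp: in_hom)
    ultimately show ?thesis
      using m by (simp add: is_cokernel_def)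
  qed
  then show ?thesis
    unfolding is_cokernel_def using mD kD by auto
qed

text \<open>An epimorphism is the cokernel of its kernel, so that kernel is the only obstruction to
  factoring through it.\<close>

lemma epi_descend:
  assumes e: "is_epi C e" and h: "h \<in> Arr C" "Dom C h = Dom C e"
    and 0: "\<And>k. is_kernel C e k \<Longrightarrow> h \<cdot> k = Zero C (Dom C k) (Cod C h)"
  obtains u where "u \<in> Arr C" "Dom C u = Cod C e" "Cod C u = Cod C h" "u \<cdot> e = h"
proof -
  obtain k where k: "is_kernel C e k"
    using ex_kernel epi_arr[OF e] by blast
  then show thesis
    using cokernel_desc[OF epi_is_cokernel_of_kernel[OF e k] h(1)] h 0[OF k] kernelD[OF k] that
    by auto
qed

lemma epi_if_cokernel_Zero:
  assumes c: "is_cokernel C f c" and "c = Zero C (Dom C c) (Cod C c)"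
  shows "is_epi C f"
proof (rule epiI)
  note cD = cokernelD[OF c]
  show "f \<in> Arr C" by (rule cD)
  fix g assume g: "g \<in> Arr C" "Dom C g = Cod C f" "g \<cdot> f = Zero C (Dom C f) (Cod C g)"
  then obtain u where u: "u \<in> Arr C" "Dom C u = Cod C c" "Cod C u = Cod C g" "u \<cdot> c = g"
    using cokernel_desc[OF c] by auto
  then show "g = Zero C (Cod C f) (Cod C g)"
    using assms(2) cD by (metis Comp_Zero(2) Dom_Cod_Obj)
qed

text \<open>The image of \<open>f\<close>, formed as the kernel \<open>k\<close> of its cokernel, is
  a subobject of a simple object: either it is zero, which would make \<open>f\<close> zero, or it
  is everything.\<close>

lemma to_simple_epi:
  assumes f: "f \<in> Arr C" and S: "is_simple C (Cod C f)" and nz: "f \<noteq> Zero C (Dom C f) (Cod C f)"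
  shows "is_epi C f"
proof -
  obtain c where c: "is_cokernel C f c"
    using ex_cokernel f by blast
  note cD = cokernelD[OF c]
  obtain k where k: "is_kernel C c k"
    using ex_kernel cD by blast
  note kD = kernelD[OF k]
  obtain e where e: "e \<in> Arr C" "Dom C e = Dom C f" "Cod C e = Dom C k" "k \<cdot> e = f"
    using kernel_lift[OF k f] cD by auto
  have "is_zero_obj C (Dom C k) \<or> is_iso C k"
    using S kernel_mono[OF k] kD cD unfolding is_simple_def by metis
  moreover have False if "is_zero_obj C (Dom C k)"
    using zero_obj_unique[OF that e(1)] e kD cD nz f by (metis Comp_Zero(2) Dom_Cod_Obj)
  moreover have "is_epi C f" if "is_iso C k"
  proof (rule epi_if_cokernel_Zero[OF c])
    have "c = Zero C (Cod C k) (Cod C c)"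
      using kD cD by (intro epi_Zero[OF iso_epi[OF that]]) auto
    then show "c = Zero C (Dom C c) (Cod C c)"
      using kD by simp
  qed
  ultimately show ?thesis by blast
qed

text \<open>The image is the kernel \<open>k\<close> of the cokernel of \<open>f\<close>. The point
  is that the other factor \<open>e\<close> is epi: a morphism \<open>h\<close> killing
  \<open>e\<close> cuts out a subobject of \<open>k\<close> through which \<open>f\<close> still
  factors, and such a subobject must contain all of \<open>k\<close>.\<close>

lemma image_factorization:
  assumes f: "f \<in> Arr C"
  obtains k e where "is_mono C k" "is_epi C e" "Cod C e = Dom C k" "k \<cdot> e = f"
proof -
  obtain c where c: "is_cokernel C f c"
    using ex_cokernel f by blast
  note cD = cokernelD[OF c]
  obtain k where k: "is_kernel C c k"
    using ex_kernel cD by blast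
  note kD = kernelD[OF k]
  obtain e where e: "e \<in> Arr C" "Dom C e = Dom C f" "Cod C e = Dom C k" "k \<cdot> e = f"
    using kernel_lift[OF k f] cD by auto
  have "is_epi C e"
  proof (rule epiI[OF e(1)])
    fix h assume h: "h \<in> Arr C" "Dom C h = Cod C e" "h \<cdot> e = Zero C (Dom C e) (Cod C h)"
    obtain m where m: "is_kernel C h m"
      using ex_kernel h by blast
    note mD = kernelD[OF m]
    obtain e' where e': "e' \<in> Arr C" "Dom C e' = Dom C e" "Cod C e' = Dom C m" "m \<cdot> e' = e"
      using kernel_lift[OF m e(1)] h by auto
    have "is_mono C (k \<cdot> m)"
    proof (rule monoI)
      show "k \<cdot> m \<in> Arr C" using kD mD h e by simp
      fix g assume g: "g \<in> Arr C" "Cod C g = Dom C (k \<cdot> m)"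
        "(k \<cdot> m) \<cdot> g = Zero C (Dom C g) (Cod C (k \<cdot> m))"
      then have g': "Cod C g = Dom C m" "k \<cdot> (m \<cdot> g) = Zero C (Dom C g) (Cod C k)"
        using kD mD h e by auto
      have "m \<cdot> g = Zero C (Dom C (m \<cdot> g)) (Dom C k)"
        using g g' mD h e by (intro mono_Zero[OF kernel_mono[OF k]]) auto
      then show "g = Zero C (Dom C g) (Dom C (k \<cdot> m))"
        using g g' mD kD h e mono_Zero[OF kernel_mono[OF m] g(1)] by auto
    qed
    \<comment> \<open>As the kernel of some \<open>t\<close>, the smaller subobject
      \<open>k \<cdot> m\<close> is detected by an equation: \<open>t\<close> kills
      \<open>f\<close>, so it factors through the cokernel \<open>c\<close> and kills
      \<open>k\<close> as well.\<close>
    then obtain t where t: "is_kernel C t (k \<cdot> m)"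
      using mono_kernel by blast
    note tD = kernelD[OF t]
    have "t \<cdot> f = Zero C (Dom C f) (Cod C t)"
    proof -
      have "t \<cdot> f = t \<cdot> ((k \<cdot> m) \<cdot> e')"
        using e e' kD mD h by simp
      also have "\<dots> = Zero C (Dom C (k \<cdot> m)) (Cod C t) \<cdot> e'"
        using tD e' kD mD h e by (intro Comp_extend) auto
      finally show ?thesis
        using tD e e' kD mD h by auto
    qed
    then obtain t' where t': "t' \<in> Arr C" "Dom C t' = Cod C c" "Cod C t' = Cod C t" "t' \<cdot> c = t"
      using cokernel_desc[OF c tD(1)] tD kD mD h e cD by auto
    have "t' \<cdot> (c \<cdot> k) = t \<cdot> k"
      using t' kD cD by (intro Comp_extend) auto
    then have "t \<cdot> k = Zero C (Dom C k) (Cod C t)"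
      using t'(1-3) kD cD by simp
    then obtain s where s: "s \<in> Arr C" "Dom C s = Dom C k" "Cod C s = Dom C (k \<cdot> m)" "(k \<cdot> m) \<cdot> s = k"
      using kernel_lift[OF t kD(2)] tD kD mD h e by auto
    have "k \<cdot> (m \<cdot> s) = k \<cdot> Id C (Dom C k)"
      using s kD mD h e by simp
    \<comment> \<open>Now \<open>m\<close> has a right inverse, so \<open>h\<close>, which kills
      \<open>m\<close>, is zero.\<close>
    then have ms: "m \<cdot> s = Id C (Dom C k)"
      using s kD mD h e by (rule_tac mono_cancel[OF kernel_mono[OF k]]) auto
    have "h \<cdot> (m \<cdot> s) = Zero C (Dom C m) (Cod C h) \<cdot> s"
      using mD s kD h e by (intro Comp_extend) auto
    then show "h = Zero C (Cod C e) (Cod C h)"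
      using ms s mD kD h e by auto
  qed
  then show thesis
    using that kernel_mono[OF k] e by blast
qed

text \<open>The pullback is the kernel of the difference \<open>m\<close> of \<open>p\<close> and
  \<open>g\<close> on a biproduct, and \<open>a\<close>, \<open>b\<close> are its projections. This
  lemma stands in for choosing preimages of elements under \<open>p\<close>; for that purpose the
  commuting square and the fact that \<open>b\<close> is epi suffice.\<close>

lemma epi_pullback:
  assumes p: "is_epi C p" and g: "g \<in> Arr C" "Cod C g = Cod C p"
  obtains a b where "a \<in> Arr C" "is_epi C b" "Dom C a = Dom C b" "Cod C a = Dom C p" "Cod C b = Dom C g"
    "p \<cdot> a = g \<cdot> b"
proof -
  note pa = epi_arr[OF p]
  obtain B i j r q where B: "is_biproduct C (Dom C p) (Dom C g) B i j r q"
    using ex_biproduct pa g by (metis Dom_Cod_Obj(1))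
  note b = biproductD[OF B]
  define m where "m = p \<cdot> r \<oplus> (- 1) \<odot> (g \<cdot> q)"
  have m: "m \<in> Arr C" "Dom C m = B" "Cod C m = Cod C p"
    using b pa g by (auto simp: m_def)
  have mi: "m \<cdot> i = p" and mj: "m \<cdot> j = (- 1) \<odot> g"
    using b pa g by (auto simp: m_def Comp_Add Comp_Smul Smul_0)
  have em: "is_epi C m"
  proof (rule epiI[OF m(1)])
    fix h assume h: "h \<in> Arr C" "Dom C h = Cod C m" "h \<cdot> m = Zero C (Dom C m) (Cod C h)"
    have "h \<cdot> (m \<cdot> i) = Zero C (Dom C m) (Cod C h) \<cdot> i"
      using h m b by (intro Comp_extend) auto
    then show "h = Zero C (Cod C m) (Cod C h)"
      using h m b mi epi_Zero[OF p h(1)] by auto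
  qed
  obtain k where k: "is_kernel C m k"
    using ex_kernel m by blast
  note kD = kernelD[OF k]
  \<comment> \<open>If \<open>h\<close> kills \<open>q \<cdot> k\<close>, then
    \<open>h \<cdot> q\<close> kills the kernel of the epimorphism \<open>m\<close>, so it is some
    \<open>t \<cdot> m\<close>. Restricted to the summand \<open>i\<close> this says that
    \<open>t\<close> kills \<open>p\<close>; hence \<open>t\<close>, \<open>h \<cdot> q\<close> and
    \<open>h\<close> vanish in turn.\<close>
  have eb: "is_epi C (q \<cdot> k)"
  proof (rule epiI)
    show "q \<cdot> k \<in> Arr C" using kD b m by simp
    fix h assume h: "h \<in> Arr C" "Dom C h = Cod C (q \<cdot> k)" "h \<cdot> (q \<cdot> k) = Zero C (Dom C (q \<cdot> k)) (Cod C h)"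
    then have h': "Dom C h = Dom C g" using kD b m by simp
    have "(h \<cdot> q) \<cdot> k = Zero C (Dom C k) (Cod C h)"
      using h h' kD b m by simp
    then obtain t where t: "t \<in> Arr C" "Dom C t = Cod C m" "Cod C t = Cod C h" "t \<cdot> m = h \<cdot> q"
      using cokernel_desc[OF epi_is_cokernel_of_kernel[OF em k], of "h \<cdot> q"] h h' kD b m by auto
    have "t \<cdot> (m \<cdot> i) = (h \<cdot> q) \<cdot> i"
      using t m b by (intro Comp_extend) auto
    then have "t \<cdot> p = Zero C (Dom C p) (Cod C t)"
      using t m mi h h' b by simp
    then have "t = Zero C (Cod C p) (Cod C t)"
      using epi_Zero[OF p t(1)] t(2-3) m by simp
    then have "h \<cdot> q = Zero C B (Cod C h)"
      using t m by (metis Comp_Zero(1) Dom_Cod_Obj(2))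
    then have "h = Zero C (Dom C g) (Cod C h)"
      using epi_Zero[OF biproduct_epi(2)[OF B] h(1)] h' b by simp
    then show "h = Zero C (Cod C (q \<cdot> k)) (Cod C h)"
      using kD b m by simp
  qed
  have "p \<cdot> (r \<cdot> k) = g \<cdot> (q \<cdot> k)"
  proof (rule eq_if_diff_Zero)
    have "(p \<cdot> r \<oplus> (- 1) \<odot> (g \<cdot> q)) \<cdot> k = Zero C (Dom C k) (Cod C p)"
      using kD(4) m by (simp only: m_def[symmetric])
    then show "p \<cdot> (r \<cdot> k) \<oplus> (- 1) \<odot> (g \<cdot> (q \<cdot> k)) = Zero C (Dom C (g \<cdot> (q \<cdot> k))) (Cod C (g \<cdot> (q \<cdot> k)))"
      using kD m b pa g by (simp add: Comp_Add Comp_Smul)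
  qed (use kD m b pa g in auto)
  then show thesis
    using that[of "r \<cdot> k" "q \<cdot> k"] eb kD m b by auto
qed

text \<open>Read \<open>S\<close> as a set of generalised elements of \<open>X\<close>. The
  conditions hold for the morphisms that factor through a fixed subobject of \<open>X\<close>; the
  next lemma shows that for \<open>X\<close> of finite length every such class arises in this
  way.\<close>

definition subobject_class :: "'o \<Rightarrow> ('m \<Rightarrow> bool) \<Rightarrow> bool" where
  "subobject_class X S \<longleftrightarrow>
     (\<forall>f g. S f \<longrightarrow> f \<in> Arr C \<longrightarrow> g \<in> Arr C \<longrightarrow> Cod C f = X \<longrightarrow> Dom C f = Cod C g \<longrightarrow> S (f \<cdot> g)) \<and>
     (\<forall>f g. S f \<longrightarrow> S g \<longrightarrow> f \<in> Arr C \<longrightarrow> g \<in> Arr C \<longrightarrow> Cod C f = X \<longrightarrow> Cod C g = X \<longrightarrow>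
       Dom C f = Dom C g \<longrightarrow> S (f \<oplus> g)) \<and>
     (\<forall>f e. S (f \<cdot> e) \<longrightarrow> f \<in> Arr C \<longrightarrow> is_epi C e \<longrightarrow> Cod C f = X \<longrightarrow> Dom C f = Cod C e \<longrightarrow> S f) \<and>
     (\<forall>Y \<in> Obj C. S (Zero C Y X))"

text \<open>Induction along the filtration: inside the subobject \<open>i\<close> a largest
  \<open>k\<close> is already known, and simplicity of the quotient leaves two cases, according to
  whether some member of \<open>S\<close> has nonzero image there.\<close>

lemma largest_subobject:
  assumes "finite_length C X" "subobject_class X S"
  obtains k where "is_mono C k" "Cod C k = X" "S k"
    "\<And>f. S f \<Longrightarrow> f \<in> Arr C \<Longrightarrow> Cod C f = X \<Longrightarrow> \<exists>u \<in> hom C (Dom C f) (Dom C k). k \<cdot> u = f"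
proof -
  have "\<exists>k. is_mono C k \<and> Cod C k = X \<and> S k \<and>
    (\<forall>f. S f \<longrightarrow> f \<in> Arr C \<longrightarrow> Cod C f = X \<longrightarrow> (\<exists>u \<in> hom C (Dom C f) (Dom C k). k \<cdot> u = f))"
    using assms
  proof (induction X arbitrary: S rule: finite_length.induct)
    case (zero Z)
    then have Z: "Z \<in> Obj C" by (auto simp: is_zero_obj_def)
    have u: "f = Zero C (Dom C f) Z" if "f \<in> Arr C" "Cod C f = Z" for f
      using zero_obj_unique[OF zero.hyps] that by blast
    show ?case
    proof (intro exI[of _ "Id C Z"] conjI allI impI)
      show "is_mono C (Id C Z)"
        unfolding is_mono_def
      proof (intro conjI allI ballI impI)
        fix X g h
        assume "g \<in> hom C X (Dom C (Id C Z))" "h \<in> hom C X (Dom C (Id C Z))" "Id C Z \<cdot> g = Id C Z \<cdot> h"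
        then show "g = h" using Z by (simp add: in_hom)
      qed (use Z in simp)
      have "Id C Z = Zero C Z Z"
        using u[of "Id C Z"] Z by (metis Id_arr)
      moreover have "S (Zero C Z Z)"
        using zero.prems Z unfolding subobject_class_def by blast
      ultimately show "S (Id C Z)"
        by simp
    qed (use Z in \<open>auto simp: in_hom\<close>)
  next
    case (step i p)
    have pre: "S f \<Longrightarrow> f \<in> Arr C \<Longrightarrow> g \<in> Arr C \<Longrightarrow> Cod C f = Cod C i \<Longrightarrow> Dom C f = Cod C g \<Longrightarrow> S (f \<cdot> g)"
      and add: "S f \<Longrightarrow> S g \<Longrightarrow> f \<in> Arr C \<Longrightarrow> g \<in> Arr C \<Longrightarrow> Cod C f = Cod C i \<Longrightarrow> Cod C g = Cod C i \<Longrightarrow>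
        Dom C f = Dom C g \<Longrightarrow> S (f \<oplus> g)"
      and desc: "S (f \<cdot> e) \<Longrightarrow> f \<in> Arr C \<Longrightarrow> is_epi C e \<Longrightarrow> Cod C f = Cod C i \<Longrightarrow> Dom C f = Cod C e \<Longrightarrow> S f"
      and nil: "Y \<in> Obj C \<Longrightarrow> S (Zero C Y (Cod C i))" for f g e Y
      using step.prems unfolding subobject_class_def by blast+
    note ia = mono_arr[OF step.hyps(2)] and pD = cokernelD[OF step.hyps(3)]
      and ik = mono_is_kernel_of_cokernel[OF step.hyps(2,3)]
    have neg: "S ((- 1) \<odot> f)" if "S f" "f \<in> Arr C" "Cod C f = Cod C i" for f
    proof -
      have "S (f \<cdot> ((- 1) \<odot> Id C (Dom C f)))"
        using that by (intro pre) auto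
      then show ?thesis
        using that by (simp add: Comp_Smul)
    qed
    \<comment> \<open>The induction hypothesis is applied to the class of all \<open>f\<close> with
      \<open>S (i \<cdot> f)\<close>, the part of \<open>S\<close> that lies inside
      \<open>i\<close>.\<close>
    have "\<exists>k. is_mono C k \<and> Cod C k = Dom C i \<and> S (i \<cdot> k) \<and>
      (\<forall>f. S (i \<cdot> f) \<longrightarrow> f \<in> Arr C \<longrightarrow> Cod C f = Dom C i \<longrightarrow> (\<exists>u \<in> hom C (Dom C f) (Dom C k). k \<cdot> u = f))"
    proof (rule step.IH, unfold subobject_class_def, intro conjI allI impI ballI)
      fix f g assume "S (i \<cdot> f)" "f \<in> Arr C" "g \<in> Arr C" "Cod C f = Dom C i" "Dom C f = Cod C g"
      then show "S (i \<cdot> (f \<cdot> g))"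
        using pre[of "i \<cdot> f" g] ia by simp
    next
      fix f g assume "S (i \<cdot> f)" "S (i \<cdot> g)" "f \<in> Arr C" "g \<in> Arr C" "Cod C f = Dom C i" "Cod C g = Dom C i"
        "Dom C f = Dom C g"
      then show "S (i \<cdot> (f \<oplus> g))"
        using add[of "i \<cdot> f" "i \<cdot> g"] ia by (simp add: Comp_Add)
    next
      fix f e assume "S (i \<cdot> (f \<cdot> e))" "f \<in> Arr C" "is_epi C e" "Cod C f = Dom C i" "Dom C f = Cod C e"
      then show "S (i \<cdot> f)"
        using desc[of "i \<cdot> f" e] ia by (simp add: epi_arr)
    next
      fix Y assume "Y \<in> Obj C"
      then show "S (i \<cdot> Zero C Y (Dom C i))"
        using nil ia by simp
    qed
    then obtain k where k: "is_mono C k" "Cod C k = Dom C i" "S (i \<cdot> k)"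
      "\<And>f. S (i \<cdot> f) \<Longrightarrow> f \<in> Arr C \<Longrightarrow> Cod C f = Dom C i \<Longrightarrow> \<exists>u \<in> hom C (Dom C f) (Dom C k). k \<cdot> u = f"
      by blast
    note ka = mono_arr[OF k(1)]
    \<comment> \<open>Members of \<open>S\<close> that vanish in the simple quotient lie in
      \<open>i\<close>, the kernel of \<open>p\<close>, hence in \<open>k\<close>.\<close>
    have lift: "\<exists>u \<in> hom C (Dom C f) (Dom C k). i \<cdot> (k \<cdot> u) = f"
      if f: "S f" "f \<in> Arr C" "Cod C f = Cod C i" "p \<cdot> f = Zero C (Dom C f) (Cod C p)" for f
    proof -
      obtain v where v: "v \<in> Arr C" "Dom C v = Dom C f" "Cod C v = Dom C i" "i \<cdot> v = f"
        using kernel_lift[OF ik f(2)] f pD by auto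
      then show ?thesis
        using k(4)[of v] f by auto
    qed
    show ?case
    proof (cases "\<forall>f. S f \<longrightarrow> f \<in> Arr C \<longrightarrow> Cod C f = Cod C i \<longrightarrow> p \<cdot> f = Zero C (Dom C f) (Cod C p)")
      case True
      have "is_mono C (i \<cdot> k)"
        unfolding is_mono_def
      proof (intro conjI allI ballI impI)
        fix X g h assume "g \<in> hom C X (Dom C (i \<cdot> k))" "h \<in> hom C X (Dom C (i \<cdot> k))" and eq: "(i \<cdot> k) \<cdot> g = (i \<cdot> k) \<cdot> h"
        then have gh: "g \<in> Arr C" "h \<in> Arr C" "Cod C g = Dom C k" "Cod C h = Dom C k"
          using ia ka k by (auto simp: in_hom)
        have "k \<cdot> g = k \<cdot> h"
          using gh ia ka k eq by (rule_tac mono_cancel[OF step.hyps(2)]) auto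
        then show "g = h"
          using gh by (rule_tac mono_cancel[OF k(1)]) auto
      qed (use ia ka k in simp)
      moreover have "\<exists>u \<in> hom C (Dom C f) (Dom C (i \<cdot> k)). (i \<cdot> k) \<cdot> u = f"
        if f: "S f" "f \<in> Arr C" "Cod C f = Cod C i" for f
      proof -
        obtain u where "u \<in> hom C (Dom C f) (Dom C k)" "i \<cdot> (k \<cdot> u) = f"
          using lift[OF f] True f by blast
        then show ?thesis
          using ia ka k by (intro bexI[of _ u]) (auto simp: in_hom)
      qed
      ultimately show ?thesis
        using k ia ka by (intro exI[of _ "i \<cdot> k"]) auto
    next
      case False
      then obtain f where f: "S f" "f \<in> Arr C" "Cod C f = Cod C i" "p \<cdot> f \<noteq> Zero C (Dom C f) (Cod C p)"
        by blast
      \<comment> \<open>One member with nonzero image covers the whole simple quotient, so the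
        subobject generated by \<open>k\<close> and \<open>f\<close> is already the largest
        one.\<close>
      have pf: "is_epi C (p \<cdot> f)"
        using f pD step.hyps(4) by (intro to_simple_epi) auto
      obtain B a b r q where B: "is_biproduct C (Dom C k) (Dom C f) B a b r q"
        using ex_biproduct ka f by (metis Dom_Cod_Obj(1))
      note bD = biproductD[OF B]
      \<comment> \<open>That subobject is the image \<open>n\<close> of the map with components
        \<open>i \<cdot> k\<close> and \<open>f\<close>. It belongs to \<open>S\<close> because
        \<open>m\<close> does and \<open>S\<close> descends along the epimorphism \<open>e\<close>
        onto the image.\<close>
      define m where "m = (i \<cdot> k) \<cdot> r \<oplus> f \<cdot> q"
      have m: "m \<in> Arr C" "Dom C m = B" "Cod C m = Cod C i"
        using bD f ia ka k by (auto simp: m_def)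
      have "S ((i \<cdot> k) \<cdot> r)" "S (f \<cdot> q)"
        using bD f ia ka k by (auto intro: pre[OF f(1)] simp del: Comp_assoc intro!: pre[OF k(3)])
      then have Sm: "S m"
        unfolding m_def using bD f ia ka k by (rule_tac add) auto
      have ma: "m \<cdot> a = i \<cdot> k" and mb: "m \<cdot> b = f"
        using bD f ia ka k by (auto simp: m_def Comp_Add)
      obtain n e where n: "is_mono C n" "is_epi C e" "Cod C e = Dom C n" "n \<cdot> e = m"
        using image_factorization[OF m(1)] .
      note na = mono_arr[OF n(1)] epi_arr[OF n(2)]
      have nc: "Cod C n = Cod C i" "Dom C e = B"
        using n na m by auto
      have Sn: "S n"
        using desc[of n e] Sm n na m nc by auto
      obtain c where c: "is_cokernel C n c"
        using ex_cokernel na by blast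
      note cD = cokernelD[OF c] and nk = mono_is_kernel_of_cokernel[OF n(1) c]
      have "\<exists>u \<in> hom C (Dom C g) (Dom C n). n \<cdot> u = g"
        if g: "S g" "g \<in> Arr C" "Cod C g = Cod C i" for g
      proof -
        \<comment> \<open>On the pullback along \<open>p \<cdot> f\<close>, the members
          \<open>g \<cdot> z\<close> and \<open>f \<cdot> y\<close> agree in the simple quotient, so
          their difference \<open>w\<close> factors through \<open>k\<close>.\<close>
        obtain y z where yz: "y \<in> Arr C" "is_epi C z" "Dom C y = Dom C z" "Cod C y = Dom C (p \<cdot> f)"
          "Cod C z = Dom C (p \<cdot> g)" "(p \<cdot> f) \<cdot> y = (p \<cdot> g) \<cdot> z"
          using epi_pullback[OF pf, of "p \<cdot> g"] g f pD by auto
        note za = epi_arr[OF yz(2)]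
        have yz': "Cod C y = Dom C f" "Cod C z = Dom C g" "p \<cdot> (f \<cdot> y) = p \<cdot> (g \<cdot> z)"
          using yz za f g pD by auto
        define w where "w = g \<cdot> z \<oplus> (- 1) \<odot> (f \<cdot> y)"
        have w: "w \<in> Arr C" "Dom C w = Dom C z" "Cod C w = Cod C i"
          using yz yz' za f g by (auto simp: w_def)
        have "S w"
          unfolding w_def using yz yz' za f g by (intro add neg pre) auto
        moreover have "p \<cdot> w = Zero C (Dom C w) (Cod C p)"
          using w yz yz' za f g pD by (simp add: w_def Comp_Add Comp_Smul)
        ultimately obtain u where u: "u \<in> Arr C" "Dom C u = Dom C z" "Cod C u = Dom C k" "i \<cdot> (k \<cdot> u) = w"
          using lift[of w] w by (auto simp: in_hom)
        define v where "v = e \<cdot> (a \<cdot> u \<oplus> b \<cdot> y)"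
        have v: "v \<in> Arr C" "Dom C v = Dom C z" "Cod C v = Dom C n"
          using yz yz' za u bD nc n na by (auto simp: v_def)
        have "n \<cdot> v = m \<cdot> (a \<cdot> u \<oplus> b \<cdot> y)"
          unfolding v_def using yz yz' za u bD nc n na by (intro Comp_extend) auto
        also have "\<dots> = (m \<cdot> a) \<cdot> u \<oplus> (m \<cdot> b) \<cdot> y"
          using yz yz' za u bD m by (simp add: Comp_Add)
        also have "\<dots> = w \<oplus> f \<cdot> y"
          using ma mb u ia ka k by simp
        also have "\<dots> = g \<cdot> z"
          using w yz yz' za f g
          by (simp add: w_def add_assoc[of _ "Dom C z" "Cod C i"] in_hom)
        finally have nv: "n \<cdot> v = g \<cdot> z" .
        \<comment> \<open>So \<open>g \<cdot> z\<close> factors through \<open>n\<close>. As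
          \<open>z\<close> is epi and \<open>n\<close> is the kernel of its cokernel
          \<open>c\<close>, the same follows for \<open>g\<close>.\<close>
        have "c \<cdot> (g \<cdot> z) = Zero C (Dom C n) (Cod C c) \<cdot> v"
          unfolding nv[symmetric] using v na cD by (intro Comp_extend) auto
        then have "(c \<cdot> g) \<cdot> z = Zero C (Dom C z) (Cod C c)"
          using v na cD g za yz' nc by simp
        then have "c \<cdot> g = Zero C (Cod C z) (Cod C (c \<cdot> g))"
          using cD g za yz' nc by (intro epi_Zero[OF yz(2)]) auto
        then obtain u where "u \<in> Arr C" "Dom C u = Dom C g" "Cod C u = Dom C n" "n \<cdot> u = g"
          using kernel_lift[OF nk g(2)] cD nc g yz' by auto
        then show ?thesis by (auto simp: in_hom)
      qed
      then show ?thesis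
        using n nc Sn by blast
    qed
  qed
  then show thesis
    using that by blast
qed

end

section \<open>Generators\<close>

context finite_category
begin

lemma projective_epi_lift:
  assumes "is_projective C P" "is_epi C e" "f \<in> Arr C" "Dom C f = P" "Cod C f = Cod C e"
  obtains g where "g \<in> Arr C" "Dom C g = P" "Cod C g = Dom C e" "e \<cdot> g = f"
proof -
  have "f \<in> hom C P (Cod C e)"
    using assms by (simp add: in_hom)
  then obtain g where "g \<in> hom C P (Dom C e)" "e \<cdot> g = f"
    using assms(1,2) unfolding is_projective_def by blast
  then show thesis
    using that by (auto simp: in_hom)
qed

text \<open>\<open>Q\<close> is the biproduct of projective covers of representatives of the
  simples, formed one representative at a time, so each cover is a quotient of \<open>Q\<close>
  through projections. Lifting later uses projectivity of the individual covers.\<close>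

lemma ex_projective_covering_simples:
  "\<exists>Q \<in> Obj C. \<forall>S. is_simple C S \<longrightarrow> (\<exists>P e r. is_projective C P \<and> is_epi C e \<and> Dom C e = P \<and> Cod C e = S \<and>
     is_epi C r \<and> Dom C r = Q \<and> Cod C r = P)"
proof -
  obtain T where T: "finite T" "\<And>S. is_simple C S \<Longrightarrow> \<exists>S' \<in> T. is_simple C S' \<and> isomorphic C S S'"
    using finitely_many_simples by blast
  have "\<exists>Q \<in> Obj C. \<forall>S \<in> T. is_simple C S \<longrightarrow> (\<exists>P e r. is_projective C P \<and> is_epi C e \<and> Dom C e = P \<and> Cod C e = S \<and>
     is_epi C r \<and> Dom C r = Q \<and> Cod C r = P)"
    using T(1)
  proof (induction T)
    case empty
    then show ?case using ex_zero_obj by (auto simp: is_zero_obj_def)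
  next
    case (insert S T)
    then obtain Q where Q: "Q \<in> Obj C" "\<And>S. S \<in> T \<Longrightarrow> is_simple C S \<Longrightarrow>
        \<exists>P e r. is_projective C P \<and> is_epi C e \<and> Dom C e = P \<and> Cod C e = S \<and> is_epi C r \<and> Dom C r = Q \<and> Cod C r = P"
      by blast
    show ?case
    proof (cases "is_simple C S")
      case False
      then show ?thesis using Q by blast
    next
      case True
      then obtain P e where "projective_cover C S P e"
        using enough_projectives by blast
      then have P: "is_projective C P" "P \<in> Obj C" "is_epi C e" "Dom C e = P" "Cod C e = S"
        by (auto simp: projective_cover_def is_projective_def in_hom)
      obtain B i j p q where B: "is_biproduct C Q P B i j p q"
        using ex_biproduct[OF Q(1) P(2)] by blast
      note b = biproductD[OF B] biproduct_epi[OF B]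
      have "\<exists>P e r. is_projective C P \<and> is_epi C e \<and> Dom C e = P \<and> Cod C e = S' \<and> is_epi C r \<and> Dom C r = B \<and> Cod C r = P"
        if S': "S' \<in> insert S T" "is_simple C S'" for S'
      proof (cases "S' = S")
        case True
        then show ?thesis using P b by blast
      next
        case False
        then obtain P e r where r: "is_projective C P" "is_epi C e" "Dom C e = P" "Cod C e = S'"
          "is_epi C r" "Dom C r = Q" "Cod C r = P"
          using Q(2)[of S'] S' False by blast
        then have "is_epi C (r \<cdot> p)" "Dom C (r \<cdot> p) = B" "Cod C (r \<cdot> p) = P"
          using b epi_arr[of r] by (auto intro: epi_Comp)
        then show ?thesis using r by blast
      qed
      then show ?thesis using b by blast
    qed
  qed
  then obtain Q where Q: "Q \<in> Obj C" "\<And>S. S \<in> T \<Longrightarrow> is_simple C S \<Longrightarrow>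
        \<exists>P e r. is_projective C P \<and> is_epi C e \<and> Dom C e = P \<and> Cod C e = S \<and> is_epi C r \<and> Dom C r = Q \<and> Cod C r = P"
    by blast
  have "\<exists>P e r. is_projective C P \<and> is_epi C e \<and> Dom C e = P \<and> Cod C e = S \<and> is_epi C r \<and> Dom C r = Q \<and> Cod C r = P"
    if S: "is_simple C S" for S
  proof -
    obtain S' f where f: "S' \<in> T" "is_simple C S'" "f \<in> hom C S S'" "is_iso C f"
      using T(2)[OF S] by (auto simp: isomorphic_def)
    obtain P e r where r: "is_projective C P" "is_epi C e" "Dom C e = P" "Cod C e = S'"
          "is_epi C r" "Dom C r = Q" "Cod C r = P"
      using Q(2)[OF f(1,2)] by blast
    have "is_epi C (inv_arr C f \<cdot> e)"
      using r f by (intro epi_Comp[OF iso_epi]) (auto simp: in_hom)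
    moreover have "Dom C (inv_arr C f \<cdot> e) = P" "Cod C (inv_arr C f \<cdot> e) = S"
      using r f epi_arr[OF r(2)] by (auto simp: in_hom)
    ultimately show ?thesis using r by blast
  qed
  then show ?thesis using Q(1) by blast
qed

text \<open>A cover \<open>f\<close> of the subobject and a lift \<open>l\<close> of a cover of the
  quotient jointly cover the extension. A morphism killing both vanishes on \<open>i\<close>, so it
  factors through \<open>p\<close>, and there \<open>p \<cdot> l\<close> detects it.\<close>

lemma epi_from_extension:
  assumes i: "is_cokernel C i p" and f: "is_epi C f" "Cod C f = Dom C i"
    and l: "l \<in> Arr C" "Cod C l = Cod C i" "is_epi C (p \<cdot> l)"
    and B: "is_biproduct C (Dom C f) (Dom C l) B a b r q"
  shows "is_epi C (i \<cdot> f \<cdot> r \<oplus> l \<cdot> q)"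
proof (rule epiI)
  note iD = cokernelD[OF i] and bD = biproductD[OF B] and fa = epi_arr[OF f(1)]
  let ?m = "i \<cdot> f \<cdot> r \<oplus> l \<cdot> q"
  show m: "?m \<in> Arr C"
    using iD bD fa f l by simp
  fix h assume "h \<in> Arr C" "Dom C h = Cod C ?m" "h \<cdot> ?m = Zero C (Dom C ?m) (Cod C h)"
  then have h: "h \<in> Arr C" "Dom C h = Cod C i" "h \<cdot> ?m = Zero C B (Cod C h)"
    using iD bD fa f l by auto
  have "?m \<cdot> a = i \<cdot> f" "?m \<cdot> b = l"
    using iD bD fa f l biproduct_cancel[OF B] by (auto simp: Comp_Add)
  moreover have "h \<cdot> (?m \<cdot> a) = Zero C B (Cod C h) \<cdot> a"
    using h m iD bD fa f l by (intro Comp_extend) auto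
  moreover have "h \<cdot> (?m \<cdot> b) = Zero C B (Cod C h) \<cdot> b"
    using h m iD bD fa f l by (intro Comp_extend) auto
  ultimately have eq: "h \<cdot> (i \<cdot> f) = Zero C (Dom C f) (Cod C h)" "h \<cdot> l = Zero C (Dom C l) (Cod C h)"
    using h bD by auto
  have "h \<cdot> i = Zero C (Cod C f) (Cod C (h \<cdot> i))"
    using h iD fa f eq by (intro epi_Zero[OF f(1)]) auto
  then obtain u where u: "u \<in> Arr C" "Dom C u = Cod C p" "Cod C u = Cod C h" "u \<cdot> p = h"
    using cokernel_desc[OF i h(1)] h f iD by auto
  have "u \<cdot> (p \<cdot> l) = Zero C (Dom C l) (Cod C u)"
    using u iD l eq by (subst Comp_extend[OF u(4)]) auto
  then have "u = Zero C (Cod C p) (Cod C u)"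
    using epi_Zero[OF l(3) u(1)] u iD l by auto
  then show "h = Zero C (Cod C ?m) (Cod C h)"
    using u iD l bD fa f h by (metis Add_arr(3) Comp_Zero(1) Comp_arr Dom_Cod_Obj(2))
qed

text \<open>Encoded as an induction principle and not as the statement that every object is a
  quotient of a finite power of \<open>Q\<close>: all uses are inductions over biproducts and
  quotients, and powers never have to be formed.\<close>

definition generates :: "'o \<Rightarrow> bool" where
  "generates Q \<longleftrightarrow> Q \<in> Obj C \<and>
     (\<forall>\<G>. \<G> Q \<longrightarrow> (\<forall>X Y B i j p q. is_biproduct C X Y B i j p q \<longrightarrow> \<G> X \<longrightarrow> \<G> Y \<longrightarrow> \<G> B) \<longrightarrow>
       (\<forall>e. is_epi C e \<longrightarrow> \<G> (Dom C e) \<longrightarrow> \<G> (Cod C e)) \<longrightarrow> (\<forall>X \<in> Obj C. \<G> X))"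

lemma generates_induct [consumes 2, case_names generator biproduct quotient]:
  assumes "generates Q" "X \<in> Obj C" "\<G> Q"
    "\<And>X Y B i j p q. is_biproduct C X Y B i j p q \<Longrightarrow> \<G> X \<Longrightarrow> \<G> Y \<Longrightarrow> \<G> B"
    "\<And>e. is_epi C e \<Longrightarrow> \<G> (Dom C e) \<Longrightarrow> \<G> (Cod C e)"
  shows "\<G> X"
proof -
  have "\<G> Q \<longrightarrow> (\<forall>X Y B i j p q. is_biproduct C X Y B i j p q \<longrightarrow> \<G> X \<longrightarrow> \<G> Y \<longrightarrow> \<G> B) \<longrightarrow>
       (\<forall>e. is_epi C e \<longrightarrow> \<G> (Dom C e) \<longrightarrow> \<G> (Cod C e)) \<longrightarrow> (\<forall>X \<in> Obj C. \<G> X)"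
    using assms(1) unfolding generates_def by (elim conjE) (erule spec)
  from mp[OF mp[OF mp[OF this assms(3)]]] show ?thesis
    using assms(2,4,5) by blast
qed

text \<open>Induction on the length of the object. In an extension by a simple object, a projective
  cover of the simple lifts to the middle term, and this cover is itself a quotient of
  \<open>Q\<close>.\<close>

lemma ex_generator: "\<exists>Q. generates Q"
proof -
  obtain Q where Q: "Q \<in> Obj C" "\<And>S. is_simple C S \<Longrightarrow> \<exists>P e r. is_projective C P \<and> is_epi C e \<and> Dom C e = P \<and> Cod C e = S \<and>
     is_epi C r \<and> Dom C r = Q \<and> Cod C r = P"
    using ex_projective_covering_simples by blast
  have "\<G> X" if gen: "\<G> Q" and bip: "\<And>X Y B i j p q. is_biproduct C X Y B i j p q \<Longrightarrow> \<G> X \<Longrightarrow> \<G> Y \<Longrightarrow> \<G> B"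
    and quot: "\<And>e. is_epi C e \<Longrightarrow> \<G> (Dom C e) \<Longrightarrow> \<G> (Cod C e)" and X: "X \<in> Obj C" for \<G> X
    using finite_length_obj[OF X]
  proof (induction X)
    case (zero Z)
    then have Z: "Z \<in> Obj C" by (auto simp: is_zero_obj_def)
    \<comment> \<open>The induction can start because every map to a zero object is epi, which makes
      the zero object a quotient of \<open>Q\<close>.\<close>
    have "is_epi C (Zero C Q Z)"
    proof (rule epiI)
      fix g assume "g \<in> Arr C" "Dom C g = Cod C (Zero C Q Z)"
      then show "g = Zero C (Cod C (Zero C Q Z)) (Cod C g)"
        using zero_obj_unique[OF zero, of g] Z Q by simp
    qed (use Z Q in simp)
    from quot[OF this] show ?case
      using gen Z Q by simp
  next
    case (step i p)
    obtain P e r where r: "is_projective C P" "is_epi C e" "Dom C e = P" "Cod C e = Cod C p"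
          "is_epi C r" "Dom C r = Q" "Cod C r = P"
      using Q(2)[OF step.hyps(4)] by blast
    note iD = cokernelD[OF step.hyps(3)] and ea = epi_arr[OF r(2)]
    obtain l where l: "l \<in> Arr C" "Dom C l = P" "Cod C l = Dom C p" "p \<cdot> l = e"
      using projective_epi_lift[OF r(1) cokernel_epi[OF step.hyps(3)] ea] r by auto
    have P: "\<G> P" "P \<in> Obj C"
      using quot[OF r(5)] r gen ea by auto
    obtain B a b s q where B: "is_biproduct C (Dom C i) P B a b s q"
      using ex_biproduct[of "Dom C i" P] iD P by auto
    note bD = biproductD[OF B]
    have "is_epi C (i \<cdot> Id C (Dom C i) \<cdot> s \<oplus> l \<cdot> q)"
      using l r iD B by (intro epi_from_extension[OF step.hyps(3)]) (auto intro: iso_epi)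
    from quot[OF this] show ?case
      using bip[OF B step.IH P(1)] bD iD l by simp
  qed
  note gen = this
  have "generates Q"
    unfolding generates_def
  proof (intro conjI allI impI ballI)
    fix \<G> X
    assume 1: "\<G> Q" and 2: "\<forall>X Y B i j p q. is_biproduct C X Y B i j p q \<longrightarrow> \<G> X \<longrightarrow> \<G> Y \<longrightarrow> \<G> B"
      and 3: "\<forall>e. is_epi C e \<longrightarrow> \<G> (Dom C e) \<longrightarrow> \<G> (Cod C e)" and X: "X \<in> Obj C"
    show "\<G> X"
      by (rule gen[of \<G>, OF 1 2[rule_format] 3[rule_format] X])
  qed (rule Q(1))
  then show ?thesis ..
qed

end

section \<open>Module categories\<close>

context strict_monoidal_category
begin

lemma Ten_Obj [simp]:
  "\<one> \<in> Obj C" "X \<in> Obj C \<Longrightarrow> Y \<in> Obj C \<Longrightarrow> X \<otimes> Y \<in> Obj C"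
  "X \<in> Obj C \<Longrightarrow> Y \<in> Obj C \<Longrightarrow> Z \<in> Obj C \<Longrightarrow> (X \<otimes> Y) \<otimes> Z = X \<otimes> (Y \<otimes> Z)"
  "X \<in> Obj C \<Longrightarrow> \<one> \<otimes> X = X" "X \<in> Obj C \<Longrightarrow> X \<otimes> \<one> = X"
  by (auto simp: unit_obj ten_obj ten_assoc_obj unit_left_obj unit_right_obj)

lemma Ten_arr [simp]:
  assumes "f \<in> Arr C" "g \<in> Arr C"
  shows "f \<boxtimes> g \<in> Arr C" "Dom C (f \<boxtimes> g) = Dom C f \<otimes> Dom C g" "Cod C (f \<boxtimes> g) = Cod C f \<otimes> Cod C g"
  using ten_hom[of f "Dom C f" "Cod C f" g "Dom C g" "Cod C g"] assms by (auto simp: in_hom)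

lemma Ten_unit [simp]:
  "f \<in> Arr C \<Longrightarrow> Id C \<one> \<boxtimes> f = f" "f \<in> Arr C \<Longrightarrow> f \<boxtimes> Id C \<one> = f"
  "f \<in> Arr C \<Longrightarrow> g \<in> Arr C \<Longrightarrow> h \<in> Arr C \<Longrightarrow> (f \<boxtimes> g) \<boxtimes> h = f \<boxtimes> (g \<boxtimes> h)"
  by (auto simp: unit_left_arr unit_right_arr ten_assoc_arr)

lemma Ten_Id [simp]: "X \<in> Obj C \<Longrightarrow> Y \<in> Obj C \<Longrightarrow> Id C X \<boxtimes> Id C Y = Id C (X \<otimes> Y)"
  by (rule ten_id)

lemma Ten_Comp:
  assumes "g \<in> Arr C" "f \<in> Arr C" "g' \<in> Arr C" "f' \<in> Arr C" "Dom C g = Cod C f" "Dom C g' = Cod C f'"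
  shows "(g \<boxtimes> g') \<cdot> (f \<boxtimes> f') = (g \<cdot> f) \<boxtimes> (g' \<cdot> f')"
  using ten_comp[of g "Cod C f" "Cod C g" f "Dom C f" g' "Cod C f'" "Cod C g'" f' "Dom C f'"] assms
  by (simp add: in_hom)

lemma Ten_Comp_Id:
  "g \<in> Arr C \<Longrightarrow> f \<in> Arr C \<Longrightarrow> Dom C g = Cod C f \<Longrightarrow> X \<in> Obj C \<Longrightarrow>
    (g \<cdot> f) \<boxtimes> Id C X = (g \<boxtimes> Id C X) \<cdot> (f \<boxtimes> Id C X)"
  "g \<in> Arr C \<Longrightarrow> f \<in> Arr C \<Longrightarrow> Dom C g = Cod C f \<Longrightarrow> X \<in> Obj C \<Longrightarrow>
    Id C X \<boxtimes> (g \<cdot> f) = (Id C X \<boxtimes> g) \<cdot> (Id C X \<boxtimes> f)"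
  by (simp_all add: Ten_Comp)

lemma Id_Ten: "X \<in> Obj C \<Longrightarrow> Y \<in> Obj C \<Longrightarrow> f \<in> Arr C \<Longrightarrow> Id C (X \<otimes> Y) \<boxtimes> f = Id C X \<boxtimes> Id C Y \<boxtimes> f"
  by (simp flip: Ten_Id)

lemma Ten_split:
  assumes "f \<in> Arr C" "g \<in> Arr C"
  shows "(f \<boxtimes> Id C (Cod C g)) \<cdot> (Id C (Dom C f) \<boxtimes> g) = f \<boxtimes> g"
    "(Id C (Cod C f) \<boxtimes> g) \<cdot> (f \<boxtimes> Id C (Dom C g)) = f \<boxtimes> g"
  using assms by (simp_all add: Ten_Comp)

lemma Ten_iso:
  assumes "is_iso C f" "is_iso C g"
  shows "is_iso C (f \<boxtimes> g)" "inv_arr C (f \<boxtimes> g) = inv_arr C f \<boxtimes> inv_arr C g"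
  using isoI[of "f \<boxtimes> g" "inv_arr C f \<boxtimes> inv_arr C g"] iso_arr[OF assms(1)] iso_arr[OF assms(2)] assms
  by (auto simp: Ten_Comp)

end

locale tensor_module = C: tensor_category C + module_category C M A
  for C :: "('co, 'cm, 'k::alg_closed_field) moncat"
    and M :: "('mo, 'mm, 'k) lincat"
    and A :: "('co, 'cm, 'mo, 'mm) action" (structure)
begin

abbreviation comp_C (infixr "\<cdot>\<^sub>C" 60) where "g \<cdot>\<^sub>C f \<equiv> g \<cdot>\<^bsub>C\<^esub> f"
abbreviation comp_M (infixr "\<bullet>" 60) where "g \<bullet> f \<equiv> g \<cdot>\<^bsub>M\<^esub> f"
abbreviation ten_C (infixr "\<otimes>\<^sub>C" 70) where "X \<otimes>\<^sub>C Y \<equiv> X \<otimes>\<^bsub>C\<^esub> Y"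
abbreviation tenA_C (infixr "\<boxtimes>\<^sub>C" 70) where "f \<boxtimes>\<^sub>C g \<equiv> f \<boxtimes>\<^bsub>C\<^esub> g"

lemma Act_Obj [simp]: "X \<in> Obj C \<Longrightarrow> N \<in> Obj M \<Longrightarrow> X \<rhd> N \<in> Obj M"
  by (rule act_obj)

lemma Act_arr [simp]:
  assumes "f \<in> Arr C" "g \<in> Arr M"
  shows "f \<triangleright> g \<in> Arr M" "Dom M (f \<triangleright> g) = Dom C f \<rhd> Dom M g" "Cod M (f \<triangleright> g) = Cod C f \<rhd> Cod M g"
  using act_hom[of f "Dom C f" "Cod C f" g "Dom M g" "Cod M g"] assms by (auto simp: in_hom)

lemma Act_Id [simp]: "X \<in> Obj C \<Longrightarrow> N \<in> Obj M \<Longrightarrow> Id C X \<triangleright> Id M N = Id M (X \<rhd> N)"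
  by (rule act_id)

lemma Act_Comp:
  assumes "g \<in> Arr C" "f \<in> Arr C" "g' \<in> Arr M" "f' \<in> Arr M" "Dom C g = Cod C f" "Dom M g' = Cod M f'"
  shows "(g \<triangleright> g') \<bullet> (f \<triangleright> f') = (g \<cdot>\<^sub>C f) \<triangleright> (g' \<bullet> f')"
  using act_comp[of g "Cod C f" "Cod C g" f "Dom C f" g' "Cod M f'" "Cod M g'" f' "Dom M f'"] assms
  by (simp add: in_hom)

lemma Act_Comp_Id:
  "g \<in> Arr C \<Longrightarrow> f \<in> Arr C \<Longrightarrow> Dom C g = Cod C f \<Longrightarrow> N \<in> Obj M \<Longrightarrow>
    (g \<cdot>\<^sub>C f) \<triangleright> Id M N = (g \<triangleright> Id M N) \<bullet> (f \<triangleright> Id M N)"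
  "g' \<in> Arr M \<Longrightarrow> f' \<in> Arr M \<Longrightarrow> Dom M g' = Cod M f' \<Longrightarrow> X \<in> Obj C \<Longrightarrow>
    Id C X \<triangleright> (g' \<bullet> f') = (Id C X \<triangleright> g') \<bullet> (Id C X \<triangleright> f')"
  by (simp_all add: Act_Comp)

lemma Act_swap:
  assumes "f \<in> Arr C" "g \<in> Arr M" "Dom C f = X" "Cod C f = Y" "Dom M g = N" "Cod M g = L"
  shows "(Id C Y \<triangleright> g) \<bullet> (f \<triangleright> Id M N) = (f \<triangleright> Id M L) \<bullet> (Id C X \<triangleright> g)"
  using assms by (auto simp: Act_Comp)

lemma Act_iso:
  assumes "is_iso C f" "is_iso M g"
  shows "is_iso M (f \<triangleright> g)" "inv_arr M (f \<triangleright> g) = inv_arr C f \<triangleright> inv_arr M g"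
  using isoI[of "f \<triangleright> g" "inv_arr C f \<triangleright> inv_arr M g"] C.iso_arr[OF assms(1)] iso_arr[OF assms(2)] assms
  by (auto simp: Act_Comp)

lemma Act_Add:
  assumes "f \<in> Arr C" "f' \<in> Arr C" "Dom C f = Dom C f'" "Cod C f = Cod C f'" "N \<in> Obj M"
  shows "(f \<oplus>\<^bsub>C\<^esub> f') \<triangleright> Id M N = (f \<triangleright> Id M N) \<oplus>\<^bsub>M\<^esub> (f' \<triangleright> Id M N)"
  using act_exact_left[of N] assms
  unfolding exact_def left_exact_def linear_functor_def in_hom by (auto simp: in_hom)

lemma Act_Smul:
  assumes "f \<in> Arr C" "N \<in> Obj M"
  shows "(a \<odot>\<^bsub>C\<^esub> f) \<triangleright> Id M N = a \<odot>\<^bsub>M\<^esub> (f \<triangleright> Id M N)"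
  using act_exact_left[of N] assms
  unfolding exact_def left_exact_def linear_functor_def in_hom by (auto simp: in_hom)

lemma Act_Zero:
  assumes "X \<in> Obj C" "Y \<in> Obj C" "N \<in> Obj M"
  shows "Zero C X Y \<triangleright> Id M N = Zero M (X \<rhd> N) (Y \<rhd> N)"
proof -
  have "Zero C X Y \<triangleright> Id M N = (0 \<odot>\<^bsub>C\<^esub> Zero C X Y) \<triangleright> Id M N"
    using assms by simp
  also have "\<dots> = 0 \<odot>\<^bsub>M\<^esub> (Zero C X Y \<triangleright> Id M N)"
    using assms by (intro Act_Smul) auto
  also have "\<dots> = Zero M (X \<rhd> N) (Y \<rhd> N)"
    using assms by (intro Smul_0) (auto simp: in_hom)
  finally show ?thesis .
qed

lemma Act_Add_right:
  assumes "g \<in> Arr M" "g' \<in> Arr M" "Dom M g = Dom M g'" "Cod M g = Cod M g'" "X \<in> Obj C"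
  shows "Id C X \<triangleright> (g \<oplus>\<^bsub>M\<^esub> g') = (Id C X \<triangleright> g) \<oplus>\<^bsub>M\<^esub> (Id C X \<triangleright> g')"
  using act_exact_right[of X] assms
  unfolding exact_def left_exact_def linear_functor_def in_hom by (auto simp: in_hom)

lemma Act_Smul_right:
  assumes "g \<in> Arr M" "X \<in> Obj C"
  shows "Id C X \<triangleright> (a \<odot>\<^bsub>M\<^esub> g) = a \<odot>\<^bsub>M\<^esub> (Id C X \<triangleright> g)"
  using act_exact_right[of X] assms
  unfolding exact_def left_exact_def linear_functor_def by simp

lemma Act_Zero_right:
  assumes "N \<in> Obj M" "L \<in> Obj M" "X \<in> Obj C"
  shows "Id C X \<triangleright> Zero M N L = Zero M (X \<rhd> N) (X \<rhd> L)"
  using Act_Smul_right[of "Zero M N L" X 0] Smul_0[of "Id C X \<triangleright> Zero M N L" "X \<rhd> N" "X \<rhd> L"] assms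
  by (simp add: in_hom)

lemma Act_cokernel:
  assumes "is_cokernel C f p" "N \<in> Obj M"
  shows "is_cokernel M (f \<triangleright> Id M N) (p \<triangleright> Id M N)"
  using act_exact_left[of N] assms unfolding exact_def right_exact_def by auto

text \<open>Exactness speaks of cokernels, so the epimorphism is first written as the cokernel of
  its kernel. \<open>Act_epi_right\<close> does the same in the other variable.\<close>

lemma Act_epi:
  assumes "is_epi C e" "N \<in> Obj M"
  shows "is_epi M (e \<triangleright> Id M N)"
proof -
  obtain k where "is_kernel C e k"
    using C.ex_kernel C.epi_arr[OF assms(1)] by blast
  then show ?thesis
    using cokernel_epi Act_cokernel C.epi_is_cokernel_of_kernel assms by blast
qed

lemma Act_epi_right:
  assumes "is_epi M e" "X \<in> Obj C"
  shows "is_epi M (Id C X \<triangleright> e)"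
proof -
  obtain k where "is_kernel M e k"
    using ex_kernel epi_arr[OF assms(1)] by blast
  then have "is_cokernel M k e"
    using epi_is_cokernel_of_kernel assms(1) by blast
  then have "is_cokernel M (Id C X \<triangleright> k) (Id C X \<triangleright> e)"
    using act_exact_right[of X] assms unfolding exact_def right_exact_def by auto
  then show ?thesis
    by (rule cokernel_epi)
qed

subsection \<open>Internal Homs\<close>

text \<open>\<open>X\<close> is a sum of copies of \<open>Q\<close> with one summand for each
  element of \<open>B\<close> and a starting copy, and \<open>u\<close> has the elements of
  \<open>B\<close> as its components.\<close>

lemma hits_finite_set:
  assumes "finite B" "B \<subseteq> hom M (Q \<rhd> N) L" "Q \<in> Obj C" "N \<in> Obj M" "L \<in> Obj M"
  shows "\<exists>X u. X \<in> Obj C \<and> u \<in> hom M (X \<rhd> N) L \<and> (\<forall>b \<in> B. \<exists>e \<in> hom C Q X. u \<bullet> (e \<triangleright> Id M N) = b)"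
  using assms(1,2)
proof (induction B)
  case empty
  \<comment> \<open>For the empty set any pair would do; \<open>Q\<close> with the zero map is at
    hand.\<close>
  have "Zero M (Q \<rhd> N) L \<in> hom M (Q \<rhd> N) L"
    using assms by (simp add: in_hom)
  then show ?case using assms by blast
next
  case (insert b B)
  then obtain X u where X: "X \<in> Obj C" "u \<in> Arr M" "Dom M u = X \<rhd> N" "Cod M u = L"
    "\<And>b. b \<in> B \<Longrightarrow> \<exists>e \<in> hom C Q X. u \<bullet> (e \<triangleright> Id M N) = b"
    by (auto simp: in_hom)
  have b: "b \<in> Arr M" "Dom M b = Q \<rhd> N" "Cod M b = L"
    using insert by (auto simp: in_hom)
  obtain Y i j p q where Y: "is_biproduct C X Q Y i j p q"
    using C.ex_biproduct[OF X(1) assms(3)] by blast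
  note d = C.biproductD[OF Y]
  define w where "w = u \<bullet> (p \<triangleright> Id M N) \<oplus>\<^bsub>M\<^esub> b \<bullet> (q \<triangleright> Id M N)"
  have w: "w \<in> Arr M" "Dom M w = Y \<rhd> N" "Cod M w = L"
    using d X b assms by (auto simp: w_def)
  have "w \<bullet> (j \<triangleright> Id M N) = b"
    using d X b assms by (simp add: w_def Comp_Add Act_Comp Act_Zero)
  moreover have "j \<in> hom C Q Y"
    using d by (simp add: in_hom)
  moreover have "\<exists>e \<in> hom C Q Y. w \<bullet> (e \<triangleright> Id M N) = c" if c: "c \<in> B" for c
  proof -
    obtain e where e: "e \<in> Arr C" "Dom C e = Q" "Cod C e = X" "u \<bullet> (e \<triangleright> Id M N) = c"
      using X(5)[OF c] by (auto simp: in_hom)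
    have "c \<in> hom M (Q \<rhd> N) L"
      using c insert.prems by blast
    then have "w \<bullet> ((i \<cdot>\<^sub>C e) \<triangleright> Id M N) = c"
      using d X(1-4) b assms(3-5) e C.biproduct_cancel[OF Y]
      by (simp add: w_def Comp_Add Act_Comp Act_Zero in_hom)
    then show ?thesis
      using d e by (intro bexI[of _ "i \<cdot>\<^sub>C e"]) (auto simp: in_hom)
  qed
  moreover have "w \<in> hom M (Y \<rhd> N) L"
    using w by (simp add: in_hom)
  ultimately show ?case
    using d(3) by blast
qed

text \<open>\<open>p\<close> is the cokernel of the largest subobject of \<open>X\<close> killed by \<open>u\<close>.\<close>

lemma injective_quotient:
  assumes X: "X \<in> Obj C" and u: "u \<in> hom M (X \<rhd> N) L" and N: "N \<in> Obj M"
  obtains p u' where "p \<in> Arr C" "Dom C p = X" "u' \<in> hom M (Cod C p \<rhd> N) L" "u' \<bullet> (p \<triangleright> Id M N) = u"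
    "\<And>f. f \<in> Arr C \<Longrightarrow> Cod C f = Cod C p \<Longrightarrow> u' \<bullet> (f \<triangleright> Id M N) = Zero M (Dom C f \<rhd> N) L \<Longrightarrow>
      f = Zero C (Dom C f) (Cod C f)"
proof -
  define S where "S f \<longleftrightarrow> u \<bullet> (f \<triangleright> Id M N) = Zero M (Dom C f \<rhd> N) L" for f
  have u': "u \<in> Arr M" "Dom M u = X \<rhd> N" "Cod M u = L" "L \<in> Obj M"
    using u by (auto simp: in_hom)
  \<comment> \<open>Closure under descent is the condition with content: by exactness of the action
    \<open>e \<triangleright> Id M N\<close> is again epi and can be cancelled.\<close>
  have "C.subobject_class X S"
    unfolding C.subobject_class_def
  proof (intro conjI allI impI ballI)
    fix f g assume a: "S f" "f \<in> Arr C" "g \<in> Arr C" "Cod C f = X" "Dom C f = Cod C g"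
    have "u \<bullet> ((f \<triangleright> Id M N) \<bullet> (g \<triangleright> Id M N)) = Zero M (Dom C f \<rhd> N) L \<bullet> (g \<triangleright> Id M N)"
      using a u' N by (intro Comp_extend) (auto simp: S_def)
    then show "S (f \<cdot>\<^sub>C g)"
      using a u' N by (simp add: S_def Act_Comp)
  next
    fix f g assume "S f" "S g" "f \<in> Arr C" "g \<in> Arr C" "Cod C f = X" "Cod C g = X" "Dom C f = Dom C g"
    then show "S (f \<oplus>\<^bsub>C\<^esub> g)"
      using u' N by (simp add: S_def Act_Add Comp_Add)
  next
    fix f e assume a: "S (f \<cdot>\<^sub>C e)" "f \<in> Arr C" "is_epi C e" "Cod C f = X" "Dom C f = Cod C e"
    note ea = C.epi_arr[OF a(3)]
    have "u \<bullet> (f \<triangleright> Id M N) = Zero M (Cod M (e \<triangleright> Id M N)) (Cod M (u \<bullet> (f \<triangleright> Id M N)))"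
      using a u' N ea by (intro epi_Zero[OF Act_epi[OF a(3) N]]) (auto simp: S_def Act_Comp_Id)
    then show "S f"
      using a u' N ea by (simp add: S_def)
  next
    fix Y assume "Y \<in> Obj C"
    then show "S (Zero C Y X)"
      using u' N X by (simp add: S_def Act_Zero)
  qed
  then obtain k where k: "is_mono C k" "Cod C k = X" "S k"
    "\<And>f. S f \<Longrightarrow> f \<in> Arr C \<Longrightarrow> Cod C f = X \<Longrightarrow> \<exists>u \<in> hom C (Dom C f) (Dom C k). k \<cdot>\<^sub>C u = f"
    using C.largest_subobject[OF C.finite_length_obj[OF X]] by metis
  obtain p where p: "is_cokernel C k p"
    using C.ex_cokernel C.mono_arr[OF k(1)] by blast
  note pD = C.cokernelD[OF p]
  \<comment> \<open>By exactness \<open>p \<triangleright> Id M N\<close> is a cokernel of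
    \<open>k \<triangleright> Id M N\<close>, which \<open>u\<close> kills, so \<open>u\<close>
    descends to the quotient.\<close>
  obtain v where v: "v \<in> Arr M" "Dom M v = Cod C p \<rhd> N" "Cod M v = L" "v \<bullet> (p \<triangleright> Id M N) = u"
    using cokernel_desc[OF Act_cokernel[OF p N] u'(1)] u' k pD N by (auto simp: S_def)
  have "f = Zero C (Dom C f) (Cod C f)"
    if f: "f \<in> Arr C" "Cod C f = Cod C p" "v \<bullet> (f \<triangleright> Id M N) = Zero M (Dom C f \<rhd> N) L" for f
  proof -
    \<comment> \<open>A morphism \<open>f\<close> into the quotient lifts to \<open>X\<close> after
      an epimorphism \<open>b\<close>. The lift \<open>a\<close> is killed by \<open>u\<close>,
      hence factors through \<open>k\<close>, so \<open>f \<cdot>\<^sub>C b\<close>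
      vanishes.\<close>
    obtain a b where ab: "a \<in> Arr C" "is_epi C b" "Dom C a = Dom C b" "Cod C a = Dom C p" "Cod C b = Dom C f"
      "p \<cdot>\<^sub>C a = f \<cdot>\<^sub>C b"
      using C.epi_pullback[OF C.cokernel_epi[OF p] f(1,2)] .
    note ba = C.epi_arr[OF ab(2)]
    have "u \<bullet> (a \<triangleright> Id M N) = v \<bullet> ((p \<triangleright> Id M N) \<bullet> (a \<triangleright> Id M N))"
      using v pD ab ba N by (intro Comp_extend[symmetric]) auto
    also have "\<dots> = v \<bullet> ((f \<triangleright> Id M N) \<bullet> (b \<triangleright> Id M N))"
      using pD ab ba N f by (simp add: Act_Comp)
    also have "\<dots> = Zero M (Dom C f \<rhd> N) L \<bullet> (b \<triangleright> Id M N)"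
      using v ab ba N f by (intro Comp_extend) auto
    finally have "S a"
      using ab ba N f u' by (simp add: S_def)
    then obtain w where w: "w \<in> Arr C" "Dom C w = Dom C a" "Cod C w = Dom C k" "k \<cdot>\<^sub>C w = a"
      using k(4)[of a] ab(1,4) pD(3) k(2) unfolding in_hom Bex_def by metis
    have "p \<cdot>\<^sub>C (k \<cdot>\<^sub>C w) = Zero C (Dom C k) (Cod C p) \<cdot>\<^sub>C w"
      using w pD by (intro C.Comp_extend) auto
    then have "f \<cdot>\<^sub>C b = Zero C (Dom C b) (Cod C f)"
      using w pD(1,2) ab(3,6) f(2) by simp
    then show ?thesis
      using C.epi_Zero[OF ab(2) f(1)] ab(5) by simp
  qed
  note inj = this
  show thesis
  proof (rule that[of p v])
    show "v \<in> hom M (Cod C p \<rhd> N) L"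
      using v by (simp add: in_hom)
    show "f = Zero C (Dom C f) (Cod C f)" if "f \<in> Arr C" "Cod C f = Cod C p"
      "v \<bullet> (f \<triangleright> Id M N) = Zero M (Dom C f \<rhd> N) L" for f
      using that by (rule inj)
  qed (use pD(2,3) k(2) v(4) in simp_all)
qed

text \<open>Passing to the quotient makes composition with \<open>u\<close> injective for all
  \<open>Y\<close> at once. Surjectivity holds at the generator by the choice of \<open>X0\<close>,
  and injectivity is what lets it spread to quotients.\<close>

lemma representing_object:
  assumes N: "N \<in> Obj M" and L: "L \<in> Obj M"
  shows "\<exists>X u. X \<in> Obj C \<and> u \<in> hom M (X \<rhd> N) L \<and>
    (\<forall>Y \<in> Obj C. bij_betw (\<lambda>f. u \<bullet> (f \<triangleright> Id M N)) (hom C Y X) (hom M (Y \<rhd> N) L))"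
proof -
  obtain Q where gen: "C.generates Q"
    using C.ex_generator by blast
  then have Q: "Q \<in> Obj C"
    by (simp add: C.generates_def)
  obtain B where B: "finite B" "B \<subseteq> hom M (Q \<rhd> N) L" "hom M (Q \<rhd> N) L = lin_span M (Q \<rhd> N) L B"
    using finite_dim_hom[of "Q \<rhd> N" L] Q N L by auto
  obtain X0 u0 where X0: "X0 \<in> Obj C" "u0 \<in> hom M (X0 \<rhd> N) L"
    "\<And>b. b \<in> B \<Longrightarrow> \<exists>e \<in> hom C Q X0. u0 \<bullet> (e \<triangleright> Id M N) = b"
    using hits_finite_set[OF B(1,2) Q N L] by blast
  obtain p u where p: "p \<in> Arr C" "Dom C p = X0" "u \<in> hom M (Cod C p \<rhd> N) L" "u \<bullet> (p \<triangleright> Id M N) = u0"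
    and inj: "\<And>f. f \<in> Arr C \<Longrightarrow> Cod C f = Cod C p \<Longrightarrow> u \<bullet> (f \<triangleright> Id M N) = Zero M (Dom C f \<rhd> N) L \<Longrightarrow>
      f = Zero C (Dom C f) (Cod C f)"
    using injective_quotient[OF X0(1,2) N] by blast
  define X where "X = Cod C p"
  have u: "u \<in> Arr M" "Dom M u = X \<rhd> N" "Cod M u = L" and X: "X \<in> Obj C"
    using p by (auto simp: in_hom X_def)
  have surj: "\<forall>v \<in> hom M (Y \<rhd> N) L. \<exists>f \<in> hom C Y X. u \<bullet> (f \<triangleright> Id M N) = v" if "Y \<in> Obj C" for Y
    using gen that
  proof (induction Y rule: C.generates_induct)
    case generator
    have "\<exists>f \<in> hom C Q X. u \<bullet> (f \<triangleright> Id M N) = v" if "v \<in> lin_span M (Q \<rhd> N) L B" for v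
      using that
    proof induction
      case zero
      then show ?case
        using u X Q N L by (intro bexI[of _ "Zero C Q X"]) (auto simp: Act_Zero in_hom)
    next
      case (base b)
      then obtain e where e: "e \<in> Arr C" "Dom C e = Q" "Cod C e = X0" "u0 \<bullet> (e \<triangleright> Id M N) = b"
        using X0(3)[OF base] by (auto simp: in_hom)
      have "u \<bullet> ((p \<triangleright> Id M N) \<bullet> (e \<triangleright> Id M N)) = u0 \<bullet> (e \<triangleright> Id M N)"
        using u p e N by (intro Comp_extend) (auto simp: X_def)
      then show ?case
        using e p N by (intro bexI[of _ "p \<cdot>\<^sub>C e"]) (auto simp: X_def Act_Comp in_hom)
    next
      case (add v w)
      then obtain f g where "f \<in> Arr C" "Dom C f = Q" "Cod C f = X" "u \<bullet> (f \<triangleright> Id M N) = v"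
        "g \<in> Arr C" "Dom C g = Q" "Cod C g = X" "u \<bullet> (g \<triangleright> Id M N) = w"
        by (auto simp: in_hom)
      then show ?case
        using u N by (intro bexI[of _ "f \<oplus>\<^bsub>C\<^esub> g"]) (auto simp: Act_Add Comp_Add in_hom)
    next
      case (smul v a)
      then obtain f where "f \<in> Arr C" "Dom C f = Q" "Cod C f = X" "u \<bullet> (f \<triangleright> Id M N) = v"
        by (auto simp: in_hom)
      then show ?case
        using u N by (intro bexI[of _ "a \<odot>\<^bsub>C\<^esub> f"]) (auto simp: Act_Smul Comp_Smul in_hom)
    qed
    then show ?case
      using B by blast
  next
    case (biproduct Y1 Y2 Y i j s q)
    note d = C.biproductD[OF biproduct(1)]
    show ?case
    proof
      fix v assume "v \<in> hom M (Y \<rhd> N) L"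
      then have v: "v \<in> Arr M" "Dom M v = Y \<rhd> N" "Cod M v = L" by (auto simp: in_hom)
      then have "v \<bullet> (i \<triangleright> Id M N) \<in> hom M (Y1 \<rhd> N) L" "v \<bullet> (j \<triangleright> Id M N) \<in> hom M (Y2 \<rhd> N) L"
        using d N by (auto simp: in_hom)
      then obtain f g where f: "f \<in> Arr C" "Dom C f = Y1" "Cod C f = X" "u \<bullet> (f \<triangleright> Id M N) = v \<bullet> (i \<triangleright> Id M N)"
        and g: "g \<in> Arr C" "Dom C g = Y2" "Cod C g = X" "u \<bullet> (g \<triangleright> Id M N) = v \<bullet> (j \<triangleright> Id M N)"
        using biproduct(2,3) unfolding in_hom Ball_def Bex_def by metis
      have "u \<bullet> ((f \<cdot>\<^sub>C s) \<triangleright> Id M N) = v \<bullet> ((i \<cdot>\<^sub>C s) \<triangleright> Id M N)"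
        using Comp_extend2[OF f(4), of "s \<triangleright> Id M N"] u f v d N by (simp add: Act_Comp)
      moreover have "u \<bullet> ((g \<cdot>\<^sub>C q) \<triangleright> Id M N) = v \<bullet> ((j \<cdot>\<^sub>C q) \<triangleright> Id M N)"
        using Comp_extend2[OF g(4), of "q \<triangleright> Id M N"] u g v d N by (simp add: Act_Comp)
      ultimately have "u \<bullet> ((f \<cdot>\<^sub>C s \<oplus>\<^bsub>C\<^esub> g \<cdot>\<^sub>C q) \<triangleright> Id M N) = v \<bullet> ((i \<cdot>\<^sub>C s \<oplus>\<^bsub>C\<^esub> j \<cdot>\<^sub>C q) \<triangleright> Id M N)"
        using u f g v d(1-19) N by (simp add: Act_Add Comp_Add)
      then have "u \<bullet> ((f \<cdot>\<^sub>C s \<oplus>\<^bsub>C\<^esub> g \<cdot>\<^sub>C q) \<triangleright> Id M N) = v"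
        using v d N by simp
      then show "\<exists>f \<in> hom C Y X. u \<bullet> (f \<triangleright> Id M N) = v"
        using f g d by (intro bexI[of _ "f \<cdot>\<^sub>C s \<oplus>\<^bsub>C\<^esub> g \<cdot>\<^sub>C q"]) (auto simp: in_hom)
    qed
  next
    case (quotient e)
    note e = quotient(1) and ea = C.epi_arr[OF quotient(1)]
    show ?case
    proof
      fix v assume "v \<in> hom M (Cod C e \<rhd> N) L"
      then have v: "v \<in> Arr M" "Dom M v = Cod C e \<rhd> N" "Cod M v = L" by (auto simp: in_hom)
      then have "v \<bullet> (e \<triangleright> Id M N) \<in> hom M (Dom C e \<rhd> N) L"
        using ea N by (auto simp: in_hom)
      then obtain f where f: "f \<in> Arr C" "Dom C f = Dom C e" "Cod C f = X"
        "u \<bullet> (f \<triangleright> Id M N) = v \<bullet> (e \<triangleright> Id M N)"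
        using quotient(2) unfolding in_hom Ball_def Bex_def by metis
      \<comment> \<open>The preimage \<open>f\<close> of
        \<open>v \<bullet> (e \<triangleright> Id M N)\<close> must descend along \<open>e\<close>.
        Its restriction to the kernel of \<open>e\<close> is sent to zero by composition with
        \<open>u\<close>, so injectivity makes it vanish.\<close>
      have "f \<cdot>\<^sub>C k = Zero C (Dom C k) (Cod C f)" if k: "is_kernel C e k" for k
      proof -
        note kD = C.kernelD[OF k]
        have "u \<bullet> ((f \<cdot>\<^sub>C k) \<triangleright> Id M N) = v \<bullet> ((e \<cdot>\<^sub>C k) \<triangleright> Id M N)"
          using Comp_extend2[OF f(4), of "k \<triangleright> Id M N"] u f v kD(1-3) N by (simp add: Act_Comp)
        also have "\<dots> = Zero M (Dom C k \<rhd> N) L"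
          using kD v N by (simp add: Act_Zero)
        finally show ?thesis
          using inj[of "f \<cdot>\<^sub>C k"] f kD by (simp add: X_def)
      qed
      then obtain g where g: "g \<in> Arr C" "Dom C g = Cod C e" "Cod C g = X" "g \<cdot>\<^sub>C e = f"
        using C.epi_descend[OF e f(1)] f by metis
      have "(u \<bullet> (g \<triangleright> Id M N)) \<bullet> (e \<triangleright> Id M N) = v \<bullet> (e \<triangleright> Id M N)"
        using u g ea N f(4) by (simp add: Act_Comp)
      then have "u \<bullet> (g \<triangleright> Id M N) = v"
        using u g ea N v by (rule_tac epi_cancel[OF Act_epi[OF e N]]) auto
      then show "\<exists>f \<in> hom C (Cod C e) X. u \<bullet> (f \<triangleright> Id M N) = v"
        using g by (auto simp: in_hom)
    qed
  qed
  have "bij_betw (\<lambda>f. u \<bullet> (f \<triangleright> Id M N)) (hom C Y X) (hom M (Y \<rhd> N) L)" if Y: "Y \<in> Obj C" for Y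
    unfolding bij_betw_def
  proof
    show "inj_on (\<lambda>f. u \<bullet> (f \<triangleright> Id M N)) (hom C Y X)"
    proof (rule inj_onI)
      fix f g assume fg: "f \<in> hom C Y X" "g \<in> hom C Y X" "u \<bullet> (f \<triangleright> Id M N) = u \<bullet> (g \<triangleright> Id M N)"
      have "u \<bullet> ((f \<oplus>\<^bsub>C\<^esub> (- 1) \<odot>\<^bsub>C\<^esub> g) \<triangleright> Id M N) = Zero M (Y \<rhd> N) L"
        using fg u N by (auto simp: in_hom Act_Add Act_Smul Comp_Add Comp_Smul)
      then have "f \<oplus>\<^bsub>C\<^esub> (- 1) \<odot>\<^bsub>C\<^esub> g = Zero C Y X"
        using inj[of "f \<oplus>\<^bsub>C\<^esub> (- 1) \<odot>\<^bsub>C\<^esub> g"] fg by (auto simp: in_hom X_def)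
      then show "f = g"
        using fg by (rule_tac C.eq_if_diff_Zero) (auto simp: in_hom)
    qed
    show "(\<lambda>f. u \<bullet> (f \<triangleright> Id M N)) ` hom C Y X = hom M (Y \<rhd> N) L"
      using surj[OF Y] u N by (fastforce simp: in_hom)
  qed
  then show ?thesis
    using X u by (auto simp: in_hom)
qed

lemma ex_internal_hom: "\<exists>H. internal_hom C M A H"
proof -
  obtain X u where X: "\<And>N L. N \<in> Obj M \<Longrightarrow> L \<in> Obj M \<Longrightarrow> X N L \<in> Obj C \<and> u N L \<in> hom M (X N L \<rhd> N) L \<and>
    (\<forall>Y \<in> Obj C. bij_betw (\<lambda>f. u N L \<bullet> (f \<triangleright> Id M N)) (hom C Y (X N L)) (hom M (Y \<rhd> N) L))"
    using representing_object by metis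
  have "internal_hom C M A \<lparr> IHom = X, Phi = \<lambda>N L Y f. u N L \<bullet> (f \<triangleright> Id M N) \<rparr>"
    using X by (auto simp: internal_hom_def in_hom Act_Comp)
  then show ?thesis by blast
qed

end

section \<open>Coherence for module categories\<close>

text \<open>For lists \<open>Xs = [X\<^sub>1, \<dots>, X\<^sub>m]\<close> and \<open>Ys = [Y\<^sub>1, \<dots>, Y\<^sub>n]\<close> of objects, \<open>br Xs Ys f N\<close> transports
  \<open>f \<triangleright> N\<close> along the canonical isomorphisms to an arrow from \<open>X\<^sub>1 \<rhd> \<cdots> \<rhd> X\<^sub>m \<rhd> N\<close> to
  \<open>Y\<^sub>1 \<rhd> \<cdots> \<rhd> Y\<^sub>n \<rhd> N\<close>. All structural arrows are of this form, so that
  identities between them reduce to identities in the strict category \<open>C\<close>.\<close>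

context tensor_module
begin

primrec tens :: "'co list \<Rightarrow> 'co" where
  "tens [] = \<one>\<^bsub>C\<^esub>"
| "tens (X # Xs) = X \<otimes>\<^sub>C tens Xs"

primrec acts :: "'co list \<Rightarrow> 'mo \<Rightarrow> 'mo" where
  "acts [] N = N"
| "acts (X # Xs) N = X \<rhd> acts Xs N"

primrec acta :: "'co list \<Rightarrow> 'mm \<Rightarrow> 'mm" where
  "acta [] g = g"
| "acta (X # Xs) g = Id C X \<triangleright> acta Xs g"

text \<open>The canonical isomorphism from \<open>tens Xs \<rhd> N\<close> to
  \<open>acts Xs N\<close>. It ends in \<open>Lun\<close> because \<open>tens\<close> ends in the
  unit object; \<open>can_singleton\<close> shows that this extra unit does no harm.\<close>

primrec can :: "'co list \<Rightarrow> 'mo \<Rightarrow> 'mm" where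
  "can [] N = Lun A N"
| "can (X # Xs) N = (Id C X \<triangleright> can Xs N) \<bullet> Asc A X (tens Xs) N"

definition br :: "'co list \<Rightarrow> 'co list \<Rightarrow> 'cm \<Rightarrow> 'mo \<Rightarrow> 'mm" where
  "br Xs Ys f N = can Ys N \<bullet> (f \<triangleright> Id M N) \<bullet> inv_arr M (can Xs N)"

lemma Asc_arr [simp]:
  assumes "X \<in> Obj C" "Y \<in> Obj C" "N \<in> Obj M"
  shows "Asc A X Y N \<in> Arr M" "Dom M (Asc A X Y N) = (X \<otimes>\<^sub>C Y) \<rhd> N" "Cod M (Asc A X Y N) = X \<rhd> Y \<rhd> N"
    "is_iso M (Asc A X Y N)"
  using asc_iso[OF assms] by (auto simp: in_hom)

lemma Lun_arr [simp]:
  assumes "N \<in> Obj M"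
  shows "Lun A N \<in> Arr M" "Dom M (Lun A N) = \<one>\<^bsub>C\<^esub> \<rhd> N" "Cod M (Lun A N) = N" "is_iso M (Lun A N)"
  using lun_iso[OF assms] by (auto simp: in_hom)

lemma Asc_natural:
  assumes "f \<in> Arr C" "f' \<in> Arr C" "g \<in> Arr M" "Dom C f = X" "Cod C f = X'" "Dom C f' = Y" "Cod C f' = Y'"
    "Dom M g = N" "Cod M g = N'"
  shows "Asc A X' Y' N' \<bullet> ((f \<boxtimes>\<^sub>C f') \<triangleright> g) = (f \<triangleright> f' \<triangleright> g) \<bullet> Asc A X Y N"
  using assms by (intro asc_natural) (auto simp: in_hom)

lemma Lun_natural:
  assumes "g \<in> Arr M" "Dom M g = N" "Cod M g = N'"
  shows "Lun A N' \<bullet> (Id C \<one>\<^bsub>C\<^esub> \<triangleright> g) = g \<bullet> Lun A N"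
  using assms by (intro lun_natural) (auto simp: in_hom)

text \<open>\<open>Lun\<close> is a natural isomorphism from the action of the unit to the identity
  functor, so it can be cancelled.\<close>

lemma Act_unit_faithful:
  assumes "Id C \<one>\<^bsub>C\<^esub> \<triangleright> g = Id C \<one>\<^bsub>C\<^esub> \<triangleright> h" "g \<in> Arr M" "h \<in> Arr M" "Dom M g = Dom M h" "Cod M g = Cod M h"
  shows "g = h"
proof -
  have "g \<bullet> Lun A (Dom M h) = h \<bullet> Lun A (Dom M h)"
    using Lun_natural[of g "Dom M h" "Cod M h"] Lun_natural[of h "Dom M h" "Cod M h"] assms by simp
  then show ?thesis
    using assms(2-) by (rule_tac iso_cancel_right[of "Lun A (Dom M h)"]) auto
qed

text \<open>Kelly's argument: this unit law follows from the pentagon and the triangle.\<close>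

lemma Lun_Asc:
  assumes X: "X \<in> Obj C" and N: "N \<in> Obj M"
  shows "Lun A (X \<rhd> N) \<bullet> Asc A \<one>\<^bsub>C\<^esub> X N = Id M (X \<rhd> N)"
proof (rule Act_unit_faithful)
  \<comment> \<open>This is the pentagon at two unit objects: strictness of \<open>C\<close> gives
    both sides the same right-hand associator, which can then be cancelled.\<close>
  have "Asc A \<one>\<^bsub>C\<^esub> \<one>\<^bsub>C\<^esub> (X \<rhd> N) \<bullet> Asc A \<one>\<^bsub>C\<^esub> X N = (Id C \<one>\<^bsub>C\<^esub> \<triangleright> Asc A \<one>\<^bsub>C\<^esub> X N) \<bullet> Asc A \<one>\<^bsub>C\<^esub> X N"
    using pentagon[of "\<one>\<^bsub>C\<^esub>" "\<one>\<^bsub>C\<^esub>" X N] X N by simp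
  then have "Asc A \<one>\<^bsub>C\<^esub> \<one>\<^bsub>C\<^esub> (X \<rhd> N) = Id C \<one>\<^bsub>C\<^esub> \<triangleright> Asc A \<one>\<^bsub>C\<^esub> X N"
    using X N by (rule_tac iso_cancel_right[of "Asc A \<one>\<^bsub>C\<^esub> X N"]) auto
  then show "Id C \<one>\<^bsub>C\<^esub> \<triangleright> (Lun A (X \<rhd> N) \<bullet> Asc A \<one>\<^bsub>C\<^esub> X N) = Id C \<one>\<^bsub>C\<^esub> \<triangleright> Id M (X \<rhd> N)"
    using triangle[of "\<one>\<^bsub>C\<^esub>" "X \<rhd> N"] X N by (simp add: Act_Comp_Id)
qed (use X N in auto)

lemma tens_Obj [simp]: "set Xs \<subseteq> Obj C \<Longrightarrow> tens Xs \<in> Obj C"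
  by (induction Xs) auto

lemma tens_append: "set Xs \<subseteq> Obj C \<Longrightarrow> set Ys \<subseteq> Obj C \<Longrightarrow> tens (Xs @ Ys) = tens Xs \<otimes>\<^sub>C tens Ys"
  by (induction Xs) auto

lemma acts_Obj [simp]: "set Xs \<subseteq> Obj C \<Longrightarrow> N \<in> Obj M \<Longrightarrow> acts Xs N \<in> Obj M"
  by (induction Xs) auto

lemma acta_arr [simp]:
  assumes "set Xs \<subseteq> Obj C" "g \<in> Arr M"
  shows "acta Xs g \<in> Arr M" "Dom M (acta Xs g) = acts Xs (Dom M g)" "Cod M (acta Xs g) = acts Xs (Cod M g)"
  using assms(1) by (induction Xs) (use assms(2) in auto)

lemma can_arr [simp]:
  assumes "set Xs \<subseteq> Obj C" "N \<in> Obj M"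
  shows "can Xs N \<in> Arr M" "Dom M (can Xs N) = tens Xs \<rhd> N" "Cod M (can Xs N) = acts Xs N" "is_iso M (can Xs N)"
  using assms(1) by (induction Xs) (use assms(2) in \<open>auto intro!: iso_Comp Act_iso\<close>)

lemma can_natural:
  assumes "set Xs \<subseteq> Obj C" "g \<in> Arr M" "Dom M g = N" "Cod M g = L"
  shows "can Xs L \<bullet> (Id C (tens Xs) \<triangleright> g) = acta Xs g \<bullet> can Xs N"
  using assms(1)
proof (induction Xs)
  case Nil
  then show ?case using Lun_natural assms by simp
next
  case (Cons X Xs)
  have N: "N \<in> Obj M" "L \<in> Obj M" using assms by auto
  have "can (X # Xs) L \<bullet> (Id C (tens (X # Xs)) \<triangleright> g) =
      (Id C X \<triangleright> can Xs L) \<bullet> (Asc A X (tens Xs) L \<bullet> ((Id C X \<boxtimes>\<^sub>C Id C (tens Xs)) \<triangleright> g))"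
    using Cons.prems assms N by simp
  also have "Asc A X (tens Xs) L \<bullet> ((Id C X \<boxtimes>\<^sub>C Id C (tens Xs)) \<triangleright> g) =
      (Id C X \<triangleright> Id C (tens Xs) \<triangleright> g) \<bullet> Asc A X (tens Xs) N"
    using Cons.prems assms N by (intro Asc_natural) auto
  also have "(Id C X \<triangleright> can Xs L) \<bullet> ((Id C X \<triangleright> Id C (tens Xs) \<triangleright> g) \<bullet> Asc A X (tens Xs) N) =
      (Id C X \<triangleright> (can Xs L \<bullet> (Id C (tens Xs) \<triangleright> g))) \<bullet> Asc A X (tens Xs) N"
    using Cons.prems assms N by (simp add: Act_Comp_Id)
  also have "\<dots> = acta (X # Xs) g \<bullet> can (X # Xs) N"
    using Cons assms N by (simp add: Act_Comp_Id)
  finally show ?case .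
qed

text \<open>The induction step is the pentagon and the start is \<open>Lun_Asc\<close>. This is the
  coherence statement proper; it enters the later computations through
  \<open>br_acts\<close>.\<close>

lemma can_append:
  assumes "set Xs \<subseteq> Obj C" "set Ys \<subseteq> Obj C" "N \<in> Obj M"
  shows "can (Xs @ Ys) N = can Xs (acts Ys N) \<bullet> (Id C (tens Xs) \<triangleright> can Ys N) \<bullet> Asc A (tens Xs) (tens Ys) N"
  using assms(1)
proof (induction Xs)
  case Nil
  have "Lun A (acts Ys N) \<bullet> ((Id C \<one>\<^bsub>C\<^esub> \<triangleright> can Ys N) \<bullet> Asc A \<one>\<^bsub>C\<^esub> (tens Ys) N) =
      can Ys N \<bullet> (Lun A (tens Ys \<rhd> N) \<bullet> Asc A \<one>\<^bsub>C\<^esub> (tens Ys) N)"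
    using assms by (intro Comp_extend2 Lun_natural) auto
  then show ?case
    using assms by (simp add: Lun_Asc)
next
  case (Cons X Xs)
  define Y where "Y = tens Xs"
  define Z where "Z = tens Ys"
  have X: "X \<in> Obj C" "Y \<in> Obj C" "Z \<in> Obj C" "set Xs \<subseteq> Obj C" using Cons assms by (auto simp: Y_def Z_def)
  have d: "Dom M (can Ys N) = Z \<rhd> N" "Dom M (can Xs (acts Ys N)) = Y \<rhd> acts Ys N"
    using X assms by (auto simp: Y_def Z_def)
  have IH: "can (Xs @ Ys) N = can Xs (acts Ys N) \<bullet> (Id C Y \<triangleright> can Ys N) \<bullet> Asc A Y Z N"
    using Cons by (simp add: Y_def Z_def)
  have "can ((X # Xs) @ Ys) N = (Id C X \<triangleright> can (Xs @ Ys) N) \<bullet> Asc A X (Y \<otimes>\<^sub>C Z) N"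
    using assms X by (simp add: tens_append Y_def Z_def)
  also have "\<dots> = (Id C X \<triangleright> can Xs (acts Ys N)) \<bullet> (Id C X \<triangleright> Id C Y \<triangleright> can Ys N) \<bullet>
      ((Id C X \<triangleright> Asc A Y Z N) \<bullet> Asc A X (Y \<otimes>\<^sub>C Z) N)"
    unfolding IH using assms X d by (simp add: Act_Comp_Id)
  also have "(Id C X \<triangleright> Asc A Y Z N) \<bullet> Asc A X (Y \<otimes>\<^sub>C Z) N = Asc A X Y (Z \<rhd> N) \<bullet> Asc A (X \<otimes>\<^sub>C Y) Z N"
    using X assms by (simp add: pentagon)
  also have "(Id C X \<triangleright> Id C Y \<triangleright> can Ys N) \<bullet> (Asc A X Y (Z \<rhd> N) \<bullet> Asc A (X \<otimes>\<^sub>C Y) Z N) =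
      Asc A X Y (acts Ys N) \<bullet> (((Id C X \<boxtimes>\<^sub>C Id C Y) \<triangleright> can Ys N) \<bullet> Asc A (X \<otimes>\<^sub>C Y) Z N)"
    using X assms d by (intro Comp_extend2 Asc_natural[symmetric]) auto
  finally show ?case
    using X assms d by (simp add: Y_def Z_def)
qed

text \<open>This is the triangle axiom. It makes one-element lists transparent, so that an ordinary
  \<open>f \<triangleright> Id M N\<close> is itself a \<open>br\<close>.\<close>

lemma can_singleton [simp]: "X \<in> Obj C \<Longrightarrow> N \<in> Obj M \<Longrightarrow> can [X] N = Id M (X \<rhd> N)"
  using triangle by simp

lemma br_arr [simp]:
  assumes "set Xs \<subseteq> Obj C" "set Ys \<subseteq> Obj C" "N \<in> Obj M" "f \<in> Arr C" "Dom C f = tens Xs" "Cod C f = tens Ys"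
  shows "br Xs Ys f N \<in> Arr M" "Dom M (br Xs Ys f N) = acts Xs N" "Cod M (br Xs Ys f N) = acts Ys N"
  using assms by (simp_all add: br_def)

text \<open>The inner \<open>can\<close> cancels against its inverse. Together with
  \<open>Act_br\<close> and \<open>br_acts\<close>, which add factors on the left and on the right,
  this collapses a composite of structural arrows to a single \<open>br\<close>.\<close>

lemma br_Comp:
  assumes "set Xs \<subseteq> Obj C" "set Ys \<subseteq> Obj C" "set Zs \<subseteq> Obj C" "N \<in> Obj M"
    "f \<in> Arr C" "Dom C f = tens Xs" "Cod C f = tens Ys" "g \<in> Arr C" "Dom C g = tens Ys" "Cod C g = tens Zs"
  shows "br Ys Zs g N \<bullet> br Xs Ys f N = br Xs Zs (g \<cdot>\<^sub>C f) N"
  using assms by (simp add: br_def Act_Comp_Id)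

lemma br_Id [simp]: "set Xs \<subseteq> Obj C \<Longrightarrow> N \<in> Obj M \<Longrightarrow> br Xs Xs (Id C (tens Xs)) N = Id M (acts Xs N)"
  by (simp add: br_def)

lemma br_iso:
  assumes "set Xs \<subseteq> Obj C" "set Ys \<subseteq> Obj C" "N \<in> Obj M" "Dom C f = tens Xs" "Cod C f = tens Ys" "is_iso C f"
  shows "is_iso M (br Xs Ys f N)" "inv_arr M (br Xs Ys f N) = br Ys Xs (inv_arr C f) N"
  using isoI[of "br Xs Ys f N" "br Ys Xs (inv_arr C f) N"] assms C.iso_arr[of f]
  by (auto simp: br_Comp)

lemma br_natural:
  assumes "set Xs \<subseteq> Obj C" "set Ys \<subseteq> Obj C" "f \<in> Arr C" "Dom C f = tens Xs" "Cod C f = tens Ys"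
    "g \<in> Arr M" "Dom M g = N" "Cod M g = L"
  shows "acta Ys g \<bullet> br Xs Ys f N = br Xs Ys f L \<bullet> acta Xs g"
proof -
  have N: "N \<in> Obj M" "L \<in> Obj M" using assms by auto
  have i: "(Id C (tens Xs) \<triangleright> g) \<bullet> inv_arr M (can Xs N) = inv_arr M (can Xs L) \<bullet> acta Xs g"
    using assms N by (intro conj_inv[symmetric] can_natural) auto
  have "acta Ys g \<bullet> br Xs Ys f N = can Ys L \<bullet> ((Id C (tens Ys) \<triangleright> g) \<bullet> ((f \<triangleright> Id M N) \<bullet> inv_arr M (can Xs N)))"
    unfolding br_def using assms N by (intro Comp_extend2[symmetric] can_natural) auto
  also have "(Id C (tens Ys) \<triangleright> g) \<bullet> ((f \<triangleright> Id M N) \<bullet> inv_arr M (can Xs N)) =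
      (f \<triangleright> Id M L) \<bullet> ((Id C (tens Xs) \<triangleright> g) \<bullet> inv_arr M (can Xs N))"
    using assms N by (intro Comp_extend2 Act_swap) auto
  finally show ?thesis
    using assms N by (simp add: br_def i)
qed

lemma Act_br:
  assumes "X \<in> Obj C" "set Xs \<subseteq> Obj C" "set Ys \<subseteq> Obj C" "N \<in> Obj M" "f \<in> Arr C" "Dom C f = tens Xs" "Cod C f = tens Ys"
  shows "Id C X \<triangleright> br Xs Ys f N = br (X # Xs) (X # Ys) (Id C X \<boxtimes>\<^sub>C f) N"
proof -
  define j where "j = inv_arr M (can (X # Xs) N)"
  have inv: "j = inv_arr M (Asc A X (tens Xs) N) \<bullet> (Id C X \<triangleright> inv_arr M (can Xs N))"
    using assms by (simp add: j_def iso_Comp Act_iso)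
  then have j: "j \<in> Arr M" "Cod M j = (X \<otimes>\<^sub>C tens Xs) \<rhd> N"
    using assms by auto
  have "br (X # Xs) (X # Ys) (Id C X \<boxtimes>\<^sub>C f) N = (Id C X \<triangleright> can Ys N) \<bullet>
     (Asc A X (tens Ys) N \<bullet> (((Id C X \<boxtimes>\<^sub>C f) \<triangleright> Id M N) \<bullet> j))"
    unfolding br_def j_def[symmetric] using assms j by simp
  also have "Asc A X (tens Ys) N \<bullet> (((Id C X \<boxtimes>\<^sub>C f) \<triangleright> Id M N) \<bullet> j) =
     (Id C X \<triangleright> f \<triangleright> Id M N) \<bullet> (Asc A X (tens Xs) N \<bullet> j)"
    using assms j by (intro Comp_extend2 Asc_natural) auto
  finally show ?thesis
    using assms by (simp add: inv br_def Act_Comp_Id)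
qed

text \<open>By \<open>can_append\<close>, \<open>can\<close> of a concatenation is
  \<open>can\<close> of the first list composed with \<open>k\<close>. The arrow \<open>k\<close> is
  natural in the first factor because the associator is, so it cancels from both sides of
  \<open>f\<close>.\<close>

lemma br_acts:
  assumes "set Xs \<subseteq> Obj C" "set Ys \<subseteq> Obj C" "set Zs \<subseteq> Obj C" "N \<in> Obj M"
    "f \<in> Arr C" "Dom C f = tens Xs" "Cod C f = tens Ys"
  shows "br Xs Ys f (acts Zs N) = br (Xs @ Zs) (Ys @ Zs) (f \<boxtimes>\<^sub>C Id C (tens Zs)) N"
proof -
  define Z where "Z = tens Zs"
  define c where "c = can Zs N"
  have c: "is_iso M c" "c \<in> Arr M" "Dom M c = Z \<rhd> N" "Cod M c = acts Zs N" and Z: "Z \<in> Obj C"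
    using assms by (auto simp: c_def Z_def)
  define k where "k Xs = (Id C (tens Xs) \<triangleright> c) \<bullet> Asc A (tens Xs) Z N" for Xs
  have k: "k Xs \<in> Arr M" "Dom M (k Xs) = (tens Xs \<otimes>\<^sub>C Z) \<rhd> N" "Cod M (k Xs) = tens Xs \<rhd> acts Zs N" "is_iso M (k Xs)"
    if "set Xs \<subseteq> Obj C" for Xs
    using that assms c Z by (auto simp: k_def intro!: iso_Comp Act_iso)
  have can: "can (Xs @ Zs) N = can Xs (acts Zs N) \<bullet> k Xs" if "set Xs \<subseteq> Obj C" for Xs
    using that assms by (simp add: can_append k_def c_def Z_def)
  have nat: "k Ys \<bullet> ((f \<boxtimes>\<^sub>C Id C Z) \<triangleright> Id M N) = (f \<triangleright> Id M (acts Zs N)) \<bullet> k Xs"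
  proof -
    have "k Ys \<bullet> ((f \<boxtimes>\<^sub>C Id C Z) \<triangleright> Id M N) =
        (Id C (tens Ys) \<triangleright> c) \<bullet> (Asc A (tens Ys) Z N \<bullet> ((f \<boxtimes>\<^sub>C Id C Z) \<triangleright> Id M N))"
      using assms c Z by (simp add: k_def)
    also have "Asc A (tens Ys) Z N \<bullet> ((f \<boxtimes>\<^sub>C Id C Z) \<triangleright> Id M N) =
        (f \<triangleright> Id C Z \<triangleright> Id M N) \<bullet> Asc A (tens Xs) Z N"
      using assms Z by (intro Asc_natural) auto
    also have "(Id C (tens Ys) \<triangleright> c) \<bullet> ((f \<triangleright> Id C Z \<triangleright> Id M N) \<bullet> Asc A (tens Xs) Z N) =
        (f \<triangleright> Id M (acts Zs N)) \<bullet> ((Id C (tens Xs) \<triangleright> c) \<bullet> Asc A (tens Xs) Z N)"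
      using assms c Z by (intro Comp_extend2) (auto simp: Act_Comp)
    finally show ?thesis by (simp add: k_def)
  qed
  have nat': "k Ys \<bullet> (((f \<boxtimes>\<^sub>C Id C Z) \<triangleright> Id M N) \<bullet> x) = (f \<triangleright> Id M (acts Zs N)) \<bullet> (k Xs \<bullet> x)"
    if "x \<in> Arr M" "Cod M x = (tens Xs \<otimes>\<^sub>C Z) \<rhd> N" for x
    using that assms Z k by (intro Comp_extend2[OF nat]) auto
  have "br (Xs @ Zs) (Ys @ Zs) (f \<boxtimes>\<^sub>C Id C Z) N = (can Ys (acts Zs N) \<bullet> k Ys) \<bullet>
     (((f \<boxtimes>\<^sub>C Id C Z) \<triangleright> Id M N) \<bullet> (inv_arr M (k Xs) \<bullet> inv_arr M (can Xs (acts Zs N))))"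
    using assms k[OF assms(1)] by (simp add: br_def can iso_Comp)
  also have "\<dots> = br Xs Ys f (acts Zs N)"
    using assms Z k[OF assms(1)] k[OF assms(2)] by (simp add: br_def nat')
  finally show ?thesis by (simp add: Z_def)
qed

lemma Act_eq_br:
  "f \<in> Arr C \<Longrightarrow> Dom C f = X \<Longrightarrow> Cod C f = Y \<Longrightarrow> N \<in> Obj M \<Longrightarrow> f \<triangleright> Id M N = br [X] [Y] f N"
  using C.Dom_Cod_Obj[of f] by (simp add: br_def del: can.simps)

lemma can_pair: "X \<in> Obj C \<Longrightarrow> Y \<in> Obj C \<Longrightarrow> N \<in> Obj M \<Longrightarrow> can [X, Y] N = Asc A X Y N"
  using can.simps(2)[of X "[Y]" N] by (simp del: can.simps)

end

section \<open>Central tensor categories\<close>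

lemma center_hom:
  assumes "\<phi> \<in> hom (center C) P Q"
  shows "und \<phi> \<in> hom C (fst P) (fst Q)" "half_braiding C (fst P) (snd P)" "half_braiding C (fst Q) (snd Q)"
    "X \<in> Obj C \<Longrightarrow> (Id C X \<boxtimes>\<^bsub>C\<^esub> und \<phi>) \<cdot>\<^bsub>C\<^esub> snd P X = snd Q X \<cdot>\<^bsub>C\<^esub> (und \<phi> \<boxtimes>\<^bsub>C\<^esub> Id C X)"
    "fst \<phi> = P" "snd (snd \<phi>) = Q"
  using assms by (auto simp: hom_def center_def und_def)

text \<open>Forgetting half-braidings is functorial, so an inverse in the center gives an inverse in
  \<open>C\<close>.\<close>

lemma center_iso:
  assumes "\<phi> \<in> hom (center C) P Q" "is_iso (center C) \<phi>"
  shows "is_iso C (und \<phi>)"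
proof -
  obtain \<psi> where \<psi>: "inverse_arrows (center C) \<phi> \<psi>"
    using assms(2) by (auto simp: is_iso_def)
  have "\<psi> \<in> hom (center C) Q P"
    using \<psi> assms(1) by (simp add: inverse_arrows_def in_hom)
  note f = center_hom(1)[OF assms(1)] and g = center_hom(1)[OF this]
  have "\<psi> \<cdot>\<^bsub>center C\<^esub> \<phi> = Id (center C) P" "\<phi> \<cdot>\<^bsub>center C\<^esub> \<psi> = Id (center C) Q"
    using \<psi> assms(1) by (auto simp: inverse_arrows_def in_hom)
  then have "und \<psi> \<cdot>\<^bsub>C\<^esub> und \<phi> = Id C (fst P)" "und \<phi> \<cdot>\<^bsub>C\<^esub> und \<psi> = Id C (fst Q)"
    by (auto simp: center_def und_def)
  then have "inverse_arrows C (und \<phi>) (und \<psi>)"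
    using f g by (simp add: inverse_arrows_def in_hom)
  then show ?thesis by (auto simp: is_iso_def)
qed

lemma center_simps:
  "Obj (center C) = {P. half_braiding C (fst P) (snd P)}"
  "und (Id (center C) P) = Id C (fst P)"
  "und (g \<cdot>\<^bsub>center C\<^esub> f) = und g \<cdot>\<^bsub>C\<^esub> und f"
  "und (f \<boxtimes>\<^bsub>center C\<^esub> g) = und f \<boxtimes>\<^bsub>C\<^esub> und g"
  "fst (\<one>\<^bsub>center C\<^esub>) = \<one>\<^bsub>C\<^esub>" "X \<in> Obj C \<Longrightarrow> snd (\<one>\<^bsub>center C\<^esub>) X = Id C X"
  "fst (P \<otimes>\<^bsub>center C\<^esub> Q) = fst P \<otimes>\<^bsub>C\<^esub> fst Q"
  "X \<in> Obj C \<Longrightarrow> snd (P \<otimes>\<^bsub>center C\<^esub> Q) X = (snd P X \<boxtimes>\<^bsub>C\<^esub> Id C (fst Q)) \<cdot>\<^bsub>C\<^esub> (Id C (fst P) \<boxtimes>\<^bsub>C\<^esub> snd Q X)"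
  by (auto simp: center_def und_def center_ten_def)

context strict_monoidal_category
begin

lemma left_dualityD:
  assumes "left_duality C D" "X \<in> Obj C"
  shows "DualO D X \<in> Obj C"
    "Ev D X \<in> Arr C" "Dom C (Ev D X) = DualO D X \<otimes> X" "Cod C (Ev D X) = \<one>"
    "Coev D X \<in> Arr C" "Dom C (Coev D X) = \<one>" "Cod C (Coev D X) = X \<otimes> DualO D X"
    "(Id C X \<boxtimes> Ev D X) \<cdot> (Coev D X \<boxtimes> Id C X) = Id C X"
    "(Ev D X \<boxtimes> Id C (DualO D X)) \<cdot> (Id C (DualO D X) \<boxtimes> Coev D X) = Id C (DualO D X)"
  using assms by (auto simp: left_duality_def is_left_dual_def in_hom)

lemma DualA_arr:
  assumes "left_duality C D" "f \<in> Arr C"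
  shows "DualA C D f \<in> Arr C" "Dom C (DualA C D f) = DualO D (Cod C f)" "Cod C (DualA C D f) = DualO D (Dom C f)"
  using left_dualityD[OF assms(1), of "Dom C f"] left_dualityD[OF assms(1), of "Cod C f"] assms(2)
  by (auto simp: DualA_def Let_def)

text \<open>After the dual of \<open>f\<close> is expanded, interchange moves \<open>Ev D X\<close>
  past \<open>Ev D Y\<close> and past \<open>f\<close>, until it meets \<open>Coev D X\<close> and
  both disappear by the zigzag identity.\<close>

lemma Ev_dinatural:
  assumes D: "left_duality C D" and f: "f \<in> Arr C" "Dom C f = X" "Cod C f = Y"
  shows "Ev D X \<cdot> (DualA C D f \<boxtimes> Id C X) = Ev D Y \<cdot> (Id C (DualO D Y) \<boxtimes> f)"
proof -
  have XY: "X \<in> Obj C" "Y \<in> Obj C" using f by auto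
  let ?X' = "DualO D X" and ?Y' = "DualO D Y"
  note x = left_dualityD[OF D XY(1)] and y = left_dualityD[OF D XY(2)]
  have fE: "f \<cdot> (Id C X \<boxtimes> Ev D X) = f \<boxtimes> Ev D X"
    using Ten_split(1)[of f "Ev D X"] f x(1-7) by simp
  have "DualA C D f \<boxtimes> Id C X = (Ev D Y \<boxtimes> Id C (?X' \<otimes> X)) \<cdot> (Id C ?Y' \<boxtimes> f \<boxtimes> Id C (?X' \<otimes> X)) \<cdot>
      (Id C ?Y' \<boxtimes> Coev D X \<boxtimes> Id C X)"
    unfolding DualA_def Let_def using f XY x(1-7) y(1-7) by (simp add: Ten_Comp_Id flip: Ten_Id)
  then have "Ev D X \<cdot> (DualA C D f \<boxtimes> Id C X) =
      Ev D X \<cdot> ((Ev D Y \<boxtimes> Id C (?X' \<otimes> X)) \<cdot> ((Id C ?Y' \<boxtimes> f \<boxtimes> Id C (?X' \<otimes> X)) \<cdot> (Id C ?Y' \<boxtimes> Coev D X \<boxtimes> Id C X)))"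
    by simp
  also have "\<dots> = Ev D Y \<cdot> ((Id C (?Y' \<otimes> Y) \<boxtimes> Ev D X) \<cdot> ((Id C ?Y' \<boxtimes> f \<boxtimes> Id C (?X' \<otimes> X)) \<cdot> (Id C ?Y' \<boxtimes> Coev D X \<boxtimes> Id C X)))"
    using Ten_split[of "Ev D Y" "Ev D X"] f XY x(1-7) y(1-7) by (intro Comp_extend2) auto
  also have "(Id C (?Y' \<otimes> Y) \<boxtimes> Ev D X) \<cdot> ((Id C ?Y' \<boxtimes> f \<boxtimes> Id C (?X' \<otimes> X)) \<cdot> (Id C ?Y' \<boxtimes> Coev D X \<boxtimes> Id C X)) =
      (Id C ?Y' \<boxtimes> f \<boxtimes> Id C \<one>) \<cdot> ((Id C (?Y' \<otimes> X) \<boxtimes> Ev D X) \<cdot> (Id C ?Y' \<boxtimes> Coev D X \<boxtimes> Id C X))"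
    using f XY x(1-7) y(1-7) fE by (intro Comp_extend2) (auto simp: Ten_Comp Id_Ten)
  also have "(Id C (?Y' \<otimes> X) \<boxtimes> Ev D X) \<cdot> (Id C ?Y' \<boxtimes> Coev D X \<boxtimes> Id C X) =
      Id C ?Y' \<boxtimes> ((Id C X \<boxtimes> Ev D X) \<cdot> (Coev D X \<boxtimes> Id C X))"
    using f XY x(1-7) y(1-7) by (simp add: Ten_Comp Id_Ten)
  finally show ?thesis
    using f XY x y by simp
qed

end

section \<open>Half-braidings, tensor structure and duals carried over by \<open>G\<close>\<close>

locale central_module = tensor_module C M A + V: braided_tensor_category V c
  for V :: "('vo, 'vm, 'k::alg_closed_field) moncat"
    and c :: "'vo \<Rightarrow> 'vo \<Rightarrow> 'vm"
    and C :: "('co, 'cm, 'k) moncat"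
    and M :: "('mo, 'mm, 'k) lincat"
    and A :: "('co, 'cm, 'mo, 'mm) action" (structure) +
  fixes D :: "('vo, 'vm) duality"
    and G :: "('vo, 'vm, ('co, 'cm) center_obj, ('co, 'cm) center_arr) monfunctr"
  assumes duality: "left_duality V D"
    and central: "central_via V c C G"
begin

abbreviation gO where "gO v \<equiv> GO G v"
abbreviation gA where "gA k \<equiv> und (amap G k)"
abbreviation mu where "mu v w \<equiv> und (Mu G v w)"
abbreviation eta where "eta \<equiv> und (Eta G)"
abbreviation s where "s v X \<equiv> hb G v X"
abbreviation si where "si v X \<equiv> inv_arr C (hb G v X)"
abbreviation gev where "gev v \<equiv> GEv C D G v"
abbreviation dual ("_\<^sup>\<star>" [1000] 999) where "v\<^sup>\<star> \<equiv> DualO D v"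

lemma monoidal: "monoidal_functor V (center C) G"
  using central by (simp add: central_via_def braided_functor_def)

lemma G_functor: "is_functor V (center C) G"
  using monoidal by (simp add: monoidal_functor_def linear_functor_def)

lemma G_half_braiding: "v \<in> Obj V \<Longrightarrow> half_braiding C (gO v) (s v)"
  using G_functor by (simp add: is_functor_def center_simps)

lemma gO_Obj [simp]: "v \<in> Obj V \<Longrightarrow> gO v \<in> Obj C"
  using G_half_braiding by (simp add: half_braiding_def)

lemma s_arr [simp]:
  assumes "v \<in> Obj V" "X \<in> Obj C"
  shows "s v X \<in> Arr C" "Dom C (s v X) = gO v \<otimes>\<^sub>C X" "Cod C (s v X) = X \<otimes>\<^sub>C gO v" "is_iso C (s v X)"
  using G_half_braiding[OF assms(1)] assms(2) by (auto simp: half_braiding_def in_hom)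

lemma s_natural:
  assumes "v \<in> Obj V" "f \<in> Arr C" "Dom C f = X" "Cod C f = Y"
  shows "s v Y \<cdot>\<^sub>C (Id C (gO v) \<boxtimes>\<^sub>C f) = (f \<boxtimes>\<^sub>C Id C (gO v)) \<cdot>\<^sub>C s v X"
  using G_half_braiding[OF assms(1)] assms(2-) unfolding half_braiding_def in_hom[symmetric] by (auto simp: in_hom)

lemma si_natural:
  assumes "v \<in> Obj V" "f \<in> Arr C" "Dom C f = X" "Cod C f = Y"
  shows "si v Y \<cdot>\<^sub>C (f \<boxtimes>\<^sub>C Id C (gO v)) = (Id C (gO v) \<boxtimes>\<^sub>C f) \<cdot>\<^sub>C si v X"
  using assms by (intro C.conj_inv s_natural) auto

lemma amap_G: "k \<in> Arr V \<Longrightarrow> amap G k \<in> hom (center C) (omap G (Dom V k)) (omap G (Cod V k))"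
  using G_functor by (auto simp: is_functor_def in_hom)

lemma gA_arr [simp]:
  assumes "k \<in> Arr V"
  shows "gA k \<in> Arr C" "Dom C (gA k) = gO (Dom V k)" "Cod C (gA k) = gO (Cod V k)"
  using center_hom(1)[OF amap_G[OF assms]] by (auto simp: in_hom)

lemma gA_s:
  assumes "k \<in> Arr V" "Dom V k = v" "Cod V k = w" "X \<in> Obj C"
  shows "s w X \<cdot>\<^sub>C (gA k \<boxtimes>\<^sub>C Id C X) = (Id C X \<boxtimes>\<^sub>C gA k) \<cdot>\<^sub>C s v X"
  using center_hom(4)[OF amap_G[OF assms(1)] assms(4)] assms by simp

lemma gA_si:
  assumes "k \<in> Arr V" "Dom V k = v" "Cod V k = w" "X \<in> Obj C"
  shows "si w X \<cdot>\<^sub>C (Id C X \<boxtimes>\<^sub>C gA k) = (gA k \<boxtimes>\<^sub>C Id C X) \<cdot>\<^sub>C si v X"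
  using assms by (intro C.conj_inv gA_s) auto

lemma gA_Id [simp]: "v \<in> Obj V \<Longrightarrow> gA (Id V v) = Id C (gO v)"
  using G_functor by (simp add: is_functor_def center_simps)

lemma gA_Comp:
  assumes "k \<in> Arr V" "l \<in> Arr V" "Dom V k = Cod V l"
  shows "gA (k \<cdot>\<^bsub>V\<^esub> l) = gA k \<cdot>\<^sub>C gA l"
proof -
  have "k \<in> hom V (Cod V l) (Cod V k)" "l \<in> hom V (Dom V l) (Cod V l)"
    using assms by (auto simp: in_hom)
  then have "amap G (k \<cdot>\<^bsub>V\<^esub> l) = amap G k \<cdot>\<^bsub>center C\<^esub> amap G l"
    using G_functor unfolding is_functor_def by blast
  then show ?thesis by (simp add: center_simps)
qed

lemma Mu_hom:
  assumes "v \<in> Obj V" "w \<in> Obj V"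
  shows "Mu G v w \<in> hom (center C) (omap G v \<otimes>\<^bsub>center C\<^esub> omap G w) (omap G (v \<otimes>\<^bsub>V\<^esub> w))"
    "is_iso (center C) (Mu G v w)"
  using monoidal assms by (auto simp: monoidal_functor_def)

lemma mu_arr [simp]:
  assumes "v \<in> Obj V" "w \<in> Obj V"
  shows "mu v w \<in> Arr C" "Dom C (mu v w) = gO v \<otimes>\<^sub>C gO w" "Cod C (mu v w) = gO (v \<otimes>\<^bsub>V\<^esub> w)" "is_iso C (mu v w)"
  using center_hom(1)[OF Mu_hom(1)[OF assms]] center_iso[OF Mu_hom[OF assms]]
  by (auto simp: in_hom center_simps)

lemma mu_s:
  assumes "v \<in> Obj V" "w \<in> Obj V" "X \<in> Obj C"
  shows "s (v \<otimes>\<^bsub>V\<^esub> w) X \<cdot>\<^sub>C (mu v w \<boxtimes>\<^sub>C Id C X) =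
    (Id C X \<boxtimes>\<^sub>C mu v w) \<cdot>\<^sub>C ((s v X \<boxtimes>\<^sub>C Id C (gO w)) \<cdot>\<^sub>C (Id C (gO v) \<boxtimes>\<^sub>C s w X))"
  using center_hom(4)[OF Mu_hom(1)[OF assms(1,2)] assms(3)] assms by (simp add: center_simps)

lemma mu_natural:
  assumes "k \<in> Arr V" "l \<in> Arr V" "Dom V k = v" "Cod V k = v'" "Dom V l = w" "Cod V l = w'"
  shows "mu v' w' \<cdot>\<^sub>C (gA k \<boxtimes>\<^sub>C gA l) = gA (k \<boxtimes>\<^bsub>V\<^esub> l) \<cdot>\<^sub>C mu v w"
proof -
  have "k \<in> hom V v v'" "l \<in> hom V w w'"
    using assms by (auto simp: in_hom)
  then have "Mu G v' w' \<cdot>\<^bsub>center C\<^esub> (amap G k \<boxtimes>\<^bsub>center C\<^esub> amap G l) = amap G (k \<boxtimes>\<^bsub>V\<^esub> l) \<cdot>\<^bsub>center C\<^esub> Mu G v w"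
    using monoidal unfolding monoidal_functor_def by blast
  from arg_cong[OF this, of und] show ?thesis by (simp add: center_simps)
qed

lemma mu_assoc:
  assumes "u \<in> Obj V" "v \<in> Obj V" "w \<in> Obj V"
  shows "mu (u \<otimes>\<^bsub>V\<^esub> v) w \<cdot>\<^sub>C (mu u v \<boxtimes>\<^sub>C Id C (gO w)) = mu u (v \<otimes>\<^bsub>V\<^esub> w) \<cdot>\<^sub>C (Id C (gO u) \<boxtimes>\<^sub>C mu v w)"
proof -
  have "Mu G (u \<otimes>\<^bsub>V\<^esub> v) w \<cdot>\<^bsub>center C\<^esub> (Mu G u v \<boxtimes>\<^bsub>center C\<^esub> Id (center C) (omap G w)) =
      Mu G u (v \<otimes>\<^bsub>V\<^esub> w) \<cdot>\<^bsub>center C\<^esub> (Id (center C) (omap G u) \<boxtimes>\<^bsub>center C\<^esub> Mu G v w)"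
    using monoidal assms unfolding monoidal_functor_def by blast
  from arg_cong[OF this, of und] show ?thesis by (simp add: center_simps)
qed

lemma Eta_hom: "Eta G \<in> hom (center C) \<one>\<^bsub>center C\<^esub> (omap G \<one>\<^bsub>V\<^esub>)" "is_iso (center C) (Eta G)"
  using monoidal by (auto simp: monoidal_functor_def)

lemma eta_arr [simp]: "eta \<in> Arr C" "Dom C eta = \<one>\<^bsub>C\<^esub>" "Cod C eta = gO \<one>\<^bsub>V\<^esub>" "is_iso C eta"
  using center_hom(1)[OF Eta_hom(1)] center_iso[OF Eta_hom] by (auto simp: in_hom center_simps)

lemma eta_s: "X \<in> Obj C \<Longrightarrow> s \<one>\<^bsub>V\<^esub> X \<cdot>\<^sub>C (eta \<boxtimes>\<^sub>C Id C X) = Id C X \<boxtimes>\<^sub>C eta"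
  using center_hom(4)[OF Eta_hom(1), of X] by (simp add: center_simps)

lemma mu_unit:
  assumes "v \<in> Obj V"
  shows "mu \<one>\<^bsub>V\<^esub> v \<cdot>\<^sub>C (eta \<boxtimes>\<^sub>C Id C (gO v)) = Id C (gO v)" "mu v \<one>\<^bsub>V\<^esub> \<cdot>\<^sub>C (Id C (gO v) \<boxtimes>\<^sub>C eta) = Id C (gO v)"
proof -
  have "Mu G \<one>\<^bsub>V\<^esub> v \<cdot>\<^bsub>center C\<^esub> (Eta G \<boxtimes>\<^bsub>center C\<^esub> Id (center C) (omap G v)) = Id (center C) (omap G v)"
    "Mu G v \<one>\<^bsub>V\<^esub> \<cdot>\<^bsub>center C\<^esub> (Id (center C) (omap G v) \<boxtimes>\<^bsub>center C\<^esub> Eta G) = Id (center C) (omap G v)"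
    using monoidal assms unfolding monoidal_functor_def by blast+
  from arg_cong[OF this(1), of und] arg_cong[OF this(2), of und]
  show "mu \<one>\<^bsub>V\<^esub> v \<cdot>\<^sub>C (eta \<boxtimes>\<^sub>C Id C (gO v)) = Id C (gO v)" "mu v \<one>\<^bsub>V\<^esub> \<cdot>\<^sub>C (Id C (gO v) \<boxtimes>\<^sub>C eta) = Id C (gO v)"
    by (simp_all add: center_simps)
qed

lemmas dualD [simp] = V.left_dualityD(1-7)[OF duality]

lemma gev_eq: "gev v = inv_arr C eta \<cdot>\<^sub>C gA (Ev D v) \<cdot>\<^sub>C mu (v\<^sup>\<star>) v"
  by (simp add: GEv_def)

lemma gev_arr [simp]:
  assumes "v \<in> Obj V"
  shows "gev v \<in> Arr C" "Dom C (gev v) = gO (v\<^sup>\<star>) \<otimes>\<^sub>C gO v" "Cod C (gev v) = \<one>\<^bsub>C\<^esub>"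
  using assms by (auto simp: gev_eq)

lemma eta_si:
  assumes X: "X \<in> Obj C"
  shows "(inv_arr C eta \<boxtimes>\<^sub>C Id C X) \<cdot>\<^sub>C si \<one>\<^bsub>V\<^esub> X = Id C X \<boxtimes>\<^sub>C inv_arr C eta"
proof -
  have "inv_arr C (s \<one>\<^bsub>V\<^esub> X \<cdot>\<^sub>C (eta \<boxtimes>\<^sub>C Id C X)) = inv_arr C (Id C X \<boxtimes>\<^sub>C eta)"
    using eta_s[OF X] by simp
  then show ?thesis
    using X by (simp add: C.iso_Comp C.Ten_iso)
qed

text \<open>\<open>mu_s\<close> with all isomorphisms inverted, because the module structure of the
  action functor is built from inverse half-braidings.\<close>

lemma mu_si:
  assumes "v \<in> Obj V" "w \<in> Obj V" "X \<in> Obj C"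
  shows "(inv_arr C (mu v w) \<boxtimes>\<^sub>C Id C X) \<cdot>\<^sub>C si (v \<otimes>\<^bsub>V\<^esub> w) X =
    (Id C (gO v) \<boxtimes>\<^sub>C si w X) \<cdot>\<^sub>C (si v X \<boxtimes>\<^sub>C Id C (gO w)) \<cdot>\<^sub>C (Id C X \<boxtimes>\<^sub>C inv_arr C (mu v w))"
proof -
  have "inv_arr C (s (v \<otimes>\<^bsub>V\<^esub> w) X \<cdot>\<^sub>C (mu v w \<boxtimes>\<^sub>C Id C X)) =
    inv_arr C ((Id C X \<boxtimes>\<^sub>C mu v w) \<cdot>\<^sub>C ((s v X \<boxtimes>\<^sub>C Id C (gO w)) \<cdot>\<^sub>C (Id C (gO v) \<boxtimes>\<^sub>C s w X)))"
    using mu_s[OF assms] by simp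
  then show ?thesis
    using assms by (simp add: C.iso_Comp C.Ten_iso)
qed

text \<open>\<open>gev v\<close> is composed of \<open>mu\<close>, the image of
  \<open>Ev D v\<close> and the inverse of \<open>eta\<close>. All of these are morphisms of the
  center, so they pass the half-braidings one after another; at the unit the half-braiding is
  trivial.\<close>

lemma gev_s:
  assumes v: "v \<in> Obj V" and X: "X \<in> Obj C"
  shows "(Id C X \<boxtimes>\<^sub>C gev v) \<cdot>\<^sub>C (s (v\<^sup>\<star>) X \<boxtimes>\<^sub>C Id C (gO v)) \<cdot>\<^sub>C (Id C (gO (v\<^sup>\<star>)) \<boxtimes>\<^sub>C s v X) = gev v \<boxtimes>\<^sub>C Id C X"
proof -
  let ?w = "v\<^sup>\<star> \<otimes>\<^bsub>V\<^esub> v" and ?h = "(s (v\<^sup>\<star>) X \<boxtimes>\<^sub>C Id C (gO v)) \<cdot>\<^sub>C (Id C (gO (v\<^sup>\<star>)) \<boxtimes>\<^sub>C s v X)"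
  have "(Id C X \<boxtimes>\<^sub>C gev v) \<cdot>\<^sub>C ?h = (Id C X \<boxtimes>\<^sub>C inv_arr C eta) \<cdot>\<^sub>C ((Id C X \<boxtimes>\<^sub>C gA (Ev D v)) \<cdot>\<^sub>C ((Id C X \<boxtimes>\<^sub>C mu (v\<^sup>\<star>) v) \<cdot>\<^sub>C ?h))"
  proof -
    have "Id C X \<boxtimes>\<^sub>C gev v = (Id C X \<boxtimes>\<^sub>C inv_arr C eta) \<cdot>\<^sub>C (Id C X \<boxtimes>\<^sub>C gA (Ev D v)) \<cdot>\<^sub>C (Id C X \<boxtimes>\<^sub>C mu (v\<^sup>\<star>) v)"
      using v X by (simp add: gev_eq C.Ten_Comp)
    then show ?thesis using v X by simp
  qed
  also have "(Id C X \<boxtimes>\<^sub>C mu (v\<^sup>\<star>) v) \<cdot>\<^sub>C ?h = s ?w X \<cdot>\<^sub>C (mu (v\<^sup>\<star>) v \<boxtimes>\<^sub>C Id C X)"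
    using v X by (intro mu_s[symmetric]) auto
  also have "(Id C X \<boxtimes>\<^sub>C gA (Ev D v)) \<cdot>\<^sub>C (s ?w X \<cdot>\<^sub>C (mu (v\<^sup>\<star>) v \<boxtimes>\<^sub>C Id C X)) =
      s \<one>\<^bsub>V\<^esub> X \<cdot>\<^sub>C ((gA (Ev D v) \<boxtimes>\<^sub>C Id C X) \<cdot>\<^sub>C (mu (v\<^sup>\<star>) v \<boxtimes>\<^sub>C Id C X))"
    using v X by (intro C.Comp_extend2 gA_s[symmetric]) auto
  also have "(Id C X \<boxtimes>\<^sub>C inv_arr C eta) \<cdot>\<^sub>C (s \<one>\<^bsub>V\<^esub> X \<cdot>\<^sub>C ((gA (Ev D v) \<boxtimes>\<^sub>C Id C X) \<cdot>\<^sub>C (mu (v\<^sup>\<star>) v \<boxtimes>\<^sub>C Id C X))) =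
      (inv_arr C eta \<boxtimes>\<^sub>C Id C X) \<cdot>\<^sub>C ((gA (Ev D v) \<boxtimes>\<^sub>C Id C X) \<cdot>\<^sub>C (mu (v\<^sup>\<star>) v \<boxtimes>\<^sub>C Id C X))"
    using v X by (subst eta_si[symmetric]) auto
  also have "\<dots> = gev v \<boxtimes>\<^sub>C Id C X"
    using v X by (simp add: gev_eq C.Ten_Comp)
  finally show ?thesis .
qed

lemma gev_si:
  assumes v: "v \<in> Obj V" and X: "X \<in> Obj C"
  shows "(gev v \<boxtimes>\<^sub>C Id C X) \<cdot>\<^sub>C (Id C (gO (v\<^sup>\<star>)) \<boxtimes>\<^sub>C si v X) \<cdot>\<^sub>C (si (v\<^sup>\<star>) X \<boxtimes>\<^sub>C Id C (gO v)) = Id C X \<boxtimes>\<^sub>C gev v"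
proof -
  let ?a = "s (v\<^sup>\<star>) X \<boxtimes>\<^sub>C Id C (gO v)" and ?b = "Id C (gO (v\<^sup>\<star>)) \<boxtimes>\<^sub>C s v X"
  have inv: "inv_arr C ?a = si (v\<^sup>\<star>) X \<boxtimes>\<^sub>C Id C (gO v)" "inv_arr C ?b = Id C (gO (v\<^sup>\<star>)) \<boxtimes>\<^sub>C si v X"
    and iso: "is_iso C ?a" "is_iso C ?b"
    using v X by (auto simp: C.Ten_iso)
  have "(gev v \<boxtimes>\<^sub>C Id C X) \<cdot>\<^sub>C (inv_arr C ?b \<cdot>\<^sub>C inv_arr C ?a) =
     ((Id C X \<boxtimes>\<^sub>C gev v) \<cdot>\<^sub>C ?a \<cdot>\<^sub>C ?b) \<cdot>\<^sub>C (inv_arr C ?b \<cdot>\<^sub>C inv_arr C ?a)"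
    using gev_s[OF v X] by simp
  also have "\<dots> = Id C X \<boxtimes>\<^sub>C gev v"
    using v X iso by simp
  finally show ?thesis by (simp add: inv)
qed

text \<open>The partner of \<open>gev\<close>: \<open>Coev D v\<close> carried over by the monoidal
  structure of \<open>G\<close>. Together they exhibit \<open>gO (v\<^sup>\<star>)\<close> as a left
  dual of \<open>gO v\<close>, which is the identification of duals built into
  \<open>GEv\<close>.\<close>

definition gcoev :: "'vo \<Rightarrow> 'cm" where
  "gcoev v = inv_arr C (mu v (v\<^sup>\<star>)) \<cdot>\<^sub>C gA (Coev D v) \<cdot>\<^sub>C eta"

lemma gcoev_arr [simp]:
  assumes "v \<in> Obj V"
  shows "gcoev v \<in> Arr C" "Dom C (gcoev v) = \<one>\<^bsub>C\<^esub>" "Cod C (gcoev v) = gO v \<otimes>\<^sub>C gO (v\<^sup>\<star>)"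
  using assms by (auto simp: gcoev_def)

text \<open>Monoidal functors preserve duals. Associativity and naturality of \<open>mu\<close>
  bring the images of \<open>Coev D v\<close> and \<open>Ev D v\<close> next to each other, where
  the zigzag identity of \<open>V\<close> applies; the remaining \<open>mu\<close> and
  \<open>eta\<close> cancel by the unit laws.\<close>

lemma zigzag_left:
  assumes v: "v \<in> Obj V"
  shows "(Id C (gO v) \<boxtimes>\<^sub>C gev v) \<cdot>\<^sub>C (gcoev v \<boxtimes>\<^sub>C Id C (gO v)) = Id C (gO v)"
proof -
  let ?a = "gO v" and ?w = "v\<^sup>\<star>" and ?u = "\<one>\<^bsub>V\<^esub>"
  let ?x = "(gA (Coev D v) \<boxtimes>\<^sub>C Id C ?a) \<cdot>\<^sub>C (eta \<boxtimes>\<^sub>C Id C ?a)"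
  have 1: "(Id C ?a \<boxtimes>\<^sub>C mu ?w v) \<cdot>\<^sub>C (inv_arr C (mu v ?w) \<boxtimes>\<^sub>C Id C ?a) =
      inv_arr C (mu v (?w \<otimes>\<^bsub>V\<^esub> v)) \<cdot>\<^sub>C mu (v \<otimes>\<^bsub>V\<^esub> ?w) v"
    using C.conj_inv[OF _ _ mu_assoc[of v ?w v, symmetric]] v by (simp add: C.Ten_iso)
  have 2: "(Id C ?a \<boxtimes>\<^sub>C gA (Ev D v)) \<cdot>\<^sub>C inv_arr C (mu v (?w \<otimes>\<^bsub>V\<^esub> v)) =
      inv_arr C (mu v ?u) \<cdot>\<^sub>C gA (Id V v \<boxtimes>\<^bsub>V\<^esub> Ev D v)"
    using C.conj_inv[OF _ _ mu_natural[of "Id V v" "Ev D v" v v "?w \<otimes>\<^bsub>V\<^esub> v" ?u]] v by simp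
  have 3: "mu (v \<otimes>\<^bsub>V\<^esub> ?w) v \<cdot>\<^sub>C (gA (Coev D v) \<boxtimes>\<^sub>C Id C ?a) = gA (Coev D v \<boxtimes>\<^bsub>V\<^esub> Id V v) \<cdot>\<^sub>C mu ?u v"
    using mu_natural[of "Coev D v" "Id V v" ?u "v \<otimes>\<^bsub>V\<^esub> ?w" v v] v by simp
  have "Id C ?a \<boxtimes>\<^sub>C gev v = (Id C ?a \<boxtimes>\<^sub>C inv_arr C eta) \<cdot>\<^sub>C (Id C ?a \<boxtimes>\<^sub>C gA (Ev D v)) \<cdot>\<^sub>C (Id C ?a \<boxtimes>\<^sub>C mu ?w v)"
    using v by (simp add: gev_eq C.Ten_Comp)
  moreover have "gcoev v \<boxtimes>\<^sub>C Id C ?a = (inv_arr C (mu v ?w) \<boxtimes>\<^sub>C Id C ?a) \<cdot>\<^sub>C ?x"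
    using v by (simp add: gcoev_def C.Ten_Comp)
  ultimately have "(Id C ?a \<boxtimes>\<^sub>C gev v) \<cdot>\<^sub>C (gcoev v \<boxtimes>\<^sub>C Id C ?a) =
      (Id C ?a \<boxtimes>\<^sub>C inv_arr C eta) \<cdot>\<^sub>C ((Id C ?a \<boxtimes>\<^sub>C gA (Ev D v)) \<cdot>\<^sub>C
        ((Id C ?a \<boxtimes>\<^sub>C mu ?w v) \<cdot>\<^sub>C ((inv_arr C (mu v ?w) \<boxtimes>\<^sub>C Id C ?a) \<cdot>\<^sub>C ?x)))"
    using v by simp
  also have "(Id C ?a \<boxtimes>\<^sub>C mu ?w v) \<cdot>\<^sub>C ((inv_arr C (mu v ?w) \<boxtimes>\<^sub>C Id C ?a) \<cdot>\<^sub>C ?x) =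
      inv_arr C (mu v (?w \<otimes>\<^bsub>V\<^esub> v)) \<cdot>\<^sub>C (mu (v \<otimes>\<^bsub>V\<^esub> ?w) v \<cdot>\<^sub>C ?x)"
    using v by (intro C.Comp_extend2 1) auto
  also have "(Id C ?a \<boxtimes>\<^sub>C gA (Ev D v)) \<cdot>\<^sub>C (inv_arr C (mu v (?w \<otimes>\<^bsub>V\<^esub> v)) \<cdot>\<^sub>C (mu (v \<otimes>\<^bsub>V\<^esub> ?w) v \<cdot>\<^sub>C ?x)) =
      inv_arr C (mu v ?u) \<cdot>\<^sub>C (gA (Id V v \<boxtimes>\<^bsub>V\<^esub> Ev D v) \<cdot>\<^sub>C (mu (v \<otimes>\<^bsub>V\<^esub> ?w) v \<cdot>\<^sub>C ?x))"
    using v by (intro C.Comp_extend2 2) auto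
  also have "mu (v \<otimes>\<^bsub>V\<^esub> ?w) v \<cdot>\<^sub>C ?x = gA (Coev D v \<boxtimes>\<^bsub>V\<^esub> Id V v) \<cdot>\<^sub>C (mu ?u v \<cdot>\<^sub>C (eta \<boxtimes>\<^sub>C Id C ?a))"
    using v by (intro C.Comp_extend2 3) auto
  also have "mu ?u v \<cdot>\<^sub>C (eta \<boxtimes>\<^sub>C Id C ?a) = Id C ?a"
    using v by (simp add: mu_unit)
  also have "gA (Id V v \<boxtimes>\<^bsub>V\<^esub> Ev D v) \<cdot>\<^sub>C (gA (Coev D v \<boxtimes>\<^bsub>V\<^esub> Id V v) \<cdot>\<^sub>C Id C ?a) = Id C ?a"
    using v V.left_dualityD(8)[OF duality v] by (simp flip: gA_Comp)
  also have "(Id C ?a \<boxtimes>\<^sub>C inv_arr C eta) \<cdot>\<^sub>C (inv_arr C (mu v ?u) \<cdot>\<^sub>C Id C ?a) = inv_arr C (mu v ?u \<cdot>\<^sub>C (Id C ?a \<boxtimes>\<^sub>C eta))"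
    using v by (simp add: C.iso_Comp C.Ten_iso)
  also have "\<dots> = Id C ?a"
    using v by (simp add: mu_unit)
  finally show ?thesis .
qed

lemma zigzag_right:
  assumes v: "v \<in> Obj V"
  shows "(gev v \<boxtimes>\<^sub>C Id C (gO (v\<^sup>\<star>))) \<cdot>\<^sub>C (Id C (gO (v\<^sup>\<star>)) \<boxtimes>\<^sub>C gcoev v) = Id C (gO (v\<^sup>\<star>))"
proof -
  let ?a = "gO (v\<^sup>\<star>)" and ?w = "v\<^sup>\<star>" and ?u = "\<one>\<^bsub>V\<^esub>"
  let ?x = "(Id C ?a \<boxtimes>\<^sub>C gA (Coev D v)) \<cdot>\<^sub>C (Id C ?a \<boxtimes>\<^sub>C eta)"
  have 1: "(mu ?w v \<boxtimes>\<^sub>C Id C ?a) \<cdot>\<^sub>C (Id C ?a \<boxtimes>\<^sub>C inv_arr C (mu v ?w)) =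
      inv_arr C (mu (?w \<otimes>\<^bsub>V\<^esub> v) ?w) \<cdot>\<^sub>C mu ?w (v \<otimes>\<^bsub>V\<^esub> ?w)"
    using C.conj_inv[OF _ _ mu_assoc[of ?w v ?w]] v by (simp add: C.Ten_iso)
  have 2: "(gA (Ev D v) \<boxtimes>\<^sub>C Id C ?a) \<cdot>\<^sub>C inv_arr C (mu (?w \<otimes>\<^bsub>V\<^esub> v) ?w) =
      inv_arr C (mu ?u ?w) \<cdot>\<^sub>C gA (Ev D v \<boxtimes>\<^bsub>V\<^esub> Id V ?w)"
    using C.conj_inv[OF _ _ mu_natural[of "Ev D v" "Id V ?w" "?w \<otimes>\<^bsub>V\<^esub> v" ?u ?w ?w]] v by simp
  have 3: "mu ?w (v \<otimes>\<^bsub>V\<^esub> ?w) \<cdot>\<^sub>C (Id C ?a \<boxtimes>\<^sub>C gA (Coev D v)) = gA (Id V ?w \<boxtimes>\<^bsub>V\<^esub> Coev D v) \<cdot>\<^sub>C mu ?w ?u"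
    using mu_natural[of "Id V ?w" "Coev D v" ?w ?w ?u "v \<otimes>\<^bsub>V\<^esub> ?w"] v by simp
  have "gev v \<boxtimes>\<^sub>C Id C ?a = (inv_arr C eta \<boxtimes>\<^sub>C Id C ?a) \<cdot>\<^sub>C (gA (Ev D v) \<boxtimes>\<^sub>C Id C ?a) \<cdot>\<^sub>C (mu ?w v \<boxtimes>\<^sub>C Id C ?a)"
    using v by (simp add: gev_eq C.Ten_Comp)
  moreover have "Id C ?a \<boxtimes>\<^sub>C gcoev v = (Id C ?a \<boxtimes>\<^sub>C inv_arr C (mu v ?w)) \<cdot>\<^sub>C ?x"
    using v by (simp add: gcoev_def C.Ten_Comp)
  ultimately have "(gev v \<boxtimes>\<^sub>C Id C ?a) \<cdot>\<^sub>C (Id C ?a \<boxtimes>\<^sub>C gcoev v) =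
      (inv_arr C eta \<boxtimes>\<^sub>C Id C ?a) \<cdot>\<^sub>C ((gA (Ev D v) \<boxtimes>\<^sub>C Id C ?a) \<cdot>\<^sub>C
        ((mu ?w v \<boxtimes>\<^sub>C Id C ?a) \<cdot>\<^sub>C ((Id C ?a \<boxtimes>\<^sub>C inv_arr C (mu v ?w)) \<cdot>\<^sub>C ?x)))"
    using v by simp
  also have "(mu ?w v \<boxtimes>\<^sub>C Id C ?a) \<cdot>\<^sub>C ((Id C ?a \<boxtimes>\<^sub>C inv_arr C (mu v ?w)) \<cdot>\<^sub>C ?x) =
      inv_arr C (mu (?w \<otimes>\<^bsub>V\<^esub> v) ?w) \<cdot>\<^sub>C (mu ?w (v \<otimes>\<^bsub>V\<^esub> ?w) \<cdot>\<^sub>C ?x)"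
    using v by (intro C.Comp_extend2 1) auto
  also have "(gA (Ev D v) \<boxtimes>\<^sub>C Id C ?a) \<cdot>\<^sub>C (inv_arr C (mu (?w \<otimes>\<^bsub>V\<^esub> v) ?w) \<cdot>\<^sub>C (mu ?w (v \<otimes>\<^bsub>V\<^esub> ?w) \<cdot>\<^sub>C ?x)) =
      inv_arr C (mu ?u ?w) \<cdot>\<^sub>C (gA (Ev D v \<boxtimes>\<^bsub>V\<^esub> Id V ?w) \<cdot>\<^sub>C (mu ?w (v \<otimes>\<^bsub>V\<^esub> ?w) \<cdot>\<^sub>C ?x))"
    using v by (intro C.Comp_extend2 2) auto
  also have "mu ?w (v \<otimes>\<^bsub>V\<^esub> ?w) \<cdot>\<^sub>C ?x = gA (Id V ?w \<boxtimes>\<^bsub>V\<^esub> Coev D v) \<cdot>\<^sub>C (mu ?w ?u \<cdot>\<^sub>C (Id C ?a \<boxtimes>\<^sub>C eta))"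
    using v by (intro C.Comp_extend2 3) auto
  also have "mu ?w ?u \<cdot>\<^sub>C (Id C ?a \<boxtimes>\<^sub>C eta) = Id C ?a"
    using v by (simp add: mu_unit)
  also have "gA (Ev D v \<boxtimes>\<^bsub>V\<^esub> Id V ?w) \<cdot>\<^sub>C (gA (Id V ?w \<boxtimes>\<^bsub>V\<^esub> Coev D v) \<cdot>\<^sub>C Id C ?a) = Id C ?a"
    using v V.left_dualityD(9)[OF duality v] by (simp flip: gA_Comp)
  also have "(inv_arr C eta \<boxtimes>\<^sub>C Id C ?a) \<cdot>\<^sub>C (inv_arr C (mu ?u ?w) \<cdot>\<^sub>C Id C ?a) = inv_arr C (mu ?u ?w \<cdot>\<^sub>C (eta \<boxtimes>\<^sub>C Id C ?a))"
    using v by (simp add: C.iso_Comp C.Ten_iso)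
  also have "\<dots> = Id C ?a"
    using v by (simp add: mu_unit)
  finally show ?thesis .
qed

text \<open>The image under \<open>G\<close> of \<open>V.Ev_dinatural\<close>, with naturality of
  \<open>mu\<close> used once on each side.\<close>

lemma gev_dinatural:
  assumes k: "k \<in> Arr V" "Dom V k = v" "Cod V k = w"
  shows "gev v \<cdot>\<^sub>C (gA (DualA V D k) \<boxtimes>\<^sub>C Id C (gO v)) = gev w \<cdot>\<^sub>C (Id C (gO (w\<^sup>\<star>)) \<boxtimes>\<^sub>C gA k)"
proof -
  have vw: "v \<in> Obj V" "w \<in> Obj V" using k by auto
  note d = V.DualA_arr[OF duality k(1)]
  have "gev v \<cdot>\<^sub>C (gA (DualA V D k) \<boxtimes>\<^sub>C Id C (gO v)) =
      inv_arr C eta \<cdot>\<^sub>C (gA (Ev D v) \<cdot>\<^sub>C (mu (v\<^sup>\<star>) v \<cdot>\<^sub>C (gA (DualA V D k) \<boxtimes>\<^sub>C gA (Id V v))))"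
    using vw k d by (simp add: gev_eq)
  also have "mu (v\<^sup>\<star>) v \<cdot>\<^sub>C (gA (DualA V D k) \<boxtimes>\<^sub>C gA (Id V v)) = gA (DualA V D k \<boxtimes>\<^bsub>V\<^esub> Id V v) \<cdot>\<^sub>C mu (w\<^sup>\<star>) v"
    using vw k d by (intro mu_natural) auto
  also have "gA (Ev D v) \<cdot>\<^sub>C (gA (DualA V D k \<boxtimes>\<^bsub>V\<^esub> Id V v) \<cdot>\<^sub>C mu (w\<^sup>\<star>) v) =
      gA (Ev D v \<cdot>\<^bsub>V\<^esub> (DualA V D k \<boxtimes>\<^bsub>V\<^esub> Id V v)) \<cdot>\<^sub>C mu (w\<^sup>\<star>) v"
    using vw k d by (simp add: gA_Comp)
  also have "\<dots> = gA (Ev D w) \<cdot>\<^sub>C (gA (Id V (w\<^sup>\<star>) \<boxtimes>\<^bsub>V\<^esub> k) \<cdot>\<^sub>C mu (w\<^sup>\<star>) v)"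
    using vw k V.Ev_dinatural[OF duality k] by (simp add: gA_Comp)
  also have "gA (Id V (w\<^sup>\<star>) \<boxtimes>\<^bsub>V\<^esub> k) \<cdot>\<^sub>C mu (w\<^sup>\<star>) v = mu (w\<^sup>\<star>) w \<cdot>\<^sub>C (gA (Id V (w\<^sup>\<star>)) \<boxtimes>\<^sub>C gA k)"
    using vw k by (intro mu_natural[symmetric]) auto
  finally show ?thesis
    using vw k by (simp add: gev_eq)
qed

end

context tensor_module
begin

lemma br_pair: "X \<in> Obj C \<Longrightarrow> Y \<in> Obj C \<Longrightarrow> N \<in> Obj M \<Longrightarrow> f \<in> Arr C \<Longrightarrow> Dom C f = Z \<Longrightarrow> Cod C f = X \<otimes>\<^sub>C Y \<Longrightarrow>
    br [Z] [X, Y] f N = Asc A X Y N \<bullet> (f \<triangleright> Id M N)"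
  using C.Dom_Cod_Obj(1)[of f] by (simp add: br_def can_pair del: can.simps)

lemma Act_br_Nil:
  assumes "X \<in> Obj C" "set Xs \<subseteq> Obj C" "N \<in> Obj M" "f \<in> Arr C" "Dom C f = tens Xs" "Cod C f = \<one>\<^bsub>C\<^esub>"
  shows "Id C X \<triangleright> br Xs [] f N = br (X # Xs) [X] (Id C X \<boxtimes>\<^sub>C f) N"
  using Act_br[of X Xs "[]" N f] assms by simp

end

section \<open>The restricted action of \<open>V\<close> and the module structure of the action
  functor\<close>

context central_module
begin

abbreviation B where "B \<equiv> central_action C M A G"
abbreviation endo where "endo \<equiv> module_endofunctor V M B"
abbreviation transf where "transf \<equiv> module_transformation V M B"
abbreviation \<rho> where "\<rho> \<equiv> act_obj_functor C M A G"
abbreviation gam where "gam \<equiv> gamma D C M A G"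

lemma B_simps [simp]:
  "v \<rhd>\<^bsub>B\<^esub> N = gO v \<rhd> N" "k \<triangleright>\<^bsub>B\<^esub> g = gA k \<triangleright> g"
  by (simp_all add: central_action_def)

lemma Asc_B:
  assumes "v \<in> Obj V" "w \<in> Obj V" "N \<in> Obj M"
  shows "Asc B v w N = br [gO (v \<otimes>\<^bsub>V\<^esub> w)] [gO v, gO w] (inv_arr C (mu v w)) N"
  using assms by (simp add: central_action_def br_pair)

lemma Lun_B: "N \<in> Obj M \<Longrightarrow> Lun B N = br [gO \<one>\<^bsub>V\<^esub>] [] (inv_arr C eta) N"
  by (simp add: central_action_def br_def del: can.simps(2))

abbreviation ev_br where "ev_br v N \<equiv> br [gO (v\<^sup>\<star>), gO v] [] (gev v) N"
abbreviation coev_br where "coev_br v N \<equiv> br [] [gO v, gO (v\<^sup>\<star>)] (gcoev v) N"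
abbreviation dX where "dX X v N \<equiv> br [X, gO v] [gO v, X] (si v X) N"

text \<open>The unitor of the restricted action contributes the inverse of \<open>eta\<close> and
  its inverted associator contributes \<open>mu\<close>; with the image of \<open>Ev D v\<close>
  between them they assemble to \<open>gev v\<close>.\<close>

lemma act_ev_eq:
  assumes "v \<in> Obj V" "N \<in> Obj M"
  shows "act_ev D M B v N = ev_br v N"
proof -
  have "inv_arr M (Asc B (v\<^sup>\<star>) v N) = br [gO (v\<^sup>\<star>), gO v] [gO (v\<^sup>\<star> \<otimes>\<^bsub>V\<^esub> v)] (mu (v\<^sup>\<star>) v) N"
    using assms by (simp add: Asc_B br_iso)
  moreover have "gA (Ev D v) \<triangleright> Id M N = br [gO (v\<^sup>\<star> \<otimes>\<^bsub>V\<^esub> v)] [gO \<one>\<^bsub>V\<^esub>] (gA (Ev D v)) N"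
    using assms by (intro Act_eq_br) auto
  ultimately show ?thesis
    using assms by (simp add: act_ev_def Lun_B br_Comp gev_eq)
qed

lemma act_d_eq:
  assumes "v \<in> Obj V" "X \<in> Obj C" "N \<in> Obj M"
  shows "snd (\<rho> X) v N = dX X v N"
  using assms by (simp add: act_obj_functor_def br_def can_pair del: can.simps)

lemma act_functor_simps [simp]:
  "omap (fst (\<rho> X)) N = X \<rhd> N" "amap (fst (\<rho> X)) g = Id C X \<triangleright> g"
  by (simp_all add: act_obj_functor_def)

lemma dX_arr [simp]:
  assumes "v \<in> Obj V" "X \<in> Obj C" "N \<in> Obj M"
  shows "dX X v N \<in> Arr M" "Dom M (dX X v N) = X \<rhd> gO v \<rhd> N" "Cod M (dX X v N) = gO v \<rhd> X \<rhd> N" "is_iso M (dX X v N)"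
  using assms by (auto simp: br_iso)

lemma ev_br_arr [simp]:
  assumes "v \<in> Obj V" "N \<in> Obj M"
  shows "ev_br v N \<in> Arr M" "Dom M (ev_br v N) = gO (v\<^sup>\<star>) \<rhd> gO v \<rhd> N" "Cod M (ev_br v N) = N"
    "coev_br v N \<in> Arr M" "Dom M (coev_br v N) = N" "Cod M (coev_br v N) = gO v \<rhd> gO (v\<^sup>\<star>) \<rhd> N"
  using assms by auto

text \<open>Naturality in \<open>v\<close> holds because \<open>gA k\<close> is a morphism of the
  center (\<open>gA_si\<close>); naturality in \<open>N\<close> is \<open>br_natural\<close>. The
  arrow \<open>gA k \<triangleright> g\<close> is split accordingly.\<close>

lemma dX_natural:
  assumes "k \<in> Arr V" "Dom V k = v" "Cod V k = w" "X \<in> Obj C" "g \<in> Arr M" "Dom M g = N" "Cod M g = L"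
  shows "dX X w L \<bullet> (Id C X \<triangleright> gA k \<triangleright> g) = (gA k \<triangleright> Id C X \<triangleright> g) \<bullet> dX X v N"
proof -
  have vw: "v \<in> Obj V" "w \<in> Obj V" "N \<in> Obj M" "L \<in> Obj M"
    using assms by auto
  have g: "Id C X \<triangleright> gA k \<triangleright> g = (Id C X \<triangleright> (gA k \<triangleright> Id M L)) \<bullet> acta [X, gO v] g"
    "gA k \<triangleright> Id C X \<triangleright> g = (gA k \<triangleright> Id M (X \<rhd> L)) \<bullet> acta [gO v, X] g"
    using assms vw by (auto simp: Act_Comp)
  have 1: "Id C X \<triangleright> (gA k \<triangleright> Id M L) = br [X, gO v] [X, gO w] (Id C X \<boxtimes>\<^sub>C gA k) L"
    using assms vw Act_eq_br[of "gA k" "gO v" "gO w" L] Act_br[of X "[gO v]" "[gO w]" L "gA k"] by simp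
  have 2: "gA k \<triangleright> Id M (X \<rhd> L) = br [gO v, X] [gO w, X] (gA k \<boxtimes>\<^sub>C Id C X) L"
    using assms vw Act_eq_br[of "gA k" "gO v" "gO w" "X \<rhd> L"] br_acts[of "[gO v]" "[gO w]" "[X]" L "gA k"] by simp
  have "dX X w L \<bullet> (br [X, gO v] [X, gO w] (Id C X \<boxtimes>\<^sub>C gA k) L \<bullet> acta [X, gO v] g) =
      br [gO v, X] [gO w, X] (gA k \<boxtimes>\<^sub>C Id C X) L \<bullet> (dX X v L \<bullet> acta [X, gO v] g)"
    using assms vw by (intro Comp_extend2) (auto simp: br_Comp gA_si)
  also have "dX X v L \<bullet> acta [X, gO v] g = acta [gO v, X] g \<bullet> dX X v N"
    using assms vw by (intro br_natural[symmetric]) auto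
  finally show ?thesis
    unfolding g 1 2 using assms vw by (simp del: acta.simps)
qed

text \<open>Here the half-braiding is natural in its argument from \<open>C\<close>
  (\<open>si_natural\<close>), in contrast to \<open>dX_natural\<close>.\<close>

lemma dX_natural_left:
  assumes "v \<in> Obj V" "f \<in> Arr C" "Dom C f = X" "Cod C f = Y" "N \<in> Obj M"
  shows "dX Y v N \<bullet> (f \<triangleright> Id M (gO v \<rhd> N)) = (Id C (gO v) \<triangleright> f \<triangleright> Id M N) \<bullet> dX X v N"
proof -
  have XY: "X \<in> Obj C" "Y \<in> Obj C" using assms by auto
  have 1: "f \<triangleright> Id M (gO v \<rhd> N) = br [X, gO v] [Y, gO v] (f \<boxtimes>\<^sub>C Id C (gO v)) N"
    using assms XY Act_eq_br[of f X Y "gO v \<rhd> N"] br_acts[of "[X]" "[Y]" "[gO v]" N f] by simp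
  have 2: "Id C (gO v) \<triangleright> f \<triangleright> Id M N = br [gO v, X] [gO v, Y] (Id C (gO v) \<boxtimes>\<^sub>C f) N"
    using assms XY Act_eq_br[of f X Y N] Act_br[of "gO v" "[X]" "[Y]" N f] by simp
  show ?thesis
    unfolding 1 2 using assms XY by (simp add: br_Comp si_natural)
qed

text \<open>On lists of objects all four arrows become \<open>br\<close>, and the identity left in
  \<open>C\<close> is \<open>mu_si\<close>, which holds because \<open>Mu G v w\<close> is a
  morphism of the center.\<close>

lemma dX_Asc:
  assumes "v \<in> Obj V" "w \<in> Obj V" "X \<in> Obj C" "N \<in> Obj M"
  shows "Asc B v w (X \<rhd> N) \<bullet> dX X (v \<otimes>\<^bsub>V\<^esub> w) N =
    (Id C (gO v) \<triangleright> dX X w N) \<bullet> dX X v (gO w \<rhd> N) \<bullet> (Id C X \<triangleright> Asc B v w N)"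
proof -
  let ?a = "gO v" and ?b = "gO w" and ?ab = "gO (v \<otimes>\<^bsub>V\<^esub> w)"
  have 1: "Asc B v w (X \<rhd> N) = br [?ab, X] [?a, ?b, X] (inv_arr C (mu v w) \<boxtimes>\<^sub>C Id C X) N"
    using assms br_acts[of "[?ab]" "[?a, ?b]" "[X]" N "inv_arr C (mu v w)"] by (simp add: Asc_B)
  have 2: "Id C X \<triangleright> Asc B v w N = br [X, ?ab] [X, ?a, ?b] (Id C X \<boxtimes>\<^sub>C inv_arr C (mu v w)) N"
    using assms by (simp add: Asc_B Act_br)
  have 3: "dX X v (?b \<rhd> N) = br [X, ?a, ?b] [?a, X, ?b] (si v X \<boxtimes>\<^sub>C Id C ?b) N"
    using assms br_acts[of "[X, ?a]" "[?a, X]" "[?b]" N "si v X"] by simp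
  have 4: "Id C ?a \<triangleright> dX X w N = br [?a, X, ?b] [?a, ?b, X] (Id C ?a \<boxtimes>\<^sub>C si w X) N"
    using assms by (simp add: Act_br)
  show ?thesis
    unfolding 1 2 3 4 using assms mu_si[of v w X] by (simp add: br_Comp)
qed

lemma dX_Lun:
  assumes "X \<in> Obj C" "N \<in> Obj M"
  shows "Lun B (X \<rhd> N) \<bullet> dX X \<one>\<^bsub>V\<^esub> N = Id C X \<triangleright> Lun B N"
proof -
  let ?u = "gO \<one>\<^bsub>V\<^esub>"
  have 1: "Lun B (X \<rhd> N) = br [?u, X] [X] (inv_arr C eta \<boxtimes>\<^sub>C Id C X) N"
    using assms br_acts[of "[?u]" "[]" "[X]" N "inv_arr C eta"] by (simp add: Lun_B)
  have 2: "Id C X \<triangleright> Lun B N = br [X, ?u] [X] (Id C X \<boxtimes>\<^sub>C inv_arr C eta) N"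
    using assms by (simp add: Lun_B Act_br_Nil)
  show ?thesis
    unfolding 1 2 using assms by (simp add: br_Comp eta_si)
qed

lemma right_exact_act: "X \<in> Obj C \<Longrightarrow> right_exact M M (fst (\<rho> X))"
  using act_exact_right by (simp add: act_obj_functor_def exact_def)

lemma act_module_endofunctor:
  assumes X: "X \<in> Obj C"
  shows "endo (\<rho> X)"
  unfolding module_endofunctor_def Let_def
proof (intro conjI ballI allI impI)
  fix v w N L k g assume "k \<in> hom V v w" "g \<in> hom M N L"
  then have k: "k \<in> Arr V" "Dom V k = v" "Cod V k = w" "g \<in> Arr M" "Dom M g = N" "Cod M g = L"
    and o: "v \<in> Obj V" "w \<in> Obj V" "N \<in> Obj M" "L \<in> Obj M"
    by (auto simp: in_hom)
  show "snd (\<rho> X) w L \<bullet> amap (fst (\<rho> X)) (k \<triangleright>\<^bsub>B\<^esub> g) =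
       (k \<triangleright>\<^bsub>B\<^esub> amap (fst (\<rho> X)) g) \<bullet> snd (\<rho> X) v N"
    using dX_natural[OF k(1-3) X k(4-6)] o X by (simp add: act_d_eq)
next
  fix v w N assume o: "v \<in> Obj V" "w \<in> Obj V" "N \<in> Obj M"
  show "Asc B v w (omap (fst (\<rho> X)) N) \<bullet> snd (\<rho> X) (v \<otimes>\<^bsub>V\<^esub> w) N =
        (Id V v \<triangleright>\<^bsub>B\<^esub> snd (\<rho> X) w N) \<bullet> snd (\<rho> X) v (w \<rhd>\<^bsub>B\<^esub> N) \<bullet>
        amap (fst (\<rho> X)) (Asc B v w N)"
    using dX_Asc[OF o(1,2) X o(3)] o X by (simp add: act_d_eq)
next
  fix N assume "N \<in> Obj M"
  then show "Lun B (omap (fst (\<rho> X)) N) \<bullet> snd (\<rho> X) \<one>\<^bsub>V\<^esub> N =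
         amap (fst (\<rho> X)) (Lun B N)"
    using dX_Lun[OF X] X by (simp add: act_d_eq)
qed (use X right_exact_act in \<open>auto simp: act_d_eq in_hom\<close>)

lemma endofunctorD:
  assumes "endo P"
  shows "N \<in> Obj M \<Longrightarrow> omap (fst P) N \<in> Obj M"
    "g \<in> Arr M \<Longrightarrow> amap (fst P) g \<in> Arr M"
    "g \<in> Arr M \<Longrightarrow> Dom M (amap (fst P) g) = omap (fst P) (Dom M g)"
    "g \<in> Arr M \<Longrightarrow> Cod M (amap (fst P) g) = omap (fst P) (Cod M g)"
    "N \<in> Obj M \<Longrightarrow> amap (fst P) (Id M N) = Id M (omap (fst P) N)"
    "v \<in> Obj V \<Longrightarrow> N \<in> Obj M \<Longrightarrow> snd P v N \<in> Arr M"
    "v \<in> Obj V \<Longrightarrow> N \<in> Obj M \<Longrightarrow> Dom M (snd P v N) = omap (fst P) (gO v \<rhd> N)"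
    "v \<in> Obj V \<Longrightarrow> N \<in> Obj M \<Longrightarrow> Cod M (snd P v N) = gO v \<rhd> omap (fst P) N"
    "v \<in> Obj V \<Longrightarrow> N \<in> Obj M \<Longrightarrow> is_iso M (snd P v N)"
  using assms
  unfolding module_endofunctor_def right_exact_def linear_functor_def is_functor_def Let_def
  by (auto simp: in_hom)

lemma endofunctor_Comp:
  assumes "endo P" "g \<in> Arr M" "f \<in> Arr M" "Dom M g = Cod M f"
  shows "amap (fst P) (g \<bullet> f) = amap (fst P) g \<bullet> amap (fst P) f"
proof -
  have "g \<in> hom M (Cod M f) (Cod M g)" "f \<in> hom M (Dom M f) (Cod M f)"
    using assms by (auto simp: in_hom)
  moreover have "is_functor M M (fst P)"
    using assms by (simp add: module_endofunctor_def right_exact_def linear_functor_def Let_def)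
  ultimately show ?thesis
    unfolding is_functor_def by blast
qed

lemma endofunctor_d_natural:
  assumes "endo P" "k \<in> Arr V" "Dom V k = v" "Cod V k = w" "g \<in> Arr M" "Dom M g = N" "Cod M g = L"
  shows "snd P w L \<bullet> amap (fst P) (gA k \<triangleright> g) = (gA k \<triangleright> amap (fst P) g) \<bullet> snd P v N"
proof -
  have "k \<in> hom V v w" "g \<in> hom M N L"
    using assms by (auto simp: in_hom)
  then have "snd P w L \<bullet> amap (fst P) (k \<triangleright>\<^bsub>B\<^esub> g) = (k \<triangleright>\<^bsub>B\<^esub> amap (fst P) g) \<bullet> snd P v N"
    using assms(1) unfolding module_endofunctor_def Let_def by blast
  then show ?thesis by simp
qed

subsection \<open>Transposition along the duality\<close>

text \<open>With \<open>coev_transpose\<close>, the two directions of the Hom bijection for the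
  adjunction with left adjoint \<open>gO (v\<^sup>\<star>) \<rhd> -\<close> and right adjoint
  \<open>gO v \<rhd> -\<close>, whose counit is \<open>ev_br\<close> and whose unit is
  \<open>coev_br\<close>.\<close>

definition ev_transpose :: "'vo \<Rightarrow> 'mo \<Rightarrow> 'mm \<Rightarrow> 'mm" where
  "ev_transpose v K h = ev_br v K \<bullet> (Id C (gO (v\<^sup>\<star>)) \<triangleright> h)"

definition coev_transpose :: "'vo \<Rightarrow> 'mo \<Rightarrow> 'mm \<Rightarrow> 'mm" where
  "coev_transpose v W h = (Id C (gO v) \<triangleright> h) \<bullet> coev_br v W"

lemma ev_transpose_arr [simp]:
  assumes "v \<in> Obj V" "h \<in> Arr M" "Cod M h = gO v \<rhd> K" "K \<in> Obj M"
  shows "ev_transpose v K h \<in> Arr M" "Dom M (ev_transpose v K h) = gO (v\<^sup>\<star>) \<rhd> Dom M h" "Cod M (ev_transpose v K h) = K"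
  using assms by (auto simp: ev_transpose_def)

lemma coev_transpose_arr [simp]:
  assumes "v \<in> Obj V" "h \<in> Arr M" "Dom M h = gO (v\<^sup>\<star>) \<rhd> W" "W \<in> Obj M"
  shows "coev_transpose v W h \<in> Arr M" "Dom M (coev_transpose v W h) = W" "Cod M (coev_transpose v W h) = gO v \<rhd> Cod M h"
  using assms by (auto simp: coev_transpose_def)

text \<open>Naturality moves \<open>coev_br\<close> past \<open>h\<close>, next to
  \<open>ev_br\<close>, and \<open>zigzag_left\<close> removes the pair. The other composite uses
  \<open>zigzag_right\<close>.\<close>

lemma coev_transpose_ev_transpose:
  assumes "v \<in> Obj V" "h \<in> Arr M" "Cod M h = gO v \<rhd> K" "K \<in> Obj M" "Dom M h = W"
  shows "coev_transpose v W (ev_transpose v K h) = h"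
proof -
  let ?a = "gO v" and ?w = "gO (v\<^sup>\<star>)"
  have W: "W \<in> Obj M" using assms by auto
  have nat: "acta [?a, ?w] h \<bullet> coev_br v W = coev_br v (?a \<rhd> K) \<bullet> acta [] h"
    using assms W by (intro br_natural) auto
  have 1: "coev_br v (?a \<rhd> K) = br [?a] [?a, ?w, ?a] (gcoev v \<boxtimes>\<^sub>C Id C ?a) K"
    using assms br_acts[of "[]" "[?a, ?w]" "[?a]" K "gcoev v"] by simp
  have 2: "Id C ?a \<triangleright> ev_br v K = br [?a, ?w, ?a] [?a] (Id C ?a \<boxtimes>\<^sub>C gev v) K"
    using assms by (simp add: Act_br_Nil)
  have 3: "(Id C ?a \<triangleright> ev_br v K) \<bullet> coev_br v (?a \<rhd> K) = Id M (?a \<rhd> K)"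
    unfolding 1 2 using assms br_Id[of "[?a]" K] zigzag_left[of v] by (simp add: br_Comp)
  have "coev_transpose v W (ev_transpose v K h) = (Id C ?a \<triangleright> ev_br v K) \<bullet> (acta [?a, ?w] h \<bullet> coev_br v W)"
    using assms W by (simp add: coev_transpose_def ev_transpose_def Act_Comp_Id)
  also have "\<dots> = (Id C ?a \<triangleright> ev_br v K) \<bullet> (coev_br v (?a \<rhd> K) \<bullet> h)"
    unfolding nat by simp
  also have "\<dots> = Id M (?a \<rhd> K) \<bullet> h"
    using assms by (intro Comp_extend 3) auto
  finally show ?thesis using assms by simp
qed

lemma ev_transpose_coev_transpose:
  assumes "v \<in> Obj V" "h \<in> Arr M" "Dom M h = gO (v\<^sup>\<star>) \<rhd> W" "W \<in> Obj M" "Cod M h = K"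
  shows "ev_transpose v K (coev_transpose v W h) = h"
proof -
  let ?a = "gO v" and ?w = "gO (v\<^sup>\<star>)"
  have K: "K \<in> Obj M" using assms by auto
  have nat: "acta [] h \<bullet> ev_br v (?w \<rhd> W) = ev_br v K \<bullet> acta [?w, ?a] h"
    using assms K by (intro br_natural) auto
  have 1: "ev_br v (?w \<rhd> W) = br [?w, ?a, ?w] [?w] (gev v \<boxtimes>\<^sub>C Id C ?w) W"
    using assms br_acts[of "[?w, ?a]" "[]" "[?w]" W "gev v"] by simp
  have 2: "Id C ?w \<triangleright> coev_br v W = br [?w] [?w, ?a, ?w] (Id C ?w \<boxtimes>\<^sub>C gcoev v) W"
    using assms Act_br[of ?w "[]" "[?a, ?w]" W "gcoev v"] by simp
  have 3: "ev_br v (?w \<rhd> W) \<bullet> (Id C ?w \<triangleright> coev_br v W) = Id M (?w \<rhd> W)"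
    unfolding 1 2 using assms br_Id[of "[?w]" W] zigzag_right[of v] by (simp add: br_Comp)
  have "ev_transpose v K (coev_transpose v W h) = ev_br v K \<bullet> (acta [?w, ?a] h \<bullet> (Id C ?w \<triangleright> coev_br v W))"
    using assms K by (simp add: coev_transpose_def ev_transpose_def Act_Comp_Id)
  also have "\<dots> = h \<bullet> (ev_br v (?w \<rhd> W) \<bullet> (Id C ?w \<triangleright> coev_br v W))"
    using assms K nat by (intro Comp_extend2) auto
  finally show ?thesis using assms by (simp add: 3)
qed

lemma ev_transpose_Comp:
  assumes "v \<in> Obj V" "h \<in> Arr M" "Cod M h = gO v \<rhd> K" "K \<in> Obj M" "g \<in> Arr M" "Dom M h = Cod M g"
  shows "ev_transpose v K (h \<bullet> g) = ev_transpose v K h \<bullet> (Id C (gO (v\<^sup>\<star>)) \<triangleright> g)"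
  using assms by (simp add: ev_transpose_def Act_Comp_Id)

lemma ev_transpose_natural:
  assumes "v \<in> Obj V" "h \<in> Arr M" "Cod M h = gO v \<rhd> K" "K \<in> Obj M" "g \<in> Arr M" "Dom M g = K" "Cod M g = L"
  shows "ev_transpose v L ((Id C (gO v) \<triangleright> g) \<bullet> h) = g \<bullet> ev_transpose v K h"
proof -
  have L: "L \<in> Obj M" using assms by auto
  have nat: "acta [] g \<bullet> ev_br v K = ev_br v L \<bullet> acta [gO (v\<^sup>\<star>), gO v] g"
    using assms L by (intro br_natural) auto
  have "ev_transpose v L ((Id C (gO v) \<triangleright> g) \<bullet> h) =
      ev_br v L \<bullet> (acta [gO (v\<^sup>\<star>), gO v] g \<bullet> (Id C (gO (v\<^sup>\<star>)) \<triangleright> h))"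
    using assms by (simp add: ev_transpose_def Act_Comp_Id)
  also have "\<dots> = g \<bullet> (ev_br v K \<bullet> (Id C (gO (v\<^sup>\<star>)) \<triangleright> h))"
    using assms L nat by (intro Comp_extend2) auto
  finally show ?thesis by (simp add: ev_transpose_def)
qed

text \<open>By \<open>gev_dinatural\<close>, acting with \<open>gA k\<close> on one factor before
  evaluating equals acting with its dual on the other factor; \<open>Act_swap\<close> then moves the
  dual past \<open>h\<close>.\<close>

lemma ev_transpose_dinatural:
  assumes k: "k \<in> Arr V" "Dom V k = v" "Cod V k = w" and h: "h \<in> Arr M" "Cod M h = gO v \<rhd> K" "Dom M h = W" and K: "K \<in> Obj M"
  shows "ev_transpose w K ((gA k \<triangleright> Id M K) \<bullet> h) = ev_transpose v K h \<bullet> (gA (DualA V D k) \<triangleright> Id M W)"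
proof -
  have vw: "v \<in> Obj V" "w \<in> Obj V" "W \<in> Obj M" using assms by auto
  note d = V.DualA_arr[OF duality k(1)]
  let ?k = "gA (DualA V D k)"
  have 1: "Id C (gO (w\<^sup>\<star>)) \<triangleright> gA k \<triangleright> Id M K = br [gO (w\<^sup>\<star>), gO v] [gO (w\<^sup>\<star>), gO w] (Id C (gO (w\<^sup>\<star>)) \<boxtimes>\<^sub>C gA k) K"
    using assms vw Act_eq_br[of "gA k" "gO v" "gO w" K] Act_br[of "gO (w\<^sup>\<star>)" "[gO v]" "[gO w]" K "gA k"] by simp
  have 2: "?k \<triangleright> Id M (gO v \<rhd> K) = br [gO (w\<^sup>\<star>), gO v] [gO (v\<^sup>\<star>), gO v] (?k \<boxtimes>\<^sub>C Id C (gO v)) K"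
    using assms vw d Act_eq_br[of ?k "gO (w\<^sup>\<star>)" "gO (v\<^sup>\<star>)" "gO v \<rhd> K"]
      br_acts[of "[gO (w\<^sup>\<star>)]" "[gO (v\<^sup>\<star>)]" "[gO v]" K ?k] by simp
  have "ev_transpose w K ((gA k \<triangleright> Id M K) \<bullet> h) =
      ev_br w K \<bullet> ((Id C (gO (w\<^sup>\<star>)) \<triangleright> gA k \<triangleright> Id M K) \<bullet> (Id C (gO (w\<^sup>\<star>)) \<triangleright> h))"
    using assms vw by (simp add: ev_transpose_def Act_Comp_Id)
  also have "\<dots> = ev_br v K \<bullet> ((?k \<triangleright> Id M (gO v \<rhd> K)) \<bullet> (Id C (gO (w\<^sup>\<star>)) \<triangleright> h))"
    unfolding 1 2 using assms vw d gev_dinatural[OF k] by (intro Comp_extend2) (auto simp: br_Comp)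
  also have "(?k \<triangleright> Id M (gO v \<rhd> K)) \<bullet> (Id C (gO (w\<^sup>\<star>)) \<triangleright> h) = (Id C (gO (v\<^sup>\<star>)) \<triangleright> h) \<bullet> (?k \<triangleright> Id M W)"
    using assms vw d by (intro Act_swap[symmetric]) auto
  finally show ?thesis
    using assms vw d by (simp add: ev_transpose_def)
qed

text \<open>The left side starts from one side of the module condition for \<open>a\<close>; the
  right side is what the evaluation term of the wedge condition becomes in \<open>M\<close>. They
  agree because \<open>gev v\<close> is compatible with half-braidings
  (\<open>gev_si\<close>).\<close>

lemma ev_transpose_dX:
  assumes "v \<in> Obj V" "X \<in> Obj C" "N \<in> Obj M" "a \<in> Arr M" "Dom M a = X \<rhd> N" "Cod M a = K"
  shows "ev_transpose v K ((Id C (gO v) \<triangleright> a) \<bullet> dX X v N) \<bullet> dX X (v\<^sup>\<star>) (gO v \<rhd> N) = a \<bullet> (Id C X \<triangleright> ev_br v N)"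
proof -
  let ?a = "gO v" and ?w = "gO (v\<^sup>\<star>)"
  have K: "K \<in> Obj M" using assms by auto
  have 1: "ev_br v (X \<rhd> N) = br [?w, ?a, X] [X] (gev v \<boxtimes>\<^sub>C Id C X) N"
    using assms br_acts[of "[?w, ?a]" "[]" "[X]" N "gev v"] by simp
  have 2: "Id C ?w \<triangleright> dX X v N = br [?w, X, ?a] [?w, ?a, X] (Id C ?w \<boxtimes>\<^sub>C si v X) N"
    using assms by (simp add: Act_br)
  have 3: "dX X (v\<^sup>\<star>) (?a \<rhd> N) = br [X, ?w, ?a] [?w, X, ?a] (si (v\<^sup>\<star>) X \<boxtimes>\<^sub>C Id C ?a) N"
    using assms br_acts[of "[X, ?w]" "[?w, X]" "[?a]" N "si (v\<^sup>\<star>) X"] by simp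
  have 4: "Id C X \<triangleright> ev_br v N = br [X, ?w, ?a] [X] (Id C X \<boxtimes>\<^sub>C gev v) N"
    using assms by (simp add: Act_br_Nil)
  have 5: "ev_transpose v (X \<rhd> N) (dX X v N) \<bullet> dX X (v\<^sup>\<star>) (?a \<rhd> N) = Id C X \<triangleright> ev_br v N"
    unfolding ev_transpose_def 1 2 3 4 using assms gev_si[of v X] by (simp add: br_Comp)
  have "ev_transpose v K ((Id C (gO v) \<triangleright> a) \<bullet> dX X v N) = a \<bullet> ev_transpose v (X \<rhd> N) (dX X v N)"
    using assms by (intro ev_transpose_natural) auto
  then show ?thesis
    using assms K by (simp add: 5)
qed

subsection \<open>The map \<open>\<gamma>\<close>\<close>

text \<open>Separates the ingredients of \<open>gamma\<close>: the module structure of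
  \<open>P\<close>, transposition along the duality, and the inverse half-braiding. The arguments
  below use \<open>gamma\<close> in this form.\<close>

lemma gamma_eq:
  assumes "v \<in> Obj V" "X \<in> Obj C" "N \<in> Obj M" "L \<in> Obj M" and P: "endo P"
    and "f \<in> Arr M" "Dom M f = X \<rhd> N" "Cod M f = omap (fst P) (gO v \<rhd> L)"
  shows "gam P X v N L f = ev_transpose v (omap (fst P) L) (snd P v L \<bullet> f) \<bullet> dX X (v\<^sup>\<star>) N"
proof -
  have "ev_br v K = Lun A K \<bullet> (gev v \<triangleright> Id M K) \<bullet> inv_arr M (Asc A (gO (v\<^sup>\<star>)) (gO v) K)" if "K \<in> Obj M" for K
    using assms(1) that by (simp add: br_def can_pair del: can.simps(2))
  then show ?thesis
    using assms endofunctorD[OF P]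
    by (simp add: gamma_def Let_def ev_transpose_def br_def can_pair del: can.simps(2))
qed

lemma gamma_hom:
  assumes "v \<in> Obj V" "X \<in> Obj C" "N \<in> Obj M" "L \<in> Obj M" and P: "endo P"
    and f: "f \<in> hom M (X \<rhd> N) (omap (fst P) (gO v \<rhd> L))"
  shows "gam P X v N L f \<in> hom M (X \<rhd> gO (v\<^sup>\<star>) \<rhd> N) (omap (fst P) L)"
  using assms(1-4) f gamma_eq[OF assms(1-5), of f] endofunctorD[OF P] by (simp add: in_hom)

text \<open>Each ingredient in \<open>gamma_eq\<close> is invertible, and \<open>\<delta>\<close>
  undoes them in reverse order.\<close>

lemma gamma_bij:
  assumes v: "v \<in> Obj V" and X: "X \<in> Obj C" and N: "N \<in> Obj M" and L: "L \<in> Obj M" and P: "endo P"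
  shows "bij_betw (gam P X v N L) (hom M (X \<rhd> N) (omap (fst P) (gO v \<rhd> L)))
    (hom M (X \<rhd> gO (v\<^sup>\<star>) \<rhd> N) (omap (fst P) L))"
proof -
  note p = endofunctorD[OF P]
  let ?d = "dX X (v\<^sup>\<star>) N" and ?K = "omap (fst P) L"
  define \<delta> where "\<delta> k = inv_arr M (snd P v L) \<bullet> coev_transpose v (X \<rhd> N) (k \<bullet> inv_arr M ?d)" for k
  show ?thesis
  proof (rule bij_betw_byWitness[where f' = \<delta>])
    show "\<forall>f \<in> hom M (X \<rhd> N) (omap (fst P) (gO v \<rhd> L)). \<delta> (gam P X v N L f) = f"
    proof
      fix f assume "f \<in> hom M (X \<rhd> N) (omap (fst P) (gO v \<rhd> L))"
      then have f: "f \<in> Arr M" "Dom M f = X \<rhd> N" "Cod M f = omap (fst P) (gO v \<rhd> L)" by (auto simp: in_hom)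
      show "\<delta> (gam P X v N L f) = f"
        using gamma_eq[OF v X N L P f] v X N L f p by (simp add: \<delta>_def coev_transpose_ev_transpose)
    qed
    show "\<forall>k \<in> hom M (X \<rhd> gO (v\<^sup>\<star>) \<rhd> N) ?K. gam P X v N L (\<delta> k) = k"
    proof
      fix k assume "k \<in> hom M (X \<rhd> gO (v\<^sup>\<star>) \<rhd> N) ?K"
      then have k: "k \<in> Arr M" "Dom M k = X \<rhd> gO (v\<^sup>\<star>) \<rhd> N" "Cod M k = ?K" by (auto simp: in_hom)
      have "\<delta> k \<in> Arr M" "Dom M (\<delta> k) = X \<rhd> N" "Cod M (\<delta> k) = omap (fst P) (gO v \<rhd> L)"
        using k v X N L p by (auto simp: \<delta>_def)
      from gamma_eq[OF v X N L P this]
      show "gam P X v N L (\<delta> k) = k"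
        using k v X N L p by (simp add: \<delta>_def ev_transpose_coev_transpose)
    qed
    show "gam P X v N L ` hom M (X \<rhd> N) (omap (fst P) (gO v \<rhd> L)) \<subseteq> hom M (X \<rhd> gO (v\<^sup>\<star>) \<rhd> N) ?K"
      using gamma_hom[OF v X N L P] by blast
    show "\<delta> ` hom M (X \<rhd> gO (v\<^sup>\<star>) \<rhd> N) ?K \<subseteq> hom M (X \<rhd> N) (omap (fst P) (gO v \<rhd> L))"
      using v X N L p by (auto simp: \<delta>_def in_hom)
  qed
qed

text \<open>Naturality in the acting object. It allows \<open>beta\<close>, which is defined from
  \<open>gamma\<close> at the universal morphism, to represent \<open>gamma\<close> at every
  morphism.\<close>

lemma gamma_Comp:
  assumes "v \<in> Obj V" "N \<in> Obj M" "L \<in> Obj M" and P: "endo P"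
    and f: "f \<in> Arr M" "Dom M f = X \<rhd> N" "Cod M f = omap (fst P) (gO v \<rhd> L)"
    and u: "u \<in> Arr C" "Dom C u = Y" "Cod C u = X"
  shows "gam P Y v N L (f \<bullet> (u \<triangleright> Id M N)) = gam P X v N L f \<bullet> (u \<triangleright> Id M (gO (v\<^sup>\<star>) \<rhd> N))"
proof -
  note p = endofunctorD[OF P]
  have XY: "X \<in> Obj C" "Y \<in> Obj C" using u by auto
  let ?K = "omap (fst P) L" and ?w = "gO (v\<^sup>\<star>)"
  have "gam P Y v N L (f \<bullet> (u \<triangleright> Id M N)) =
      ev_transpose v ?K ((snd P v L \<bullet> f) \<bullet> (u \<triangleright> Id M N)) \<bullet> dX Y (v\<^sup>\<star>) N"
    using gamma_eq[OF assms(1) XY(2) assms(2,3) P, of "f \<bullet> (u \<triangleright> Id M N)"] assms XY p by simp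
  also have "\<dots> = ev_transpose v ?K (snd P v L \<bullet> f) \<bullet> ((Id C ?w \<triangleright> u \<triangleright> Id M N) \<bullet> dX Y (v\<^sup>\<star>) N)"
    using assms XY p by (subst ev_transpose_Comp) auto
  also have "(Id C ?w \<triangleright> u \<triangleright> Id M N) \<bullet> dX Y (v\<^sup>\<star>) N = dX X (v\<^sup>\<star>) N \<bullet> (u \<triangleright> Id M (?w \<rhd> N))"
    using assms XY by (intro dX_natural_left[symmetric]) auto
  finally show ?thesis
    using gamma_eq[OF assms(1) XY(1) assms(2,3) P f] assms XY p by simp
qed

text \<open>Naturality of the module structure, dinaturality and naturality of the transpose, and
  naturality of the half-braiding are applied in turn. The prebalancing inherits its naturality from
  this identity.\<close>

lemma gamma_natural:
  assumes P: "endo P" and X: "X \<in> Obj C"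
    and k: "k \<in> Arr V" "Dom V k = v" "Cod V k = w"
    and f: "f \<in> Arr M" "Dom M f = N'" "Cod M f = N" and g: "g \<in> Arr M" "Dom M g = L" "Cod M g = L'"
    and h: "h \<in> Arr M" "Dom M h = X \<rhd> N" "Cod M h = omap (fst P) (gO v \<rhd> L)"
  shows "gam P X w N' L' (amap (fst P) (gA k \<triangleright> g) \<bullet> h \<bullet> (Id C X \<triangleright> f)) =
    amap (fst P) g \<bullet> gam P X v N L h \<bullet> (Id C X \<triangleright> gA (DualA V D k) \<triangleright> f)"
proof -
  note p = endofunctorD[OF P]
  have o: "v \<in> Obj V" "w \<in> Obj V" "N \<in> Obj M" "N' \<in> Obj M" "L \<in> Obj M" "L' \<in> Obj M" using k f g by auto
  note d = V.DualA_arr[OF duality k(1)]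
  let ?F = "fst P" and ?k = "gA (DualA V D k)"
  \<comment> \<open>The action of \<open>gA k \<triangleright> amap ?F g\<close> is split into two
    factors, because \<open>ev_transpose_dinatural\<close> handles the first and
    \<open>ev_transpose_natural\<close> the second.\<close>
  have nat: "snd P w L' \<bullet> amap ?F (gA k \<triangleright> g) = (gA k \<triangleright> Id M (omap ?F L')) \<bullet> (Id C (gO v) \<triangleright> amap ?F g) \<bullet> snd P v L"
    using endofunctor_d_natural[OF P k g] o k g p by (simp add: Act_Comp Comp_assoc[symmetric] del: Comp_assoc)
  have "snd P w L' \<bullet> (amap ?F (gA k \<triangleright> g) \<bullet> (h \<bullet> (Id C X \<triangleright> f))) =
      ((gA k \<triangleright> Id M (omap ?F L')) \<bullet> (Id C (gO v) \<triangleright> amap ?F g) \<bullet> snd P v L) \<bullet> (h \<bullet> (Id C X \<triangleright> f))"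
    using o k g p f h X by (intro Comp_extend nat) auto
  also have "\<dots> = (gA k \<triangleright> Id M (omap ?F L')) \<bullet> ((Id C (gO v) \<triangleright> amap ?F g) \<bullet> ((snd P v L \<bullet> h) \<bullet> (Id C X \<triangleright> f)))"
    using o k g p f h X by simp
  finally have "gam P X w N' L' (amap (fst P) (gA k \<triangleright> g) \<bullet> h \<bullet> (Id C X \<triangleright> f)) =
      ev_transpose w (omap ?F L') ((gA k \<triangleright> Id M (omap ?F L')) \<bullet> ((Id C (gO v) \<triangleright> amap ?F g) \<bullet> ((snd P v L \<bullet> h) \<bullet> (Id C X \<triangleright> f))))
        \<bullet> dX X (w\<^sup>\<star>) N'"
    using gamma_eq[OF o(2) X o(4,6) P, of "amap (fst P) (gA k \<triangleright> g) \<bullet> h \<bullet> (Id C X \<triangleright> f)"] o k g p f h X by simp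
  also have "ev_transpose w (omap ?F L') ((gA k \<triangleright> Id M (omap ?F L')) \<bullet> ((Id C (gO v) \<triangleright> amap ?F g) \<bullet> ((snd P v L \<bullet> h) \<bullet> (Id C X \<triangleright> f)))) =
      ev_transpose v (omap ?F L') ((Id C (gO v) \<triangleright> amap ?F g) \<bullet> ((snd P v L \<bullet> h) \<bullet> (Id C X \<triangleright> f))) \<bullet> (?k \<triangleright> Id M (X \<rhd> N'))"
    using o k g p f h X by (intro ev_transpose_dinatural) auto
  also have "ev_transpose v (omap ?F L') ((Id C (gO v) \<triangleright> amap ?F g) \<bullet> ((snd P v L \<bullet> h) \<bullet> (Id C X \<triangleright> f))) =
      amap ?F g \<bullet> ev_transpose v (omap ?F L) ((snd P v L \<bullet> h) \<bullet> (Id C X \<triangleright> f))"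
    using o k g p f h X by (intro ev_transpose_natural) auto
  also have "ev_transpose v (omap ?F L) ((snd P v L \<bullet> h) \<bullet> (Id C X \<triangleright> f)) =
      ev_transpose v (omap ?F L) (snd P v L \<bullet> h) \<bullet> (Id C (gO (v\<^sup>\<star>)) \<triangleright> Id C X \<triangleright> f)"
    using o k g p f h X by (intro ev_transpose_Comp) auto
  also have "((amap ?F g \<bullet> ev_transpose v (omap ?F L) (snd P v L \<bullet> h) \<bullet> (Id C (gO (v\<^sup>\<star>)) \<triangleright> Id C X \<triangleright> f)) \<bullet> (?k \<triangleright> Id M (X \<rhd> N')))
        \<bullet> dX X (w\<^sup>\<star>) N' =
      amap ?F g \<bullet> (ev_transpose v (omap ?F L) (snd P v L \<bullet> h) \<bullet> ((?k \<triangleright> Id C X \<triangleright> f) \<bullet> dX X (w\<^sup>\<star>) N'))"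
    using o k g p f h X d by (simp add: Act_Comp Comp_extend[OF Act_Comp])
  also have "(?k \<triangleright> Id C X \<triangleright> f) \<bullet> dX X (w\<^sup>\<star>) N' = dX X (v\<^sup>\<star>) N \<bullet> (Id C X \<triangleright> ?k \<triangleright> f)"
    using o k d X f by (intro dX_natural[symmetric]) auto
  finally show ?thesis
    using gamma_eq[OF o(1) X o(3,5) P h] o k g p f h X d by simp
qed

end

section \<open>Relative wedges and module transformations\<close>

locale central_module_ihom = central_module V c C M A D G
  for V :: "('vo, 'vm, 'k::alg_closed_field) moncat"
    and c :: "'vo \<Rightarrow> 'vo \<Rightarrow> 'vm"
    and C :: "('co, 'cm, 'k) moncat"
    and M :: "('mo, 'mm, 'k) lincat"
    and A :: "('co, 'cm, 'mo, 'mm) action" (structure)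
    and D :: "('vo, 'vm) duality"
    and G :: "('vo, 'vm, ('co, 'cm) center_obj, ('co, 'cm) center_arr) monfunctr" +
  fixes H :: "('co, 'cm, 'mo, 'mm) inthom"
  assumes internal_hom: "internal_hom C M A H"
begin

abbreviation ihA where "ihA \<equiv> IHomA C M A H"
abbreviation bt where "bt \<equiv> beta D C M A G H"

text \<open>Reading the object argument of \<open>Phi\<close> off from the morphism leaves one
  argument less to carry through rewriting. Its inverse \<open>psi\<close> has to keep that
  argument.\<close>

definition phi :: "'mo \<Rightarrow> 'mo \<Rightarrow> 'cm \<Rightarrow> 'mm" where
  "phi N L u = Phi H N L (Dom C u) u"

definition psi :: "'mo \<Rightarrow> 'mo \<Rightarrow> 'co \<Rightarrow> 'mm \<Rightarrow> 'cm" where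
  "psi N L X h = inv_into (hom C X (IHom H N L)) (Phi H N L X) h"

lemma IHom_Obj [simp]: "N \<in> Obj M \<Longrightarrow> L \<in> Obj M \<Longrightarrow> IHom H N L \<in> Obj C"
  using internal_hom by (simp add: internal_hom_def)

lemma Phi_bij:
  "N \<in> Obj M \<Longrightarrow> L \<in> Obj M \<Longrightarrow> X \<in> Obj C \<Longrightarrow> bij_betw (Phi H N L X) (hom C X (IHom H N L)) (hom M (X \<rhd> N) L)"
  using internal_hom by (simp add: internal_hom_def)

lemma phi_arr [simp]:
  assumes "u \<in> Arr C" "Cod C u = IHom H N L" "N \<in> Obj M" "L \<in> Obj M"
  shows "phi N L u \<in> Arr M" "Dom M (phi N L u) = Dom C u \<rhd> N" "Cod M (phi N L u) = L"
proof -
  have "phi N L u \<in> hom M (Dom C u \<rhd> N) L"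
    unfolding phi_def using assms by (intro bij_betwE[OF Phi_bij, rule_format]) (auto simp: in_hom)
  then show "phi N L u \<in> Arr M" "Dom M (phi N L u) = Dom C u \<rhd> N" "Cod M (phi N L u) = L"
    by (auto simp: in_hom)
qed

lemma phi_Comp:
  assumes "u \<in> Arr C" "Cod C u = IHom H N L" "N \<in> Obj M" "L \<in> Obj M" "f \<in> Arr C" "Dom C u = Cod C f"
  shows "phi N L (u \<cdot>\<^sub>C f) = phi N L u \<bullet> (f \<triangleright> Id M N)"
proof -
  have "f \<in> hom C (Dom C f) (Dom C u)" "u \<in> hom C (Dom C u) (IHom H N L)"
    using assms by (auto simp: in_hom)
  then show ?thesis
    using internal_hom assms by (simp add: internal_hom_def phi_def)
qed

lemma phi_inj:
  assumes "phi N L u = phi N L u'" "u \<in> Arr C" "u' \<in> Arr C" "Dom C u = Dom C u'"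
    "Cod C u = IHom H N L" "Cod C u' = IHom H N L" "N \<in> Obj M" "L \<in> Obj M"
  shows "u = u'"
proof (rule inj_onD)
  show "inj_on (Phi H N L (Dom C u)) (hom C (Dom C u) (IHom H N L))"
    using Phi_bij assms by (auto simp: bij_betw_def)
qed (use assms in \<open>auto simp: phi_def in_hom\<close>)

lemma psi_arr [simp]:
  assumes "h \<in> Arr M" "Dom M h = X \<rhd> N" "Cod M h = L" "X \<in> Obj C" "N \<in> Obj M"
  shows "psi N L X h \<in> Arr C" "Dom C (psi N L X h) = X" "Cod C (psi N L X h) = IHom H N L" "phi N L (psi N L X h) = h"
proof -
  have L: "L \<in> Obj M" using assms by auto
  have h: "h \<in> Phi H N L X ` hom C X (IHom H N L)"
    using bij_betw_imp_surj_on[OF Phi_bij[of N L X]] assms L by (simp add: in_hom)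
  have "psi N L X h \<in> hom C X (IHom H N L)"
    unfolding psi_def by (rule inv_into_into[OF h])
  then show "psi N L X h \<in> Arr C" and X: "Dom C (psi N L X h) = X" and "Cod C (psi N L X h) = IHom H N L"
    by (auto simp: in_hom)
  show "phi N L (psi N L X h) = h"
    unfolding phi_def X unfolding psi_def by (rule f_inv_into_f[OF h])
qed

lemma psi_phi [simp]:
  assumes "u \<in> Arr C" "Dom C u = X" "Cod C u = IHom H N L" "N \<in> Obj M" "L \<in> Obj M"
  shows "psi N L X (phi N L u) = u"
proof -
  have "X \<in> Obj C" using assms by auto
  then show ?thesis
    using assms by (intro phi_inj[of N L]) simp_all
qed

text \<open>\<open>IHomA\<close> and \<open>beta\<close> are both defined by descriptions of this
  shape.\<close>

lemma The_psi:
  assumes "h \<in> Arr M" "Dom M h = X \<rhd> N" "Cod M h = L" "X \<in> Obj C" "N \<in> Obj M"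
  shows "(THE u. u \<in> hom C X (IHom H N L) \<and> Phi H N L X u = h) = psi N L X h"
proof (rule the_equality)
  show "psi N L X h \<in> hom C X (IHom H N L) \<and> Phi H N L X (psi N L X h) = h"
    using psi_arr[OF assms] by (simp add: in_hom phi_def)
  show "u = psi N L X h" if u: "u \<in> hom C X (IHom H N L) \<and> Phi H N L X u = h" for u
  proof -
    have "u \<in> Arr C" "Dom C u = X" "Cod C u = IHom H N L" "phi N L u = h" "L \<in> Obj M"
      using u assms by (auto simp: in_hom phi_def)
    then show ?thesis
      using assms(5) psi_phi[of u X N L] by simp
  qed
qed

lemma ih_eval_eq: "N \<in> Obj M \<Longrightarrow> L \<in> Obj M \<Longrightarrow> ih_eval C H N L = phi N L (Id C (IHom H N L))"
  by (simp add: ih_eval_def phi_def)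

lemma phi_eval:
  assumes "u \<in> Arr C" "Cod C u = IHom H N L" "N \<in> Obj M" "L \<in> Obj M"
  shows "phi N L (Id C (IHom H N L)) \<bullet> (u \<triangleright> Id M N) = phi N L u"
  using assms phi_Comp[of "Id C (IHom H N L)" N L u] by simp

lemma IHomA_eq:
  assumes f: "f \<in> Arr M" "Dom M f = N'" "Cod M f = N" and g: "g \<in> Arr M" "Dom M g = L" "Cod M g = L'"
  shows "ihA f g =
    psi N' L' (IHom H N L) (g \<bullet> phi N L (Id C (IHom H N L)) \<bullet> (Id C (IHom H N L) \<triangleright> f))"
proof -
  have "N \<in> Obj M" "N' \<in> Obj M" "L \<in> Obj M" "L' \<in> Obj M" using f g by auto
  then show ?thesis
    using f g by (simp add: IHomA_def Let_def ih_eval_eq The_psi)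
qed

lemma IHomA_arr [simp]:
  assumes f: "f \<in> Arr M" and g: "g \<in> Arr M"
  shows "ihA f g \<in> Arr C" "Dom C (ihA f g) = IHom H (Cod M f) (Dom M g)"
    "Cod C (ihA f g) = IHom H (Dom M f) (Cod M g)"
  using f g by (simp_all add: IHomA_eq[OF f refl refl g refl refl])

text \<open>Yoneda: \<open>IHomA\<close> is defined by its effect on the universal morphism, and
  naturality of \<open>phi\<close> extends this to every \<open>u\<close>.\<close>

lemma phi_IHomA:
  assumes f: "f \<in> Arr M" "Dom M f = N'" "Cod M f = N" and g: "g \<in> Arr M" "Dom M g = L" "Cod M g = L'"
    and u: "u \<in> Arr C" "Cod C u = IHom H N L" "Dom C u = X"
  shows "phi N' L' (ihA f g \<cdot>\<^sub>C u) = g \<bullet> phi N L u \<bullet> (Id C X \<triangleright> f)"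
proof -
  have o: "N \<in> Obj M" "N' \<in> Obj M" "L \<in> Obj M" "L' \<in> Obj M" "X \<in> Obj C" using f g u by auto
  let ?E = "IHom H N L"
  have "phi N' L' (ihA f g \<cdot>\<^sub>C u) = phi N' L' (ihA f g) \<bullet> (u \<triangleright> Id M N')"
    using f g u o by (intro phi_Comp) auto
  also have "\<dots> = g \<bullet> (phi N L (Id C ?E) \<bullet> ((Id C ?E \<triangleright> f) \<bullet> (u \<triangleright> Id M N')))"
    using f g u o by (simp add: IHomA_eq[OF f g])
  also have "(Id C ?E \<triangleright> f) \<bullet> (u \<triangleright> Id M N') = (u \<triangleright> Id M N) \<bullet> (Id C X \<triangleright> f)"
    using f u by (intro Act_swap) auto
  also have "phi N L (Id C ?E) \<bullet> ((u \<triangleright> Id M N) \<bullet> (Id C X \<triangleright> f)) = phi N L u \<bullet> (Id C X \<triangleright> f)"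
    using f g u o by (intro Comp_extend phi_eval) auto
  finally show ?thesis .
qed

text \<open>Yoneda again: \<open>gamma_Comp\<close> carries the defining equation of
  \<open>beta\<close> from the universal morphism to every \<open>u\<close>.\<close>

lemma phi_beta:
  assumes P: "endo P" and v: "v \<in> Obj V" and N: "N \<in> Obj M" and L: "L \<in> Obj M"
  defines "b \<equiv> bt P v N L"
  shows beta_arr: "b \<in> Arr C" "Dom C b = IHom H N (omap (fst P) (gO v \<rhd> L))" "Cod C b = IHom H (gO (v\<^sup>\<star>) \<rhd> N) (omap (fst P) L)"
    and "u \<in> Arr C \<Longrightarrow> Cod C u = Dom C b \<Longrightarrow> Dom C u = X \<Longrightarrow>
      phi (gO (v\<^sup>\<star>) \<rhd> N) (omap (fst P) L) (b \<cdot>\<^sub>C u) = gam P X v N L (phi N (omap (fst P) (gO v \<rhd> L)) u)"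
proof -
  note p = endofunctorD[OF P]
  let ?L = "omap (fst P) (gO v \<rhd> L)" and ?N = "gO (v\<^sup>\<star>) \<rhd> N" and ?K = "omap (fst P) L"
  let ?E = "IHom H N ?L"
  have o: "?L \<in> Obj M" "?N \<in> Obj M" "?K \<in> Obj M" "?E \<in> Obj C"
    using v N L p by auto
  have "phi N ?L (Id C ?E) \<in> hom M (?E \<rhd> N) ?L"
    using v N L o by (simp add: in_hom)
  from gamma_hom[OF v o(4) N L P this]
  have h: "gam P ?E v N L (phi N ?L (Id C ?E)) \<in> Arr M"
    "Dom M (gam P ?E v N L (phi N ?L (Id C ?E))) = ?E \<rhd> ?N"
    "Cod M (gam P ?E v N L (phi N ?L (Id C ?E))) = ?K"
    by (auto simp: in_hom)
  have b: "b = psi ?N ?K ?E (gam P ?E v N L (phi N ?L (Id C ?E)))"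
    using v N L o h by (simp add: b_def beta_def Let_def ih_eval_eq The_psi)
  show ba: "b \<in> Arr C" "Dom C b = ?E" "Cod C b = IHom H ?N ?K"
    using v N L o h by (auto simp: b)
  assume u: "u \<in> Arr C" "Cod C u = Dom C b" "Dom C u = X"
  have "phi ?N ?K (b \<cdot>\<^sub>C u) = phi ?N ?K b \<bullet> (u \<triangleright> Id M ?N)"
    using u ba v N L o by (intro phi_Comp) auto
  also have "\<dots> = gam P ?E v N L (phi N ?L (Id C ?E)) \<bullet> (u \<triangleright> Id M ?N)"
    using o h by (simp add: b)
  also have "\<dots> = gam P X v N L (phi N ?L (Id C ?E) \<bullet> (u \<triangleright> Id M N))"
    using v N L o u ba by (intro gamma_Comp[OF v N L P, symmetric]) auto
  also have "phi N ?L (Id C ?E) \<bullet> (u \<triangleright> Id M N) = phi N ?L u"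
    using v N L o u ba by (intro phi_eval) auto
  finally show "phi ?N ?K (b \<cdot>\<^sub>C u) = gam P X v N L (phi N ?L u)" .
qed

text \<open>As \<open>phi\<close> is injective, the functor laws may be checked after applying it,
  where \<open>phi_IHomA\<close> turns them into associativity in \<open>M\<close>.\<close>

lemma ihom_is_bifunctor:
  assumes P: "endo P"
  shows "is_bifunctor M C (ihom_bifunctr C M A H (fst P))"
  unfolding is_bifunctor_def
proof (intro conjI ballI allI impI)
  note p = endofunctorD[OF P]
  let ?F = "fst P" and ?S = "ihom_bifunctr C M A H (fst P)"
  fix N L assume o: "N \<in> Obj M" "L \<in> Obj M"
  show "SO ?S N L \<in> Obj C"
    using o p by (simp add: ihom_bifunctr_def)
  let ?E = "IHom H N (omap ?F L)"
  have "ihA (Id M N) (Id M (omap ?F L)) \<cdot>\<^sub>C Id C ?E = Id C ?E"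
    using o p phi_IHomA[of "Id M N" N N "Id M (omap ?F L)" "omap ?F L" "omap ?F L" "Id C ?E" ?E]
    by (intro phi_inj[of N "omap ?F L"]) simp_all
  then show "SA ?S (Id M N) (Id M L) = Id C (SO ?S N L)"
    using o p by (simp add: ihom_bifunctr_def)
next
  note p = endofunctorD[OF P]
  let ?S = "ihom_bifunctr C M A H (fst P)"
  fix N N' L L' f g assume "f \<in> hom M N' N" "g \<in> hom M L L'"
  then show "SA ?S f g \<in> hom C (SO ?S N L) (SO ?S N' L')"
    using p by (auto simp: ihom_bifunctr_def in_hom)
next
  note p = endofunctorD[OF P]
  let ?F = "fst P" and ?S = "ihom_bifunctr C M A H (fst P)"
  fix N N' N'' L L' L'' f f' g g'
  assume "f \<in> hom M N' N" "f' \<in> hom M N'' N'" "g \<in> hom M L L'" "g' \<in> hom M L' L''"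
  then have f: "f \<in> Arr M" "Dom M f = N'" "Cod M f = N" and f': "f' \<in> Arr M" "Dom M f' = N''" "Cod M f' = N'"
    and g: "g \<in> Arr M" "Dom M g = L" "Cod M g = L'" and g': "g' \<in> Arr M" "Dom M g' = L'" "Cod M g' = L''"
    by (auto simp: in_hom)
  have o: "N \<in> Obj M" "N' \<in> Obj M" "N'' \<in> Obj M" "L \<in> Obj M" "L' \<in> Obj M" "L'' \<in> Obj M"
    using f f' g g' by auto
  have Fg: "amap ?F g \<in> Arr M" "Dom M (amap ?F g) = omap ?F L" "Cod M (amap ?F g) = omap ?F L'"
    and Fg': "amap ?F g' \<in> Arr M" "Dom M (amap ?F g') = omap ?F L'" "Cod M (amap ?F g') = omap ?F L''"
    using g g' p by auto
  have FO: "omap ?F L \<in> Obj M" "omap ?F L' \<in> Obj M" "omap ?F L'' \<in> Obj M" using p o by auto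
  let ?E = "IHom H N (omap ?F L)"
  let ?h = "ihA f (amap ?F g)"
  have h: "?h \<in> Arr C" "Dom C ?h = ?E" "Cod C ?h = IHom H N' (omap ?F L')"
    using f Fg by auto
  have E: "?E \<in> Obj C" using o FO by simp
  have 1: "phi N' (omap ?F L') ?h = amap ?F g \<bullet> phi N (omap ?F L) (Id C ?E) \<bullet> (Id C ?E \<triangleright> f)"
    using phi_IHomA[OF f Fg, of "Id C ?E" ?E] h E by simp
  have 2: "phi N'' (omap ?F L'') (ihA f' (amap ?F g') \<cdot>\<^sub>C ?h) =
      amap ?F g' \<bullet> phi N' (omap ?F L') ?h \<bullet> (Id C ?E \<triangleright> f')"
    using phi_IHomA[OF f' Fg' h(1,3,2)] .
  have 3: "phi N'' (omap ?F L'') (ihA (f \<bullet> f') (amap ?F g' \<bullet> amap ?F g) \<cdot>\<^sub>C Id C ?E) =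
      (amap ?F g' \<bullet> amap ?F g) \<bullet> phi N (omap ?F L) (Id C ?E) \<bullet> (Id C ?E \<triangleright> (f \<bullet> f'))"
    using f f' Fg Fg' E by (intro phi_IHomA) auto
  have "ihA (f \<bullet> f') (amap ?F g' \<bullet> amap ?F g) \<cdot>\<^sub>C Id C ?E = ihA f' (amap ?F g') \<cdot>\<^sub>C ?h"
  proof (rule phi_inj)
    show "phi N'' (omap ?F L'') (ihA (f \<bullet> f') (amap ?F g' \<bullet> amap ?F g) \<cdot>\<^sub>C Id C ?E) =
        phi N'' (omap ?F L'') (ihA f' (amap ?F g') \<cdot>\<^sub>C ?h)"
      unfolding 1 2 3 using f f' Fg Fg' o FO E by (simp add: Act_Comp_Id)
  qed (use f f' Fg Fg' o FO E h in auto)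
  then show "SA ?S (f \<bullet> f') (g' \<bullet> g) = SA ?S f' g' \<cdot>\<^sub>C SA ?S f g"
    using f f' g g' Fg Fg' E endofunctor_Comp[OF P g'(1) g(1)] by (simp add: ihom_bifunctr_def)
qed

text \<open>\<open>beta\<close> represents the natural bijection \<open>gamma\<close>. Surjectivity
  of \<open>gamma\<close> yields a preimage of the universal morphism, hence a right inverse of
  \<open>beta\<close>, and injectivity shows that this inverse is two-sided.\<close>

lemma beta_iso:
  assumes P: "endo P" and v: "v \<in> Obj V" and N: "N \<in> Obj M" and L: "L \<in> Obj M"
  shows "is_iso C (bt P v N L)"
proof -
  note p = endofunctorD[OF P]
  let ?L = "omap (fst P) (gO v \<rhd> L)" and ?N = "gO (v\<^sup>\<star>) \<rhd> N" and ?K = "omap (fst P) L"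
  let ?E = "IHom H N ?L" and ?E' = "IHom H ?N ?K" and ?b = "bt P v N L"
  have o: "?L \<in> Obj M" "?N \<in> Obj M" "?K \<in> Obj M" "?E \<in> Obj C" "?E' \<in> Obj C"
    using v N L p by auto
  note b = beta_arr[OF P v N L]
  have "phi ?N ?K (Id C ?E') \<in> gam P ?E' v N L ` hom M (?E' \<rhd> N) ?L"
    using gamma_bij[OF v o(5) N L P] o by (auto simp: bij_betw_def in_hom)
  then obtain h where h: "h \<in> Arr M" "Dom M h = ?E' \<rhd> N" "Cod M h = ?L"
    "gam P ?E' v N L h = phi ?N ?K (Id C ?E')"
    by (auto simp: in_hom)
  let ?u = "psi N ?L ?E' h"
  have u: "?u \<in> Arr C" "Dom C ?u = ?E'" "Cod C ?u = ?E" "phi N ?L ?u = h"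
    using h o N by auto
  have bu: "?b \<cdot>\<^sub>C ?u = Id C ?E'"
  proof (rule phi_inj)
    show "phi ?N ?K (?b \<cdot>\<^sub>C ?u) = phi ?N ?K (Id C ?E')"
      using phi_beta(4)[OF P v N L u(1)] u b h by simp
  qed (use o u b in auto)
  have ub: "?u \<cdot>\<^sub>C ?b = Id C ?E"
  proof (rule phi_inj)
    show "phi N ?L (?u \<cdot>\<^sub>C ?b) = phi N ?L (Id C ?E)"
    proof (rule inj_onD)
      show "inj_on (gam P ?E v N L) (hom M (?E \<rhd> N) ?L)"
        using gamma_bij[OF v o(4) N L P] by (simp add: bij_betw_def)
      have "gam P ?E v N L (phi N ?L (?u \<cdot>\<^sub>C ?b)) = gam P ?E v N L (h \<bullet> (?b \<triangleright> Id M N))"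
        using phi_Comp[of ?u N ?L ?b] u b o N by simp
      also have "\<dots> = gam P ?E' v N L h \<bullet> (?b \<triangleright> Id M ?N)"
        using b h by (intro gamma_Comp[OF v N L P]) auto
      also have "\<dots> = phi ?N ?K (?b \<cdot>\<^sub>C Id C ?E)"
        using phi_eval[of ?b ?N ?K] b h o by simp
      also have "\<dots> = gam P ?E v N L (phi N ?L (Id C ?E))"
        using phi_beta(4)[OF P v N L, of "Id C ?E" ?E] b o by simp
      finally show "gam P ?E v N L (phi N ?L (?u \<cdot>\<^sub>C ?b)) = gam P ?E v N L (phi N ?L (Id C ?E))" .
    qed (use o u b N in \<open>auto simp: in_hom\<close>)
  qed (use o u b N in auto)
  show ?thesis
    using b u bu ub by (intro C.isoI(1)[of _ ?u]) auto
qed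

lemma ihom_prebalancing:
  assumes P: "endo P"
  shows "prebalancing V D M B C (ihom_bifunctr C M A H (fst P)) (bt P)"
  unfolding prebalancing_def
proof (intro conjI ballI allI)
  let ?S = "ihom_bifunctr C M A H (fst P)"
  fix v N L assume o: "v \<in> Obj V" "N \<in> Obj M" "L \<in> Obj M"
  show "bt P v N L \<in> hom C (SO ?S N (v \<rhd>\<^bsub>B\<^esub> L)) (SO ?S (v\<^sup>\<star> \<rhd>\<^bsub>B\<^esub> N) L)"
    using beta_arr[OF P o] by (simp add: in_hom ihom_bifunctr_def)
  show "is_iso C (bt P v N L)"
    by (rule beta_iso[OF P o])
next
  note p = endofunctorD[OF P]
  let ?F = "fst P" and ?S = "ihom_bifunctr C M A H (fst P)"
  fix v w N N' L L' k f g
  assume "k \<in> hom V v w" "f \<in> hom M N' N" "g \<in> hom M L L'"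
  then have k: "k \<in> Arr V" "Dom V k = v" "Cod V k = w" and f: "f \<in> Arr M" "Dom M f = N'" "Cod M f = N"
    and g: "g \<in> Arr M" "Dom M g = L" "Cod M g = L'"
    by (auto simp: in_hom)
  have o: "v \<in> Obj V" "w \<in> Obj V" "N \<in> Obj M" "N' \<in> Obj M" "L \<in> Obj M" "L' \<in> Obj M" using k f g by auto
  note d = V.DualA_arr[OF duality k(1)]
  let ?kg = "amap ?F (gA k \<triangleright> g)" and ?kf = "gA (DualA V D k) \<triangleright> f"
  let ?E = "IHom H N (omap ?F (gO v \<rhd> L))"
  let ?b = "bt P v N L" and ?b' = "bt P w N' L'"
  note b = beta_arr[OF P o(1,3,5)] and b' = beta_arr[OF P o(2,4,6)]
  have E: "?E \<in> Obj C" "omap ?F (gO v \<rhd> L) \<in> Obj M" "omap ?F L \<in> Obj M" "omap ?F L' \<in> Obj M" "omap ?F (gO w \<rhd> L') \<in> Obj M"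
    using o p by auto
  have kg: "?kg \<in> Arr M" "Dom M ?kg = omap ?F (gO v \<rhd> L)" "Cod M ?kg = omap ?F (gO w \<rhd> L')"
    using k g p by auto
  have kf: "?kf \<in> Arr M" "Dom M ?kf = gO (w\<^sup>\<star>) \<rhd> N'" "Cod M ?kf = gO (v\<^sup>\<star>) \<rhd> N"
    using k f d by auto
  have Fg: "amap ?F g \<in> Arr M" "Dom M (amap ?F g) = omap ?F L" "Cod M (amap ?F g) = omap ?F L'"
    using g p by auto
  have 1: "phi N' (omap ?F (gO w \<rhd> L')) (ihA f ?kg \<cdot>\<^sub>C Id C ?E) =
      ?kg \<bullet> phi N (omap ?F (gO v \<rhd> L)) (Id C ?E) \<bullet> (Id C ?E \<triangleright> f)"
    using E by (intro phi_IHomA[OF f kg]) auto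
  have 2: "phi (gO (w\<^sup>\<star>) \<rhd> N') (omap ?F L') (?b' \<cdot>\<^sub>C ihA f ?kg) =
      gam P ?E w N' L' (?kg \<bullet> phi N (omap ?F (gO v \<rhd> L)) (Id C ?E) \<bullet> (Id C ?E \<triangleright> f))"
    using phi_beta(4)[OF P o(2,4,6), of "ihA f ?kg" ?E] b' f kg 1 by simp
  have 3: "phi (gO (w\<^sup>\<star>) \<rhd> N') (omap ?F L') (ihA ?kf (amap ?F g) \<cdot>\<^sub>C ?b) =
      amap ?F g \<bullet> phi (gO (v\<^sup>\<star>) \<rhd> N) (omap ?F L) ?b \<bullet> (Id C ?E \<triangleright> ?kf)"
    using b by (intro phi_IHomA[OF kf Fg]) auto
  have 4: "phi (gO (v\<^sup>\<star>) \<rhd> N) (omap ?F L) ?b = gam P ?E v N L (phi N (omap ?F (gO v \<rhd> L)) (Id C ?E))"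
    using phi_beta(4)[OF P o(1,3,5), of "Id C ?E" ?E] b E by simp
  have "?b' \<cdot>\<^sub>C ihA f ?kg = ihA ?kf (amap ?F g) \<cdot>\<^sub>C ?b"
  proof (rule phi_inj)
    show "phi (gO (w\<^sup>\<star>) \<rhd> N') (omap ?F L') (?b' \<cdot>\<^sub>C ihA f ?kg) =
      phi (gO (w\<^sup>\<star>) \<rhd> N') (omap ?F L') (ihA ?kf (amap ?F g) \<cdot>\<^sub>C ?b)"
      unfolding 2 3 4 using E o by (intro gamma_natural[OF P E(1) k f g]) auto
  qed (use o b b' f kg kf Fg E in auto)
  then show "?b' \<cdot>\<^sub>C SA ?S f (k \<triangleright>\<^bsub>B\<^esub> g) = SA ?S (DualA V D k \<triangleright>\<^bsub>B\<^esub> f) g \<cdot>\<^sub>C ?b"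
    by (simp add: ihom_bifunctr_def)
qed

text \<open>The restriction to \<open>Obj M\<close> is there because
  \<open>module_transformation\<close> asks for extensional families.\<close>

definition transformation_of :: "('vo, 'mo, 'mm) modend \<Rightarrow> ('mo \<Rightarrow> 'cm) \<Rightarrow> 'mo \<Rightarrow> 'mm" where
  "transformation_of P \<xi> = (\<lambda>N \<in> Obj M. phi N (omap (fst P) N) (\<xi> N))"

abbreviation wedge where
  "wedge P X \<xi> \<equiv> relative_wedge V D M B C (ihom_bifunctr C M A H (fst P)) (bt P) X \<xi>"

abbreviation nat_trans where
  "nat_trans X \<alpha> P \<equiv> transf (\<rho> X) \<alpha> P"

lemma nat_transD:
  assumes P: "endo P" and t: "nat_trans X \<alpha> P"
  shows "\<alpha> \<in> extensional (Obj M)" "N \<in> Obj M \<Longrightarrow> \<alpha> N \<in> Arr M" "N \<in> Obj M \<Longrightarrow> Dom M (\<alpha> N) = X \<rhd> N"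
    "N \<in> Obj M \<Longrightarrow> Cod M (\<alpha> N) = omap (fst P) N"
    "g \<in> Arr M \<Longrightarrow> Dom M g = N \<Longrightarrow> Cod M g = L \<Longrightarrow> \<alpha> L \<bullet> (Id C X \<triangleright> g) = amap (fst P) g \<bullet> \<alpha> N"
    "X \<in> Obj C \<Longrightarrow> v \<in> Obj V \<Longrightarrow> N \<in> Obj M \<Longrightarrow>
      snd P v N \<bullet> \<alpha> (gO v \<rhd> N) = (Id C (gO v) \<triangleright> \<alpha> N) \<bullet> dX X v N"
  using t by (auto simp: module_transformation_def in_hom act_d_eq)

lemma nat_transI:
  assumes "\<alpha> \<in> extensional (Obj M)" "X \<in> Obj C"
    "\<And>N. N \<in> Obj M \<Longrightarrow> \<alpha> N \<in> Arr M \<and> Dom M (\<alpha> N) = X \<rhd> N \<and> Cod M (\<alpha> N) = omap (fst P) N"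
    "\<And>g N L. g \<in> Arr M \<Longrightarrow> Dom M g = N \<Longrightarrow> Cod M g = L \<Longrightarrow> N \<in> Obj M \<Longrightarrow> L \<in> Obj M \<Longrightarrow>
      \<alpha> L \<bullet> (Id C X \<triangleright> g) = amap (fst P) g \<bullet> \<alpha> N"
    "\<And>v N. v \<in> Obj V \<Longrightarrow> N \<in> Obj M \<Longrightarrow> snd P v N \<bullet> \<alpha> (gO v \<rhd> N) = (Id C (gO v) \<triangleright> \<alpha> N) \<bullet> dX X v N"
  shows "nat_trans X \<alpha> P"
  using assms by (auto simp: module_transformation_def in_hom act_d_eq)

text \<open>The wedge conditions are equations between morphisms into internal Homs, so they can be
  compared after the injective map \<open>phi\<close>. Each of the two conditions is matched
  separately with one axiom of a module transformation.\<close>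

lemma wedge_iff:
  assumes P: "endo P" and X: "X \<in> Obj C"
    and \<xi>: "\<And>N. N \<in> Obj M \<Longrightarrow> \<xi> N \<in> hom C X (IHom H N (omap (fst P) N))"
  shows "wedge P X \<xi> \<longleftrightarrow> nat_trans X (transformation_of P \<xi>) P"
proof -
  note p = endofunctorD[OF P]
  let ?F = "fst P" and ?S = "ihom_bifunctr C M A H (fst P)"
  define \<alpha> where "\<alpha> = transformation_of P \<xi>"
  have \<alpha>: "\<alpha> N = phi N (omap ?F N) (\<xi> N)" if "N \<in> Obj M" for N
    using that by (simp add: \<alpha>_def transformation_of_def)
  have \<xi>': "\<xi> N \<in> Arr C" "Dom C (\<xi> N) = X" "Cod C (\<xi> N) = IHom H N (omap ?F N)" if "N \<in> Obj M" for N
    using \<xi>[OF that] by (auto simp: in_hom)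
  have \<alpha>': "\<alpha> N \<in> Arr M" "Dom M (\<alpha> N) = X \<rhd> N" "Cod M (\<alpha> N) = omap ?F N" if "N \<in> Obj M" for N
    using \<xi>'[OF that] that p by (auto simp: \<alpha>)
  have ext: "\<alpha> \<in> extensional (Obj M)"
    by (simp add: \<alpha>_def transformation_of_def)
  have 1: "SA ?S (Id M N) f \<cdot>\<^sub>C \<xi> N = SA ?S f (Id M L) \<cdot>\<^sub>C \<xi> L \<longleftrightarrow>
      \<alpha> L \<bullet> (Id C X \<triangleright> f) = amap ?F f \<bullet> \<alpha> N"
    if f: "f \<in> Arr M" "Dom M f = N" "Cod M f = L" for f N L
  proof -
    have o: "N \<in> Obj M" "L \<in> Obj M" using f by auto
    have FO: "omap ?F N \<in> Obj M" "omap ?F L \<in> Obj M" using o p by auto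
    have Ff: "amap ?F f \<in> Arr M" "Dom M (amap ?F f) = omap ?F N" "Cod M (amap ?F f) = omap ?F L"
      using f p by auto
    have l: "phi N (omap ?F L) (ihA (Id M N) (amap ?F f) \<cdot>\<^sub>C \<xi> N) = amap ?F f \<bullet> \<alpha> N"
      using phi_IHomA[of "Id M N" N N "amap ?F f" "omap ?F N" "omap ?F L" "\<xi> N" X] o f Ff FO \<xi>' X by (simp add: \<alpha>)
    have r: "phi N (omap ?F L) (ihA f (Id M (omap ?F L)) \<cdot>\<^sub>C \<xi> L) = \<alpha> L \<bullet> (Id C X \<triangleright> f)"
      using phi_IHomA[of f N L "Id M (omap ?F L)" "omap ?F L" "omap ?F L" "\<xi> L" X] o f FO \<xi>' X by (simp add: \<alpha>)
    have "ihA (Id M N) (amap ?F f) \<cdot>\<^sub>C \<xi> N = ihA f (Id M (omap ?F L)) \<cdot>\<^sub>C \<xi> L \<longleftrightarrow>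
      \<alpha> L \<bullet> (Id C X \<triangleright> f) = amap ?F f \<bullet> \<alpha> N"
      unfolding l[symmetric] r[symmetric]
    proof
      assume "phi N (omap ?F L) (ihA f (Id M (omap ?F L)) \<cdot>\<^sub>C \<xi> L) =
        phi N (omap ?F L) (ihA (Id M N) (amap ?F f) \<cdot>\<^sub>C \<xi> N)"
      from this[symmetric] show "ihA (Id M N) (amap ?F f) \<cdot>\<^sub>C \<xi> N = ihA f (Id M (omap ?F L)) \<cdot>\<^sub>C \<xi> L"
        by (rule phi_inj) (use o f Ff FO \<xi>' in auto)
    qed simp
    then show ?thesis
      using o p by (simp add: ihom_bifunctr_def)
  qed
  \<comment> \<open>After \<open>phi\<close>, the evaluation side becomes a transpose by
    \<open>ev_transpose_dX\<close> and the \<open>beta\<close> side becomes one by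
    \<open>gamma_eq\<close>, both followed by the same half-braiding.\<close>
  have 2: "SA ?S (act_ev D M B v N) (Id M N) \<cdot>\<^sub>C \<xi> N = bt P v (v \<rhd>\<^bsub>B\<^esub> N) N \<cdot>\<^sub>C \<xi> (v \<rhd>\<^bsub>B\<^esub> N) \<longleftrightarrow>
      snd P v N \<bullet> \<alpha> (gO v \<rhd> N) = (Id C (gO v) \<triangleright> \<alpha> N) \<bullet> dX X v N"
    if v: "v \<in> Obj V" and N: "N \<in> Obj M" for v N
  proof -
    let ?vN = "gO v \<rhd> N" and ?K = "omap ?F N"
    let ?W = "gO (v\<^sup>\<star>) \<rhd> ?vN"
    have o: "?vN \<in> Obj M" "?K \<in> Obj M" "?W \<in> Obj M" "omap ?F ?vN \<in> Obj M" using v N p by auto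
    let ?b = "bt P v ?vN N"
    note b = beta_arr[OF P v o(1) N]
    have l: "phi ?W ?K (ihA (ev_br v N) (Id M ?K) \<cdot>\<^sub>C \<xi> N) = \<alpha> N \<bullet> (Id C X \<triangleright> ev_br v N)"
      using phi_IHomA[of "ev_br v N" ?W N "Id M ?K" ?K ?K "\<xi> N" X] v N o \<xi>'[OF N] X by (simp add: \<alpha>)
    have r: "phi ?W ?K (?b \<cdot>\<^sub>C \<xi> ?vN) = gam P X v ?vN N (\<alpha> ?vN)"
      using phi_beta(4)[OF P v o(1) N, of "\<xi> ?vN" X] \<xi>'[OF o(1)] b o by (simp add: \<alpha>)
    have "ihA (ev_br v N) (Id M ?K) \<cdot>\<^sub>C \<xi> N = ?b \<cdot>\<^sub>C \<xi> ?vN \<longleftrightarrow>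
      phi ?W ?K (ihA (ev_br v N) (Id M ?K) \<cdot>\<^sub>C \<xi> N) = phi ?W ?K (?b \<cdot>\<^sub>C \<xi> ?vN)"
    proof
      assume "phi ?W ?K (ihA (ev_br v N) (Id M ?K) \<cdot>\<^sub>C \<xi> N) = phi ?W ?K (?b \<cdot>\<^sub>C \<xi> ?vN)"
      then show "ihA (ev_br v N) (Id M ?K) \<cdot>\<^sub>C \<xi> N = ?b \<cdot>\<^sub>C \<xi> ?vN"
        by (rule phi_inj) (use v N o b \<xi>' in auto)
    qed simp
    also have "\<dots> \<longleftrightarrow> ev_transpose v ?K ((Id C (gO v) \<triangleright> \<alpha> N) \<bullet> dX X v N) \<bullet> dX X (v\<^sup>\<star>) ?vN =
        ev_transpose v ?K (snd P v N \<bullet> \<alpha> ?vN) \<bullet> dX X (v\<^sup>\<star>) ?vN"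
      unfolding l r
      using ev_transpose_dX[OF v X N, of "\<alpha> N" ?K] gamma_eq[OF v X o(1) N P, of "\<alpha> ?vN"] \<alpha>'[OF N] \<alpha>'[OF o(1)] by simp
    \<comment> \<open>The half-braiding is invertible and transposition is injective, so both can be
      stripped off.\<close>
    also have "\<dots> \<longleftrightarrow> snd P v N \<bullet> \<alpha> ?vN = (Id C (gO v) \<triangleright> \<alpha> N) \<bullet> dX X v N" (is "?l \<longleftrightarrow> ?r")
    proof
      assume ?l
      then have "ev_transpose v ?K ((Id C (gO v) \<triangleright> \<alpha> N) \<bullet> dX X v N) = ev_transpose v ?K (snd P v N \<bullet> \<alpha> ?vN)"
        using v X N o p \<alpha>'[OF N] \<alpha>'[OF o(1)] by (rule_tac iso_cancel_right[of "dX X (v\<^sup>\<star>) ?vN"]) auto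
      then have "coev_transpose v (X \<rhd> ?vN) (ev_transpose v ?K ((Id C (gO v) \<triangleright> \<alpha> N) \<bullet> dX X v N)) =
        coev_transpose v (X \<rhd> ?vN) (ev_transpose v ?K (snd P v N \<bullet> \<alpha> ?vN))"
        by simp
      then show ?r
        using v X N o p \<alpha>'[OF N] \<alpha>'[OF o(1)] by (simp add: coev_transpose_ev_transpose)
    qed simp
    finally show ?thesis
      using v N o p by (simp add: act_ev_eq ihom_bifunctr_def)
  qed
  show ?thesis
    unfolding \<alpha>_def[symmetric]
  proof
    assume w: "wedge P X \<xi>"
    show "nat_trans X \<alpha> P"
    proof (rule nat_transI[OF ext X])
      show "\<alpha> L \<bullet> (Id C X \<triangleright> g) = amap ?F g \<bullet> \<alpha> N"
        if "g \<in> Arr M" "Dom M g = N" "Cod M g = L" "N \<in> Obj M" "L \<in> Obj M" for g N L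
        using w that(1-3) unfolding relative_wedge_def 1[OF that(1-3), symmetric] by (auto simp: in_hom)
      show "snd P v N \<bullet> \<alpha> (gO v \<rhd> N) = (Id C (gO v) \<triangleright> \<alpha> N) \<bullet> dX X v N"
        if "v \<in> Obj V" "N \<in> Obj M" for v N
        using w that unfolding relative_wedge_def 2[OF that, symmetric] by blast
    qed (use \<alpha>' in blast)
  next
    assume t: "nat_trans X \<alpha> P"
    note tD = nat_transD[OF P t]
    show "wedge P X \<xi>"
      unfolding relative_wedge_def
    proof (intro conjI ballI allI)
      fix N L f assume "f \<in> hom M N L"
      then have f: "f \<in> Arr M" "Dom M f = N" "Cod M f = L" by (auto simp: in_hom)
      show "SA ?S (Id M N) f \<cdot>\<^sub>C \<xi> N = SA ?S f (Id M L) \<cdot>\<^sub>C \<xi> L"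
        unfolding 1[OF f] using tD(5)[OF f] .
    next
      fix v N assume v: "v \<in> Obj V" "N \<in> Obj M"
      show "SA ?S (act_ev D M B v N) (Id M N) \<cdot>\<^sub>C \<xi> N = bt P v (v \<rhd>\<^bsub>B\<^esub> N) N \<cdot>\<^sub>C \<xi> (v \<rhd>\<^bsub>B\<^esub> N)"
        unfolding 2[OF v] using tD(6)[OF X v] .
    next
      fix N assume "N \<in> Obj M"
      then show "\<xi> N \<in> hom C X (SO ?S N N)"
        using \<xi> by (simp add: ihom_bifunctr_def)
    qed (rule X)
  qed
qed

end

section \<open>The category of module endofunctors\<close>

context central_module
begin

lemma transformationD:
  assumes "transf P \<alpha> Q"
  shows "\<alpha> \<in> extensional (Obj M)" "N \<in> Obj M \<Longrightarrow> \<alpha> N \<in> Arr M" "N \<in> Obj M \<Longrightarrow> Dom M (\<alpha> N) = omap (fst P) N"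
    "N \<in> Obj M \<Longrightarrow> Cod M (\<alpha> N) = omap (fst Q) N"
    "g \<in> Arr M \<Longrightarrow> Dom M g = N \<Longrightarrow> Cod M g = L \<Longrightarrow> \<alpha> L \<bullet> amap (fst P) g = amap (fst Q) g \<bullet> \<alpha> N"
    "v \<in> Obj V \<Longrightarrow> N \<in> Obj M \<Longrightarrow> snd Q v N \<bullet> \<alpha> (gO v \<rhd> N) = (Id C (gO v) \<triangleright> \<alpha> N) \<bullet> snd P v N"
  using assms by (auto simp: module_transformation_def in_hom)

lemma transformation_Comp:
  assumes P: "endo P" "endo Q" "endo R"
    and \<alpha>: "transf P \<alpha> Q" and \<beta>: "transf Q \<beta> R"
  shows "transf P (\<lambda>N \<in> Obj M. \<beta> N \<bullet> \<alpha> N) R"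
  unfolding module_transformation_def
proof (intro conjI ballI allI)
  note p = endofunctorD[OF P(1)] endofunctorD[OF P(2)] endofunctorD[OF P(3)]
  note a = transformationD[OF \<alpha>] and b = transformationD[OF \<beta>]
  show "(\<lambda>N \<in> Obj M. \<beta> N \<bullet> \<alpha> N) \<in> extensional (Obj M)" by simp
  show "(\<lambda>N \<in> Obj M. \<beta> N \<bullet> \<alpha> N) N \<in> hom M (omap (fst P) N) (omap (fst R) N)" if "N \<in> Obj M" for N
    using that a(2-4)[OF that] b(2-4)[OF that] by (simp add: in_hom)
  fix N L g assume "g \<in> hom M N L"
  then have g: "g \<in> Arr M" "Dom M g = N" "Cod M g = L" "N \<in> Obj M" "L \<in> Obj M" by (auto simp: in_hom)
  have "\<beta> L \<bullet> (\<alpha> L \<bullet> amap (fst P) g) = \<beta> L \<bullet> (amap (fst Q) g \<bullet> \<alpha> N)"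
    using a(5)[OF g(1-3)] by simp
  also have "\<dots> = amap (fst R) g \<bullet> (\<beta> N \<bullet> \<alpha> N)"
    using a(2-4)[OF g(4)] b(2-4)[OF g(4)] b(2-4)[OF g(5)] g p by (intro Comp_extend2 b(5)) auto
  finally show "(\<lambda>N \<in> Obj M. \<beta> N \<bullet> \<alpha> N) L \<bullet> amap (fst P) g = amap (fst R) g \<bullet> (\<lambda>N \<in> Obj M. \<beta> N \<bullet> \<alpha> N) N"
    using a(2-4)[OF g(5)] b(2-4)[OF g(5)] g p by simp
next
  note p = endofunctorD[OF P(1)] endofunctorD[OF P(2)] endofunctorD[OF P(3)]
  note a = transformationD[OF \<alpha>] and b = transformationD[OF \<beta>]
  fix v N assume o: "v \<in> Obj V" "N \<in> Obj M"
  have o': "gO v \<rhd> N \<in> Obj M" using o by simp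
  note an = a(2-4)[OF o(2)] a(2-4)[OF o'] b(2-4)[OF o(2)] b(2-4)[OF o']
  have "snd R v N \<bullet> (\<beta> (gO v \<rhd> N) \<bullet> \<alpha> (gO v \<rhd> N)) = (Id C (gO v) \<triangleright> \<beta> N) \<bullet> (snd Q v N \<bullet> \<alpha> (gO v \<rhd> N))"
    using an o p by (intro Comp_extend2 b(6)) auto
  also have "\<dots> = (Id C (gO v) \<triangleright> \<beta> N) \<bullet> ((Id C (gO v) \<triangleright> \<alpha> N) \<bullet> snd P v N)"
    using a(6)[OF o] by simp
  also have "\<dots> = (Id C (gO v) \<triangleright> (\<beta> N \<bullet> \<alpha> N)) \<bullet> snd P v N"
    using an o p by (simp add: Act_Comp_Id)
  finally show "snd R v N \<bullet> (\<lambda>N \<in> Obj M. \<beta> N \<bullet> \<alpha> N) (v \<rhd>\<^bsub>B\<^esub> N) =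
      (Id V v \<triangleright>\<^bsub>B\<^esub> (\<lambda>N \<in> Obj M. \<beta> N \<bullet> \<alpha> N) N) \<bullet> snd P v N"
    using o by simp
qed

lemma transformation_Id:
  assumes P: "endo P"
  shows "transf P (\<lambda>N \<in> Obj M. Id M (omap (fst P) N)) P"
  using endofunctorD[OF P] by (auto simp: module_transformation_def in_hom)

lemma transformation_act:
  assumes f: "f \<in> Arr C" "Dom C f = X" "Cod C f = Y"
  shows "transf (\<rho> X) (\<lambda>N \<in> Obj M. f \<triangleright> Id M N) (\<rho> Y)"
  unfolding module_transformation_def
proof (intro conjI ballI allI)
  have X: "X \<in> Obj C" "Y \<in> Obj C" using f by auto
  fix N L g assume "g \<in> hom M N L"
  then have g: "g \<in> Arr M" "Dom M g = N" "Cod M g = L" "N \<in> Obj M" "L \<in> Obj M" by (auto simp: in_hom)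
  show "(\<lambda>N \<in> Obj M. f \<triangleright> Id M N) L \<bullet> amap (fst (\<rho> X)) g =
      amap (fst (\<rho> Y)) g \<bullet> (\<lambda>N \<in> Obj M. f \<triangleright> Id M N) N"
    using f g X by (simp add: Act_Comp)
next
  have X: "X \<in> Obj C" "Y \<in> Obj C" using f by auto
  fix v N assume o: "v \<in> Obj V" "N \<in> Obj M"
  show "snd (\<rho> Y) v N \<bullet> (\<lambda>N \<in> Obj M. f \<triangleright> Id M N) (v \<rhd>\<^bsub>B\<^esub> N) =
      (Id V v \<triangleright>\<^bsub>B\<^esub> (\<lambda>N \<in> Obj M. f \<triangleright> Id M N) N) \<bullet> snd (\<rho> X) v N"
    using dX_natural_left[OF o(1) f o(2)] o X by (simp add: act_d_eq)
qed (use f in \<open>auto simp: in_hom\<close>)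

lemma EndV_simps [simp]:
  "Obj (EndV V M B) = {P. endo P}"
  "Dom (EndV V M B) t = fst t" "Cod (EndV V M B) t = snd (snd t)"
  "Id (EndV V M B) P = (P, \<lambda>N \<in> Obj M. Id M (omap (fst P) N), P)"
  "(Q, \<beta>, R) \<cdot>\<^bsub>EndV V M B\<^esub> (P, \<alpha>, Q') = (P, \<lambda>N \<in> Obj M. \<beta> N \<bullet> \<alpha> N, R)"
  "(P, \<alpha>, Q) \<in> Arr (EndV V M B) \<longleftrightarrow> endo P \<and> endo Q \<and> transf P \<alpha> Q"
  by (auto simp: EndV_def und_def)

lemma EndV_hom:
  "t \<in> hom (EndV V M B) P Q \<longleftrightarrow> endo P \<and> endo Q \<and>
    (\<exists>\<alpha>. t = (P, \<alpha>, Q) \<and> transf P \<alpha> Q)"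
  by (cases t) (auto simp: in_hom)

lemma EndV_category: "category (EndV V M B)"
proof
  let ?E = "EndV V M B"
  fix t assume t: "t \<in> Arr ?E"
  then show "Dom ?E t \<in> Obj ?E" "Cod ?E t \<in> Obj ?E"
    by (cases t, simp)+
next
  fix P assume "P \<in> Obj (EndV V M B)"
  then show "Id (EndV V M B) P \<in> hom (EndV V M B) P P"
    by (auto simp: EndV_hom transformation_Id)
next
  fix P Q R t u assume "t \<in> hom (EndV V M B) Q R" "u \<in> hom (EndV V M B) P Q"
  then show "t \<cdot>\<^bsub>EndV V M B\<^esub> u \<in> hom (EndV V M B) P R"
    by (auto simp: EndV_hom intro: transformation_Comp)
next
  fix P Q t assume "t \<in> hom (EndV V M B) P Q"
  then obtain \<alpha> where t: "t = (P, \<alpha>, Q)" and \<alpha>: "transf P \<alpha> Q"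
    by (auto simp: EndV_hom)
  note a = transformationD[OF \<alpha>]
  \<comment> \<open>The identity laws need equality of whole families; extensionality settles the
    values outside \<open>Obj M\<close>.\<close>
  have "(\<lambda>N \<in> Obj M. (\<lambda>N \<in> Obj M. Id M (omap (fst Q) N)) N \<bullet> \<alpha> N) = \<alpha>"
    using a(2-4) by (intro extensionalityI[OF _ a(1)]) auto
  then show "Id (EndV V M B) Q \<cdot>\<^bsub>EndV V M B\<^esub> t = t"
    by (simp add: t)
  have "(\<lambda>N \<in> Obj M. \<alpha> N \<bullet> (\<lambda>N \<in> Obj M. Id M (omap (fst P) N)) N) = \<alpha>"
    using a(2-4) by (intro extensionalityI[OF _ a(1)]) auto
  then show "t \<cdot>\<^bsub>EndV V M B\<^esub> Id (EndV V M B) P = t"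
    by (simp add: t)
next
  fix P Q R S t u w
  assume "t \<in> hom (EndV V M B) R S" "u \<in> hom (EndV V M B) Q R" "w \<in> hom (EndV V M B) P Q"
  then obtain \<alpha> \<beta> \<gamma> where t: "t = (R, \<alpha>, S)" and \<alpha>: "transf R \<alpha> S"
    and u: "u = (Q, \<beta>, R)" and \<beta>: "transf Q \<beta> R"
    and w: "w = (P, \<gamma>, Q)" and \<gamma>: "transf P \<gamma> Q"
    by (auto simp: EndV_hom)
  show "(t \<cdot>\<^bsub>EndV V M B\<^esub> u) \<cdot>\<^bsub>EndV V M B\<^esub> w = t \<cdot>\<^bsub>EndV V M B\<^esub> (u \<cdot>\<^bsub>EndV V M B\<^esub> w)"
    using transformationD(2-4)[OF \<alpha>] transformationD(2-4)[OF \<beta>] transformationD(2-4)[OF \<gamma>]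
    by (simp add: t u w cong: restrict_cong)
qed

lemma act_functor_is_functor: "is_functor C (EndV V M B) (act_functor C M A G)"
  unfolding is_functor_def
proof (intro conjI ballI allI)
  let ?L = "act_functor C M A G"
  show "omap ?L X \<in> Obj (EndV V M B)" if "X \<in> Obj C" for X
    using that act_module_endofunctor by (simp add: act_functor_def)
  show "amap ?L f \<in> hom (EndV V M B) (omap ?L X) (omap ?L Y)" if "f \<in> hom C X Y" for f X Y
  proof -
    have f: "f \<in> Arr C" "Dom C f = X" "Cod C f = Y" "X \<in> Obj C" "Y \<in> Obj C"
      using that by (auto simp: in_hom)
    then show ?thesis
      using transformation_act[OF f(1-3)] act_module_endofunctor by (simp add: act_functor_def EndV_hom)
  qed
  show "amap ?L (Id C X) = Id (EndV V M B) (omap ?L X)" if "X \<in> Obj C" for X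
    using that by (simp add: act_functor_def cong: restrict_cong)
  show "amap ?L (g \<cdot>\<^sub>C f) = amap ?L g \<cdot>\<^bsub>EndV V M B\<^esub> amap ?L f" if "g \<in> hom C Y Z" "f \<in> hom C X Y" for f g X Y Z
    using that by (auto simp: act_functor_def in_hom Act_Comp cong: restrict_cong)
qed

end

section \<open>Existence of the relative ends\<close>

context central_module_ihom
begin

lemma nat_trans_precomp:
  assumes P: "endo P" and t: "nat_trans X \<alpha> P"
    and f: "f \<in> Arr C" "Dom C f = Y" "Cod C f = X"
  shows "nat_trans Y (\<lambda>N \<in> Obj M. \<alpha> N \<bullet> (f \<triangleright> Id M N)) P"
proof -
  have "transf (\<rho> Y) (\<lambda>N \<in> Obj M. \<alpha> N \<bullet> (\<lambda>N \<in> Obj M. f \<triangleright> Id M N) N) P"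
    using f by (intro transformation_Comp[OF _ _ P transformation_act[OF f] t] act_module_endofunctor) auto
  then show ?thesis by (simp cong: restrict_cong)
qed

lemma nat_trans_Add:
  assumes P: "endo P" and X: "X \<in> Obj C" and t: "nat_trans X \<alpha> P" "nat_trans X \<beta> P"
  shows "nat_trans X (\<lambda>N \<in> Obj M. \<alpha> N \<oplus>\<^bsub>M\<^esub> \<beta> N) P"
proof (rule nat_transI)
  note p = endofunctorD[OF P] and a = nat_transD[OF P t(1)] and b = nat_transD[OF P t(2)]
  show "(\<lambda>N \<in> Obj M. \<alpha> N \<oplus>\<^bsub>M\<^esub> \<beta> N) N \<in> Arr M \<and> Dom M ((\<lambda>N \<in> Obj M. \<alpha> N \<oplus>\<^bsub>M\<^esub> \<beta> N) N) = X \<rhd> N \<and>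
      Cod M ((\<lambda>N \<in> Obj M. \<alpha> N \<oplus>\<^bsub>M\<^esub> \<beta> N) N) = omap (fst P) N" if "N \<in> Obj M" for N
    using that a(2-4)[OF that] b(2-4)[OF that] by simp
  show "(\<lambda>N \<in> Obj M. \<alpha> N \<oplus>\<^bsub>M\<^esub> \<beta> N) L \<bullet> (Id C X \<triangleright> g) = amap (fst P) g \<bullet> (\<lambda>N \<in> Obj M. \<alpha> N \<oplus>\<^bsub>M\<^esub> \<beta> N) N"
    if g: "g \<in> Arr M" "Dom M g = N" "Cod M g = L" and o: "N \<in> Obj M" "L \<in> Obj M" for g N L
    using a(5)[OF g] b(5)[OF g] g o X p a(2-4)[OF o(1)] b(2-4)[OF o(1)] a(2-4)[OF o(2)] b(2-4)[OF o(2)]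
    by (simp add: Comp_Add)
  show "snd P v N \<bullet> (\<lambda>N \<in> Obj M. \<alpha> N \<oplus>\<^bsub>M\<^esub> \<beta> N) (gO v \<rhd> N) =
      (Id C (gO v) \<triangleright> (\<lambda>N \<in> Obj M. \<alpha> N \<oplus>\<^bsub>M\<^esub> \<beta> N) N) \<bullet> dX X v N" if o: "v \<in> Obj V" "N \<in> Obj M" for v N
  proof -
    have o': "gO v \<rhd> N \<in> Obj M" using o by simp
    show ?thesis
      using a(6)[OF X o] b(6)[OF X o] o o' X p a(2-4)[OF o(2)] b(2-4)[OF o(2)] a(2-4)[OF o'] b(2-4)[OF o']
      by (simp add: Comp_Add Act_Add_right)
  qed
qed (use X in simp_all)

text \<open>Serves as the competitor in \<open>nat_trans_determined\<close>, turning vanishing at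
  the generator into vanishing everywhere.\<close>

lemma nat_trans_Zero:
  assumes P: "endo P" and X: "X \<in> Obj C"
  shows "nat_trans X (\<lambda>N \<in> Obj M. Zero M (X \<rhd> N) (omap (fst P) N)) P"
proof (rule nat_transI)
  note p = endofunctorD[OF P]
  show "snd P v N \<bullet> (\<lambda>N \<in> Obj M. Zero M (X \<rhd> N) (omap (fst P) N)) (gO v \<rhd> N) =
      (Id C (gO v) \<triangleright> (\<lambda>N \<in> Obj M. Zero M (X \<rhd> N) (omap (fst P) N)) N) \<bullet> dX X v N" if o: "v \<in> Obj V" "N \<in> Obj M" for v N
    using o X p by (simp add: Act_Zero_right)
qed (use X endofunctorD[OF P] in auto)

text \<open>Since \<open>e \<triangleright> Id M N\<close> is epi, the conditions on
  \<open>\<alpha>\<close> may be checked after precomposition with it, where they become the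
  conditions on \<open>\<beta>\<close>.\<close>

lemma nat_trans_descend:
  assumes P: "endo P" and e: "is_epi C e" "Dom C e = Y" "Cod C e = X" and t: "nat_trans Y \<beta> P"
    and ext: "\<alpha> \<in> extensional (Obj M)"
    and \<alpha>: "\<And>N. N \<in> Obj M \<Longrightarrow> \<alpha> N \<in> Arr M \<and> Dom M (\<alpha> N) = X \<rhd> N \<and> Cod M (\<alpha> N) = omap (fst P) N \<and>
      \<alpha> N \<bullet> (e \<triangleright> Id M N) = \<beta> N"
  shows "nat_trans X \<alpha> P"
proof (rule nat_transI[OF ext])
  note p = endofunctorD[OF P] and b = nat_transD[OF P t] and ea = C.epi_arr[OF e(1)]
  have X: "X \<in> Obj C" "Y \<in> Obj C" using e ea by auto
  then show "X \<in> Obj C" by simp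
  show "\<alpha> N \<in> Arr M \<and> Dom M (\<alpha> N) = X \<rhd> N \<and> Cod M (\<alpha> N) = omap (fst P) N" if "N \<in> Obj M" for N
    using \<alpha>[OF that] by simp
  show "\<alpha> L \<bullet> (Id C X \<triangleright> g) = amap (fst P) g \<bullet> \<alpha> N"
    if g: "g \<in> Arr M" "Dom M g = N" "Cod M g = L" and o: "N \<in> Obj M" "L \<in> Obj M" for g N L
  proof (rule epi_cancel[OF Act_epi[OF e(1) o(1)]])
    have "(\<alpha> L \<bullet> (Id C X \<triangleright> g)) \<bullet> (e \<triangleright> Id M N) = \<alpha> L \<bullet> ((e \<triangleright> Id M L) \<bullet> (Id C Y \<triangleright> g))"
      using \<alpha>[OF o(2)] g o e ea X by (simp add: Act_Comp)
    also have "\<dots> = \<beta> L \<bullet> (Id C Y \<triangleright> g)"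
      using \<alpha>[OF o(2)] g o e ea X by (intro Comp_extend) auto
    also have "\<dots> = amap (fst P) g \<bullet> (\<alpha> N \<bullet> (e \<triangleright> Id M N))"
      using b(5)[OF g] \<alpha>[OF o(1)] by simp
    finally show "(\<alpha> L \<bullet> (Id C X \<triangleright> g)) \<bullet> (e \<triangleright> Id M N) = (amap (fst P) g \<bullet> \<alpha> N) \<bullet> (e \<triangleright> Id M N)"
      using \<alpha>[OF o(1)] g o e ea X p by simp
  qed (use \<alpha>[OF o(1)] \<alpha>[OF o(2)] g o e ea X p in auto)
  show "snd P v N \<bullet> \<alpha> (gO v \<rhd> N) = (Id C (gO v) \<triangleright> \<alpha> N) \<bullet> dX X v N" if o: "v \<in> Obj V" "N \<in> Obj M" for v N
  proof -
    have o': "gO v \<rhd> N \<in> Obj M" using o by simp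
    show ?thesis
    proof (rule epi_cancel[OF Act_epi[OF e(1) o']])
      have "((Id C (gO v) \<triangleright> \<alpha> N) \<bullet> dX X v N) \<bullet> (e \<triangleright> Id M (gO v \<rhd> N)) =
          (Id C (gO v) \<triangleright> \<alpha> N) \<bullet> ((Id C (gO v) \<triangleright> e \<triangleright> Id M N) \<bullet> dX Y v N)"
        using dX_natural_left[OF o(1) ea e(2,3) o(2)] \<alpha>[OF o(2)] o e ea X by simp
      also have "\<dots> = (Id C (gO v) \<triangleright> \<beta> N) \<bullet> dX Y v N"
        using \<alpha>[OF o(2)] o e ea X by (intro Comp_extend) (auto simp: Act_Comp)
      also have "\<dots> = snd P v N \<bullet> (\<alpha> (gO v \<rhd> N) \<bullet> (e \<triangleright> Id M (gO v \<rhd> N)))"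
        using b(6)[OF X(2) o] \<alpha>[OF o'] by simp
      finally show "(snd P v N \<bullet> \<alpha> (gO v \<rhd> N)) \<bullet> (e \<triangleright> Id M (gO v \<rhd> N)) =
          ((Id C (gO v) \<triangleright> \<alpha> N) \<bullet> dX X v N) \<bullet> (e \<triangleright> Id M (gO v \<rhd> N))"
        using \<alpha>[OF o'] o e ea X p by simp
    qed (use \<alpha>[OF o(2)] \<alpha>[OF o'] o e ea X p in auto)
  qed
qed

text \<open>Naturality carries the component along the generation of \<open>N\<close>: on a
  biproduct it is fixed by its restrictions to the summands, and on a quotient it is fixed because
  \<open>Id C X \<triangleright> e\<close> is epi.\<close>

lemma nat_trans_determined:
  assumes P: "endo P" and X: "X \<in> Obj C" and t: "nat_trans X \<alpha> P" "nat_trans X \<beta> P"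
    and Q: "generates Q" "\<alpha> Q = \<beta> Q" and N: "N \<in> Obj M"
  shows "\<alpha> N = \<beta> N"
  using Q(1) N
proof (induction N rule: generates_induct)
  case generator
  show ?case by (rule Q(2))
next
  case (biproduct N1 N2 N i j p q)
  note d = biproductD[OF biproduct(1)]
  have eq: "\<alpha> N = (amap (fst P) i \<bullet> \<alpha> N1) \<bullet> (Id C X \<triangleright> p) \<oplus>\<^bsub>M\<^esub> (amap (fst P) j \<bullet> \<alpha> N2) \<bullet> (Id C X \<triangleright> q)"
    if t: "nat_trans X \<alpha> P" for \<alpha>
  proof -
    note a = nat_transD[OF P t]
    have "\<alpha> N = \<alpha> N \<bullet> (Id C X \<triangleright> (i \<bullet> p \<oplus>\<^bsub>M\<^esub> j \<bullet> q))"
      using a(2-4)[OF d(3)] d X by simp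
    also have "\<dots> = (\<alpha> N \<bullet> (Id C X \<triangleright> i)) \<bullet> (Id C X \<triangleright> p) \<oplus>\<^bsub>M\<^esub> (\<alpha> N \<bullet> (Id C X \<triangleright> j)) \<bullet> (Id C X \<triangleright> q)"
      using a(2-4)[OF d(3)] d(1-19) X by (simp add: Act_Add_right Act_Comp_Id Comp_Add)
    finally show ?thesis
      using a(5)[of i N1 N] a(5)[of j N2 N] d by simp
  qed
  show ?case
    unfolding eq[OF t(1)] eq[OF t(2)] biproduct(2,3) ..
next
  case (quotient e)
  note ea = epi_arr[OF quotient(1)] and a = nat_transD[OF P t(1)] and b = nat_transD[OF P t(2)]
  have o: "Cod M e \<in> Obj M" "Dom M e \<in> Obj M" using ea by auto
  have "\<alpha> (Cod M e) \<bullet> (Id C X \<triangleright> e) = \<beta> (Cod M e) \<bullet> (Id C X \<triangleright> e)"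
    using a(5)[OF ea refl refl] b(5)[OF ea refl refl] quotient(2) by simp
  then show ?case
    using a(2-4)[OF o(1)] b(2-4)[OF o(1)] ea X by (rule_tac epi_cancel[OF Act_epi_right[OF quotient(1) X]]) auto
qed

lemma ex_relative_end:
  assumes P: "endo P"
  shows "\<exists>E \<pi>. ihom_relative_end V D C M A G H P E \<pi>"
proof -
  note p = endofunctorD[OF P]
  obtain Q where gen: "generates Q"
    using ex_generator by blast
  then have Q: "Q \<in> Obj M" by (simp add: generates_def)
  let ?F = "omap (fst P)"
  let ?I = "IHom H Q (?F Q)"
  have I: "?F Q \<in> Obj M" "?I \<in> Obj C" using Q p by auto
  \<comment> \<open>\<open>S f\<close> says that the morphism corresponding to \<open>f\<close>
    extends from \<open>Q\<close> to a module transformation; by \<open>nat_trans_determined\<close>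
    there is at most one extension.\<close>
  define S where "S f \<longleftrightarrow> (\<exists>\<alpha>. nat_trans (Dom C f) \<alpha> P \<and> \<alpha> Q = phi Q (?F Q) f)" for f
  have "C.subobject_class ?I S"
    unfolding C.subobject_class_def
  proof (intro conjI allI impI ballI)
    fix f g assume a: "S f" "f \<in> Arr C" "g \<in> Arr C" "Cod C f = ?I" "Dom C f = Cod C g"
    then obtain \<alpha> where \<alpha>: "nat_trans (Dom C f) \<alpha> P" "\<alpha> Q = phi Q (?F Q) f"
      by (auto simp: S_def)
    have "phi Q (?F Q) (f \<cdot>\<^sub>C g) = phi Q (?F Q) f \<bullet> (g \<triangleright> Id M Q)"
      using a Q I by (intro phi_Comp) auto
    then show "S (f \<cdot>\<^sub>C g)"
      unfolding S_def using nat_trans_precomp[OF P \<alpha>(1), of g] a \<alpha>(2) Q by (intro exI) (auto intro: conjI)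
  next
    fix f g assume a: "S f" "S g" "f \<in> Arr C" "g \<in> Arr C" "Cod C f = ?I" "Cod C g = ?I" "Dom C f = Dom C g"
    then obtain \<alpha> \<beta> where \<alpha>: "nat_trans (Dom C g) \<alpha> P" "\<alpha> Q = phi Q (?F Q) f"
      and \<beta>: "nat_trans (Dom C g) \<beta> P" "\<beta> Q = phi Q (?F Q) g"
      by (auto simp: S_def)
    let ?ev = "phi Q (?F Q) (Id C ?I)"
    have "phi Q (?F Q) (f \<oplus>\<^bsub>C\<^esub> g) = ?ev \<bullet> ((f \<oplus>\<^bsub>C\<^esub> g) \<triangleright> Id M Q)"
      using a Q I by (intro phi_eval[symmetric]) auto
    also have "\<dots> = ?ev \<bullet> (f \<triangleright> Id M Q) \<oplus>\<^bsub>M\<^esub> ?ev \<bullet> (g \<triangleright> Id M Q)"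
      using a Q I by (simp add: Act_Add Comp_Add)
    also have "\<dots> = phi Q (?F Q) f \<oplus>\<^bsub>M\<^esub> phi Q (?F Q) g"
      using a Q I by (simp add: phi_eval)
    finally show "S (f \<oplus>\<^bsub>C\<^esub> g)"
      unfolding S_def using nat_trans_Add[OF P _ \<alpha>(1) \<beta>(1)] a \<alpha>(2) \<beta>(2) Q by (intro exI) (auto intro: conjI)
  next
    fix f e assume a: "S (f \<cdot>\<^sub>C e)" "f \<in> Arr C" "is_epi C e" "Cod C f = ?I" "Dom C f = Cod C e"
    note ea = C.epi_arr[OF a(3)]
    obtain \<beta> where \<beta>: "nat_trans (Dom C e) \<beta> P" "\<beta> Q = phi Q (?F Q) (f \<cdot>\<^sub>C e)"
      using a ea by (auto simp: S_def)
    note b = nat_transD[OF P \<beta>(1)]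
    obtain k where k: "is_kernel C e k"
      using C.ex_kernel ea by blast
    note kD = C.kernelD[OF k]
    have K: "Dom C k \<in> Obj C" using kD by simp
    have bQ: "\<beta> Q = phi Q (?F Q) f \<bullet> (e \<triangleright> Id M Q)"
      unfolding \<beta>(2) using a ea Q I by (intro phi_Comp) auto
    \<comment> \<open>At \<open>Q\<close> this composite vanishes because \<open>\<beta> Q\<close>
      factors through \<open>e\<close>. It is a component of a transformation, so it vanishes at
      every \<open>N\<close>.\<close>
    have "\<beta> N \<bullet> (k \<triangleright> Id M N) = Zero M (Dom C k \<rhd> N) (?F N)" if N: "N \<in> Obj M" for N
    proof -
      have "(e \<triangleright> Id M Q) \<bullet> (k \<triangleright> Id M Q) = Zero M (Dom C k \<rhd> Q) (Cod C e \<rhd> Q)"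
        using kD ea Q by (simp add: Act_Comp Act_Zero)
      then have "(\<lambda>N \<in> Obj M. \<beta> N \<bullet> (k \<triangleright> Id M N)) Q = (\<lambda>N \<in> Obj M. Zero M (Dom C k \<rhd> N) (?F N)) Q"
        using bQ a ea Q I kD by simp
      from nat_trans_determined[OF P K nat_trans_precomp[OF P \<beta>(1)] nat_trans_Zero[OF P K] gen this N]
      show ?thesis
        using kD N by simp
    qed
    \<comment> \<open>Exactness makes \<open>e \<triangleright> Id M N\<close> a cokernel, so each
      component descends on its own; \<open>nat_trans_descend\<close> then recovers naturality of
      the chosen family.\<close>
    then have "\<exists>x. x \<in> Arr M \<and> Dom M x = Cod C e \<rhd> N \<and> Cod M x = ?F N \<and> x \<bullet> (e \<triangleright> Id M N) = \<beta> N" if N: "N \<in> Obj M" for N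
      using cokernel_desc[OF Act_cokernel[OF C.epi_is_cokernel_of_kernel[OF a(3) k] N], of "\<beta> N"] b(2-4)[OF N] kD ea N
      by auto
    then obtain x where x: "\<And>N. N \<in> Obj M \<Longrightarrow> x N \<in> Arr M \<and> Dom M (x N) = Cod C e \<rhd> N \<and> Cod M (x N) = ?F N \<and>
        x N \<bullet> (e \<triangleright> Id M N) = \<beta> N"
      by metis
    have "nat_trans (Cod C e) (\<lambda>N \<in> Obj M. x N) P"
      using x by (intro nat_trans_descend[OF P a(3) refl refl \<beta>(1)]) auto
    moreover have "x Q = phi Q (?F Q) f"
      using x[OF Q] bQ a ea Q I by (rule_tac epi_cancel[OF Act_epi[OF a(3) Q]]) auto
    ultimately show "S f"
      unfolding S_def using a(5) Q by (intro exI[of _ "\<lambda>N \<in> Obj M. x N"]) auto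
  next
    fix Y assume Y: "Y \<in> Obj C"
    have "phi Q (?F Q) (Zero C Y ?I) = Zero M (Y \<rhd> Q) (?F Q)"
      using phi_eval[of "Zero C Y ?I" Q "?F Q"] Y Q I by (simp add: Act_Zero)
    then show "S (Zero C Y ?I)"
      unfolding S_def using nat_trans_Zero[OF P Y] Y Q I by (intro exI) (auto intro: conjI)
  qed
  then obtain k where k: "is_mono C k" "Cod C k = ?I" "S k"
    "\<And>f. S f \<Longrightarrow> f \<in> Arr C \<Longrightarrow> Cod C f = ?I \<Longrightarrow> \<exists>u \<in> hom C (Dom C f) (Dom C k). k \<cdot>\<^sub>C u = f"
    using C.largest_subobject[OF C.finite_length_obj[OF I(2)]] by metis
  note ka = C.mono_arr[OF k(1)]
  let ?E = "Dom C k"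
  obtain \<alpha> where \<alpha>: "nat_trans ?E \<alpha> P" "\<alpha> Q = phi Q (?F Q) k"
    using k(3) by (auto simp: S_def)
  note a = nat_transD[OF P \<alpha>(1)]
  have E: "?E \<in> Obj C" using ka by simp
  \<comment> \<open>The projections correspond to the components of the transformation that extends
    \<open>k\<close>, so that the projection at \<open>Q\<close> is \<open>k\<close> itself.\<close>
  define \<pi> where "\<pi> N = psi N (?F N) ?E (\<alpha> N)" for N
  have \<pi>: "\<pi> N \<in> Arr C" "Dom C (\<pi> N) = ?E" "Cod C (\<pi> N) = IHom H N (?F N)" "phi N (?F N) (\<pi> N) = \<alpha> N"
    if "N \<in> Obj M" for N
    using a(2-4)[OF that] that E by (auto simp: \<pi>_def)
  have \<pi>Q: "\<pi> Q = k"
    using \<alpha>(2) ka k(2) Q I by (simp add: \<pi>_def)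
  have "transformation_of P \<pi> = \<alpha>"
    using \<pi> by (intro extensionalityI[OF _ a(1)]) (auto simp: transformation_of_def)
  then have w: "wedge P ?E \<pi>"
    using wedge_iff[OF P E, of \<pi>] \<pi> \<alpha>(1) by (auto simp: in_hom)
  have "\<exists>!h. h \<in> hom C E' ?E \<and> (\<forall>N \<in> Obj M. \<xi> N = \<pi> N \<cdot>\<^sub>C h)" if w': "wedge P E' \<xi>" for E' \<xi>
  proof -
    have E': "E' \<in> Obj C" and \<xi>h: "\<And>N. N \<in> Obj M \<Longrightarrow> \<xi> N \<in> hom C E' (IHom H N (?F N))"
      using w' by (auto simp: relative_wedge_def ihom_bifunctr_def)
    then have \<xi>: "\<xi> N \<in> Arr C" "Dom C (\<xi> N) = E'" "Cod C (\<xi> N) = IHom H N (?F N)" if "N \<in> Obj M" for N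
      using that by (auto simp: in_hom)
    have t: "nat_trans E' (transformation_of P \<xi>) P"
      using wedge_iff[OF P E' \<xi>h] w' by simp
    have "S (\<xi> Q)"
      unfolding S_def using t \<xi>(2)[OF Q] Q by (intro exI[of _ "transformation_of P \<xi>"]) (auto simp: transformation_of_def)
    \<comment> \<open>The mediating morphism is found at \<open>Q\<close> alone and is unique
      because \<open>\<pi> Q\<close> is the monomorphism \<open>k\<close>; determinacy gives the
      factorisation at every other \<open>N\<close>.\<close>
    then obtain h where h: "h \<in> Arr C" "Dom C h = E'" "Cod C h = ?E" "k \<cdot>\<^sub>C h = \<xi> Q"
      using k(4)[of "\<xi> Q"] \<xi>[OF Q] by (auto simp: in_hom)
    have "\<xi> N = \<pi> N \<cdot>\<^sub>C h" if N: "N \<in> Obj M" for N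
    proof (rule phi_inj)
      have "phi Q (?F Q) k \<bullet> (h \<triangleright> Id M Q) = phi Q (?F Q) (\<xi> Q)"
        using phi_Comp[of k Q "?F Q" h] h ka k(2) Q I by simp
      then have "transformation_of P \<xi> Q = (\<lambda>N \<in> Obj M. \<alpha> N \<bullet> (h \<triangleright> Id M N)) Q"
        using Q \<alpha>(2) by (simp add: transformation_of_def)
      from nat_trans_determined[OF P E' t nat_trans_precomp[OF P \<alpha>(1) h(1-3)] gen this N]
      have "phi N (?F N) (\<xi> N) = \<alpha> N \<bullet> (h \<triangleright> Id M N)"
        using N by (simp add: transformation_of_def)
      then show "phi N (?F N) (\<xi> N) = phi N (?F N) (\<pi> N \<cdot>\<^sub>C h)"
        using phi_Comp[of "\<pi> N" N "?F N" h] \<pi>[OF N] h N p by simp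
    qed (use \<xi>[OF N] \<pi>[OF N] h N p in auto)
    moreover have "h' = h" if "h' \<in> hom C E' ?E" "\<forall>N \<in> Obj M. \<xi> N = \<pi> N \<cdot>\<^sub>C h'" for h'
    proof (rule C.mono_cancel[OF k(1)])
      show "k \<cdot>\<^sub>C h' = k \<cdot>\<^sub>C h"
        using that(2) Q \<pi>Q h(4) by simp
    qed (use that h in \<open>auto simp: in_hom\<close>)
    ultimately show ?thesis
      using h by (intro ex1I[of _ h]) (auto simp: in_hom)
  qed
  then have "ihom_relative_end V D C M A G H P ?E \<pi>"
    unfolding ihom_relative_end_def relative_end_def
    using ihom_is_bifunctor[OF P] ihom_prebalancing[OF P] w by blast
  then show ?thesis by blast
qed

section \<open>The adjunction\<close>

text \<open>\<open>wedge_iff\<close> turns the universal property into a bijection with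
  transformations out of \<open>\<rho> X\<close>. The relative end is arbitrary here, not the one
  just constructed, because the theorem covers every choice.\<close>

lemma relative_end_represents:
  assumes P: "endo P" and E: "ihom_relative_end V D C M A G H P E \<pi>" and X: "X \<in> Obj C"
  shows "E \<in> Obj C" "N \<in> Obj M \<Longrightarrow> \<pi> N \<in> Arr C" "N \<in> Obj M \<Longrightarrow> Dom C (\<pi> N) = E"
    "N \<in> Obj M \<Longrightarrow> Cod C (\<pi> N) = IHom H N (omap (fst P) N)"
    "h \<in> hom C X E \<Longrightarrow> nat_trans X (transformation_of P (\<lambda>N. \<pi> N \<cdot>\<^sub>C h)) P"
    "nat_trans X \<alpha> P \<Longrightarrow> \<exists>!h. h \<in> hom C X E \<and> transformation_of P (\<lambda>N. \<pi> N \<cdot>\<^sub>C h) = \<alpha>"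
proof -
  note p = endofunctorD[OF P]
  let ?F = "omap (fst P)"
  have w: "wedge P E \<pi>" and univ: "\<And>E' \<xi>. wedge P E' \<xi> \<Longrightarrow> \<exists>!h. h \<in> hom C E' E \<and> (\<forall>N \<in> Obj M. \<xi> N = \<pi> N \<cdot>\<^sub>C h)"
    using E by (auto simp: ihom_relative_end_def relative_end_def)
  show E': "E \<in> Obj C"
    using w by (simp add: relative_wedge_def)
  have \<pi>h: "\<pi> N \<in> hom C E (IHom H N (?F N))" if "N \<in> Obj M" for N
    using w that by (simp add: relative_wedge_def ihom_bifunctr_def)
  then have \<pi>: "\<pi> N \<in> Arr C" "Dom C (\<pi> N) = E" "Cod C (\<pi> N) = IHom H N (?F N)" if "N \<in> Obj M" for N
    using that by (auto simp: in_hom)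
  then show "N \<in> Obj M \<Longrightarrow> \<pi> N \<in> Arr C" "N \<in> Obj M \<Longrightarrow> Dom C (\<pi> N) = E"
    "N \<in> Obj M \<Longrightarrow> Cod C (\<pi> N) = IHom H N (?F N)"
    by auto
  show "nat_trans X (transformation_of P (\<lambda>N. \<pi> N \<cdot>\<^sub>C h)) P" if "h \<in> hom C X E"
  proof -
    have h: "h \<in> Arr C" "Dom C h = X" "Cod C h = E" using that by (auto simp: in_hom)
    have t: "nat_trans E (transformation_of P \<pi>) P"
      using wedge_iff[OF P E' \<pi>h] w by simp
    have "transformation_of P (\<lambda>N. \<pi> N \<cdot>\<^sub>C h) = (\<lambda>N \<in> Obj M. transformation_of P \<pi> N \<bullet> (h \<triangleright> Id M N))"
      using \<pi> h p by (auto simp: transformation_of_def phi_Comp cong: restrict_cong)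
    then show ?thesis
      using nat_trans_precomp[OF P t h] by simp
  qed
  show "\<exists>!h. h \<in> hom C X E \<and> transformation_of P (\<lambda>N. \<pi> N \<cdot>\<^sub>C h) = \<alpha>" if \<alpha>: "nat_trans X \<alpha> P"
  proof -
    note a = nat_transD[OF P \<alpha>]
    define \<xi> where "\<xi> N = psi N (?F N) X (\<alpha> N)" for N
    have \<xi>: "\<xi> N \<in> Arr C" "Dom C (\<xi> N) = X" "Cod C (\<xi> N) = IHom H N (?F N)" "phi N (?F N) (\<xi> N) = \<alpha> N"
      if "N \<in> Obj M" for N
      using a(2-4)[OF that] that X by (auto simp: \<xi>_def)
    have "transformation_of P \<xi> = \<alpha>"
      using \<xi> by (intro extensionalityI[OF _ a(1)]) (auto simp: transformation_of_def)
    then have w: "wedge P X \<xi>"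
      using wedge_iff[OF P X, of \<xi>] \<xi> \<alpha> by (auto simp: in_hom)
    have iff: "(\<forall>N \<in> Obj M. \<xi> N = \<pi> N \<cdot>\<^sub>C h) \<longleftrightarrow> transformation_of P (\<lambda>N. \<pi> N \<cdot>\<^sub>C h) = \<alpha>" if h: "h \<in> hom C X E" for h
    proof
      assume "\<forall>N \<in> Obj M. \<xi> N = \<pi> N \<cdot>\<^sub>C h"
      then show "transformation_of P (\<lambda>N. \<pi> N \<cdot>\<^sub>C h) = \<alpha>"
        using \<xi>(4) by (intro extensionalityI[OF _ a(1)]) (auto simp: transformation_of_def)
    next
      assume t: "transformation_of P (\<lambda>N. \<pi> N \<cdot>\<^sub>C h) = \<alpha>"
      show "\<forall>N \<in> Obj M. \<xi> N = \<pi> N \<cdot>\<^sub>C h"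
      proof
        fix N assume N: "N \<in> Obj M"
        have "phi N (?F N) (\<pi> N \<cdot>\<^sub>C h) = \<alpha> N"
          unfolding t[symmetric] using N by (simp add: transformation_of_def)
        moreover have "psi N (?F N) X (phi N (?F N) (\<pi> N \<cdot>\<^sub>C h)) = \<pi> N \<cdot>\<^sub>C h"
          using \<pi>[OF N] N h p(1)[OF N] by (intro psi_phi) (auto simp: in_hom)
        ultimately show "\<xi> N = \<pi> N \<cdot>\<^sub>C h"
          by (simp add: \<xi>_def)
      qed
    qed
    have "h \<in> hom C X E \<and> (\<forall>N \<in> Obj M. \<xi> N = \<pi> N \<cdot>\<^sub>C h) \<longleftrightarrow>
        h \<in> hom C X E \<and> transformation_of P (\<lambda>N. \<pi> N \<cdot>\<^sub>C h) = \<alpha>" for h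
      using iff by blast
    then show ?thesis
      using univ[OF w] by (simp only:)
  qed
qed

context
  fixes R :: "('vo, 'mo, 'mm) modend \<Rightarrow> 'co" and lam :: "('vo, 'mo, 'mm) modend \<Rightarrow> 'mo \<Rightarrow> 'cm"
  assumes R: "endo P \<Longrightarrow> ihom_relative_end V D C M A G H P (R P) (lam P)"
begin

lemma R_Obj [simp]: "endo P \<Longrightarrow> R P \<in> Obj C"
  using relative_end_represents(1)[OF _ R C.unit_obj] .

lemma lam_arr [simp]:
  assumes "endo P" "N \<in> Obj M"
  shows "lam P N \<in> Arr C" "Dom C (lam P N) = R P" "Cod C (lam P N) = IHom H N (omap (fst P) N)"
  using relative_end_represents(2-4)[OF assms(1) R[OF assms(1)] C.unit_obj assms(2)] by auto

text \<open>The Hom bijection in the direction from \<open>C\<close> to module transformations. Its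
  value at the identity of \<open>R P\<close> is the counit at \<open>P\<close>.\<close>

definition adjunct :: "('vo, 'mo, 'mm) modend \<Rightarrow> 'cm \<Rightarrow> 'mo \<Rightarrow> 'mm" where
  "adjunct P h = transformation_of P (\<lambda>N. lam P N \<cdot>\<^sub>C h)"

lemma adjunct_trans:
  "endo P \<Longrightarrow> h \<in> Arr C \<Longrightarrow> Dom C h = X \<Longrightarrow> Cod C h = R P \<Longrightarrow> nat_trans X (adjunct P h) P"
  unfolding adjunct_def using relative_end_represents(5)[OF _ R, of P X h] by (auto simp: in_hom)

lemma adjunct_ex1:
  "endo P \<Longrightarrow> X \<in> Obj C \<Longrightarrow> nat_trans X \<alpha> P \<Longrightarrow> \<exists>!h. h \<in> hom C X (R P) \<and> adjunct P h = \<alpha>"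
  unfolding adjunct_def by (rule relative_end_represents(6)[OF _ R])

lemma adjunct_inj:
  assumes P: "endo P" and "adjunct P h = adjunct P h'" "h \<in> hom C X (R P)" "h' \<in> hom C X (R P)"
  shows "h = h'"
proof -
  have "nat_trans X (adjunct P h) P" "X \<in> Obj C"
    using assms by (auto simp: in_hom intro: adjunct_trans)
  from adjunct_ex1[OF P this(2,1)] show ?thesis
    using assms by metis
qed

lemma adjunct_Comp:
  assumes P: "endo P" and "h \<in> Arr C" "Cod C h = R P" "f \<in> Arr C" "Dom C h = Cod C f" and N: "N \<in> Obj M"
  shows "adjunct P (h \<cdot>\<^sub>C f) N = adjunct P h N \<bullet> (f \<triangleright> Id M N)"
  using assms phi_Comp[of "lam P N \<cdot>\<^sub>C h" N "omap (fst P) N" f] endofunctorD[OF P]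
  by (simp add: adjunct_def transformation_of_def)

abbreviation rbar where "rbar t \<equiv> amap (rho_bar C M A H R lam) t"

text \<open>After \<open>phi\<close>, the equation defining \<open>rho_bar\<close> on morphisms says
  that the adjunct of \<open>u\<close> is the counit at \<open>P\<close> followed by
  \<open>\<beta>\<close>. So \<open>adjunct_ex1\<close> supplies the existence and uniqueness that
  the description needs.\<close>

lemma rbar:
  assumes P: "endo P" and Q: "endo Q" and t: "transf P \<beta> Q"
  shows "rbar (P, \<beta>, Q) \<in> Arr C" "Dom C (rbar (P, \<beta>, Q)) = R P" "Cod C (rbar (P, \<beta>, Q)) = R Q"
    "N \<in> Obj M \<Longrightarrow> adjunct Q (rbar (P, \<beta>, Q)) N = \<beta> N \<bullet> adjunct P (Id C (R P)) N"
proof -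
  note p = endofunctorD[OF P] and q = endofunctorD[OF Q] and b = transformationD[OF t]
  note c1 = adjunct_trans[OF P C.Id_arr(1-3)[OF R_Obj[OF P]]]
  let ?\<alpha> = "\<lambda>N \<in> Obj M. \<beta> N \<bullet> adjunct P (Id C (R P)) N"
  have "nat_trans (R P) ?\<alpha> Q"
    using P Q by (intro transformation_Comp[OF _ P Q c1 t] act_module_endofunctor) auto
  from adjunct_ex1[OF Q R_Obj[OF P] this]
  have ex1: "\<exists>!u. u \<in> hom C (R P) (R Q) \<and> adjunct Q u = ?\<alpha>" .
  have iff: "(\<forall>N \<in> Obj M. ihA (Id M N) (\<beta> N) \<cdot>\<^sub>C lam P N = lam Q N \<cdot>\<^sub>C u) \<longleftrightarrow> adjunct Q u = ?\<alpha>"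
    if u: "u \<in> hom C (R P) (R Q)" for u
  proof -
    have *: "ihA (Id M N) (\<beta> N) \<cdot>\<^sub>C lam P N = lam Q N \<cdot>\<^sub>C u \<longleftrightarrow> adjunct Q u N = ?\<alpha> N" if N: "N \<in> Obj M" for N
    proof -
      let ?l = "ihA (Id M N) (\<beta> N) \<cdot>\<^sub>C lam P N" and ?r = "lam Q N \<cdot>\<^sub>C u"
      have "phi N (omap (fst Q) N) ?l = \<beta> N \<bullet> phi N (omap (fst P) N) (lam P N)"
        using phi_IHomA[of "Id M N" N N "\<beta> N" "omap (fst P) N" "omap (fst Q) N" "lam P N" "R P"] N b(2-4)[OF N] P p
        by simp
      also have "\<dots> = ?\<alpha> N"
        using N P by (simp add: adjunct_def transformation_of_def)
      finally have l: "phi N (omap (fst Q) N) ?l = ?\<alpha> N" .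
      have r: "phi N (omap (fst Q) N) ?r = adjunct Q u N"
        using N by (simp add: adjunct_def transformation_of_def)
      show ?thesis
      proof
        show "adjunct Q u N = ?\<alpha> N" if "?l = ?r"
          using l r that by simp
        show "?l = ?r" if "adjunct Q u N = ?\<alpha> N"
        proof (rule phi_inj)
          show "phi N (omap (fst Q) N) ?l = phi N (omap (fst Q) N) ?r"
            unfolding l r that ..
        qed (use N P Q u b(2-4)[OF N] q in \<open>auto simp: in_hom\<close>)
      qed
    qed
    show ?thesis
    proof
      assume "\<forall>N \<in> Obj M. ihA (Id M N) (\<beta> N) \<cdot>\<^sub>C lam P N = lam Q N \<cdot>\<^sub>C u"
      then show "adjunct Q u = ?\<alpha>"
        using * by (intro extensionalityI[of _ "Obj M"]) (auto simp: adjunct_def transformation_of_def)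
    next
      assume "adjunct Q u = ?\<alpha>"
      then show "\<forall>N \<in> Obj M. ihA (Id M N) (\<beta> N) \<cdot>\<^sub>C lam P N = lam Q N \<cdot>\<^sub>C u"
        using * by metis
    qed
  qed
  have "rbar (P, \<beta>, Q) = (THE u. u \<in> hom C (R P) (R Q) \<and> adjunct Q u = ?\<alpha>)"
    unfolding rho_bar_def using iff by (simp cong: conj_cong)
  then have "rbar (P, \<beta>, Q) \<in> hom C (R P) (R Q) \<and> adjunct Q (rbar (P, \<beta>, Q)) = ?\<alpha>"
    using theI'[OF ex1] by simp
  then show "rbar (P, \<beta>, Q) \<in> Arr C" "Dom C (rbar (P, \<beta>, Q)) = R P" "Cod C (rbar (P, \<beta>, Q)) = R Q"
    "N \<in> Obj M \<Longrightarrow> adjunct Q (rbar (P, \<beta>, Q)) N = \<beta> N \<bullet> adjunct P (Id C (R P)) N"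
    by (auto simp: in_hom)
qed

text \<open>Naturality in the endofunctor reduces to the counit, because the adjunct of
  \<open>h\<close> is the counit precomposed with the action of \<open>h\<close>.\<close>

lemma adjunct_rbar:
  assumes P: "endo P" and Q: "endo Q" and t: "transf P \<beta> Q"
    and h: "h \<in> Arr C" "Cod C h = R P" and N: "N \<in> Obj M"
  shows "adjunct Q (rbar (P, \<beta>, Q) \<cdot>\<^sub>C h) N = \<beta> N \<bullet> adjunct P h N"
proof -
  note r = rbar[OF P Q t] and b = transformationD[OF t]
  note c1 = nat_transD[OF P adjunct_trans[OF P C.Id_arr(1-3)[OF R_Obj[OF P]]]]
  have "adjunct Q (rbar (P, \<beta>, Q) \<cdot>\<^sub>C h) N = (\<beta> N \<bullet> adjunct P (Id C (R P)) N) \<bullet> (h \<triangleright> Id M N)"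
    using adjunct_Comp[OF Q r(1,3) h(1) _ N] r(2) r(4)[OF N] h by simp
  also have "\<dots> = \<beta> N \<bullet> (adjunct P (Id C (R P)) N \<bullet> (h \<triangleright> Id M N))"
    using b(2-4)[OF N] c1(2-4)[OF N] h N by simp
  also have "adjunct P (Id C (R P)) N \<bullet> (h \<triangleright> Id M N) = adjunct P h N"
    using adjunct_Comp[OF P _ _ h(1) _ N, of "Id C (R P)"] h P by simp
  finally show ?thesis .
qed

lemma adjunct_eqI:
  assumes "\<And>N. N \<in> Obj M \<Longrightarrow> adjunct P h N = adjunct P h' N"
  shows "adjunct P h = adjunct P h'"
  using assms by (intro extensionalityI[of _ "Obj M"]) (auto simp: adjunct_def transformation_of_def)

text \<open>By \<open>adjunct_inj\<close> the functor laws can be tested on adjuncts, where they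
  follow from the componentwise composition of transformations.\<close>

lemma rho_bar_is_functor: "is_functor (EndV V M B) C (rho_bar C M A H R lam)"
  unfolding is_functor_def
proof (intro conjI ballI allI)
  let ?R = "rho_bar C M A H R lam"
  have om: "omap ?R P = R P" for P by (simp add: rho_bar_def)
  show "omap ?R P \<in> Obj C" if "P \<in> Obj (EndV V M B)" for P
    using that by (simp add: om)
  show "amap ?R t \<in> hom C (omap ?R P) (omap ?R Q)" if t0: "t \<in> hom (EndV V M B) P Q" for P Q t
  proof -
    obtain \<beta> where P: "endo P" and Q: "endo Q"
      and t: "t = (P, \<beta>, Q)" "transf P \<beta> Q"
      using t0 unfolding EndV_hom by blast
    show ?thesis
      using rbar(1-3)[OF P Q t(2)] by (simp add: om in_hom t(1))
  qed
  show "amap ?R (Id (EndV V M B) P) = Id C (omap ?R P)" if "P \<in> Obj (EndV V M B)" for P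
  proof -
    have P: "endo P" using that by simp
    note t = transformation_Id[OF P]
    note c1 = nat_transD[OF P adjunct_trans[OF P C.Id_arr(1-3)[OF R_Obj[OF P]]]]
    note r = rbar[OF P P t]
    have "adjunct P (rbar (P, \<lambda>N \<in> Obj M. Id M (omap (fst P) N), P)) N = adjunct P (Id C (R P)) N" if "N \<in> Obj M" for N
      using r(4)[OF that] that c1(2-4)[OF that] by simp
    then have "rbar (P, \<lambda>N \<in> Obj M. Id M (omap (fst P) N), P) = Id C (R P)"
      using r(1-3) P by (intro adjunct_inj[OF P adjunct_eqI, of _ _ "R P"]) (auto simp: in_hom)
    then show ?thesis by (simp add: om)
  qed
  show "amap ?R (t \<cdot>\<^bsub>EndV V M B\<^esub> u) = amap ?R t \<cdot>\<^sub>C amap ?R u"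
    if tu: "t \<in> hom (EndV V M B) Q S" "u \<in> hom (EndV V M B) P Q" for P Q S t u
  proof -
    obtain \<alpha> \<beta> where P: "endo P" and Q: "endo Q" and S: "endo S"
      and t: "t = (Q, \<beta>, S)" "transf Q \<beta> S" and u: "u = (P, \<alpha>, Q)" "transf P \<alpha> Q"
      using tu unfolding EndV_hom by blast
    note rt = rbar[OF Q S t(2)] and ru = rbar[OF P Q u(2)] and r = rbar[OF P S transformation_Comp[OF P Q S u(2) t(2)]]
    note c1 = nat_transD[OF P adjunct_trans[OF P C.Id_arr(1-3)[OF R_Obj[OF P]]]]
    have "adjunct S (rbar (P, \<lambda>N \<in> Obj M. \<beta> N \<bullet> \<alpha> N, S)) N = adjunct S (rbar (Q, \<beta>, S) \<cdot>\<^sub>C rbar (P, \<alpha>, Q)) N"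
      if N: "N \<in> Obj M" for N
      using r(4)[OF N] adjunct_rbar[OF Q S t(2) ru(1,3) N] ru(4)[OF N] N c1(2-4)[OF N]
        transformationD(2-4)[OF t(2) N] transformationD(2-4)[OF u(2) N]
      by simp
    then have "rbar (P, \<lambda>N \<in> Obj M. \<beta> N \<bullet> \<alpha> N, S) = rbar (Q, \<beta>, S) \<cdot>\<^sub>C rbar (P, \<alpha>, Q)"
      using r(1-3) rt(1-3) ru(1-3) by (intro adjunct_inj[OF S adjunct_eqI, of _ _ "R P"]) (auto simp: in_hom)
    then show ?thesis by (simp add: t u)
  qed
qed

lemma rho_bar_right_adjoint:
  "right_adjoint C (EndV V M B) (act_functor C M A G) (rho_bar C M A H R lam)"
  unfolding right_adjoint_def
proof (intro conjI exI ballI)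
  let ?E = "EndV V M B" and ?L = "act_functor C M A G" and ?R = "rho_bar C M A H R lam"
  \<comment> \<open>\<open>\<Theta>\<close> runs opposite to the bijection that
    \<open>right_adjoint\<close> asks for, since \<open>adjunct\<close> has an explicit formula.
    Naturality is verified for \<open>\<Theta>\<close> and transferred to its inverse.\<close>
  define \<Theta> where "\<Theta> X P h = (\<rho> X, adjunct P h, P)" for X P h
  let ?\<Psi> = "\<lambda>X P. inv_into (hom C X (R P)) (\<Theta> X P)"
  have om: "omap ?R P = R P" "omap ?L X = \<rho> X" for P X
    by (simp_all add: rho_bar_def act_functor_def)
  have \<Theta>: "bij_betw (\<Theta> X P) (hom C X (R P)) (hom ?E (\<rho> X) P)" if X: "X \<in> Obj C" and "P \<in> Obj ?E" for X P
  proof -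
    have P: "endo P" using that by simp
    show ?thesis
      unfolding bij_betw_def
    proof
      show "inj_on (\<Theta> X P) (hom C X (R P))"
        by (rule inj_onI) (auto simp: \<Theta>_def dest: adjunct_inj[OF P])
      show "\<Theta> X P ` hom C X (R P) = hom ?E (\<rho> X) P"
      proof (intro equalityI subsetI)
        fix t assume "t \<in> \<Theta> X P ` hom C X (R P)"
        then show "t \<in> hom ?E (\<rho> X) P"
          using P act_module_endofunctor[OF X] adjunct_trans[OF P] by (auto simp: \<Theta>_def EndV_hom in_hom)
      next
        fix t assume "t \<in> hom ?E (\<rho> X) P"
        then obtain \<alpha> where t: "t = (\<rho> X, \<alpha>, P)" "nat_trans X \<alpha> P"
          by (auto simp: EndV_hom)
        then obtain h where "h \<in> hom C X (R P)" "adjunct P h = \<alpha>"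
          using adjunct_ex1[OF P X t(2)] by blast
        then show "t \<in> \<Theta> X P ` hom C X (R P)"
          by (auto simp: t \<Theta>_def)
      qed
    qed
  qed
  show "bij_betw (?\<Psi> X P) (hom ?E (omap ?L X) P) (hom C X (omap ?R P))" if "X \<in> Obj C" "P \<in> Obj ?E" for X P
    unfolding om by (rule bij_betw_inv_into[OF \<Theta>[OF that]])
  fix X Y P Q f u g
  assume X: "X \<in> Obj C" "Y \<in> Obj C" and PQ: "P \<in> Obj ?E" "Q \<in> Obj ?E" and f: "f \<in> hom C Y X"
    and u: "u \<in> hom ?E (omap ?L X) P" and g: "g \<in> hom ?E P Q"
  have P: "endo P" and Q: "endo Q" using PQ by auto
  have f': "f \<in> Arr C" "Dom C f = Y" "Cod C f = X" using f by (auto simp: in_hom)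
  obtain h where h: "h \<in> hom C X (R P)" "u = \<Theta> X P h"
    using u \<Theta>[OF X(1) PQ(1)] by (auto simp: bij_betw_def om)
  then have h': "h \<in> Arr C" "Dom C h = X" "Cod C h = R P" by (auto simp: in_hom)
  obtain \<beta> where \<beta>: "g = (P, \<beta>, Q)" "transf P \<beta> Q"
    using g by (auto simp: EndV_hom)
  note r = rbar[OF P Q \<beta>(2)] and a = nat_transD[OF P adjunct_trans[OF P h']]
  let ?k = "amap ?R g \<cdot>\<^sub>C h \<cdot>\<^sub>C f"
  have k: "?k \<in> hom C Y (R Q)"
    using r(1-3) h' f' by (simp add: \<beta>(1) in_hom)
  have "adjunct Q ?k N = \<beta> N \<bullet> adjunct P h N \<bullet> (f \<triangleright> Id M N)" if N: "N \<in> Obj M" for N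
    using adjunct_rbar[OF P Q \<beta>(2), of "h \<cdot>\<^sub>C f" N] adjunct_Comp[OF P h'(1,3) f'(1) _ N] h' f' N by (simp add: \<beta>(1))
  then have "adjunct Q ?k = (\<lambda>N \<in> Obj M. \<beta> N \<bullet> adjunct P h N \<bullet> (f \<triangleright> Id M N))"
    by (intro extensionalityI[of _ "Obj M"]) (auto simp: adjunct_def transformation_of_def)
  then have "g \<cdot>\<^bsub>?E\<^esub> u \<cdot>\<^bsub>?E\<^esub> amap ?L f = \<Theta> Y Q ?k"
    using f' by (simp add: h \<beta> \<Theta>_def act_functor_def cong: restrict_cong)
  then have "?\<Psi> Y Q (g \<cdot>\<^bsub>?E\<^esub> u \<cdot>\<^bsub>?E\<^esub> amap ?L f) = ?k"
    using k bij_betw_imp_inj_on[OF \<Theta>[OF X(2) PQ(2)]] by simp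
  moreover have "?\<Psi> X P u = h"
    using h bij_betw_imp_inj_on[OF \<Theta>[OF X(1) PQ(1)]] by simp
  ultimately show "?\<Psi> Y Q (g \<cdot>\<^bsub>?E\<^esub> u \<cdot>\<^bsub>?E\<^esub> amap ?L f) = amap ?R g \<cdot>\<^sub>C ?\<Psi> X P u \<cdot>\<^sub>C f"
    by simp
qed (rule C.category_axioms EndV_category act_functor_is_functor rho_bar_is_functor)+

end

end

text \<open>The first conjunct keeps the quantification over internal Homs from being empty;
  existence of the relative ends does the same for the choice of \<open>R\<close> and
  \<open>lam\<close>.\<close>

theorem mainTheorem1:
  fixes V :: "('vo, 'vm, 'k::alg_closed_field) moncat"
    and c :: "'vo \<Rightarrow> 'vo \<Rightarrow> 'vm"
    and D :: "('vo, 'vm) duality"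
    and C :: "('co, 'cm, 'k) moncat"
    and G :: "('vo, 'vm, ('co, 'cm) center_obj, ('co, 'cm) center_arr) monfunctr"
    and M :: "('mo, 'mm, 'k) lincat"
    and A :: "('co, 'cm, 'mo, 'mm) action"
  assumes "braided_tensor_category V c"
    and "left_duality V D"
    and "tensor_category C"
    and "central_via V c C G"
    and "right_exact V (center C) G"
    and "module_category C M A"
  shows "(\<exists>H. internal_hom C M A H) \<and>
    (\<forall>H. internal_hom C M A H \<longrightarrow>
       (\<forall>P \<in> Obj (EndV V M (central_action C M A G)).
          \<exists>E \<pi>. ihom_relative_end V D C M A G H P E \<pi>) \<and>
       (\<forall>R lam.
          (\<forall>P \<in> Obj (EndV V M (central_action C M A G)).
             ihom_relative_end V D C M A G H P (R P) (lam P)) \<longrightarrow>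
          right_adjoint C (EndV V M (central_action C M A G))
            (act_functor C M A G) (rho_bar C M A H R lam)))"
proof (intro conjI allI impI ballI)
  interpret central_module V c C M A D G
    using assms by (simp add: central_module_def tensor_module_def central_module_axioms_def)
  show "\<exists>H. internal_hom C M A H"
    by (rule ex_internal_hom)
  fix H assume "internal_hom C M A H"
  then interpret central_module_ihom V c C M A D G H
    by unfold_locales
  show "\<exists>E \<pi>. ihom_relative_end V D C M A G H P E \<pi>" if "P \<in> Obj (EndV V M (central_action C M A G))" for P
    using that by (intro ex_relative_end) simp
  show "right_adjoint C (EndV V M (central_action C M A G)) (act_functor C M A G) (rho_bar C M A H R lam)"
    if "\<forall>P \<in> Obj (EndV V M (central_action C M A G)). ihom_relative_end V D C M A G H P (R P) (lam P)" for R lam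
    by (rule rho_bar_right_adjoint, rule that[rule_format]) simp
qed

end
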